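(* Given a spanning tree with $n$ vertices and real edge weights, a dendrogram of the tree can be computed in $O(n\log n)$ expected work and $O(\log^2 n\log\log n)$ depth with high probability.
   Context: A dendrogram of an edge-weighted tree $\mathcal{T}$ is a rooted binary tree defined recursively: if $\mathcal{T}$ is a single vertex $v$, the dendrogram is the leaf $v$; otherwise, its root corresponds to a maximum-weight edge $e$ of $\mathcal{T}$ (with height equal to the weight of $e$), and the two children of the root are dendrograms of the two subtrees obtained by removing $e$ from $\mathcal{T}$. Equivalently, it records the hierarchy of clusters obtained by removing the tree's edges in decreasing order of weight. Costs are measured in the work-depth model for parallel shared-memory algorithms (work = total number of operations, depth = length of the longest chain of sequential dependencies), with priority concurrent writes taking $O(1)$ work and depth; "with high probability" means with probability at least $1-n^{-c}$ for any constant $c>0$. *)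

theory Defs
  imports
    "HOL-Probability.Probability"
    "HOL-Library.Landau_Symbols"
    "HOL-Library.Log_Nat"
begin

section \<open>Trees and dendrograms\<close>

text \<open>
  Undirected simple graphs are given by a vertex set and a set of two-element sets of vertices.
  The predicate \<open>tree\<close> of the AFP entry \<open>Graph_Theory\<close> is not suitable: its acyclicity refers to
  directed cycles, so it accepts an acyclically oriented triangle.
\<close>

definition adjacent :: "'v set set \<Rightarrow> ('v \<times> 'v) set" where
  "adjacent E = {(u, v). {u, v} \<in> E}"

definition is_cycle :: "'v set set \<Rightarrow> 'v list \<Rightarrow> bool" where
  "is_cycle E xs \<longleftrightarrow> length xs \<ge> 3 \<and> distinct xs \<and>
     (\<forall>i<length xs. {xs ! i, xs ! (Suc i mod length xs)} \<in> E)"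

definition is_tree :: "'v set \<Rightarrow> 'v set set \<Rightarrow> bool" where
  "is_tree V E \<longleftrightarrow> finite V \<and> V \<noteq> {} \<and>
     E \<subseteq> {{u, v} |u v. u \<in> V \<and> v \<in> V \<and> u \<noteq> v} \<and>
     (\<forall>u\<in>V. \<forall>v\<in>V. (u, v) \<in> (adjacent E)\<^sup>*) \<and>
     (\<nexists>xs. is_cycle E xs)"

definition component :: "'v set set \<Rightarrow> 'v \<Rightarrow> 'v set" where
  "component E u = {x. (u, x) \<in> (adjacent E)\<^sup>*}"

definition induced_edges :: "'v set set \<Rightarrow> 'v set \<Rightarrow> 'v set set" where
  "induced_edges E X = {f \<in> E. f \<subseteq> X}"

text \<open>
  An internal node records the edge it corresponds to and its height. The two endpoints of the
  removed edge may be taken in either order, so the two children are unordered; several dendrograms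
  may also exist because of ties.
\<close>

datatype 'v dendrogram = Leaf 'v | Node "'v set" real "'v dendrogram" "'v dendrogram"

inductive is_dendrogram :: "('v set \<Rightarrow> real) \<Rightarrow> 'v set \<Rightarrow> 'v set set \<Rightarrow> 'v dendrogram \<Rightarrow> bool"
  for wt :: "'v set \<Rightarrow> real" where
  single: "is_dendrogram wt {v} {} (Leaf v)"
| split: "is_dendrogram wt V E (Node {u, v} (wt {u, v}) l r)"
    if "{u, v} \<in> E" "\<forall>f\<in>E. wt f \<le> wt {u, v}"
      "E' = E - {{u, v}}" "V\<^sub>1 = component E' u" "V\<^sub>2 = component E' v"
      "V = V\<^sub>1 \<union> V\<^sub>2"
      "is_dendrogram wt V\<^sub>1 (induced_edges E' V\<^sub>1) l"
      "is_dendrogram wt V\<^sub>2 (induced_edges E' V\<^sub>2) r"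


section \<open>The work-depth model\<close>

text \<open>
  Programs run on a randomized priority-CRCW shared-memory machine with dynamic forking. There are
  two shared memories: one holds words of \<open>w\<close> bits (naturals below \<open>2 ^ w\<close>), the other holds real
  numbers, which a program can only compare and copy. Each thread also has local word variables.

  An expression of a fixed program has constant size, so an instruction that evaluates it performs
  constantly many operations and is charged one unit. Subtraction is truncated at zero; the other
  operations that could leave the range of words are reduced modulo \<open>2 ^ w\<close>.
\<close>

datatype exp =
    Const nat
  | Var nat
  | Load exp
  | Plus exp exp
  | Minus exp exp
  | Times exp exp
  | Div exp exp
  | Mod exp exp
  | Less exp exp
  | Equal exp exp
  | RLess exp exp

datatype instr =
    Assign nat exp
  | Rand nat
  | Store exp exp
  | RStore exp exp
  | IfNZ exp "instr list" "instr list"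
  | WhileNZ exp "instr list"
  | ParFor nat exp "instr list"
  | Call nat

text \<open>A program is a list of (parameterless, possibly recursive) procedures; the first is the entry.\<close>

type_synonym program = "instr list list"

type_synonym env = "nat \<Rightarrow> nat"

text \<open>\<open>RLess a b\<close> compares the real memory cells at addresses \<open>a\<close> and \<open>b\<close>.\<close>

primrec eval :: "nat \<Rightarrow> (nat \<Rightarrow> nat) \<Rightarrow> (nat \<Rightarrow> real) \<Rightarrow> env \<Rightarrow> exp \<Rightarrow> nat" where
  "eval w m r s (Const c) = take_bit w c"
| "eval w m r s (Var x) = s x"
| "eval w m r s (Load a) = m (eval w m r s a)"
| "eval w m r s (Plus a b) = take_bit w (eval w m r s a + eval w m r s b)"
| "eval w m r s (Minus a b) = eval w m r s a - eval w m r s b"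
| "eval w m r s (Times a b) = take_bit w (eval w m r s a * eval w m r s b)"
| "eval w m r s (Div a b) = eval w m r s a div eval w m r s b"
| "eval w m r s (Mod a b) = eval w m r s a mod eval w m r s b"
| "eval w m r s (Less a b) = take_bit w (of_bool (eval w m r s a < eval w m r s b))"
| "eval w m r s (Equal a b) = take_bit w (of_bool (eval w m r s a = eval w m r s b))"
| "eval w m r s (RLess a b) = take_bit w (of_bool (r (eval w m r s a) < r (eval w m r s b)))"

text \<open>
  \<open>Active is s\<close> still has to execute \<open>is\<close> in local environment \<open>s\<close>; \<open>Waiting ts is s\<close> is a
  thread that has forked \<open>ts\<close> and resumes with \<open>is\<close> once all of them have finished.
\<close>

datatype thread = Active "instr list" env | Waiting "thread list" "instr list" env

fun finished :: "thread \<Rightarrow> bool" where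
  "finished (Active [] s) = True"
| "finished _ = False"

text \<open>
  The result of one synchronous step of a thread and its descendants: the new thread, the issued
  writes (address, value) to the word memory and to the real memory, and the number of operations
  executed.
\<close>

type_synonym outcome = "thread \<times> (nat \<times> nat) list \<times> (nat \<times> real) list \<times> nat"

text \<open>
  \<open>RStore a b\<close> copies the real cell \<open>b\<close> to the real cell \<open>a\<close>. \<open>ParFor x e body\<close> forks as many
  threads as the value of \<open>e\<close>; each inherits the local environment, with \<open>x\<close> set to its index.
  The fork is one step, but every created thread is charged.
\<close>

fun exec_instr :: "program \<Rightarrow> nat \<Rightarrow> (nat \<Rightarrow> nat) \<Rightarrow> (nat \<Rightarrow> real) \<Rightarrow> instr \<Rightarrow> instr list \<Rightarrow> env
    \<Rightarrow> outcome pmf" where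
  "exec_instr P w m r (Assign x e) is s =
     return_pmf (Active is (s(x := eval w m r s e)), [], [], 1)"
| "exec_instr P w m r (Rand x) is s =
     map_pmf (\<lambda>v. (Active is (s(x := v)), [], [], 1)) (pmf_of_set {..<2 ^ w})"
| "exec_instr P w m r (Store a e) is s =
     return_pmf (Active is s, [(eval w m r s a, eval w m r s e)], [], 1)"
| "exec_instr P w m r (RStore a b) is s =
     return_pmf (Active is s, [], [(eval w m r s a, r (eval w m r s b))], 1)"
| "exec_instr P w m r (IfNZ e is1 is2) is s =
     return_pmf (Active ((if eval w m r s e \<noteq> 0 then is1 else is2) @ is) s, [], [], 1)"
| "exec_instr P w m r (WhileNZ e body) is s =
     return_pmf (Active (if eval w m r s e \<noteq> 0 then body @ WhileNZ e body # is else is) s,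
       [], [], 1)"
| "exec_instr P w m r (ParFor x e body) is s =
     return_pmf (Waiting (map (\<lambda>i. Active body (s(x := i))) [0..<eval w m r s e]) is s,
       [], [], Suc (eval w m r s e))"
| "exec_instr P w m r (Call p) is s =
     return_pmf (Active ((if p < length P then P ! p else []) @ is) s, [], [], 1)"

fun step_thread :: "program \<Rightarrow> nat \<Rightarrow> (nat \<Rightarrow> nat) \<Rightarrow> (nat \<Rightarrow> real) \<Rightarrow> thread \<Rightarrow> outcome pmf"
  and step_threads :: "program \<Rightarrow> nat \<Rightarrow> (nat \<Rightarrow> nat) \<Rightarrow> (nat \<Rightarrow> real) \<Rightarrow> thread list
    \<Rightarrow> (thread list \<times> (nat \<times> nat) list \<times> (nat \<times> real) list \<times> nat) pmf" where
  "step_thread P w m r (Active [] s) = return_pmf (Active [] s, [], [], 0)"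
| "step_thread P w m r (Active (i # is) s) = exec_instr P w m r i is s"
| "step_thread P w m r (Waiting ts is s) =
     (if \<forall>t\<in>set ts. finished t then return_pmf (Active is s, [], [], 1)
      else map_pmf (\<lambda>(ts', ws, rs, k). (Waiting ts' is s, ws, rs, k)) (step_threads P w m r ts))"
| "step_threads P w m r [] = return_pmf ([], [], [], 0)"
| "step_threads P w m r (t # ts) =
     bind_pmf (step_thread P w m r t) (\<lambda>(t', ws, rs, k).
       map_pmf (\<lambda>(ts', ws', rs', k'). (t' # ts', ws @ ws', rs @ rs', k + k'))
         (step_threads P w m r ts))"

text \<open>
  All reads of a step see the memory before the step. Priority concurrent write: among the values
  written to the same cell in the same step, the smallest is stored.
\<close>

definition priority_write :: "(nat \<Rightarrow> 'a::linorder) \<Rightarrow> (nat \<times> 'a) list \<Rightarrow> nat \<Rightarrow> 'a" where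
  "priority_write m ws a =
     (if a \<in> fst ` set ws then Min {v. (a, v) \<in> set ws} else m a)"

record config =
  root_thread :: thread
  word_mem :: "nat \<Rightarrow> nat"
  real_mem :: "nat \<Rightarrow> real"
  work :: nat

definition step :: "program \<Rightarrow> nat \<Rightarrow> config \<Rightarrow> config pmf" where
  "step P w c = map_pmf (\<lambda>(t, ws, rs, k).
       \<lparr> root_thread = t, word_mem = priority_write (word_mem c) ws,
         real_mem = priority_write (real_mem c) rs, work = work c + k \<rparr>)
     (step_thread P w (word_mem c) (real_mem c) (root_thread c))"

text \<open>Distribution of the configuration after \<open>T\<close> steps; finished configurations stay put.\<close>

primrec run :: "program \<Rightarrow> nat \<Rightarrow> config \<Rightarrow> nat \<Rightarrow> config pmf" where
  "run P w c 0 = return_pmf c"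
| "run P w c (Suc T) = bind_pmf (run P w c T) (step P w)"

definition halted :: "config \<Rightarrow> bool" where
  "halted c \<longleftrightarrow> finished (root_thread c)"

text \<open>
  In every step each thread that is neither finished nor waiting executes one instruction. Hence the
  number of steps until the machine halts is the length of the longest chain of sequentially
  dependent instructions, that is, the depth.
\<close>

definition prob_depth_le :: "program \<Rightarrow> nat \<Rightarrow> config \<Rightarrow> nat \<Rightarrow> real" where
  "prob_depth_le P w c T = measure_pmf.prob (run P w c T) {c'. halted c'}"

text \<open>
  The work of the first \<open>T\<close> steps increases with \<open>T\<close>, so by monotone convergence the supremum is
  the expectation of the total work (infinite values included).
\<close>

definition expected_work :: "program \<Rightarrow> nat \<Rightarrow> config \<Rightarrow> ennreal" where
  "expected_work P w c = (SUP T. \<integral>\<^sup>+ c'. of_nat (work c') \<partial>measure_pmf (run P w c T))"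

text \<open>A run halts almost surely, and whenever it halts the final configuration satisfies \<open>Q\<close>.\<close>

definition computes :: "program \<Rightarrow> nat \<Rightarrow> config \<Rightarrow> (config \<Rightarrow> bool) \<Rightarrow> bool" where
  "computes P w c Q \<longleftrightarrow> prob_depth_le P w c \<longlonglongrightarrow> 1 \<and>
     (\<forall>T. \<forall>c'\<in>set_pmf (run P w c T). halted c' \<longrightarrow> Q c')"


section \<open>Input and output\<close>

definition edge :: "nat \<times> nat \<Rightarrow> nat set" where
  "edge p = {fst p, snd p}"

text \<open>
  A tree with vertices \<open>0, \<dots>, n - 1\<close> is presented as an array of its edges, in arbitrary order and
  with arbitrary order of the endpoints.
\<close>

definition tree_input :: "nat \<Rightarrow> nat set set \<Rightarrow> (nat \<times> nat) list \<Rightarrow> bool" where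
  "tree_input n E es \<longleftrightarrow> is_tree {..<n} E \<and> distinct (map edge es) \<and> set (map edge es) = E"

text \<open>
  The input occupies word cell 0 (number of vertices), word cells \<open>1 + 2 i\<close> and \<open>2 + 2 i\<close>
  (endpoints of edge \<open>i\<close>) and real cell \<open>i\<close> (weight of edge \<open>i\<close>); all other cells are zero.
\<close>

definition initial_config :: "nat \<Rightarrow> (nat set \<Rightarrow> real) \<Rightarrow> (nat \<times> nat) list \<Rightarrow> config" where
  "initial_config n wt es =
     \<lparr> root_thread = Active [Call 0] (\<lambda>_. 0),
       word_mem = (\<lambda>a. if a = 0 then n
                       else if a \<le> 2 * length es then
                         (if odd a then fst (es ! ((a - 1) div 2)) else snd (es ! ((a - 1) div 2)))
                       else 0),
       real_mem = (\<lambda>i. if i < length es then wt (edge (es ! i)) else 0),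
       work = 0 \<rparr>"

text \<open>
  Node \<open>p\<close> of the output is the leaf \<open>p\<close> if \<open>p < n\<close>, and the internal node of edge \<open>j\<close> if
  \<open>p = n + j\<close>; in the latter case real cell \<open>p\<close> holds its height and word cells \<open>2 p\<close> and
  \<open>2 p + 1\<close> hold its two children. Word cell 0 holds the root.
\<close>

primrec represents :: "nat \<Rightarrow> (nat \<times> nat) list \<Rightarrow> (nat \<Rightarrow> nat) \<Rightarrow> (nat \<Rightarrow> real)
    \<Rightarrow> nat dendrogram \<Rightarrow> nat \<Rightarrow> bool" where
  "represents n es m r (Leaf v) p \<longleftrightarrow> p < n \<and> v = p"
| "represents n es m r (Node e h d1 d2) p \<longleftrightarrow>
     (\<exists>j<length es. p = n + j \<and> e = edge (es ! j)) \<and> r p = h \<and>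
     represents n es m r d1 (m (2 * p)) \<and> represents n es m r d2 (m (2 * p + 1))"

definition dendrogram_output ::
  "nat \<Rightarrow> nat set set \<Rightarrow> (nat set \<Rightarrow> real) \<Rightarrow> (nat \<times> nat) list \<Rightarrow> config \<Rightarrow> bool" where
  "dendrogram_output n E wt es c \<longleftrightarrow>
     (\<exists>d. is_dendrogram wt {..<n} E d \<and>
          represents n es (word_mem c) (real_mem c) d (word_mem c 0))"

text \<open>Words of \<open>k\<close> times the length of the binary representation of \<open>n\<close>.\<close>

definition word_size :: "nat \<Rightarrow> nat \<Rightarrow> nat" where
  "word_size k n = k * floorlog 2 n"

end

theory Submission
  imports Defs "HOL-Real_Asymp.Real_Asymp"
begin

text \<open>
  The algorithm is deterministic, so the bounds hold surely. After a parallel merge sort the edges are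
  labelled by rank, and the dendrogram is determined by the parent of every node: the lightest edge
  that is heavier than the node and connected to it by edges that are not heavier than that edge.
  A Boruvka round contracts every vertex along its lightest incident edge. This at least halves the
  number of edges and does not change the clusters of the surviving ones. Going back through the
  rounds, every contracted edge \<open>e\<close> is inserted below the parent of \<open>\<nu> e\<close>, the topmost node below
  \<open>e\<close> on the path from its contracted vertex, which is found by binary lifting. The edges with the
  same value of \<open>\<nu>\<close> form a chain, so the parent of \<open>e\<close> is the next larger edge in that chain, or the
  parent of \<open>\<nu> e\<close> if there is none. A round with \<open>m\<close> edges takes \<open>O(m log n)\<close> work and \<open>O(log n)\<close>
  depth; the sizes decrease geometrically over at most \<open>log n\<close> rounds.
\<close>

section \<open>Deterministic execution\<close>

text \<open>Since the program draws no random words, probability and expectation reduce to one run,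
  and the real burden is to count its steps. Every parallel loop consists of straight-line code that
  ends in one store, so its threads stay in lockstep and the loop acts as one simultaneous array
  update. Two obstacles come from the work bound. A table indexed by pairs of a node and a block is
  too large to be cleared, so every round owns a slice of memory that is zero from the start, and a
  cell that was never written reads as a missing parent or an empty block. And each merge level may
  cost only \<open>O(M)\<close>: a binary search of logarithmic length is shared by \<open>L\<close>
  consecutive outputs, with \<open>L\<close> at least \<open>Lam + 1\<close>. Breaking ties by rank
  makes the labels distinct, so that parents are unique, while the dendrogram itself only needs
  weights that are weakly monotone in the labels. The depth obtained is of order
  \<open>log^2 n\<close>, which is below the required bound by an iterated logarithm.\<close>

abbreviation cfg :: "thread \<Rightarrow> (nat \<Rightarrow> nat) \<Rightarrow> (nat \<Rightarrow> real) \<Rightarrow> nat \<Rightarrow> config" where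
  "cfg t m r W \<equiv> \<lparr>root_thread = t, word_mem = m, real_mem = r, work = W\<rparr>"

lemma run_add: "run P w c (a + b) = bind_pmf (run P w c a) (\<lambda>c'. run P w c' b)"
  by (induction b) (auto simp: bind_assoc_pmf bind_return_pmf')

lemma run_Suc_left: "run P w c (Suc T) = bind_pmf (step P w c) (\<lambda>c'. run P w c' T)"
  using run_add[of P w c "Suc 0" T] by (simp add: bind_return_pmf)

lemma priority_write_Nil [simp]: "priority_write m [] = m"
  by (simp add: priority_write_def fun_eq_iff)

text \<open>\<open>d\<close> and \<open>k\<close> are fixed before the continuation
  \<open>rest\<close> and the work done so far, which makes the relation composable; equality with a
  point distribution states that no randomness occurs. \<open>D\<close> and \<open>K\<close> are
  only upper bounds, so costs can be rounded up at every composition.\<close>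

definition runs :: "program \<Rightarrow> nat \<Rightarrow> instr list \<Rightarrow> (nat \<Rightarrow> nat) \<Rightarrow> (nat \<Rightarrow> real) \<Rightarrow> env
    \<Rightarrow> (nat \<Rightarrow> nat) \<Rightarrow> (nat \<Rightarrow> real) \<Rightarrow> env \<Rightarrow> nat \<Rightarrow> nat \<Rightarrow> bool" where
  "runs P w is m r s m' r' s' D K \<longleftrightarrow>
    (\<exists>d\<le>D. \<exists>k\<le>K. \<forall>rest W. run P w (cfg (Active (is @ rest) s) m r W) d
        = return_pmf (cfg (Active rest s') m' r' (W + k)))"

lemma runs_mono: "runs P w is m r s m' r' s' D K \<Longrightarrow> D \<le> D' \<Longrightarrow> K \<le> K' \<Longrightarrow>
    runs P w is m r s m' r' s' D' K'"
  unfolding runs_def by (meson le_trans)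

lemma runs_Nil: "runs P w [] m r s m r s 0 0"
  unfolding runs_def by simp

lemma runs_append:
  assumes "runs P w is1 m r s m1 r1 s1 D1 K1" "runs P w is2 m1 r1 s1 m2 r2 s2 D2 K2"
  shows "runs P w (is1 @ is2) m r s m2 r2 s2 (D1 + D2) (K1 + K2)"
proof -
  obtain d1 k1 where 1: "d1 \<le> D1" "k1 \<le> K1" "\<And>rest W. run P w (cfg (Active (is1 @ rest) s) m r W) d1
        = return_pmf (cfg (Active rest s1) m1 r1 (W + k1))"
    using assms(1) unfolding runs_def by blast
  obtain d2 k2 where 2: "d2 \<le> D2" "k2 \<le> K2" "\<And>rest W. run P w (cfg (Active (is2 @ rest) s1) m1 r1 W) d2
        = return_pmf (cfg (Active rest s2) m2 r2 (W + k2))"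
    using assms(2) unfolding runs_def by blast
  show ?thesis unfolding runs_def
    by (rule exI[of _ "d1 + d2"], intro conjI exI[of _ "k1 + k2"])
      (use 1 2 in \<open>auto simp: run_add bind_return_pmf add.assoc\<close>)
qed

lemma runs_instr:
  assumes "\<And>rest. exec_instr P w m r i rest s = return_pmf (Active (is' @ rest) s', ws, rs, k)"
    and "m' = priority_write m ws" "r' = priority_write r rs"
    and "runs P w is' m' r' s' m2 r2 s2 D K"
  shows "runs P w [i] m r s m2 r2 s2 (Suc D) (k + K)"
proof -
  obtain d k' where 1: "d \<le> D" "k' \<le> K" "\<And>rest W. run P w (cfg (Active (is' @ rest) s') m' r' W) d
        = return_pmf (cfg (Active rest s2) m2 r2 (W + k'))"
    using assms(4) unfolding runs_def by blast
  have "step P w (cfg (Active ([i] @ rest) s) m r W) =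
      return_pmf (cfg (Active (is' @ rest) s') m' r' (W + k))" for rest W
    using assms by (simp add: step_def)
  then show ?thesis unfolding runs_def
    by (intro exI[of _ "Suc d"] conjI exI[of _ "k + k'"])
      (use 1 in \<open>auto simp: run_Suc_left bind_return_pmf add.assoc simp del: run.simps(2)\<close>)
qed

lemma runs_Assign: "runs P w [Assign x e] m r s m r (s(x := eval w m r s e)) 1 1"
  using runs_instr[where is' = "[]" and ws = "[]" and rs = "[]" and k = 1, OF _ _ _ runs_Nil]
  by simp

lemma runs_While_done:
  assumes "eval w m r s e = 0"
  shows "runs P w [WhileNZ e body] m r s m r s 1 1"
proof -
  have "runs P w [WhileNZ e body] m r s m r s (Suc 0) (1 + 0)"
    by (rule runs_instr[where is' = "[]" and ws = "[]" and rs = "[]", OF _ _ _ runs_Nil])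
      (use assms in auto)
  then show ?thesis by simp
qed

lemma runs_While_step:
  assumes "eval w m r s e \<noteq> 0" "runs P w body m r s m1 r1 s1 D1 K1"
    "runs P w [WhileNZ e body] m1 r1 s1 m2 r2 s2 D2 K2"
  shows "runs P w [WhileNZ e body] m r s m2 r2 s2 (Suc (D1 + D2)) (1 + (K1 + K2))"
  by (rule runs_instr[where is' = "body @ [WhileNZ e body]" and ws = "[]" and rs = "[]",
      OF _ _ _ runs_append[OF assms(2,3)]]) (use assms(1) in auto)

primrec assigns :: "nat \<Rightarrow> (nat \<Rightarrow> nat) \<Rightarrow> (nat \<Rightarrow> real) \<Rightarrow> (nat \<times> exp) list \<Rightarrow> env \<Rightarrow> env" where
  "assigns w m r [] s = s"
| "assigns w m r (p # ps) s = assigns w m r ps (s(fst p := eval w m r s (snd p)))"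

abbreviation lets :: "(nat \<times> exp) list \<Rightarrow> instr list" where
  "lets as \<equiv> map (\<lambda>p. Assign (fst p) (snd p)) as"

definition pwrite :: "(nat \<Rightarrow> 'a::linorder) \<Rightarrow> nat \<Rightarrow> (nat \<Rightarrow> nat) \<Rightarrow> (nat \<Rightarrow> 'a) \<Rightarrow> nat \<Rightarrow> 'a" where
  "pwrite m N a v = priority_write m (map (\<lambda>i. (a i, v i)) [0..<N])"

lemma pwrite_eq:
  "pwrite m N a v x = (if \<exists>i<N. a i = x then Min {v i |i. i < N \<and> a i = x} else m x)"
proof -
  have "{va. (x, va) \<in> set (map (\<lambda>i. (a i, v i)) [0..<N])} = {v i |i. i < N \<and> a i = x}"
    by auto
  moreover have "x \<in> fst ` set (map (\<lambda>i. (a i, v i)) [0..<N]) \<longleftrightarrow> (\<exists>i<N. a i = x)"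
    by force
  ultimately show ?thesis
    unfolding pwrite_def priority_write_def by presburger
qed

lemma step_threads_Assign:
  "step_threads P w m r (map (\<lambda>i. Active (Assign y e # bd) (f i)) xs) =
   return_pmf (map (\<lambda>i. Active bd ((f i)(y := eval w m r (f i) e))) xs, [], [], length xs)"
  by (induction xs) (auto simp: bind_return_pmf)

lemma step_threads_Store:
  "step_threads P w m r (map (\<lambda>i. Active (Store a e # bd) (f i)) xs) =
   return_pmf (map (\<lambda>i. Active bd (f i)) xs,
     map (\<lambda>i. (eval w m r (f i) a, eval w m r (f i) e)) xs, [], length xs)"
  by (induction xs) (auto simp: bind_return_pmf)

lemma step_threads_RStore:
  "step_threads P w m r (map (\<lambda>i. Active (RStore a e # bd) (f i)) xs) =
   return_pmf (map (\<lambda>i. Active bd (f i)) xs,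
     [], map (\<lambda>i. (eval w m r (f i) a, r (eval w m r (f i) e))) xs, length xs)"
  by (induction xs) (auto simp: bind_return_pmf)

text \<open>The threads execute the same straight-line code and so advance in lockstep. A nonempty
  tail \<open>bd\<close> keeps them unfinished, and \<open>xs\<close> is nonempty because a thread
  waiting for nobody would resume at once.\<close>

lemma run_lets:
  assumes "xs \<noteq> []" "bd \<noteq> []"
  shows "run P w (cfg (Waiting (map (\<lambda>i. Active (lets as @ bd) (f i)) xs) is s) m r W) (length as) =
    return_pmf (cfg (Waiting (map (\<lambda>i. Active bd (assigns w m r as (f i))) xs) is s) m r
      (W + length as * length xs))"
proof (induction as arbitrary: f W)
  case (Cons p ps)
  have "\<not> (\<forall>t\<in>set (map (\<lambda>i. Active (Assign (fst p) (snd p) # lets ps @ bd) (f i)) xs). finished t)"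
    using assms by (cases xs) auto
  then have "step P w (cfg (Waiting (map (\<lambda>i. Active (lets (p # ps) @ bd) (f i)) xs) is s) m r W) =
    return_pmf (cfg (Waiting (map (\<lambda>i. Active (lets ps @ bd)
      ((f i)(fst p := eval w m r (f i) (snd p)))) xs) is s) m r (W + length xs))"
    by (simp add: step_def step_threads_Assign)
  then have "run P w (cfg (Waiting (map (\<lambda>i. Active (lets (p # ps) @ bd) (f i)) xs) is s) m r W)
      (Suc (length ps)) =
    return_pmf (cfg (Waiting (map (\<lambda>i. Active bd (assigns w m r ps
      ((f i)(fst p := eval w m r (f i) (snd p))))) xs) is s) m r
      (W + length xs + length ps * length xs))"
    by (simp only: run_Suc_left bind_return_pmf
        Cons.IH[of "\<lambda>i. (f i)(fst p := eval w m r (f i) (snd p))" "W + length xs"])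
  then show ?case
    by (simp only: list.size assigns.simps mult_Suc add.assoc add_0_right add_Suc_right)
qed auto

text \<open>Forking takes one step and \<open>N + 1\<close> work, the assignments
  \<open>length as\<close> steps, the final instruction \<open>st\<close> and the join one step
  each. Only \<open>st\<close> affects the memory, so all reads of the loop see the memory before
  it.\<close>

lemma runs_par:
  assumes N: "eval w m r s e = N"
    and st: "\<And>W rest. N > 0 \<Longrightarrow> step P w (cfg (Waiting (map (\<lambda>i. Active [st]
        (assigns w m r as (s(x := i)))) [0..<N]) rest s) m r W) =
      return_pmf (cfg (Waiting (map (\<lambda>i. Active [] (assigns w m r as (s(x := i)))) [0..<N]) rest s)
        m' r' (W + N))"
    and 0: "N = 0 \<Longrightarrow> m' = m \<and> r' = r"
  shows "runs P w [ParFor x e (lets as @ [st])] m r s m' r' s (length as + 3) (N * (length as + 2) + 2)"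
proof -
  have fork: "step P w (cfg (Active ([ParFor x e (lets as @ [st])] @ rest) s) m r W) =
    return_pmf (cfg (Waiting (map (\<lambda>i. Active (lets as @ [st]) (s(x := i))) [0..<N]) rest s) m r
      (W + Suc N))" for rest W
    using N by (simp add: step_def)
  have join: "step P w (cfg (Waiting (map (\<lambda>i. Active [] (f i)) xs) rest s) m r W) =
    return_pmf (cfg (Active rest s) m r (W + 1))" for rest m r W xs and f :: "nat \<Rightarrow> env"
    by (simp add: step_def)
  show ?thesis
  proof (cases "N = 0")
    case True
    have "run P w (cfg (Active ([ParFor x e (lets as @ [st])] @ rest) s) m r W) 2 =
        return_pmf (cfg (Active rest s) m r (W + 2))" for rest W
      using fork[of rest W] join[of undefined "[]" rest m r "W + 1"] True
      by (simp add: numeral_2_eq_2 bind_return_pmf)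
    then show ?thesis unfolding runs_def using 0 True by (intro exI[of _ 2]) auto
  next
    case False
    have "run P w (cfg (Active ([ParFor x e (lets as @ [st])] @ rest) s) m r W)
        (Suc (length as + Suc (Suc 0))) =
        return_pmf (cfg (Active rest s) m' r' (W + (N * (length as + 2) + 2)))" for rest W
      using False
      by (subst run_Suc_left, subst fork, simp only: bind_return_pmf, subst run_add, subst run_lets)
        (auto simp: bind_return_pmf run_Suc_left st join algebra_simps simp del: run.simps(2))
    then show ?thesis unfolding runs_def
      by (intro exI[of _ "Suc (length as + Suc (Suc 0))"]) auto
  qed
qed

lemma runs_par_Store:
  assumes N: "eval w m r s e = N"
    and a: "\<And>i. i < N \<Longrightarrow> eval w m r (assigns w m r as (s(x := i))) ea = a i"
    and v: "\<And>i. i < N \<Longrightarrow> eval w m r (assigns w m r as (s(x := i))) val = v i"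
  shows "runs P w [ParFor x e (lets as @ [Store ea val])] m r s (pwrite m N a v) r s
     (length as + 3) (N * (length as + 2) + 2)"
proof (rule runs_par[OF N])
  fix W rest assume "N > 0"
  then have nf: "\<not> (\<forall>t\<in>set (map (\<lambda>i. Active [Store ea val] (assigns w m r as (s(x := i)))) [0..<N]). finished t)"
    by auto
  have eq: "map (\<lambda>i. (eval w m r (assigns w m r as (s(x := i))) ea,
       eval w m r (assigns w m r as (s(x := i))) val)) [0..<N] = map (\<lambda>i. (a i, v i)) [0..<N]"
    using a v by auto
  from nf show "step P w (cfg (Waiting (map (\<lambda>i. Active [Store ea val]
        (assigns w m r as (s(x := i)))) [0..<N]) rest s) m r W) =
      return_pmf (cfg (Waiting (map (\<lambda>i. Active [] (assigns w m r as (s(x := i)))) [0..<N]) rest s)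
        (pwrite m N a v) r (W + N))"
    by (simp only: step_def pwrite_def eq[symmetric]) (simp add: step_threads_Store)
qed (simp add: pwrite_def)

lemma runs_par_RStore:
  assumes N: "eval w m r s e = N"
    and a: "\<And>i. i < N \<Longrightarrow> eval w m r (assigns w m r as (s(x := i))) ea = a i"
    and v: "\<And>i. i < N \<Longrightarrow> r (eval w m r (assigns w m r as (s(x := i))) val) = v i"
  shows "runs P w [ParFor x e (lets as @ [RStore ea val])] m r s m (pwrite r N a v) s
     (length as + 3) (N * (length as + 2) + 2)"
proof (rule runs_par[OF N])
  fix W rest assume "N > 0"
  then have nf: "\<not> (\<forall>t\<in>set (map (\<lambda>i. Active [RStore ea val] (assigns w m r as (s(x := i)))) [0..<N]). finished t)"
    by auto
  have eq: "map (\<lambda>i. (eval w m r (assigns w m r as (s(x := i))) ea,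
       r (eval w m r (assigns w m r as (s(x := i))) val))) [0..<N] = map (\<lambda>i. (a i, v i)) [0..<N]"
    using a v by auto
  from nf show "step P w (cfg (Waiting (map (\<lambda>i. Active [RStore ea val]
        (assigns w m r as (s(x := i)))) [0..<N]) rest s) m r W) =
      return_pmf (cfg (Waiting (map (\<lambda>i. Active [] (assigns w m r as (s(x := i)))) [0..<N]) rest s)
        m (pwrite r N a v) (W + N))"
    by (simp only: step_def pwrite_def eq[symmetric]) (simp add: step_threads_RStore)
qed (simp add: pwrite_def)

section \<open>From deterministic runs to probabilities\<close>

lemma run_halted:
  assumes "halted c" shows "run P w c T = return_pmf c"
proof -
  obtain s where "root_thread c = Active [] s"
    using assms unfolding halted_def by (cases "root_thread c" rule: finished.cases) auto
  then have "step P w c = return_pmf c"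
    by (cases c) (simp add: step_def)
  then show ?thesis by (induction T) (auto simp: bind_return_pmf)
qed

text \<open>Work never decreases along a step, so the expectation at any time is bounded by the one
  at a time when the run has halted and the distribution is a point.\<close>

lemma work_mono:
  "(\<integral>\<^sup>+ c'. of_nat (work c') \<partial>measure_pmf (run P w c T))
   \<le> (\<integral>\<^sup>+ c'. of_nat (work c') \<partial>measure_pmf (run P w c (T + T')))"
proof (induction T')
  case (Suc T')
  have "of_nat (work c') \<le> (\<integral>\<^sup>+ c''. of_nat (work c'') \<partial>measure_pmf (step P w c'))" for c'
  proof -
    have "(of_nat (work c') :: ennreal) = (\<integral>\<^sup>+ c''. of_nat (work c') \<partial>measure_pmf (step P w c'))"
      by simp
    also have "\<dots> \<le> (\<integral>\<^sup>+ c''. of_nat (work c'') \<partial>measure_pmf (step P w c'))"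
      by (intro nn_integral_mono_AE) (auto simp: AE_measure_pmf_iff step_def)
    finally show ?thesis .
  qed
  then have "(\<integral>\<^sup>+ c'. of_nat (work c') \<partial>measure_pmf (run P w c (T + T')))
     \<le> (\<integral>\<^sup>+ c'. of_nat (work c') \<partial>measure_pmf (run P w c (T + Suc T')))"
    by (auto simp: nn_integral_bind_pmf intro!: nn_integral_mono)
  with Suc show ?case by (rule order_trans)
qed simp

text \<open>Determinism turns the bounds on one run into statements of probability one; the extra
  unit is the initial \<open>Call 0\<close>.\<close>

lemma runs_main:
  assumes r: "runs [main] w main m r (\<lambda>_. 0) m' r' s' D K"
    and Q: "\<And>W. Q (cfg (Active [] s') m' r' W)"
  shows "computes [main] w (cfg (Active [Call 0] (\<lambda>_. 0)) m r 0) Q"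
    and "expected_work [main] w (cfg (Active [Call 0] (\<lambda>_. 0)) m r 0) \<le> of_nat (Suc K)"
    and "prob_depth_le [main] w (cfg (Active [Call 0] (\<lambda>_. 0)) m r 0) (Suc D) = 1"
proof -
  define c where "c = cfg (Active [Call 0] (\<lambda>_. 0)) m r 0"
  have "runs [main] w [Call 0] m r (\<lambda>_. 0) m' r' s' (Suc D) (1 + K)"
    by (rule runs_instr[OF _ _ _ r, where ws = "[]" and rs = "[]"]) auto
  then obtain d k where dk: "d \<le> Suc D" "k \<le> Suc K" and
      "\<And>rest W. run [main] w (cfg (Active ([Call 0] @ rest) (\<lambda>_. 0)) m r W) d
        = return_pmf (cfg (Active rest s') m' r' (W + k))"
    unfolding runs_def by auto
  from this(3)[of "[]" 0] have d: "run [main] w c d = return_pmf (cfg (Active [] s') m' r' k)"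
    by (simp add: c_def)
  define f where "f = cfg (Active [] s') m' r' k"
  have hf: "halted f" by (simp add: halted_def f_def)
  have ge: "run [main] w c T = return_pmf f" if "T \<ge> d" for T
  proof -
    have "T = d + (T - d)" using that by simp
    then show ?thesis by (metis (no_types, lifting) run_add d bind_return_pmf run_halted hf f_def)
  qed
  have pr: "prob_depth_le [main] w c T = 1" if "T \<ge> d" for T
    using ge[OF that] hf by (simp add: prob_depth_le_def measure_return)
  show "prob_depth_le [main] w (cfg (Active [Call 0] (\<lambda>_. 0)) m r 0) (Suc D) = 1"
    using pr[OF dk(1)] by (simp add: c_def)
  have "prob_depth_le [main] w c \<longlonglongrightarrow> 1"
    by (rule tendsto_eventually, rule eventually_sequentiallyI[of d]) (rule pr)
  \<comment> \<open>A halted configuration stays in the support at every later time, and from time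
    \<open>d\<close> on the support is the single configuration \<open>f\<close>.\<close>
  moreover have "Q c'" if "c' \<in> set_pmf (run [main] w c T)" "halted c'" for c' T
  proof -
    have "c' \<in> set_pmf (run [main] w c (T + d))"
      using that by (force simp: run_add run_halted)
    then have "c' = f" using ge[of "T + d"] by simp
    then show ?thesis using Q by (simp add: f_def)
  qed
  ultimately show "computes [main] w (cfg (Active [Call 0] (\<lambda>_. 0)) m r 0) Q"
    unfolding computes_def c_def by blast
  have "(\<integral>\<^sup>+ c'. of_nat (work c') \<partial>measure_pmf (run [main] w c T)) \<le> of_nat (Suc K)" for T
  proof -
    have "(\<integral>\<^sup>+ c'. of_nat (work c') \<partial>measure_pmf (run [main] w c T)) \<le>
      (\<integral>\<^sup>+ c'. of_nat (work c') \<partial>measure_pmf (run [main] w c (T + d)))" by (rule work_mono)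
    also have "\<dots> = of_nat k" using ge[of "T + d"] by (simp add: f_def)
    also have "\<dots> \<le> of_nat (Suc K)" using dk by (simp only: of_nat_le_iff)
    finally show ?thesis .
  qed
  then show "expected_work [main] w (cfg (Active [Call 0] (\<lambda>_. 0)) m r 0) \<le> of_nat (Suc K)"
    unfolding expected_work_def c_def[symmetric] by (intro SUP_least)
qed

section \<open>Connectivity in multigraphs and contraction\<close>

text \<open>\<open>ep e 0\<close> and \<open>ep e 1\<close> are the ends of the edge labelled
  \<open>e\<close>, and \<open>1 - s\<close> is the opposite side. Contraction then only changes
  \<open>ep\<close>, so an edge keeps its label in all rounds.\<close>

definition arcs :: "nat set \<Rightarrow> (nat \<Rightarrow> nat \<Rightarrow> nat) \<Rightarrow> (nat \<times> nat) set" where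
  "arcs F ep = {(ep e s, ep e (1 - s)) |e s. e \<in> F \<and> s < 2}"

definition conn :: "nat set \<Rightarrow> (nat \<Rightarrow> nat \<Rightarrow> nat) \<Rightarrow> nat \<Rightarrow> nat \<Rightarrow> bool" where
  "conn F ep x y \<longleftrightarrow> (x, y) \<in> (arcs F ep)\<^sup>*"

abbreviation cut :: "nat set \<Rightarrow> nat \<Rightarrow> nat set" where
  "cut A g \<equiv> {e \<in> A. e \<le> g}"

lemma less_2_iff: "(s::nat) < 2 \<longleftrightarrow> s = 0 \<or> s = 1" by auto

lemma conn_refl [simp]: "conn F ep x x"
  by (simp add: conn_def)

lemma conn_trans [trans]: "conn F ep x y \<Longrightarrow> conn F ep y z \<Longrightarrow> conn F ep x z"
  unfolding conn_def by (rule rtrancl_trans)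

lemma sym_arcs: "sym (arcs F ep)"
proof (rule symI)
  fix x y assume "(x, y) \<in> arcs F ep"
  then obtain e s where "e \<in> F" "s < 2" "x = ep e s" "y = ep e (1 - s)"
    by (auto simp: arcs_def)
  then show "(y, x) \<in> arcs F ep"
    unfolding arcs_def by (intro CollectI exI[where x = e] exI[where x = "1 - s"]) auto
qed

lemma conn_sym: "conn F ep x y \<Longrightarrow> conn F ep y x"
  unfolding conn_def by (meson sym_arcs sym_rtrancl symD)

lemma conn_mono: "conn F ep x y \<Longrightarrow> F \<subseteq> G \<Longrightarrow> conn G ep x y"
  unfolding conn_def by (rule rtrancl_mono[THEN subsetD]) (auto simp: arcs_def)

lemma conn_edge:
  assumes "e \<in> F" "s < 2" "t < 2" shows "conn F ep (ep e s) (ep e t)"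
proof -
  have "(ep e 0, ep e 1) \<in> arcs F ep" "(ep e 1, ep e 0) \<in> arcs F ep"
    unfolding arcs_def using assms(1) by (force intro: exI[of _ e])+
  then show ?thesis using assms(2,3)
    unfolding conn_def less_2_iff by auto
qed

lemma conn_invariant:
  assumes "conn F ep x y" "Q x" "\<And>e s. e \<in> F \<Longrightarrow> s < 2 \<Longrightarrow> Q (ep e s) \<Longrightarrow> Q (ep e (1 - s))"
  shows "Q y"
  using assms(1) unfolding conn_def
  by (induction rule: rtrancl_induct) (use assms(2,3) in \<open>auto simp: arcs_def\<close>)

definition surv :: "nat set \<Rightarrow> (nat \<Rightarrow> nat \<Rightarrow> nat) \<Rightarrow> (nat \<Rightarrow> nat) \<Rightarrow> nat set" where
  "surv A ep P = {e \<in> A. P (ep e 0) \<noteq> P (ep e 1)}"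

definition ren :: "(nat \<Rightarrow> nat \<Rightarrow> nat) \<Rightarrow> (nat \<Rightarrow> nat) \<Rightarrow> nat \<Rightarrow> nat \<Rightarrow> nat" where
  "ren ep P e s = P (ep e s)"

text \<open>The image of a walk under \<open>P\<close> is a walk again once the edges that have
  turned into loops are dropped.\<close>

lemma conn_contract:
  assumes "conn F ep x y" "F \<subseteq> A"
  shows "conn (F \<inter> surv A ep P) (ren ep P) (P x) (P y)"
  using assms(1)
proof (rule conn_invariant)
  fix e s assume e: "e \<in> F" "s < 2" "conn (F \<inter> surv A ep P) (ren ep P) (P x) (P (ep e s))"
  have "conn (F \<inter> surv A ep P) (ren ep P) (P (ep e s)) (P (ep e (1 - s)))"
  proof (cases "e \<in> surv A ep P")
    case True
    then have "conn (F \<inter> surv A ep P) (ren ep P) (ren ep P e s) (ren ep P e (1 - s))"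
      using e by (intro conn_edge) auto
    then show ?thesis by (simp add: ren_def)
  next
    case False
    then show ?thesis using e assms(2) by (auto simp: surv_def less_2_iff)
  qed
  then show "conn (F \<inter> surv A ep P) (ren ep P) (P x) (P (ep e (1 - s)))"
    using e(3) conn_trans by blast
qed simp

text \<open>Each step of a contracted walk is expanded: from the image of one end back to that end,
  across the edge, and on to the image of the other end.\<close>

lemma conn_uncontract:
  assumes "conn F (ren ep P) x y" "F \<subseteq> G"
    and "\<And>e s. e \<in> F \<Longrightarrow> s < 2 \<Longrightarrow> conn G ep (ep e s) (P (ep e s))"
  shows "conn G ep x y"
  using assms(1)
proof (rule conn_invariant)
  fix e s assume e: "e \<in> F" "s < 2" "conn G ep x (ren ep P e s)"
  have "conn G ep (P (ep e s)) (ep e s)" using e assms(3) conn_sym by blast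
  moreover have "conn G ep (ep e s) (ep e (1 - s))" using e assms(2) by (intro conn_edge) auto
  moreover have "conn G ep (ep e (1 - s)) (P (ep e (1 - s)))"
    using e by (intro assms(3)) auto
  ultimately show "conn G ep x (ren ep P e (1 - s))"
    using e(3) unfolding ren_def by (meson conn_trans)
qed simp

text \<open>Acyclicity is expressed by every edge being a bridge. This excludes loops and parallel
  edges as well, and it passes to contracted graphs by lifting a detour with
  \<open>conn_uncontract\<close>.\<close>

definition ctree :: "nat set \<Rightarrow> nat set \<Rightarrow> (nat \<Rightarrow> nat \<Rightarrow> nat) \<Rightarrow> bool" where
  "ctree V A ep \<longleftrightarrow> finite V \<and> finite A \<and> V \<noteq> {} \<and> (\<forall>e\<in>A. \<forall>s<2. ep e s \<in> V) \<and>
     (\<forall>x\<in>V. \<forall>y\<in>V. conn A ep x y) \<and> (\<forall>e\<in>A. \<not> conn (A - {e}) ep (ep e 0) (ep e 1))"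

lemma ctreeD:
  assumes "ctree V A ep"
  shows "finite V" "finite A" "V \<noteq> {}" "\<And>e s. e \<in> A \<Longrightarrow> s < 2 \<Longrightarrow> ep e s \<in> V"
    "\<And>x y. x \<in> V \<Longrightarrow> y \<in> V \<Longrightarrow> conn A ep x y"
    "\<And>e. e \<in> A \<Longrightarrow> \<not> conn (A - {e}) ep (ep e 0) (ep e 1)"
    "\<And>e. e \<in> A \<Longrightarrow> ep e 0 \<noteq> ep e 1"
proof -
  show "\<And>e. e \<in> A \<Longrightarrow> ep e 0 \<noteq> ep e 1"
    using assms conn_refl unfolding ctree_def by metis
qed (use assms in \<open>auto simp: ctree_def\<close>)

text \<open>The paths from \<open>x\<close> to \<open>P x\<close> use contracted edges only, so a
  detour around a surviving edge lifts to a detour around the same edge before the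
  contraction.\<close>

lemma ctree_contract:
  assumes t: "ctree V A ep"
    and P: "\<And>x. x \<in> V \<Longrightarrow> P x \<in> V" "\<And>x. x \<in> V \<Longrightarrow> conn (A - surv A ep P) ep x (P x)"
  shows "ctree (P ` V) (surv A ep P) (ren ep P)"
  unfolding ctree_def
proof (intro conjI ballI allI impI)
  show "finite (P ` V)" "finite (surv A ep P)" "P ` V \<noteq> {}"
    using ctreeD[OF t] by (auto simp: surv_def)
  show "ren ep P e s \<in> P ` V" if "e \<in> surv A ep P" "s < 2" for e s
    using that ctreeD(4)[OF t] by (auto simp: surv_def ren_def)
  show "conn (surv A ep P) (ren ep P) x y" if xy: "x \<in> P ` V" "y \<in> P ` V" for x y
  proof -
    obtain u v where uv: "u \<in> V" "v \<in> V" "x = P u" "y = P v" using xy by auto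
    have "conn (A \<inter> surv A ep P) (ren ep P) (P u) (P v)"
      using conn_contract[OF ctreeD(5)[OF t uv(1,2)] subset_refl] .
    then show ?thesis using uv by (auto elim: conn_mono)
  qed
  show "\<not> conn (surv A ep P - {e}) (ren ep P) (ren ep P e 0) (ren ep P e 1)"
    if e: "e \<in> surv A ep P" for e
  proof
    assume "conn (surv A ep P - {e}) (ren ep P) (ren ep P e 0) (ren ep P e 1)"
    note c = this
    have near: "conn (A - {e}) ep x (P x)" if "x \<in> V" for x
      using P(2)[OF that] by (rule conn_mono) (use e in auto)
    have eA: "e \<in> A" using e by (auto simp: surv_def)
    have "conn (A - {e}) ep (P (ep e 0)) (P (ep e 1))"
      using c unfolding ren_def[of ep P e]
      by (rule conn_uncontract) (use ctreeD(4)[OF t] near in \<open>auto simp: surv_def\<close>)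
    then have "conn (A - {e}) ep (ep e 0) (ep e 1)"
      using near ctreeD(4)[OF t eA] conn_trans conn_sym by (meson less_2_iff)
    then show False using ctreeD(6)[OF t eA] by simp
  qed
qed

text \<open>Induction by contracting one edge onto one of its ends, which removes one vertex and one
  edge.\<close>

lemma card_ctree: "ctree V A ep \<Longrightarrow> card V = card A + 1"
proof (induction "card A" arbitrary: V A ep)
  case 0
  then have "A = {}" using ctreeD(2)[OF 0(2)] by simp
  have "x = y" if "x \<in> V" "y \<in> V" for x y
    using ctreeD(5)[OF 0(2) that] \<open>A = {}\<close> by (auto simp: conn_def arcs_def)
  then show ?case using ctreeD(1,3)[OF 0(2)] 0(1)
    by (metis One_nat_def add_0 card_1_singleton_iff is_singletonI' is_singleton_def)
next
  case (Suc k)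
  note t = Suc(3)
  from Suc(2) obtain e where e: "e \<in> A" by fastforce
  define P where "P = (\<lambda>x. if x = ep e 0 then ep e 1 else x)"
  have neq: "ep e 0 \<noteq> ep e 1" by (rule ctreeD(7)[OF t e])
  \<comment> \<open>Another edge could become a loop only by being parallel to \<open>e\<close>, and
    then \<open>e\<close> would not be a bridge.\<close>
  have S: "surv A ep P = A - {e}"
  proof (intro equalityI subsetI)
    fix f assume f: "f \<in> A - {e}"
    then have ne: "ep f 0 \<noteq> ep f 1" using ctreeD(7)[OF t] by auto
    have "P (ep f 0) \<noteq> P (ep f 1)"
    proof
      assume "P (ep f 0) = P (ep f 1)"
      then have "ep f 0 = ep e 0 \<and> ep f 1 = ep e 1 \<or> ep f 0 = ep e 1 \<and> ep f 1 = ep e 0"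
        using ne by (auto simp: P_def split: if_splits)
      moreover have "conn (A - {e}) ep (ep f 0) (ep f 1)" "conn (A - {e}) ep (ep f 1) (ep f 0)"
        using f by (auto intro!: conn_edge)
      ultimately show False using ctreeD(6)[OF t e] by auto
    qed
    then show "f \<in> surv A ep P" using f by (auto simp: surv_def)
  qed (auto simp: surv_def P_def)
  have t': "ctree (P ` V) (surv A ep P) (ren ep P)"
  proof (rule ctree_contract[OF t])
    show "P x \<in> V" if "x \<in> V" for x using that ctreeD(4)[OF t e] by (auto simp: P_def)
    have "conn {e} ep (ep e 0) (ep e 1)" by (intro conn_edge) auto
    then show "conn (A - surv A ep P) ep x (P x)" for x
      unfolding S using e by (auto simp: P_def elim!: conn_mono)
  qed
  have "P ` V = V - {ep e 0}"
    using neq ctreeD(4)[OF t e, of 1] by (auto simp: P_def image_iff)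
  moreover have "card (P ` V) = card (surv A ep P) + 1"
    by (rule Suc(1)[OF _ t']) (use Suc(2) S e ctreeD(2)[OF t] in auto)
  moreover have "ep e 0 \<in> V" using ctreeD(4)[OF t e] by auto
  ultimately show ?case
    using S e ctreeD(1,2)[OF t] Suc(2) by (simp add: card_Diff_singleton_if)
qed

section \<open>Parents in the dendrogram\<close>

text \<open>
  A dendrogram node is a vertex or an edge label; the labels increase with the weights and exceed
  all vertices. The cluster of a node \<open>c\<close> consists of everything connected to \<open>rep A ep c\<close> by
  edges with labels at most \<open>c\<close>.
\<close>

definition rep :: "nat set \<Rightarrow> (nat \<Rightarrow> nat \<Rightarrow> nat) \<Rightarrow> nat \<Rightarrow> nat" where
  "rep A ep c = (if c \<in> A then ep c 0 else c)"

definition parset :: "nat set \<Rightarrow> (nat \<Rightarrow> nat \<Rightarrow> nat) \<Rightarrow> nat \<Rightarrow> nat set" where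
  "parset A ep c = {g \<in> A. c < g \<and> conn (cut A g) ep (rep A ep c) (ep g 0)}"

text \<open>Labels are positive, so 0 can stand for a missing minimum, whereas \<open>Min\<close> is
  unspecified on the empty set.\<close>

definition minz :: "nat set \<Rightarrow> nat" where
  "minz S = (if S = {} then 0 else Min S)"

definition par :: "nat set \<Rightarrow> (nat \<Rightarrow> nat \<Rightarrow> nat) \<Rightarrow> nat \<Rightarrow> nat" where
  "par A ep c = minz (parset A ep c)"

lemma minz_eqI:
  assumes "finite T" "S \<subseteq> T" "\<And>t. t \<in> T \<Longrightarrow> \<exists>s\<in>S. s \<le> t"
  shows "minz S = minz T"
proof (cases "T = {}")
  case False
  then have ne: "S \<noteq> {}" using assms(3) by auto
  have fS: "finite S" using assms finite_subset by blast
  have "Min S = Min T"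
  proof (rule Min_eqI[symmetric])
    show "Min S \<in> T" using Min_in[OF fS ne] assms(2) by auto
    show "Min S \<le> y" if "y \<in> T" for y
      using assms(3)[OF that] Min_le[OF fS] by (meson le_trans)
  qed (rule assms)
  then show ?thesis using ne False by (simp add: minz_def)
qed (use assms in \<open>auto simp: minz_def\<close>)

lemma par_in:
  assumes "finite A" "par A ep c \<noteq> 0" shows "par A ep c \<in> parset A ep c"
proof -
  have "finite (parset A ep c)" using assms by (auto simp: parset_def)
  then show ?thesis using assms(2) Min_in by (auto simp: par_def minz_def split: if_splits)
qed

lemma par_le:
  assumes "finite A" "g \<in> parset A ep c" shows "par A ep c \<noteq> 0" "par A ep c \<le> g"
proof -
  have f: "finite (parset A ep c)" using assms by (auto simp: parset_def)
  then have "Min (parset A ep c) \<in> parset A ep c" using assms by (intro Min_in) auto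
  then show "par A ep c \<noteq> 0" using assms by (auto simp: par_def minz_def) (auto simp: parset_def)
  show "par A ep c \<le> g" using assms f by (auto simp: par_def minz_def)
qed

lemma par_gt: "finite A \<Longrightarrow> par A ep c \<noteq> 0 \<Longrightarrow> c < par A ep c \<and> par A ep c \<in> A"
  using par_in by (fastforce simp: parset_def)

text \<open>An edge that leaves the cluster of \<open>c\<close> with a label below \<open>z\<close>
  would be heavier than \<open>c\<close> and lie in \<open>parset\<close>, against the choice of the
  parent. So a cluster does not grow before its parent is reached.\<close>

lemma no_crossing:
  assumes "finite A" "par A ep c = 0 \<or> z \<le> par A ep c"
    and "conn {h \<in> A. h < z} ep (rep A ep c) y"
  shows "conn (cut A c) ep (rep A ep c) y"
  using assms(3)
proof (rule conn_invariant)
  fix h s assume h: "h \<in> {h \<in> A. h < z}" "s < 2" "conn (cut A c) ep (rep A ep c) (ep h s)"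
  have "h \<le> c"
  proof (rule ccontr)
    assume "\<not> h \<le> c"
    then have "conn (cut A h) ep (rep A ep c) (ep h s)"
      using h by (auto elim!: conn_mono)
    moreover have "conn (cut A h) ep (ep h s) (ep h 0)"
      using h by (intro conn_edge) auto
    ultimately have "h \<in> parset A ep c"
      using h \<open>\<not> h \<le> c\<close> by (auto simp: parset_def intro: conn_trans)
    from par_le[OF assms(1) this] show False using assms(2) h by auto
  qed
  then have "conn (cut A c) ep (ep h s) (ep h (1 - s))"
    using h by (intro conn_edge) auto
  then show "conn (cut A c) ep (rep A ep c) (ep h (1 - s))"
    using h conn_trans by blast
qed simp

text \<open>The highest node with number below \<open>z\<close> whose cluster contains
  \<open>x\<close>: its parent is missing or at least \<open>z\<close>.\<close>

definition istop :: "nat set \<Rightarrow> nat set \<Rightarrow> (nat \<Rightarrow> nat \<Rightarrow> nat) \<Rightarrow> nat \<Rightarrow> nat \<Rightarrow> nat \<Rightarrow> bool" where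
  "istop V A ep x z c \<longleftrightarrow> c \<in> V \<union> A \<and> c < z \<and> conn (cut A c) ep x (rep A ep c) \<and>
     (par A ep c = 0 \<or> z \<le> par A ep c)"

text \<open>By \<open>no_crossing\<close> the cluster of either node already contains everything
  that it reaches by edges below \<open>z\<close>, so the larger node would be an ancestor of the
  smaller one and still lie below \<open>z\<close>.\<close>

lemma istop_unique_aux:
  assumes fin: "finite A" and sep: "\<And>v e. v \<in> V \<Longrightarrow> e \<in> A \<Longrightarrow> v < e"
    and 1: "istop V A ep x z c" and 2: "istop V A ep y z c'"
    and xy: "conn {h \<in> A. h < z} ep x y" and "c < c'"
  shows False
proof -
  have "conn {h \<in> A. h < z} ep x (rep A ep c)" "conn {h \<in> A. h < z} ep y (rep A ep c')"
    using 1 2 by (auto simp: istop_def elim!: conn_mono)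
  then have "conn {h \<in> A. h < z} ep (rep A ep c) (rep A ep c')"
    using xy by (meson conn_sym conn_trans)
  then have c: "conn (cut A c) ep (rep A ep c) (rep A ep c')"
    by (rule no_crossing[OF fin, rotated]) (use 1 in \<open>auto simp: istop_def\<close>)
  show False
  proof (cases "c' \<in> A")
    case True
    have "conn (cut A c') ep (rep A ep c) (rep A ep c')"
      using c \<open>c < c'\<close> by (auto elim!: conn_mono)
    then have "c' \<in> parset A ep c" using True \<open>c < c'\<close> by (auto simp: parset_def rep_def)
    from par_le[OF fin this] show False using 1 2 by (auto simp: istop_def)
  next
    \<comment> \<open>\<open>c'\<close> is a vertex, hence so is the smaller \<open>c\<close>; no
      label is at most a vertex, so the cluster of \<open>c\<close> is a singleton.\<close>
    case False
    then have "c' \<in> V" using 2 by (auto simp: istop_def)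
    then have "c \<notin> A" using sep \<open>c < c'\<close> by fastforce
    then have "c \<in> V" using 1 by (auto simp: istop_def)
    then have "cut A c = {}" using sep by fastforce
    then have "conn {} ep (rep A ep c) (rep A ep c')" using c by metis
    then have "rep A ep c = rep A ep c'" by (simp add: conn_def arcs_def)
    then show False using False \<open>c \<notin> A\<close> \<open>c < c'\<close> by (simp add: rep_def)
  qed
qed

lemma istop_unique:
  assumes "finite A" "\<And>v e. v \<in> V \<Longrightarrow> e \<in> A \<Longrightarrow> v < e"
    and "istop V A ep x z c" "istop V A ep y z c'" "conn {h \<in> A. h < z} ep x y"
  shows "c = c'"
  using istop_unique_aux[OF assms] istop_unique_aux[OF assms(1,2,4,3) conn_sym[OF assms(5)]]
  by (meson linorder_neqE_nat)

text \<open>Take the largest node below \<open>z\<close> whose cluster contains \<open>x\<close>; a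
  parent below \<open>z\<close> would be a larger one.\<close>

lemma istop_exists:
  assumes fin: "finite A" "finite V" and x: "x \<in> V" "x \<notin> A" "x < z"
  shows "\<exists>c. istop V A ep x z c"
proof -
  define S where "S = {c \<in> V \<union> A. c < z \<and> conn (cut A c) ep x (rep A ep c)}"
  have "x \<in> S" using x by (simp add: S_def rep_def)
  moreover have fS: "finite S" using fin by (simp add: S_def)
  ultimately have M: "Max S \<in> S" by (intro Max_in) auto
  have "par A ep (Max S) = 0 \<or> z \<le> par A ep (Max S)"
  proof (rule ccontr)
    assume "\<not> ?thesis"
    then have g: "par A ep (Max S) \<noteq> 0" "par A ep (Max S) < z" by auto
    define p where "p = par A ep (Max S)"
    have p: "p \<in> A" "Max S < p" "conn (cut A p) ep (rep A ep (Max S)) (ep p 0)"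
      using par_in[OF fin(1) g(1)] by (auto simp: parset_def p_def)
    have "conn (cut A p) ep x (rep A ep (Max S))"
      using M p(2) by (auto simp: S_def elim!: conn_mono)
    then have "conn (cut A p) ep x (ep p 0)" using p(3) by (rule conn_trans)
    moreover have "p < z" using g(2) by (simp add: p_def)
    ultimately have "p \<in> S" using p(1) by (simp add: S_def rep_def)
    then show False using Max_ge[OF fS] p(2) by fastforce
  qed
  then show ?thesis using M by (auto simp: istop_def S_def)
qed

text \<open>
  If every vertex can reach its image under \<open>P\<close> by edges no heavier than any incident edge, then
  contracting along \<open>P\<close> does not change which edges are in the cluster of which edge.
\<close>

lemma conn_contract_iff:
  assumes near: "\<And>e s. e \<in> A \<Longrightarrow> s < 2 \<Longrightarrow> conn (cut A e) ep (ep e s) (P (ep e s))"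
    and "e \<in> A" "g \<in> A" "e \<le> g"
  shows "conn (cut A g) ep (ep e 0) (ep g 0) \<longleftrightarrow>
    conn (cut (surv A ep P) g) (ren ep P) (ren ep P e 0) (ren ep P g 0)"
proof -
  have near': "conn (cut A g) ep (ep h s) (P (ep h s))" if "h \<in> A" "s < 2" "h \<le> g" for h s
    using near[OF that(1,2)] by (rule conn_mono) (use that in auto)
  show ?thesis
  proof
    assume "conn (cut A g) ep (ep e 0) (ep g 0)"
    then have "conn (cut A g \<inter> surv A ep P) (ren ep P) (P (ep e 0)) (P (ep g 0))"
      by (rule conn_contract) auto
    then show "conn (cut (surv A ep P) g) (ren ep P) (ren ep P e 0) (ren ep P g 0)"
      unfolding ren_def by (rule conn_mono) auto
  next
    assume "conn (cut (surv A ep P) g) (ren ep P) (ren ep P e 0) (ren ep P g 0)"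
    then have "conn (cut A g) ep (P (ep e 0)) (P (ep g 0))"
      unfolding ren_def[of ep P e] ren_def[of ep P g]
      by (rule conn_uncontract) (auto simp: surv_def intro!: near')
    moreover have "conn (cut A g) ep (ep e 0) (P (ep e 0))" "conn (cut A g) ep (ep g 0) (P (ep g 0))"
      using assms(2-) by (auto intro!: near')
    ultimately show "conn (cut A g) ep (ep e 0) (ep g 0)"
      by (meson conn_sym conn_trans)
  qed
qed

text \<open>The candidates are ancestors of \<open>e\<close> because \<open>e\<close> lies between
  \<open>nu e\<close> and the parent of \<open>nu e\<close>, where the cluster in the contracted
  tree does not change. Conversely, an ancestor \<open>z\<close> of \<open>e\<close> below the
  parent of \<open>nu e\<close> cannot have survived; then \<open>nu e\<close> and
  \<open>nu z\<close> are topmost below \<open>z\<close> on connected vertices, hence equal. A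
  surviving edge has \<open>nu e = e\<close> and is the bottom of its own chain.\<close>

lemma par_uncontract:
  assumes fin: "finite A" and sep: "\<And>v e. v \<in> V' \<Longrightarrow> e \<in> A \<Longrightarrow> v < e"
    and near: "\<And>e s. e \<in> A \<Longrightarrow> s < 2 \<Longrightarrow> conn (cut A e) ep (ep e s) (P (ep e s))"
    and A': "A' = surv A ep P" and ep': "ep' = ren ep P"
    and nu1: "\<And>e. e \<in> A' \<Longrightarrow> nu e = e"
    and nu2: "\<And>e. e \<in> A - A' \<Longrightarrow> istop V' A' ep' (ep' e 0) e (nu e)"
    and e: "e \<in> A"
  shows "par A ep e =
    minz ({par A' ep' (nu e)} - {0} \<union> {g \<in> A. e < g \<and> nu g = nu e})"
proof -
  have sub: "A' \<subseteq> A" by (auto simp: A' surv_def)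
  have fin': "finite A'" using sub fin finite_subset by blast
  have nu: "nu e \<le> e" "conn (cut A' (nu e)) ep' (ep' e 0) (rep A' ep' (nu e))"
      "par A' ep' (nu e) = 0 \<or> e < par A' ep' (nu e)" "nu e \<in> V' \<union> A'" if "e \<in> A" for e
  proof -
    have *: "nu e \<le> e \<and> conn (cut A' (nu e)) ep' (ep' e 0) (rep A' ep' (nu e)) \<and>
      (par A' ep' (nu e) = 0 \<or> e < par A' ep' (nu e)) \<and> nu e \<in> V' \<union> A'"
    proof (cases "e \<in> A'")
      case True
      then show ?thesis using nu1 par_gt[OF fin'] by (auto simp: rep_def)
    next
      case False
      then have "istop V' A' ep' (ep' e 0) e (nu e)" using that nu2 by auto
      moreover have "par A' ep' (nu e) \<noteq> 0 \<Longrightarrow> par A' ep' (nu e) \<noteq> e"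
        using par_gt[OF fin', of ep' "nu e"] False by auto
      ultimately show ?thesis by (auto simp: istop_def)
    qed
    then show "nu e \<le> e" "conn (cut A' (nu e)) ep' (ep' e 0) (rep A' ep' (nu e))"
      "par A' ep' (nu e) = 0 \<or> e < par A' ep' (nu e)" "nu e \<in> V' \<union> A'" by auto
  qed
  \<comment> \<open>Whether one edge lies in the cluster of another can be decided in the contracted
    tree, even for contracted edges.\<close>
  have Z: "parset A ep e = {g \<in> A. e < g \<and> conn (cut A' g) ep' (ep' e 0) (ep' g 0)}"
    using conn_contract_iff[OF near e] e by (auto simp: parset_def rep_def A' ep')
  show ?thesis unfolding par_def[of A]
  proof (rule minz_eqI[symmetric])
    show "finite (parset A ep e)" using fin by (auto simp: parset_def)
    show "{par A' ep' (nu e)} - {0} \<union> {g \<in> A. e < g \<and> nu g = nu e} \<subseteq> parset A ep e"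
    proof
      fix g assume "g \<in> {par A' ep' (nu e)} - {0} \<union> {g \<in> A. e < g \<and> nu g = nu e}"
      then consider "g = par A' ep' (nu e)" "g \<noteq> 0" | "g \<in> A" "e < g" "nu g = nu e" by auto
      then show "g \<in> parset A ep e"
      proof cases
        case 1
        then have g: "e < g" using nu(3)[OF e] by auto
        have "g \<in> parset A' ep' (nu e)" using par_in[OF fin'] 1 by auto
        then have "g \<in> A'" "conn (cut A' g) ep' (rep A' ep' (nu e)) (ep' g 0)"
          by (auto simp: parset_def)
        moreover have "conn (cut A' g) ep' (ep' e 0) (rep A' ep' (nu e))"
          using nu(2)[OF e] by (rule conn_mono) (use nu(1)[OF e] g in auto)
        ultimately show ?thesis using g sub unfolding Z by (auto intro: conn_trans)
      next
        case 2
        have "conn (cut A' g) ep' (ep' e 0) (rep A' ep' (nu e))"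
          using nu(2)[OF e] by (rule conn_mono) (use nu(1)[OF e] 2 in auto)
        moreover have "conn (cut A' g) ep' (ep' g 0) (rep A' ep' (nu e))"
          using nu(2)[OF 2(1)] 2(3) by (auto elim!: conn_mono) (use nu(1)[OF e] 2 in auto)
        ultimately show ?thesis using 2 unfolding Z by (auto intro: conn_trans conn_sym)
      qed
    qed
    fix z assume z: "z \<in> parset A ep e"
    show "\<exists>s\<in>{par A' ep' (nu e)} - {0} \<union> {g \<in> A. e < g \<and> nu g = nu e}. s \<le> z"
    proof (cases "par A' ep' (nu e) \<noteq> 0 \<and> par A' ep' (nu e) \<le> z")
      case False
      then have F: "par A' ep' (nu e) = 0 \<or> z < par A' ep' (nu e)" by auto
      from z have zA: "z \<in> A" "e < z" and zc: "conn (cut A' z) ep' (ep' e 0) (ep' z 0)"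
        by (auto simp: Z)
      have "z \<notin> A'"
      proof
        assume "z \<in> A'"
        have "conn (cut A' z) ep' (ep' e 0) (rep A' ep' (nu e))"
          using nu(2)[OF e] by (rule conn_mono) (use nu(1)[OF e] zA in auto)
        then have "z \<in> parset A' ep' (nu e)"
          using zc zA nu(1)[OF e] \<open>z \<in> A'\<close> by (auto simp: parset_def intro: conn_trans conn_sym)
        from par_le[OF fin' this] F show False by auto
      qed
      \<comment> \<open>As \<open>z\<close> is contracted, connectivity up to \<open>z\<close> is
        connectivity strictly below \<open>z\<close>, which is what \<open>istop_unique\<close>
        needs.\<close>
      then have "cut A' z = {h \<in> A'. h < z}" by (auto simp: order.order_iff_strict)
      then have "nu e = nu z"
        using nu(1,2,4)[OF e] zA F zc \<open>z \<notin> A'\<close> nu2[of z] sep sub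
        by (intro istop_unique[OF fin', where V = V' and z = z and ep = ep' and x = "ep' e 0" and y = "ep' z 0"])
          (auto simp: istop_def)
      then show ?thesis using zA by auto
    qed auto
  qed
qed

section \<open>One round of Boruvka contraction\<close>

definition mn :: "nat set \<Rightarrow> (nat \<Rightarrow> nat \<Rightarrow> nat) \<Rightarrow> nat \<Rightarrow> nat" where
  "mn A ep x = Min {e \<in> A. \<exists>s<2. ep e s = x}"

text \<open>Subtracting \<open>x\<close> from the sum of both ends gives the other end without a
  case distinction; the machine evaluates the same expression.\<close>

definition oth :: "nat set \<Rightarrow> (nat \<Rightarrow> nat \<Rightarrow> nat) \<Rightarrow> nat \<Rightarrow> nat" where
  "oth A ep x = ep (mn A ep x) 0 + ep (mn A ep x) 1 - x"

text \<open>Along lightest edges the labels never increase, so a walk can only end by going back and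
  forth over an edge that is lightest at both ends. The smaller end of such an edge is made the
  root.\<close>

definition hook :: "nat set \<Rightarrow> (nat \<Rightarrow> nat \<Rightarrow> nat) \<Rightarrow> nat \<Rightarrow> nat" where
  "hook A ep x =
    (if mn A ep (oth A ep x) = mn A ep x \<and> x < oth A ep x then x else oth A ep x)"

context
  fixes V A ep
  assumes t: "ctree V A ep" and ne: "A \<noteq> {}"
begin

lemma incident_ne: "x \<in> V \<Longrightarrow> {e \<in> A. \<exists>s<2. ep e s = x} \<noteq> {}"
proof
  assume x: "x \<in> V" and none: "{e \<in> A. \<exists>s<2. ep e s = x} = {}"
  have "card A > 0" using ne ctreeD(2)[OF t] by (simp add: card_gt_0_iff)
  then have "\<not> V \<subseteq> {x}" using card_ctree[OF t] card_mono[of "{x}" V] by auto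
  then obtain y where y: "y \<in> V" "y \<noteq> x" by auto
  have "y = x"
    by (rule conn_invariant[where Q = "\<lambda>y. y = x", OF ctreeD(5)[OF t x y(1)]])
      (use none in auto)
  with y show False by simp
qed

lemma mn_in: "x \<in> V \<Longrightarrow> mn A ep x \<in> A \<and> (\<exists>s<2. ep (mn A ep x) s = x)"
  using Min_in[OF _ incident_ne] ctreeD(2)[OF t] unfolding mn_def by force

lemma mn_le: "e \<in> A \<Longrightarrow> s < 2 \<Longrightarrow> mn A ep (ep e s) \<le> e"
  unfolding mn_def using ctreeD(2)[OF t] by (intro Min_le) auto

lemma vertices_eq: "x \<in> V \<longleftrightarrow> (\<exists>e\<in>A. \<exists>s<2. x = ep e s)"
  using mn_in[of x] ctreeD(4)[OF t] by metis

lemma oth_other: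
  assumes "x \<in> V"
  shows "\<exists>s<2. x = ep (mn A ep x) s \<and> oth A ep x = ep (mn A ep x) (1 - s)"
proof -
  obtain s where s: "s < 2" "ep (mn A ep x) s = x" using mn_in[OF assms] by blast
  have "ep (mn A ep x) 0 + ep (mn A ep x) 1 - ep (mn A ep x) s = ep (mn A ep x) (1 - s)"
    using s(1) unfolding less_2_iff by auto
  then show ?thesis using s unfolding oth_def by metis
qed

lemma oth_facts:
  assumes "x \<in> V"
  shows "oth A ep x \<in> V" "oth A ep x \<noteq> x" "conn {mn A ep x} ep x (oth A ep x)"
    "mn A ep (oth A ep x) \<le> mn A ep x"
proof -
  obtain s where s: "s < 2" "x = ep (mn A ep x) s" "oth A ep x = ep (mn A ep x) (1 - s)"
    using oth_other[OF assms] by auto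
  have m: "mn A ep x \<in> A" using mn_in[OF assms] by simp
  show "oth A ep x \<in> V" using s ctreeD(4)[OF t m, of "1 - s"] by simp
  show "oth A ep x \<noteq> x" using s ctreeD(7)[OF t m] by (auto simp: less_2_iff)
  show "conn {mn A ep x} ep x (oth A ep x)"
    using s conn_edge[of "mn A ep x" "{mn A ep x}" s "1 - s" ep] by auto
  show "mn A ep (oth A ep x) \<le> mn A ep x" using s mn_le[OF m, of "1 - s"] by simp
qed

lemma oth_oth:
  assumes "x \<in> V" "mn A ep (oth A ep x) = mn A ep x"
  shows "oth A ep (oth A ep x) = x"
proof -
  obtain s where "s < 2" "ep (mn A ep x) s = x" using mn_in[OF assms(1)] by blast
  then have "x \<le> ep (mn A ep x) 0 + ep (mn A ep x) 1" unfolding less_2_iff by auto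
  then show ?thesis using assms(2) unfolding oth_def by simp
qed

lemma hook_facts:
  assumes "x \<in> V"
  shows "hook A ep x \<in> V" "conn {mn A ep x} ep x (hook A ep x)"
    "mn A ep (hook A ep x) \<le> mn A ep x"
    "hook A ep (hook A ep x) = hook A ep x \<or> mn A ep (hook A ep x) < mn A ep x"
proof -
  show "hook A ep x \<in> V" "conn {mn A ep x} ep x (hook A ep x)"
    "mn A ep (hook A ep x) \<le> mn A ep x"
    using oth_facts[OF assms] assms by (auto simp: hook_def)
  show "hook A ep (hook A ep x) = hook A ep x \<or> mn A ep (hook A ep x) < mn A ep x"
    using oth_facts[OF assms] oth_oth[OF assms] by (auto simp: hook_def)
qed

lemma hook_iter:
  assumes "x \<in> V"
  shows "(hook A ep ^^ k) x \<in> V \<and> mn A ep ((hook A ep ^^ k) x) \<le> mn A ep x \<and>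
    conn (cut A (mn A ep x)) ep x ((hook A ep ^^ k) x)"
proof (induction k)
  case (Suc k)
  let ?y = "(hook A ep ^^ k) x"
  have "conn (cut A (mn A ep x)) ep ?y (hook A ep ?y)"
    using hook_facts(2)[of ?y] by (rule conn_mono) (use Suc mn_in[of ?y] in auto)
  moreover have "hook A ep ?y \<in> V" "mn A ep (hook A ep ?y) \<le> mn A ep ?y"
    using hook_facts[of ?y] Suc by auto
  ultimately show ?case using Suc conn_trans by fastforce
qed (use assms in simp)

text \<open>While no root is reached, each hook strictly lowers the label of the lightest incident
  edge. These labels lie between \<open>lo + 1\<close> and \<open>lo + k\<close>, so
  \<open>k\<close> hooks suffice.\<close>

lemma hook_stable:
  assumes "x \<in> V" "\<And>e. e \<in> A \<Longrightarrow> lo < e" "mn A ep x \<le> lo + k"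
  shows "hook A ep ((hook A ep ^^ k) x) = (hook A ep ^^ k) x"
  using assms(1,3)
proof (induction k arbitrary: x)
  case 0
  have "lo < mn A ep x" using assms(2) mn_in[OF 0(1)] by blast
  then show ?case using 0 by simp
next
  case (Suc k)
  have hV: "hook A ep x \<in> V" using hook_facts Suc by blast
  show ?case
  proof (cases "hook A ep (hook A ep x) = hook A ep x")
    case True
    then have "(hook A ep ^^ j) (hook A ep x) = hook A ep x" for j
      by (induction j) auto
    then show ?thesis using True by (simp add: funpow_swap1)
  next
    case False
    then have "mn A ep (hook A ep x) < mn A ep x" using hook_facts(4)[OF Suc(2)] by simp
    then show ?thesis using Suc.IH[OF hV] Suc(3) by (simp add: funpow_swap1)
  qed
qed

context
  fixes lo K and P
  assumes keys: "\<And>e. e \<in> A \<Longrightarrow> lo < e \<and> e \<le> lo + K"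
  assumes P: "P = hook A ep ^^ K"
begin

lemma P_in: "x \<in> V \<Longrightarrow> P x \<in> V"
  using hook_iter by (simp add: P)

text \<open>The hooks from an end of \<open>e\<close> only use edges up to the lightest one there,
  which is at most \<open>e\<close>. This is the hypothesis under which contraction preserves
  clusters.\<close>

lemma P_near: "e \<in> A \<Longrightarrow> s < 2 \<Longrightarrow> conn (cut A e) ep (ep e s) (P (ep e s))"
  using hook_iter[of "ep e s" K] ctreeD(4)[OF t, of e s] mn_le[of e s]
  by (auto simp: P elim!: conn_mono)

lemma P_stable:
  assumes "x \<in> V" shows "hook A ep (P x) = P x"
  unfolding P by (rule hook_stable[OF assms, of lo]) (use keys mn_in[OF assms] in auto)

lemma P_hook: "x \<in> V \<Longrightarrow> P (hook A ep x) = P x"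
  using P_stable[of x] by (simp add: P funpow_swap1)

text \<open>If \<open>x\<close> does not hook to the other end of its lightest edge, then
  \<open>x\<close> is a root and the other end hooks to \<open>x\<close>. So the lightest edge of
  every vertex is contracted.\<close>

lemma P_oth:
  assumes x: "x \<in> V" shows "P (oth A ep x) = P x"
proof (cases "hook A ep x = oth A ep x")
  case True
  then show ?thesis using P_hook[OF x] by simp
next
  case False
  then have *: "mn A ep (oth A ep x) = mn A ep x" "x < oth A ep x"
    by (auto simp: hook_def split: if_splits)
  then have "hook A ep (oth A ep x) = x"
    using oth_oth[OF x] by (simp add: hook_def)
  then show ?thesis using P_hook[OF oth_facts(1)[OF x]] by simp
qed

lemma mn_contracted: "x \<in> V \<Longrightarrow> mn A ep x \<in> A - surv A ep P"
  using mn_in[of x] oth_other[of x] P_oth[of x] by (auto simp: surv_def less_2_iff)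

lemma P_conn:
  assumes "x \<in> V" shows "conn (A - surv A ep P) ep x (P x)"
proof -
  have "conn (A - surv A ep P) ep x ((hook A ep ^^ k) x)" for k
  proof (induction k)
    case (Suc k)
    let ?y = "(hook A ep ^^ k) x"
    have y: "?y \<in> V" using hook_iter[OF assms] by simp
    have "conn (A - surv A ep P) ep ?y (hook A ep ?y)"
      using hook_facts(2)[OF y] by (rule conn_mono) (use mn_contracted[OF y] in auto)
    with Suc show ?case by (auto intro: conn_trans)
  qed simp
  then show ?thesis by (simp add: P)
qed

lemma round_ctree: "ctree (P ` V) (surv A ep P) (ren ep P)"
  using P_in P_conn by (rule ctree_contract[OF t])

text \<open>Every fibre of \<open>P\<close> contains a vertex together with its partner
  \<open>oth\<close>, so the vertices are at least halved; edges plus one count the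
  vertices.\<close>

lemma round_halves: "2 * (card (surv A ep P) + 1) \<le> card A + 1"
proof -
  have finV: "finite V" using ctreeD[OF t] by simp
  have "2 * card (P ` V) = (\<Sum>r\<in>P ` V. 2)" by simp
  also have "\<dots> \<le> (\<Sum>r\<in>P ` V. card {x \<in> V. P x = r})"
  proof (rule sum_mono)
    fix r assume "r \<in> P ` V"
    then obtain x where x: "x \<in> V" "r = P x" by auto
    then have "{x, oth A ep x} \<subseteq> {x \<in> V. P x = r}" using oth_facts(1) P_oth by auto
    then have "card {x, oth A ep x} \<le> card {x \<in> V. P x = r}" using finV by (intro card_mono) auto
    then show "2 \<le> card {x \<in> V. P x = r}" using oth_facts(2)[OF x(1)] by auto
  qed
  also have "\<dots> = card V"
    using sum.image_gen[OF finV, of "\<lambda>_. 1::nat" P] by simp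
  finally show ?thesis using card_ctree[OF t] card_ctree[OF round_ctree] by simp
qed

end

text \<open>Edges below the lightest incident one do not touch \<open>x\<close>, so nothing else is
  reached before it. The lightest edges recorded during contraction are therefore the parents of the
  vertices.\<close>

lemma par_vertex:
  assumes "x \<in> V" "\<And>v e. v \<in> V \<Longrightarrow> e \<in> A \<Longrightarrow> v < e"
  shows "par A ep x = mn A ep x"
proof -
  have xA: "x \<notin> A" using assms(2)[OF assms(1), of x] by auto
  let ?m = "mn A ep x"
  obtain s where s: "s < 2" "ep ?m s = x" "?m \<in> A" using mn_in[OF assms(1)] by auto
  have "minz {?m} = minz (parset A ep x)"
  proof (rule minz_eqI)
    show "finite (parset A ep x)" using ctreeD[OF t] by (simp add: parset_def)
    have "conn (cut A ?m) ep (ep ?m s) (ep ?m 0)" using s by (intro conn_edge) auto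
    then show "{?m} \<subseteq> parset A ep x"
      using s xA assms by (auto simp: parset_def rep_def)
    fix g assume g: "g \<in> parset A ep x"
    have "?m \<le> g"
    proof (rule ccontr)
      assume ng: "\<not> ?m \<le> g"
      have "conn (cut A g) ep x (ep g 0)" using g xA by (auto simp: parset_def rep_def)
      then have "ep g 0 = x"
        by (rule conn_invariant[where Q = "\<lambda>y. y = x"]) (use ng mn_le in force)+
      then have "?m \<le> g" using mn_le[of g 0] g by (auto simp: parset_def)
      with ng show False by simp
    qed
    then show "\<exists>s\<in>{?m}. s \<le> g" by simp
  qed
  then show ?thesis by (simp add: par_def minz_def)
qed

end

text \<open>After its last use of \<open>f\<close>, a walk from \<open>f\<close> to \<open>y\<close>
  consists of lighter edges and starts at one of the two ends of \<open>f\<close>.\<close>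

lemma conn_without_max:
  assumes "f \<in> A" "conn (cut A f) ep y (ep f 0)"
  shows "\<exists>s<2. conn {h \<in> A. h < f} ep y (ep f s)"
proof -
  let ?Q = "\<lambda>y. conn {h \<in> A. h < f} ep y (ep f 0) \<or> conn {h \<in> A. h < f} ep y (ep f 1)"
  have "?Q y"
  proof (rule conn_invariant[where Q = ?Q, OF conn_sym[OF assms(2)]])
    fix h s assume h: "h \<in> cut A f" "s < 2" "?Q (ep h s)"
    show "?Q (ep h (1 - s))"
    proof (cases "h = f")
      case True
      then show ?thesis using h(2) by (auto simp: less_2_iff)
    next
      case False
      then have "conn {h \<in> A. h < f} ep (ep h (1 - s)) (ep h s)"
        using h by (intro conn_edge) auto
      then show ?thesis using h(3) conn_trans by blast
    qed
  qed simp
  then show ?thesis by (metis less_2_iff)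
qed

section \<open>Dendrograms from parents\<close>

context
  fixes V A ep
  assumes t: "ctree V A ep" and sep: "\<And>v e. v \<in> V \<Longrightarrow> e \<in> A \<Longrightarrow> v < e"
begin

text \<open>Deleting \<open>f\<close> splits its cluster into the sides of its two ends, and a child
  is the topmost node below \<open>f\<close> on one side.\<close>

lemma parent_iff_top:
  assumes "f \<in> A" "c \<in> V \<union> A"
  shows "par A ep c = f \<longleftrightarrow> (\<exists>s<2. istop V A ep (ep f s) f c)"
proof
  have fin: "finite A" using ctreeD[OF t] by simp
  assume pc: "par A ep c = f"
  have f0: "f \<noteq> 0" using sep ctreeD(4)[OF t assms(1), of 0] assms(1) by fastforce
  have cf: "c < f" using par_gt[OF fin] pc f0 by blast
  have cc: "conn (cut A f) ep (rep A ep c) (ep f 0)"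
    using par_in[OF fin] pc f0 by (auto simp: parset_def)
  obtain s where s: "s < 2" "conn {h \<in> A. h < f} ep (rep A ep c) (ep f s)"
    using conn_without_max[OF assms(1) cc] by blast
  from s(2) have "conn (cut A c) ep (rep A ep c) (ep f s)"
    by (rule no_crossing[OF fin, rotated]) (use pc in auto)
  then show "\<exists>s<2. istop V A ep (ep f s) f c"
    using s(1) pc cf assms conn_sym by (auto simp: istop_def)
next
  have fin: "finite A" using ctreeD[OF t] by simp
  assume "\<exists>s<2. istop V A ep (ep f s) f c"
  then obtain s where s: "s < 2" "istop V A ep (ep f s) f c" by auto
  have "conn (cut A f) ep (rep A ep c) (ep f s)"
    using s by (intro conn_sym[OF conn_mono[of "cut A c" ep "ep f s"]]) (auto simp: istop_def)
  moreover have "conn (cut A f) ep (ep f s) (ep f 0)" using s assms by (intro conn_edge) auto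
  ultimately have "f \<in> parset A ep c"
    using s assms by (auto simp: parset_def istop_def intro: conn_trans)
  from par_le[OF fin this] show "par A ep c = f" using s by (auto simp: istop_def)
qed

text \<open>The two sides have different tops because \<open>f\<close> is a bridge.\<close>

lemma tops:
  assumes "f \<in> A"
  obtains c0 c1 where "istop V A ep (ep f 0) f c0" "istop V A ep (ep f 1) f c1" "c0 \<noteq> c1"
    "c0 \<in> V \<union> A" "c1 \<in> V \<union> A" "par A ep c0 = f" "par A ep c1 = f"
    "\<And>c. c \<in> V \<union> A \<Longrightarrow> par A ep c = f \<Longrightarrow> c = c0 \<or> c = c1"
proof -
  have fin: "finite A" "finite V" using ctreeD[OF t] by auto
  have ex: "\<exists>c. istop V A ep (ep f s) f c" if "s < 2" for s
    using ctreeD(4)[OF t assms that] sep assms by (intro istop_exists fin) blast+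
  obtain c0 c1 where c: "istop V A ep (ep f 0) f c0" "istop V A ep (ep f 1) f c1"
    using ex[of 0] ex[of 1] by auto
  have "c0 \<noteq> c1"
  proof
    assume "c0 = c1"
    then have "conn (cut A c0) ep (ep f 0) (ep f 1)"
      using c unfolding istop_def by (meson conn_sym conn_trans)
    moreover have "cut A c0 \<subseteq> A - {f}" using c by (auto simp: istop_def)
    ultimately show False using ctreeD(6)[OF t assms] conn_mono by blast
  qed
  moreover have "par A ep c0 = f" "par A ep c1 = f"
    using c parent_iff_top[OF assms] by (auto simp: istop_def less_2_iff)
  moreover have "c = c0 \<or> c = c1" if "c \<in> V \<union> A" "par A ep c = f" for c
    using parent_iff_top[OF assms that(1)] that(2) c
      istop_unique[OF fin(1) sep, of V ep _ f _ _ ] by (metis conn_refl less_2_iff)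
  ultimately show thesis using that c by (auto simp: istop_def)
qed

text \<open>With \<open>z\<close> above all numbers, a node without parent is topmost below
  \<open>z\<close>, and the whole tree is connected below \<open>z\<close>, so
  \<open>istop_unique\<close> applies.\<close>

lemma root_unique:
  assumes "c \<in> V \<union> A" "c' \<in> V \<union> A" "par A ep c = 0" "par A ep c' = 0"
  shows "c = c'"
proof -
  obtain z where z: "\<And>h. h \<in> V \<union> A \<Longrightarrow> h < z"
    using ctreeD(1,2)[OF t] finite_nat_set_iff_bounded[of "V \<union> A"] by auto
  have "rep A ep c \<in> V" "rep A ep c' \<in> V"
    using assms ctreeD(4)[OF t] by (auto simp: rep_def)
  then have "conn A ep (rep A ep c) (rep A ep c')" using ctreeD[OF t] by blast
  moreover have "{h \<in> A. h < z} = A" using z by auto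
  ultimately show ?thesis using assms z
    by (intro istop_unique[OF ctreeD(2)[OF t] sep, of V ep "rep A ep c" z c "rep A ep c'"])
      (auto simp: istop_def)
qed

lemma root_exists: "\<exists>c\<in>V \<union> A. par A ep c = 0"
proof -
  obtain z where z: "\<And>h. h \<in> V \<union> A \<Longrightarrow> h < z"
    using ctreeD(1,2)[OF t] finite_nat_set_iff_bounded[of "V \<union> A"] by auto
  obtain x where x: "x \<in> V" using ctreeD(3)[OF t] by auto
  obtain c where "istop V A ep x z c"
    using istop_exists[OF ctreeD(2,1)[OF t] x] z x sep by blast
  then show ?thesis using z par_gt[OF ctreeD(2)[OF t], of ep c]
    by (auto simp: istop_def) (metis UnCI not_le)+
qed

end

section \<open>Clusters and the recursive definition of dendrograms\<close>

context
  fixes V A ep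
  assumes t: "ctree V A ep" and sep: "\<And>v e. v \<in> V \<Longrightarrow> e \<in> A \<Longrightarrow> v < e"
begin

definition cluster :: "nat \<Rightarrow> nat set" where
  "cluster c = {y. conn (cut A c) ep (rep A ep c) y}"

lemma conn_in_V:
  assumes "conn F ep x y" "F \<subseteq> A" "x \<in> V" shows "y \<in> V"
  using assms(1) by (rule conn_invariant) (use assms ctreeD(4)[OF t] in auto)

lemma rep_in_V: "c \<in> V \<union> A \<Longrightarrow> rep A ep c \<in> V"
  using ctreeD(4)[OF t] by (auto simp: rep_def)

text \<open>Every vertex in the cluster of \<open>f\<close> reaches an end of \<open>f\<close> by
  lighter edges, and \<open>no_crossing\<close> turns this into membership in the cluster of the top
  on that side.\<close>

lemma cluster_split:
  assumes f: "f \<in> A" and s: "s < 2" and c: "istop V A ep (ep f s) f c" "istop V A ep (ep f (1 - s)) f c'"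
  shows "cluster f = cluster c \<union> cluster c'"
proof (intro equalityI subsetI)
  have fin: "finite A" using ctreeD[OF t] by simp
  have *: "y \<in> cluster c" if "istop V A ep x f c" "conn {h \<in> A. h < f} ep y x" for x y c
  proof -
    have "conn {h \<in> A. h < f} ep x (rep A ep c)"
      using that(1) by (auto simp: istop_def elim!: conn_mono)
    then have "conn {h \<in> A. h < f} ep (rep A ep c) y"
      using that(2) by (meson conn_sym conn_trans)
    then show ?thesis using no_crossing[OF fin] that(1)
      unfolding cluster_def istop_def by blast
  qed
  fix y assume "y \<in> cluster f"
  then have "conn (cut A f) ep y (ep f 0)" using f by (auto simp: cluster_def rep_def intro: conn_sym)
  then obtain s' where "s' < 2" "conn {h \<in> A. h < f} ep y (ep f s')"
    using conn_without_max[OF f] by blast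
  moreover have "s' = s \<or> s' = 1 - s" using \<open>s' < 2\<close> s by auto
  ultimately show "y \<in> cluster c \<union> cluster c'" using *[OF c(1)] *[OF c(2)] by auto
next
  have *: "y \<in> cluster f" if "istop V A ep (ep f s) f c" "y \<in> cluster c" "s < 2" for s y c
  proof -
    have "conn (cut A f) ep (rep A ep c) y" "conn (cut A f) ep (ep f s) (rep A ep c)"
      using that by (auto simp: istop_def cluster_def elim!: conn_mono)
    moreover have "conn (cut A f) ep (ep f 0) (ep f s)" using f that by (intro conn_edge) auto
    ultimately show ?thesis using f unfolding cluster_def rep_def by (auto intro: conn_trans)
  qed
  fix y assume "y \<in> cluster c \<union> cluster c'"
  then show "y \<in> cluster f" using *[OF c(1)] *[OF c(2)] s by auto
qed

lemma edge_in_cluster_le: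
  assumes "e \<in> A" "ep e 0 \<in> cluster c" "par A ep c = 0 \<or> e < par A ep c"
  shows "e \<le> c"
proof (rule ccontr)
  assume "\<not> e \<le> c"
  then have "conn (cut A e) ep (rep A ep c) (ep e 0)"
    using assms by (auto simp: cluster_def elim!: conn_mono)
  then have "e \<in> parset A ep c" using assms \<open>\<not> e \<le> c\<close> by (auto simp: parset_def)
  from par_le[OF ctreeD(2)[OF t] this] assms(3) show False by auto
qed

context
  fixes al :: "nat \<Rightarrow> nat" and ed :: "nat \<Rightarrow> nat set" and wt :: "nat set \<Rightarrow> real"
  assumes al: "inj_on al V" and ed: "\<And>e. e \<in> A \<Longrightarrow> ed e = {al (ep e 0), al (ep e 1)}"
    and wt: "\<And>e g. e \<in> A \<Longrightarrow> g \<in> A \<Longrightarrow> e \<le> g \<Longrightarrow> wt (ed e) \<le> wt (ed g)"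
begin

definition cluster_edges :: "nat \<Rightarrow> nat set set" where
  "cluster_edges c = ed ` {e \<in> A. e \<le> c \<and> ep e 0 \<in> cluster c}"

lemma adjacent_conn:
  assumes "F \<subseteq> A" "x \<in> V"
  shows "(al x, b) \<in> (adjacent (ed ` F))\<^sup>* \<longleftrightarrow> (\<exists>y. conn F ep x y \<and> b = al y)"
proof
  assume "(al x, b) \<in> (adjacent (ed ` F))\<^sup>*"
  then show "\<exists>y. conn F ep x y \<and> b = al y"
  proof (induction rule: rtrancl_induct)
    case (step b b')
    then obtain y e where y: "conn F ep x y" "b = al y" and e: "e \<in> F" "{b, b'} = ed e"
      by (auto simp: adjacent_def)
    have yV: "y \<in> V" using conn_in_V y assms by blast
    have eA: "e \<in> A" using e assms by auto
    have "{al y, b'} = {al (ep e 0), al (ep e 1)}" using e y ed eA by auto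
    then have "al y = al (ep e 0) \<and> b' = al (ep e 1) \<or> al y = al (ep e 1) \<and> b' = al (ep e 0)"
      by (simp add: doubleton_eq_iff)
    moreover have "ep e 0 \<in> V" "ep e 1 \<in> V" using ctreeD(4)[OF t eA] by auto
    ultimately consider "y = ep e 0" "b' = al (ep e 1)" | "y = ep e 1" "b' = al (ep e 0)"
      using inj_onD[OF al _ yV] by metis
    then show ?case
    proof cases
      case 1
      then have "conn F ep y (ep e 1)" using conn_edge[OF e(1), of 0 1 ep] by simp
      then show ?thesis using y 1 conn_trans by blast
    next
      case 2
      then have "conn F ep y (ep e 0)" using conn_edge[OF e(1), of 1 0 ep] by simp
      then show ?thesis using y 2 conn_trans by blast
    qed
  qed (auto intro: exI[of _ x])
next
  assume "\<exists>y. conn F ep x y \<and> b = al y"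
  then obtain y where y: "conn F ep x y" "b = al y" by auto
  have "(al x, al y) \<in> (adjacent (ed ` F))\<^sup>*"
  proof (rule conn_invariant[where Q = "\<lambda>y. (al x, al y) \<in> (adjacent (ed ` F))\<^sup>*", OF y(1)])
    fix e s assume e: "e \<in> F" "s < 2" "(al x, al (ep e s)) \<in> (adjacent (ed ` F))\<^sup>*"
    then have "{al (ep e s), al (ep e (1 - s))} = ed e"
      using ed[of e] assms by (auto simp: less_2_iff)
    then have "(al (ep e s), al (ep e (1 - s))) \<in> adjacent (ed ` F)"
      using e by (auto simp: adjacent_def)
    with e(3) show "(al x, al (ep e (1 - s))) \<in> (adjacent (ed ` F))\<^sup>*" by simp
  qed simp
  then show "(al x, b) \<in> (adjacent (ed ` F))\<^sup>*" using y by simp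
qed

lemma component_eq:
  assumes "F \<subseteq> A" "x \<in> V" shows "component (ed ` F) (al x) = al ` {y. conn F ep x y}"
  using adjacent_conn[OF assms] by (auto simp: component_def)

lemma ed_inj: "inj_on ed A"
proof (rule inj_onI, rule ccontr)
  fix e g assume eg: "e \<in> A" "g \<in> A" "ed e = ed g" "e \<noteq> g"
  have V: "ep e 0 \<in> V" "ep e 1 \<in> V" "ep g 0 \<in> V" "ep g 1 \<in> V"
    using ctreeD(4)[OF t] eg by auto
  have "{al (ep e 0), al (ep e 1)} = {al (ep g 0), al (ep g 1)}" using eg ed by auto
  then have "ep e 0 = ep g 0 \<and> ep e 1 = ep g 1 \<or> ep e 0 = ep g 1 \<and> ep e 1 = ep g 0"
    using V inj_onD[OF al] by (metis doubleton_eq_iff)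
  moreover have "conn (A - {g}) ep (ep e 0) (ep e 1)" using eg by (intro conn_edge) auto
  ultimately have "conn (A - {g}) ep (ep g 0) (ep g 1)" using conn_sym by metis
  then show False using ctreeD(6)[OF t eg(2)] by simp
qed

text \<open>Removing \<open>f\<close> leaves the edges of its cluster that are below
  \<open>f\<close>. On the side of \<open>c\<close> these are the edges up to \<open>c\<close>: by
  \<open>edge_in_cluster_le\<close> none lies strictly between \<open>c\<close> and its
  parent.\<close>

lemma component_cluster:
  assumes f: "f \<in> A" and s: "s < 2" and c: "istop V A ep (ep f s) f c"
  defines "E' \<equiv> cluster_edges f - {ed f}"
  shows "component E' (al (ep f s)) = al ` cluster c"
    and "induced_edges E' (al ` cluster c) = cluster_edges c"
proof -
  have fin: "finite A" using ctreeD[OF t] by simp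
  have cnode: "c \<in> V \<union> A" and cf: "c < f" and pc: "par A ep c = 0 \<or> f \<le> par A ep c"
    and conn_c: "conn (cut A c) ep (ep f s) (rep A ep c)"
    using c by (auto simp: istop_def)
  define F where "F = {e \<in> A. e < f \<and> ep e 0 \<in> cluster f}"
  have FA: "F \<subseteq> A" by (auto simp: F_def)
  have fV: "ep f s \<in> V" using ctreeD(4)[OF t f s] .
  define G where "G = {e \<in> A. e \<le> f \<and> ep e 0 \<in> cluster f}"
  have "ed ` (G - {f}) = ed ` G - ed ` {f}"
    by (rule inj_on_image_set_diff[OF ed_inj]) (use f in \<open>auto simp: G_def\<close>)
  moreover have "G - {f} = F" by (auto simp: F_def G_def)
  ultimately have E': "E' = ed ` F"
    unfolding E'_def cluster_edges_def G_def[symmetric] by simp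
  have in_F: "e \<in> F" if e: "e \<in> A" "e \<le> c" "conn (cut A f) ep (ep f s) (ep e s')" "s' < 2" for e s'
  proof -
    have "conn (cut A f) ep (ep f 0) (ep f s)" "conn (cut A f) ep (ep e s') (ep e 0)"
      using e cf f s by (auto intro!: conn_edge)
    then have "conn (cut A f) ep (ep f 0) (ep e 0)" using e(3) conn_trans by blast
    then show ?thesis using e cf f by (auto simp: F_def cluster_def rep_def)
  qed
  have *: "conn F ep (ep f s) y \<longleftrightarrow> y \<in> cluster c" for y
  proof
    assume "conn F ep (ep f s) y"
    then have "conn {h \<in> A. h < f} ep (ep f s) y" by (rule conn_mono) (auto simp: F_def)
    moreover have "conn {h \<in> A. h < f} ep (ep f s) (rep A ep c)"
      using conn_c by (rule conn_mono) (use cf in auto)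
    ultimately have "conn {h \<in> A. h < f} ep (rep A ep c) y" by (meson conn_sym conn_trans)
    then show "y \<in> cluster c" unfolding cluster_def using no_crossing[OF fin pc] by simp
  next
    assume "y \<in> cluster c"
    then have "conn (cut A c) ep (ep f s) y"
      using conn_c conn_trans unfolding cluster_def by blast
    then show "conn F ep (ep f s) y"
    proof (rule conn_invariant)
      fix e s' assume e: "e \<in> cut A c" "s' < 2" "conn F ep (ep f s) (ep e s')"
      have "conn (cut A f) ep (ep f s) (ep e s')"
        using e(3) by (rule conn_mono) (auto simp: F_def)
      then have "e \<in> F" using in_F e by auto
      then have "conn F ep (ep e s') (ep e (1 - s'))" using e by (intro conn_edge) auto
      then show "conn F ep (ep f s) (ep e (1 - s'))" using e(3) conn_trans by blast
    qed simp
  qed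
  show "component E' (al (ep f s)) = al ` cluster c"
    unfolding E' component_eq[OF FA fV] * by simp
  have cl_V: "y \<in> V" if "y \<in> cluster c" for y
    using that conn_in_V rep_in_V[OF cnode] unfolding cluster_def by blast
  show "induced_edges E' (al ` cluster c) = cluster_edges c"
  proof (intro equalityI subsetI)
    fix x assume "x \<in> induced_edges E' (al ` cluster c)"
    then obtain e where e: "e \<in> F" "x = ed e" "ed e \<subseteq> al ` cluster c"
      by (auto simp: induced_edges_def E')
    have eA: "e \<in> A" "e < f" using e by (auto simp: F_def)
    have "al (ep e 0) \<in> al ` cluster c" using e ed[OF eA(1)] by auto
    then have "ep e 0 \<in> cluster c"
      using al cl_V ctreeD(4)[OF t eA(1), of 0] by (auto simp: inj_on_def)
    moreover have "e \<le> c"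
      using edge_in_cluster_le[OF eA(1) calculation] pc eA by auto
    ultimately show "x \<in> cluster_edges c" using e eA by (auto simp: cluster_edges_def)
  next
    fix x assume "x \<in> cluster_edges c"
    then obtain e where e: "e \<in> A" "e \<le> c" "ep e 0 \<in> cluster c" "x = ed e"
      by (auto simp: cluster_edges_def)
    have "conn (cut A c) ep (ep e 0) (ep e 1)" using e by (intro conn_edge) auto
    then have "ep e 1 \<in> cluster c" using e(3) conn_trans unfolding cluster_def by blast
    have "conn (cut A c) ep (ep f s) (ep e 0)"
      using conn_c e(3) conn_trans unfolding cluster_def by blast
    then have "conn (cut A f) ep (ep f s) (ep e 0)" by (rule conn_mono) (use cf in auto)
    then have "e \<in> F" using in_F[of e 0] e by auto
    then show "x \<in> induced_edges E' (al ` cluster c)"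
      using e \<open>ep e 1 \<in> cluster c\<close> ed[OF e(1)] by (auto simp: induced_edges_def E')
  qed
qed

text \<open>Induction on the node number, which decreases towards the leaves. The weights are only
  weakly monotone in the labels, which suffices for a root edge of maximum weight and admits
  ties.\<close>

lemma dendrogram_of_parents:
  fixes oid :: "nat \<Rightarrow> nat"
  assumes leaf: "\<And>v. v \<in> V \<Longrightarrow> al v < n \<and> oid v = al v"
    and node: "\<And>f. f \<in> A \<Longrightarrow> (\<exists>j<length es. oid f = n + j \<and> edge (es ! j) = ed f) \<and>
        r (oid f) = wt (ed f)"
    and child: "\<And>f. f \<in> A \<Longrightarrow> \<exists>c c'. c \<noteq> c' \<and> {c, c'} \<subseteq> V \<union> A \<and> par A ep c = f \<and>
        par A ep c' = f \<and> m (2 * oid f) = oid c \<and> m (2 * oid f + 1) = oid c'"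
    and c: "c \<in> V \<union> A"
  shows "\<exists>d. is_dendrogram wt (al ` cluster c) (cluster_edges c) d \<and> represents n es m r d (oid c)"
  using c
proof (induction c rule: less_induct)
  case (less f)
  show ?case
  proof (cases "f \<in> A")
    case False
    then have v: "f \<in> V" using less by auto
    then have cut0: "cut A f = {}" using sep by fastforce
    have "cluster f = {y. conn {} ep f y}"
      unfolding cluster_def cut0 using False by (simp add: rep_def)
    moreover have "cluster_edges f = {}"
      using cut0 unfolding cluster_edges_def by auto
    ultimately have "cluster f = {f}" "cluster_edges f = {}"
      by (auto simp: conn_def arcs_def)
    then show ?thesis using leaf[OF v]
      by (intro exI[of _ "Leaf (al f)"]) (auto intro: is_dendrogram.single)
  next
    case f: True
    obtain c0 c1 where t01: "istop V A ep (ep f 0) f c0" "istop V A ep (ep f 1) f c1"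
      and only: "\<And>c. c \<in> V \<union> A \<Longrightarrow> par A ep c = f \<Longrightarrow> c = c0 \<or> c = c1"
      using tops[OF t sep f] by metis
    obtain c c' where cc: "c \<noteq> c'" "{c, c'} \<subseteq> V \<union> A" "par A ep c = f" "par A ep c' = f"
      "m (2 * oid f) = oid c" "m (2 * oid f + 1) = oid c'"
      using child[OF f] by blast
    \<comment> \<open>The memory may hold the two children in either order; \<open>s\<close> will be
      the end of \<open>f\<close> on the side of the first child.\<close>
    have "c = c0 \<and> c' = c1 \<or> c = c1 \<and> c' = c0" using only cc by auto
    then have "\<exists>s<2. istop V A ep (ep f s) f c \<and> istop V A ep (ep f (1 - s)) f c'"
    proof
      assume "c = c0 \<and> c' = c1"
      then show ?thesis using t01 by (intro exI[of _ 0]) auto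
    next
      assume "c = c1 \<and> c' = c0"
      then show ?thesis using t01 by (intro exI[of _ 1]) auto
    qed
    then obtain s where s: "s < 2" "istop V A ep (ep f s) f c" "istop V A ep (ep f (1 - s)) f c'"
      by blast
    have lt: "c < f" "c' < f" using s by (auto simp: istop_def)
    obtain d where d: "is_dendrogram wt (al ` cluster c) (cluster_edges c) d"
      "represents n es m r d (oid c)" using less.IH[OF lt(1)] cc by auto
    obtain d' where d': "is_dendrogram wt (al ` cluster c') (cluster_edges c') d'"
      "represents n es m r d' (oid c')" using less.IH[OF lt(2)] cc by auto
    have s': "1 - s < 2" by auto
    note C = component_cluster[OF f s(1,2)] component_cluster[OF f s' s(3)]
    have edf: "{al (ep f s), al (ep f (1 - s))} = ed f"
      unfolding ed[OF f] using s(1) unfolding less_2_iff by (elim disjE) (simp_all add: insert_commute)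
    have "is_dendrogram wt (al ` cluster f) (cluster_edges f)
      (Node {al (ep f s), al (ep f (1 - s))} (wt {al (ep f s), al (ep f (1 - s))}) d d')"
    proof (rule is_dendrogram.split)
      show "{al (ep f s), al (ep f (1 - s))} \<in> cluster_edges f"
        unfolding edf cluster_edges_def using f by (auto simp: cluster_def rep_def)
      show "\<forall>g\<in>cluster_edges f. wt g \<le> wt {al (ep f s), al (ep f (1 - s))}"
        unfolding edf cluster_edges_def using f wt by auto
      show "cluster_edges f - {ed f} = cluster_edges f - {{al (ep f s), al (ep f (1 - s))}}"
        unfolding edf ..
      show "al ` cluster f = al ` cluster c \<union> al ` cluster c'"
        using cluster_split[OF f s] by auto
    qed (use C d d' in simp_all)
    moreover have "represents n es m r
      (Node {al (ep f s), al (ep f (1 - s))} (wt {al (ep f s), al (ep f (1 - s))}) d d') (oid f)"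
      using node[OF f] d d' cc unfolding edf by auto
    ultimately show ?thesis by blast
  qed
qed

lemma root_cluster:
  assumes "c \<in> V \<union> A" "par A ep c = 0"
  shows "cluster c = V" "cluster_edges c = ed ` A"
proof -
  obtain z where z: "\<And>h. h \<in> A \<Longrightarrow> h < z"
    using ctreeD(2)[OF t] finite_nat_set_iff_bounded[of A] by auto
  then have zA: "{h \<in> A. h < z} = A" by auto
  have "y \<in> cluster c" if "y \<in> V" for y
    using no_crossing[OF ctreeD(2)[OF t], of ep c z y] assms
      ctreeD(5)[OF t rep_in_V[OF assms(1)] that] unfolding cluster_def zA by simp
  moreover have "y \<in> V" if "y \<in> cluster c" for y
    using that conn_in_V rep_in_V[OF assms(1)] unfolding cluster_def by blast
  ultimately show V: "cluster c = V" by auto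
  show "cluster_edges c = ed ` A"
    unfolding cluster_edges_def using edge_in_cluster_le[of _ c] assms V ctreeD(4)[OF t] by auto
qed

end

end

section \<open>Trees as labelled multigraphs\<close>

text \<open>When the walk returns to a vertex of the path, the path is cut back to that vertex, so
  distinctness survives the induction.\<close>

lemma simple_path:
  assumes "(u, v) \<in> (adjacent F)\<^sup>*"
  shows "\<exists>xs. xs \<noteq> [] \<and> distinct xs \<and> hd xs = u \<and> last xs = v \<and> successively (\<lambda>x y. {x, y} \<in> F) xs"
  using assms
proof (induction rule: rtrancl_induct)
  case base
  show ?case by (intro exI[of _ "[u]"]) auto
next
  case (step y z)
  then obtain xs where xs: "xs \<noteq> []" "distinct xs" "hd xs = u" "last xs = y"
    "successively (\<lambda>x y. {x, y} \<in> F) xs" by blast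
  show ?case
  proof (cases "z \<in> set xs")
    case True
    then obtain as bs where "xs = as @ z # bs" by (meson split_list)
    then show ?thesis using xs
      by (intro exI[of _ "as @ [z]"]) (auto simp: successively_append_iff hd_append)
  next
    case False
    then show ?thesis using xs step(2)
      by (intro exI[of _ "xs @ [z]"]) (auto simp: successively_append_iff adjacent_def)
  qed
qed

text \<open>The edge \<open>{u, v}\<close> closes a simple path from \<open>u\<close> to
  \<open>v\<close>. Length 1 would give \<open>u = v\<close>, and length 2 would put
  \<open>{u, v}\<close> into \<open>F\<close>, so the cycle is long enough.\<close>

lemma path_closes_cycle:
  assumes "(u, v) \<in> (adjacent F)\<^sup>*" "u \<noteq> v" "{u, v} \<notin> F"
  shows "\<exists>xs. is_cycle (insert {u, v} F) xs"
proof -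
  obtain xs where xs: "xs \<noteq> []" "distinct xs" "hd xs = u" "last xs = v"
    "successively (\<lambda>x y. {x, y} \<in> F) xs" using simple_path[OF assms(1)] by blast
  have "length xs \<noteq> 1" using xs assms(2) by (cases xs) auto
  moreover have "length xs \<noteq> 2" using xs assms(3) by (auto simp: length_Suc_conv numeral_2_eq_2)
  moreover have "length xs \<noteq> 0" using xs by simp
  ultimately have len: "length xs \<ge> 3" by linarith
  have "{xs ! i, xs ! (Suc i mod length xs)} \<in> insert {u, v} F" if "i < length xs" for i
  proof (cases "Suc i < length xs")
    case True
    then show ?thesis using xs(5) by (auto simp: successively_conv_nth)
  next
    case False
    then have "Suc i = length xs" "i = length xs - 1" using that by simp_all
    then have "xs ! i = v" "xs ! (Suc i mod length xs) = u"
      using xs by (auto simp: last_conv_nth hd_conv_nth)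
    then show ?thesis by (simp add: insert_commute)
  qed
  then show ?thesis using len xs(2) unfolding is_cycle_def by blast
qed

text \<open>
  Vertex \<open>v\<close> becomes \<open>v + 1\<close> and the edge of rank \<open>\<rho>\<close>, which is the edge with index \<open>sig \<rho>\<close> of
  the input, becomes \<open>n + 1 + \<rho>\<close>; this leaves \<open>0\<close> to stand for a missing parent.
\<close>

definition ep_in :: "nat \<Rightarrow> (nat \<times> nat) list \<Rightarrow> (nat \<Rightarrow> nat) \<Rightarrow> nat \<Rightarrow> nat \<Rightarrow> nat" where
  "ep_in n es sig e s = Suc (if s = 0 then fst (es ! sig (e - Suc n)) else snd (es ! sig (e - Suc n)))"

text \<open>If deleting an edge left its ends connected, a remaining path together with this edge
  would be a cycle of the input. The permutation \<open>sig\<close> is arbitrary, so the lemma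
  serves the sorted order as well as the mere counting of edges.\<close>

lemma tree_input_ctree:
  assumes ti: "tree_input n E es" and sig: "bij_betw sig {..<length es} {..<length es}"
  shows "ctree {1..n} {Suc n..<Suc n + length es} (ep_in n es sig)"
proof -
  let ?A = "{Suc n..<Suc n + length es}" and ?ep = "ep_in n es sig"
  define ed where "ed e = edge (es ! sig (e - Suc n))" for e
  have tree: "is_tree {..<n} E" and dist: "distinct (map edge es)" and E: "E = edge ` set es"
    using ti by (auto simp: tree_input_def)
  note tree' = tree[unfolded is_tree_def]
  note Esub = tree'[THEN conjunct2, THEN conjunct2, THEN conjunct1]
    and connected = tree'[THEN conjunct2, THEN conjunct2, THEN conjunct2, THEN conjunct1, rule_format]
    and acyclic = tree'[THEN conjunct2, THEN conjunct2, THEN conjunct2, THEN conjunct2]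
  have idx: "sig (e - Suc n) < length es" if "e \<in> ?A" for e
    using bij_betwE[OF sig] that by auto
  have ed_inj: "inj_on ed ?A"
  proof (rule inj_onI)
    fix e g assume eg: "e \<in> ?A" "g \<in> ?A" "ed e = ed g"
    then have "sig (e - Suc n) = sig (g - Suc n)"
      using dist idx by (auto simp: ed_def distinct_conv_nth)
    then have "e - Suc n = g - Suc n"
      using inj_onD[OF bij_betw_imp_inj_on[OF sig]] eg by auto
    then show "e = g" using eg by auto
  qed
  have ed_img: "ed ` ?A = E"
  proof -
    have "(\<lambda>e. e - Suc n) ` ?A = {..<length es}"
      by (auto simp: image_iff intro!: bexI[of _ "_ + Suc n"])
    then have "(\<lambda>e. sig (e - Suc n)) ` ?A = {..<length es}"
      using bij_betw_imp_surj_on[OF sig] by (metis image_image)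
    then have "ed ` ?A = (\<lambda>i. edge (es ! i)) ` {..<length es}"
      unfolding ed_def by (metis image_image)
    also have "\<dots> = E" unfolding E by (auto simp: set_conv_nth)
    finally show ?thesis .
  qed
  have ed_eq: "ed e = {?ep e 0 - 1, ?ep e 1 - 1}" for e
    by (simp add: ed_def edge_def ep_in_def)
  have edE: "\<exists>u v. ed e = {u, v} \<and> u < n \<and> v < n \<and> u \<noteq> v" if "e \<in> ?A" for e
  proof -
    have "ed e \<in> E" using that ed_img by blast
    then have "ed e \<in> {{u, v} |u v. u \<in> {..<n} \<and> v \<in> {..<n} \<and> u \<noteq> v}"
      using Esub by (rule rev_subsetD)
    then show ?thesis unfolding mem_Collect_eq lessThan_iff by (elim exE conjE) (intro exI conjI)
  qed
  have V: "?ep e s \<in> {1..n}" if "e \<in> ?A" for e s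
    using edE[OF that] unfolding ed_eq by (auto simp: ep_in_def doubleton_eq_iff)
  have ne: "?ep e 0 \<noteq> ?ep e 1" if "e \<in> ?A" for e
    using edE[OF that] unfolding ed_eq by (auto simp: doubleton_eq_iff)
  have adj: "conn ?A ?ep (Suc u) (Suc v)" if "(u, v) \<in> (adjacent E)\<^sup>*" for u v
    using that
  proof (induction rule: rtrancl_induct)
    case (step y z)
    then obtain e where e: "e \<in> ?A" "ed e = {y, z}"
      using ed_img by (auto simp: adjacent_def)
    then have "{y, z} = {?ep e 0 - 1, ?ep e 1 - 1}" using ed_eq by simp
    then have "y = ?ep e 0 - 1 \<and> z = ?ep e 1 - 1 \<or> y = ?ep e 1 - 1 \<and> z = ?ep e 0 - 1"
      by (simp add: doubleton_eq_iff)
    then have "Suc y = ?ep e 0 \<and> Suc z = ?ep e 1 \<or> Suc y = ?ep e 1 \<and> Suc z = ?ep e 0"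
      by (auto simp: ep_in_def)
    then have "conn ?A ?ep (Suc y) (Suc z)"
      using conn_edge[OF e(1), of 0 1 ?ep] conn_edge[OF e(1), of 1 0 ?ep] by auto
    then show ?case using step conn_trans by blast
  qed simp
  show ?thesis unfolding ctree_def
  proof (intro conjI ballI allI impI)
    show "{1..n} \<noteq> {}" using tree'[THEN conjunct2, THEN conjunct1] by (cases n) auto
    show "conn ?A ?ep x y" if "x \<in> {1..n}" "y \<in> {1..n}" for x y
    proof -
      have "(x - 1, y - 1) \<in> (adjacent E)\<^sup>*"
        by (rule connected) (use that in auto)
      then show ?thesis using adj that by fastforce
    qed
    fix e assume e: "e \<in> ?A"
    show "\<not> conn (?A - {e}) ?ep (?ep e 0) (?ep e 1)"
    proof
      assume c: "conn (?A - {e}) ?ep (?ep e 0) (?ep e 1)"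
      let ?u = "?ep e 0 - 1" and ?v = "?ep e 1 - 1"
      let ?F = "ed ` (?A - {e})"
      have "(?u, ?ep e 1 - 1) \<in> (adjacent ?F)\<^sup>*"
      proof (rule conn_invariant[where Q = "\<lambda>y. (?u, y - 1) \<in> (adjacent ?F)\<^sup>*", OF c])
        fix g s assume g: "g \<in> ?A - {e}" "s < 2" "(?u, ?ep g s - 1) \<in> (adjacent ?F)\<^sup>*"
        have "{?ep g s - 1, ?ep g (1 - s) - 1} = ed g"
          unfolding ed_eq[of g] using g(2) unfolding less_2_iff
          by (elim disjE) (simp_all add: insert_commute)
        then have "(?ep g s - 1, ?ep g (1 - s) - 1) \<in> adjacent ?F"
          using g(1) unfolding adjacent_def by simp
        with g(3) show "(?u, ?ep g (1 - s) - 1) \<in> (adjacent ?F)\<^sup>*" by simp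
      qed simp
      moreover have "?u \<noteq> ?v" using ne[OF e] by (simp add: ep_in_def)
      moreover have "{?u, ?v} \<notin> ?F"
        using ed_inj e unfolding ed_eq[symmetric] by (auto simp: inj_on_def)
      ultimately have "\<exists>xs. is_cycle (insert {?u, ?v} ?F) xs"
        by (rule path_closes_cycle)
      moreover have "insert {?u, ?v} ?F = E"
        unfolding ed_eq[symmetric] image_insert[symmetric] insert_Diff[OF e] by (rule ed_img)
      ultimately show False using acyclic by auto
    qed
  qed (use V in auto)
qed

declare eval.simps [simp del]

section \<open>Arrays in memory and Hoare triples with cost bounds\<close>

text \<open>The counterpart of \<open>pwrite\<close> for arrays, with abstract indices in place of
  addresses.\<close>

definition upd :: "('p \<Rightarrow> nat) \<Rightarrow> 'i set \<Rightarrow> ('i \<Rightarrow> 'p) \<Rightarrow> ('i \<Rightarrow> nat) \<Rightarrow> 'p \<Rightarrow> nat" where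
  "upd F I idx v p = (if \<exists>i\<in>I. idx i = p then Min {v i |i. i \<in> I \<and> idx i = p} else F p)"

lemma upd_miss: "(\<And>i. i \<in> I \<Longrightarrow> idx i \<noteq> p) \<Longrightarrow> upd F I idx v p = F p"
  by (auto simp: upd_def)

lemma upd_hit:
  assumes "i \<in> I" "idx i = p" "\<And>j. j \<in> I \<Longrightarrow> idx j = p \<Longrightarrow> v j = x"
  shows "upd F I idx v p = x"
proof -
  have "{v i |i. i \<in> I \<and> idx i = p} = {x}" using assms by auto
  then show ?thesis using assms by (auto simp: upd_def)
qed

lemma upd_hit_inj: "i \<in> I \<Longrightarrow> inj_on idx I \<Longrightarrow> upd F I idx v (idx i) = v i"
  by (rule upd_hit) (auto simp: inj_on_def)

lemma upd_Min:
  assumes "i \<in> I" "idx i = p"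
  shows "upd F I idx v p = Min {v i |i. i \<in> I \<and> idx i = p}"
  using assms by (auto simp: upd_def)

lemma upd_reindex:
  assumes "h ` J = I"
  shows "upd F J (\<lambda>j. idx (h j)) (\<lambda>j. v (h j)) = upd F I idx v"
proof
  fix p
  have "(\<exists>i\<in>I. idx i = p) \<longleftrightarrow> (\<exists>j\<in>J. idx (h j) = p)"
    and "{v i |i. i \<in> I \<and> idx i = p} = {v (h j) |j. j \<in> J \<and> idx (h j) = p}"
    using assms by auto
  then show "upd F J (\<lambda>j. idx (h j)) (\<lambda>j. v (h j)) p = upd F I idx v p"
    unfolding upd_def by presburger
qed

text \<open>Thread \<open>j\<close> serves item \<open>j div c\<close> as helper number
  \<open>j mod c\<close>; a bijective list of the items makes the threads cover all pairs.\<close>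

lemma list_reindex:
  assumes "bij_betw h {..<N} A"
  shows "(\<lambda>j. (h (j div c), j mod c)) ` {..<c * N} = A \<times> {..<(c::nat)}"
proof (cases "c = 0")
  case False
  show ?thesis
  proof (intro equalityI subsetI)
    fix x assume "x \<in> (\<lambda>j. (h (j div c), j mod c)) ` {..<c * N}"
    then obtain j where "j < c * N" "x = (h (j div c), j mod c)" by auto
    then show "x \<in> A \<times> {..<c}" using bij_betwE[OF assms] False
      by (simp add: less_mult_imp_div_less mult.commute)
  next
    fix x assume "x \<in> A \<times> {..<c}"
    then obtain i q where x: "x = (h i, q)" "i < N" "q < c"
      using bij_betw_imp_surj_on[OF assms] by auto
    have "q + c * i < c * Suc i" using x by simp
    also have "\<dots> \<le> c * N" using x by (intro mult_le_mono) auto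
    finally have "q + c * i \<in> {..<c * N}" by simp
    moreover have "x = (h ((q + c * i) div c), (q + c * i) mod c)"
      using x by simp
    ultimately show "x \<in> (\<lambda>j. (h (j div c), j mod c)) ` {..<c * N}" by blast
  qed
qed simp

type_synonym index = "nat \<times> nat \<times> nat \<times> nat"
type_synonym assertion = "(nat \<Rightarrow> nat) \<Rightarrow> (nat \<Rightarrow> index \<Rightarrow> nat) \<Rightarrow> (nat \<Rightarrow> real) \<Rightarrow> env \<Rightarrow> bool"

text \<open>
  Memory cells from \<open>B\<close> on are used as four-dimensional arrays with tags; the program keeps \<open>B\<close> in
  local variable 3. No index ever reaches \<open>B\<close>, so cells of different arrays do not overlap.
\<close>

definition AD :: "nat \<Rightarrow> exp \<Rightarrow> exp \<Rightarrow> exp \<Rightarrow> exp \<Rightarrow> exp" where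
  "AD t a b c d = Plus (Times (Plus (Times (Plus (Times (Plus (Times (Const t) (Var 3)) a)
     (Var 3)) b) (Var 3)) c) (Var 3)) d"

definition LD :: "nat \<Rightarrow> exp \<Rightarrow> exp \<Rightarrow> exp \<Rightarrow> exp \<Rightarrow> exp" where
  "LD t a b c d = Load (AD t a b c d)"

definition ENot :: "exp \<Rightarrow> exp" where "ENot a = Equal a (Const 0)"
definition EAnd :: "exp \<Rightarrow> exp \<Rightarrow> exp" where "EAnd a b = ENot (Plus (ENot a) (ENot b))"
definition EOr :: "exp \<Rightarrow> exp \<Rightarrow> exp" where "EOr a b = ENot (EAnd (ENot a) (ENot b))"
text \<open>Selection by arithmetic keeps the body of a loop straight-line code, so that the threads
  stay in lockstep. The double negation reduces \<open>c\<close> to 0 or 1.\<close>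

definition EIte :: "exp \<Rightarrow> exp \<Rightarrow> exp \<Rightarrow> exp" where
  "EIte c a b = Plus (Times (ENot (ENot c)) a) (Times (ENot c) b)"

text \<open>
  Row \<open>li\<close> of array 1 lists \<open>cnt\<close> edge labels. For each of them there are \<open>c\<close> threads, with the
  label in variable 21 and the number of the thread in variable 22.
\<close>

definition list_lets :: "exp \<Rightarrow> nat \<Rightarrow> (nat \<times> exp) list" where
  "list_lets li c = [(21, LD 1 li (Div (Var 20) (Const c)) (Const 0) (Const 0)),
     (22, Mod (Var 20) (Const c))]"

definition ParL :: "exp \<Rightarrow> exp \<Rightarrow> nat \<Rightarrow> (nat \<times> exp) list \<Rightarrow> nat \<Rightarrow> exp \<Rightarrow> exp \<Rightarrow> exp \<Rightarrow> exp \<Rightarrow> exp \<Rightarrow> instr" where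
  "ParL li cnt c as t ea eb ec ed val = ParFor 20 (Times (Const c) cnt)
     (lets (list_lets li c @ as) @ [Store (AD t ea eb ec ed) val])"

text \<open>An address consists of five digits in base \<open>B\<close>, a tag and four indices, so
  the first assumption prevents wrap-around. Tags are below 16, hence themselves digits.\<close>

locale machine =
  fixes P :: program and w B :: nat
  assumes B5: "B ^ 5 \<le> 2 ^ w" and B16: "16 \<le> B"
begin

definition ad :: "nat \<Rightarrow> index \<Rightarrow> nat" where
  "ad t p = (case p of (a, b, c, d) \<Rightarrow> (((t * B + a) * B + b) * B + c) * B + d)"

definition inb :: "index \<Rightarrow> bool" where
  "inb p = (case p of (a, b, c, d) \<Rightarrow> a < B \<and> b < B \<and> c < B \<and> d < B)"

lemma inb_iff [simp]: "inb (a, b, c, d) \<longleftrightarrow> a < B \<and> b < B \<and> c < B \<and> d < B"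
  by (simp add: inb_def)

text \<open>The value 0 out of bounds lets array updates and freshness be equations between total
  functions.\<close>

definition vw :: "(nat \<Rightarrow> nat) \<Rightarrow> nat \<Rightarrow> index \<Rightarrow> nat" where
  "vw m t p = (if inb p then m (ad t p) else 0)"

definition lo :: "(nat \<Rightarrow> nat) \<Rightarrow> nat \<Rightarrow> nat" where
  "lo m x = (if x < B then m x else 0)"

lemma digit_eq: "b < B \<Longrightarrow> b' < B \<Longrightarrow> a * B + b = a' * B + b' \<longleftrightarrow> a = a' \<and> b = b'"
proof
  assume *: "b < B" "b' < B" "a * B + b = a' * B + b'"
  have "(a * B + b) div B = a" "(a * B + b) mod B = b" if "b < B" for a b
    using that by auto
  then show "a = a' \<and> b = b'" using * by metis
qed auto

lemma ad_eq: "inb p \<Longrightarrow> inb q \<Longrightarrow> ad t p = ad t' q \<longleftrightarrow> t = t' \<and> p = q"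
  by (auto simp: ad_def inb_def digit_eq split: prod.splits)

lemma digit_less: "a < x \<Longrightarrow> b < B \<Longrightarrow> a * B + b < x * B"
proof -
  assume "a < x" "b < B"
  then have "a * B + b < Suc a * B" by simp
  also have "\<dots> \<le> x * B" using \<open>a < x\<close> by (intro mult_le_mono) auto
  finally show ?thesis .
qed

lemma digits_less:
  assumes "t < B" "a < B" "b < B" "c < B" "d < B"
  shows "t * B + a < B * B" "(t * B + a) * B + b < B * B * B"
    "((t * B + a) * B + b) * B + c < B * B * B * B"
    "(((t * B + a) * B + b) * B + c) * B + d < B * B * B * B * B"
  using assms by (auto intro!: digit_less)

lemma pow5: "B * B * B * B * B \<le> 2 ^ w"
  using B5 by (simp add: numeral_eq_Suc algebra_simps)

text \<open>\<open>16 * B\<close> is the uniform bound in the evaluation rules: sums and products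
  below it are not reduced.\<close>

lemma pow_le: "B * B * B * B \<le> 2 ^ w" "B * B * B \<le> 2 ^ w" "B * B \<le> 2 ^ w" "16 * B \<le> 2 ^ w" "16 < (2::nat) ^ w"
proof -
  have *: "x \<le> x * B" for x using B16 by simp
  show 4: "B * B * B * B \<le> 2 ^ w" using pow5 * order_trans by blast
  then show 3: "B * B * B \<le> 2 ^ w" using * order_trans by blast
  then show 2: "B * B \<le> 2 ^ w" using * order_trans by blast
  have "16 * B \<le> B * B" using B16 by (rule mult_le_mono1)
  then show "16 * B \<le> 2 ^ w" using 2 by (rule le_trans)
  then show "16 < (2::nat) ^ w" using B16 by linarith
qed

text \<open>Separates the arrays from the cells below \<open>B\<close>, which hold input and
  output.\<close>

lemma ad_ge: "1 \<le> t \<Longrightarrow> B \<le> ad t p"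
proof -
  assume t: "1 \<le> t"
  have *: "B \<le> x * B + y" if "1 \<le> x" for x y
    using mult_le_mono1[OF that, of B] by linarith
  have **: "1 \<le> x * B + y" if "1 \<le> x" for x y
    using *[OF that, of y] B16 by linarith
  show ?thesis unfolding ad_def by (cases p) (simp only: prod.case * ** t)
qed

lemma take_w: "x < 2 ^ w \<Longrightarrow> take_bit w x = x" for x :: nat
  by (simp add: take_bit_nat_eq_self_iff)

lemma eval_Const: "c \<le> 16 \<Longrightarrow> eval w m r s (Const c) = c"
  using pow_le by (simp add: take_w eval.simps)

lemma eval_Plus: "eval w m r s a + eval w m r s b < 16 * B \<Longrightarrow>
    eval w m r s (Plus a b) = eval w m r s a + eval w m r s b"
  using pow_le by (simp add: take_w eval.simps)

lemma eval_Times: "eval w m r s a * eval w m r s b < 16 * B \<Longrightarrow>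
    eval w m r s (Times a b) = eval w m r s a * eval w m r s b"
  using pow_le by (simp add: take_w eval.simps)

lemma take_bool: "take_bit w (of_bool b) = (of_bool b :: nat)"
  using pow_le by (intro take_w) (auto simp: of_bool_def)

lemma eval_bool:
  "eval w m r s (Less a b) = of_bool (eval w m r s a < eval w m r s b)"
  "eval w m r s (Equal a b) = of_bool (eval w m r s a = eval w m r s b)"
  "eval w m r s (RLess a b) = of_bool (r (eval w m r s a) < r (eval w m r s b))"
  by (simp_all add: take_bool eval.simps)

lemma eval_ENot: "eval w m r s (ENot a) = of_bool (eval w m r s a = 0)"
  unfolding ENot_def eval_bool by (simp add: eval_Const)

lemma eval_EAnd: "eval w m r s (EAnd a b) = of_bool (eval w m r s a \<noteq> 0 \<and> eval w m r s b \<noteq> 0)"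
  unfolding EAnd_def eval_ENot
  by (subst eval_Plus) (use B16 in \<open>auto simp: eval_ENot of_bool_def\<close>)

lemma eval_EOr: "eval w m r s (EOr a b) = of_bool (eval w m r s a \<noteq> 0 \<or> eval w m r s b \<noteq> 0)"
  unfolding EOr_def eval_ENot eval_EAnd by simp

lemma eval_EIte:
  assumes "eval w m r s a < 16 * B" "eval w m r s b < 16 * B"
  shows "eval w m r s (EIte c a b) = (if eval w m r s c \<noteq> 0 then eval w m r s a else eval w m r s b)"
proof -
  have "eval w m r s (Times (ENot (ENot c)) a) = (if eval w m r s c \<noteq> 0 then eval w m r s a else 0)"
    by (subst eval_Times) (use assms B16 in \<open>auto simp: eval_ENot\<close>)
  moreover have "eval w m r s (Times (ENot c) b) = (if eval w m r s c \<noteq> 0 then 0 else eval w m r s b)"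
    by (subst eval_Times) (use assms B16 in \<open>auto simp: eval_ENot\<close>)
  ultimately show ?thesis unfolding EIte_def
    by (subst eval_Plus) (use assms in auto)
qed

lemma eval_AD:
  assumes "s 3 = B" "t < 16" "eval w m r s a < B" "eval w m r s b < B" "eval w m r s c < B"
    "eval w m r s d < B"
  shows "eval w m r s (AD t a b c d) =
    ad t (eval w m r s a, eval w m r s b, eval w m r s c, eval w m r s d)"
proof -
  have t: "t < B" using assms B16 by simp
  note d = digits_less[OF t assms(3-6)]
  have tB: "t * B < 2 ^ w" using pow_le(4) assms(2) B16
    by (metis le_less_trans mult_less_mono1 order_less_le_trans nat_less_le zero_less_numeral)
  have b: "t * B + eval w m r s a < 2 ^ w" "(t * B + eval w m r s a) * B + eval w m r s b < 2 ^ w"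
    "((t * B + eval w m r s a) * B + eval w m r s b) * B + eval w m r s c < 2 ^ w"
    "(((t * B + eval w m r s a) * B + eval w m r s b) * B + eval w m r s c) * B + eval w m r s d < 2 ^ w"
    using d pow_le pow5 by linarith+
  then have b': "(t * B + eval w m r s a) * B < 2 ^ w"
    "((t * B + eval w m r s a) * B + eval w m r s b) * B < 2 ^ w"
    "(((t * B + eval w m r s a) * B + eval w m r s b) * B + eval w m r s c) * B < 2 ^ w"
    by linarith+
  have c: "take_bit w t = t" using assms(2) pow_le by (intro take_w) linarith
  show ?thesis
    unfolding AD_def ad_def eval.simps assms(1) c take_w[OF tB] prod.case
      take_w[OF b(1)] take_w[OF b'(1)] take_w[OF b(2)] take_w[OF b'(2)] take_w[OF b(3)]
      take_w[OF b'(3)] take_w[OF b(4)] ..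
qed

lemma eval_LD:
  assumes "s 3 = B" "t < 16" "eval w m r s a < B" "eval w m r s b < B" "eval w m r s c < B"
    "eval w m r s d < B"
  shows "eval w m r s (LD t a b c d) =
    vw m t (eval w m r s a, eval w m r s b, eval w m r s c, eval w m r s d)"
  using eval_AD[OF assms] assms by (simp add: LD_def vw_def eval.simps)

lemma eval_Load_lo: "eval w m r s a < B \<Longrightarrow> eval w m r s (Load a) = lo m (eval w m r s a)"
  by (simp add: lo_def eval.simps)

lemma eval_Var: "eval w m r s (Var x) = s x"
  and eval_Minus: "eval w m r s (Minus a b) = eval w m r s a - eval w m r s b"
  and eval_Div: "eval w m r s (Div a b) = eval w m r s a div eval w m r s b"
  and eval_Mod: "eval w m r s (Mod a b) = eval w m r s a mod eval w m r s b"
  by (simp_all add: eval.simps)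

lemma of_bool_less: "of_bool b < 16 * B"
  using B16 by (simp add: of_bool_def)

lemmas evs = eval_Const eval_Plus eval_Times eval_bool eval_ENot eval_EAnd eval_EOr eval_EIte
  eval_LD eval_Var eval_Minus eval_Div eval_Mod
  of_bool_less

lemma vw_write:
  assumes "\<And>i. i < N \<Longrightarrow> inb (idx i)" "1 \<le> t"
  shows "vw (pwrite m N (\<lambda>i. ad t (idx i)) v) = (vw m)(t := upd (vw m t) {..<N} idx v)"
    and "lo (pwrite m N (\<lambda>i. ad t (idx i)) v) = lo m"
proof -
  show "vw (pwrite m N (\<lambda>i. ad t (idx i)) v) = (vw m)(t := upd (vw m t) {..<N} idx v)"
  proof (intro ext)
    fix t' p
    show "vw (pwrite m N (\<lambda>i. ad t (idx i)) v) t' p = ((vw m)(t := upd (vw m t) {..<N} idx v)) t' p"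
    proof (cases "inb p")
      case True
      have *: "ad t (idx i) = ad t' p \<longleftrightarrow> t = t' \<and> idx i = p" if "i < N" for i
        using ad_eq[OF assms(1)[OF that] True] .
      then have "(\<exists>i<N. ad t (idx i) = ad t' p) \<longleftrightarrow> t = t' \<and> (\<exists>i\<in>{..<N}. idx i = p)"
        and "t = t' \<Longrightarrow> {v i |i. i < N \<and> ad t (idx i) = ad t' p} = {v i |i. i \<in> {..<N} \<and> idx i = p}"
        by auto
      then show ?thesis using True by (auto simp: vw_def pwrite_eq upd_def)
    next
      case False
      then have "\<not> (\<exists>i\<in>{..<N}. idx i = p)" using assms(1) by auto
      then show ?thesis using False by (auto simp: vw_def upd_def)
    qed
  qed
  show "lo (pwrite m N (\<lambda>i. ad t (idx i)) v) = lo m"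
  proof
    fix x
    show "lo (pwrite m N (\<lambda>i. ad t (idx i)) v) x = lo m x"
    proof (cases "x < B")
      case True
      then have "ad t p \<noteq> x" for p using ad_ge[OF assms(2), of p] by linarith
      then show ?thesis by (simp add: lo_def pwrite_eq)
    qed (simp add: lo_def)
  qed
qed

lemma lo_write:
  assumes "\<And>i. i < N \<Longrightarrow> a i < B"
  shows "lo (pwrite m N a v) = upd (lo m) {..<N} a v" and "vw' \<ge> 1 \<Longrightarrow> vw (pwrite m N a v) vw' = vw m vw'"
proof -
  show "lo (pwrite m N a v) = upd (lo m) {..<N} a v"
  proof
    fix x
    show "lo (pwrite m N a v) x = upd (lo m) {..<N} a v x"
    proof (cases "x < B")
      case False
      then have "\<not> (\<exists>i\<in>{..<N}. a i = x)" using assms by auto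
      then show ?thesis using False by (simp add: lo_def upd_def)
    next
      case True
      then show ?thesis by (cases "\<exists>i<N. a i = x") (auto simp: lo_def pwrite_eq upd_def)
    qed
  qed
  show "vw (pwrite m N a v) vw' = vw m vw'" if "vw' \<ge> 1"
  proof
    fix p
    have "a i \<noteq> ad vw' p" if "i < N" for i
      using assms[OF that] ad_ge[OF \<open>vw' \<ge> 1\<close>, of p] by auto
    then show "vw (pwrite m N a v) vw' p = vw m vw' p" by (auto simp: vw_def pwrite_eq)
  qed
qed

text \<open>Total correctness with upper bounds on depth and work. Assertions see the word memory
  only as low cells \<open>lo\<close> and arrays \<open>vw\<close>, never as raw addresses.\<close>

definition tri :: "instr list \<Rightarrow> assertion \<Rightarrow> nat \<Rightarrow> nat \<Rightarrow> assertion \<Rightarrow> bool" where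
  "tri is Pre D K Post \<longleftrightarrow> (\<forall>m r s. Pre (lo m) (vw m) r s \<longrightarrow>
     (\<exists>m' r' s'. runs P w is m r s m' r' s' D K \<and> Post (lo m') (vw m') r' s'))"

lemma tri_conseq:
  assumes "tri is Pre D K Post" "\<And>l V r s. Pre' l V r s \<Longrightarrow> Pre l V r s"
    "\<And>l V r s. Post l V r s \<Longrightarrow> Post' l V r s" "D \<le> D'" "K \<le> K'"
  shows "tri is Pre' D' K' Post'"
  using assms runs_mono unfolding tri_def by (metis (no_types, opaque_lifting))

lemma tri_Nil: "tri [] Pre 0 0 Pre"
  using runs_Nil unfolding tri_def by blast

lemma tri_append:
  assumes "tri a Pre D1 K1 Mid" "tri b Mid D2 K2 Post"
  shows "tri (a @ b) Pre (D1 + D2) (K1 + K2) Post"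
  using assms runs_append unfolding tri_def by meson

lemma tri_Cons:
  assumes "tri [i] Pre D1 K1 Mid" "tri is Mid D2 K2 Post"
  shows "tri (i # is) Pre (D1 + D2) (K1 + K2) Post"
  using tri_append[OF assms] by simp

lemma tri_Ex: "(\<And>x. tri is (Pre x) D K Post) \<Longrightarrow> tri is (\<lambda>l V r s. \<exists>x. Pre x l V r s) D K Post"
  unfolding tri_def by blast

lemma tri_Assign:
  assumes "\<And>m r s. Pre (lo m) (vw m) r s \<Longrightarrow> Post (lo m) (vw m) r (s(x := eval w m r s e))"
  shows "tri [Assign x e] Pre 1 1 Post"
  unfolding tri_def using assms runs_Assign by blast

text \<open>The number \<open>R\<close> of iterations is known beforehand, so the proof is by
  induction on how many of them remain. Costs may depend on the iteration, as the geometric sum over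
  the rounds requires.\<close>

lemma tri_while:
  assumes step: "\<And>k. k < R \<Longrightarrow> tri body (I k) (D k) (K k) (I (Suc k))"
    and cond: "\<And>k m r s. k \<le> R \<Longrightarrow> I k (lo m) (vw m) r s \<Longrightarrow> eval w m r s e \<noteq> 0 \<longleftrightarrow> k < R"
  shows "tri [WhileNZ e body] (I 0) ((\<Sum>k<R. Suc (D k)) + 1) ((\<Sum>k<R. Suc (K k)) + 1) (I R)"
proof -
  have "tri [WhileNZ e body] (I (R - j)) ((\<Sum>k=R-j..<R. Suc (D k)) + 1)
      ((\<Sum>k=R-j..<R. Suc (K k)) + 1) (I R)" if "j \<le> R" for j
    using that
  proof (induction j)
    case 0
    show ?case unfolding tri_def
    proof (intro allI impI)
      fix m r s assume I: "I (R - 0) (lo m) (vw m) r s"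
      then have "eval w m r s e = 0" using cond[of R m r s] by simp
      from runs_While_done[OF this] I
      show "\<exists>m' r' s'. runs P w [WhileNZ e body] m r s m' r' s' ((\<Sum>k = R - 0..<R. Suc (D k)) + 1)
          ((\<Sum>k = R - 0..<R. Suc (K k)) + 1) \<and> I R (lo m') (vw m') r' s'"
        by (intro exI[of _ m] exI[of _ r] exI[of _ s]) simp
    qed
  next
    case (Suc j)
    define k where "k = R - Suc j"
    have k: "k < R" "R - j = Suc k" "R - Suc j = k" using Suc by (auto simp: k_def)
    show ?case unfolding tri_def
    proof (intro allI impI)
      fix m r s assume "I (R - Suc j) (lo m) (vw m) r s"
      then have I: "I k (lo m) (vw m) r s" by (simp add: k_def)
      obtain m1 r1 s1 where 1: "runs P w body m r s m1 r1 s1 (D k) (K k)" "I (Suc k) (lo m1) (vw m1) r1 s1"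
        using step[OF k(1)] I unfolding tri_def by blast
      obtain m2 r2 s2 where 2: "runs P w [WhileNZ e body] m1 r1 s1 m2 r2 s2
          ((\<Sum>k=Suc k..<R. Suc (D k)) + 1) ((\<Sum>k=Suc k..<R. Suc (K k)) + 1)" "I R (lo m2) (vw m2) r2 s2"
        using Suc.IH[unfolded tri_def k(2), rule_format, OF _ 1(2)] Suc.prems by auto
      have "eval w m r s e \<noteq> 0" using cond[of k m r s] k I by auto
      from runs_While_step[OF this 1(1) 2(1)]
      have "runs P w [WhileNZ e body] m r s m2 r2 s2 ((\<Sum>k=k..<R. Suc (D k)) + 1)
          ((\<Sum>k=k..<R. Suc (K k)) + 1)"
        using k by (simp add: sum.atLeast_Suc_lessThan)
      then show "\<exists>m' r' s'. runs P w [WhileNZ e body] m r s m' r' s'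
          ((\<Sum>k = R - Suc j..<R. Suc (D k)) + 1) ((\<Sum>k = R - Suc j..<R. Suc (K k)) + 1) \<and>
          I R (lo m') (vw m') r' s'"
        using 2(2) unfolding k(3) by blast
    qed
  qed
  from this[of R] show ?thesis by (simp add: atLeast0LessThan)
qed

lemma tri_while_const:
  assumes step: "\<And>k. k < R \<Longrightarrow> tri body (I k) D K (I (Suc k))"
    and cond: "\<And>k m r s. k \<le> R \<Longrightarrow> I k (lo m) (vw m) r s \<Longrightarrow> eval w m r s e \<noteq> 0 \<longleftrightarrow> k < R"
  shows "tri [WhileNZ e body] (I 0) (R * Suc D + 1) (R * Suc K + 1) (I R)"
  using tri_while[where D = "\<lambda>_. D" and K = "\<lambda>_. K" and I = I and R = R and e = e
      and body = body, OF assms] by simp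

lemma tri_par:
  assumes "\<And>m r s. Pre (lo m) (vw m) r s \<Longrightarrow> \<exists>idx v. eval w m r s e = N \<and>
     (\<forall>i<N. let s' = assigns w m r as (s(x := i)) in s' 3 = B \<and> inb (idx i) \<and>
       (eval w m r s' ea, eval w m r s' eb, eval w m r s' ec, eval w m r s' ed) = idx i \<and>
       eval w m r s' val = v i) \<and>
     Post (lo m) ((vw m)(t := upd (vw m t) {..<N} idx v)) r s"
    and t: "1 \<le> t" "t < 16"
  shows "tri [ParFor x e (lets as @ [Store (AD t ea eb ec ed) val])] Pre
    (length as + 3) (N * (length as + 2) + 2) Post"
  unfolding tri_def
proof (intro allI impI)
  fix m r s assume "Pre (lo m) (vw m) r s"
  from assms(1)[OF this] obtain idx v where N: "eval w m r s e = N" and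
    i: "\<And>i. i < N \<Longrightarrow> let s' = assigns w m r as (s(x := i)) in s' 3 = B \<and> inb (idx i) \<and>
       (eval w m r s' ea, eval w m r s' eb, eval w m r s' ec, eval w m r s' ed) = idx i \<and>
       eval w m r s' val = v i" and
    Post: "Post (lo m) ((vw m)(t := upd (vw m t) {..<N} idx v)) r s" by blast
  have a: "eval w m r (assigns w m r as (s(x := i))) (AD t ea eb ec ed) = ad t (idx i)" if "i < N" for i
    using i[OF that] eval_AD[of "assigns w m r as (s(x := i))" t m r ea eb ec ed] t
    by (auto simp: Let_def inb_def split: prod.splits)
  have v: "eval w m r (assigns w m r as (s(x := i))) val = v i" if "i < N" for i
    using i[OF that] by (simp add: Let_def)
  have inb: "inb (idx i)" if "i < N" for i using i[OF that] by (simp add: Let_def)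
  have "runs P w [ParFor x e (lets as @ [Store (AD t ea eb ec ed) val])] m r s
     (pwrite m N (\<lambda>i. ad t (idx i)) v) r s (length as + 3) (N * (length as + 2) + 2)"
    by (rule runs_par_Store[OF N a v])
  moreover have "Post (lo (pwrite m N (\<lambda>i. ad t (idx i)) v)) (vw (pwrite m N (\<lambda>i. ad t (idx i)) v)) r s"
    using Post vw_write[of N idx, OF inb t(1)] by simp
  ultimately show "\<exists>m' r' s'. runs P w [ParFor x e (lets as @ [Store (AD t ea eb ec ed) val])] m r s
     m' r' s' (length as + 3) (N * (length as + 2) + 2) \<and> Post (lo m') (vw m') r' s'" by blast
qed

text \<open>A write below \<open>B\<close> may alter what \<open>vw\<close> shows for tag 0, whose
  addresses can fall among the low cells; hence the postcondition must hold for every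
  \<open>V\<close> that agrees from tag 1 on.\<close>

lemma tri_par_lo:
  assumes "\<And>m r s. Pre (lo m) (vw m) r s \<Longrightarrow> \<exists>a v. eval w m r s e = N \<and>
     (\<forall>i<N. let s' = assigns w m r as (s(x := i)) in eval w m r s' ea = a i \<and> a i < B \<and>
       eval w m r s' val = v i) \<and>
     (\<forall>V. (\<forall>t\<ge>1. V t = vw m t) \<longrightarrow> Post (upd (lo m) {..<N} a v) V r s)"
  shows "tri [ParFor x e (lets as @ [Store ea val])] Pre
    (length as + 3) (N * (length as + 2) + 2) Post"
  unfolding tri_def
proof (intro allI impI)
  fix m r s assume "Pre (lo m) (vw m) r s"
  from assms(1)[OF this] obtain a v where N: "eval w m r s e = N" and
    i: "\<And>i. i < N \<Longrightarrow> let s' = assigns w m r as (s(x := i)) in eval w m r s' ea = a i \<and> a i < B \<and>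
       eval w m r s' val = v i" and
    Post: "\<And>V. (\<And>t. t \<ge> 1 \<Longrightarrow> V t = vw m t) \<Longrightarrow> Post (upd (lo m) {..<N} a v) V r s" by blast
  have "runs P w [ParFor x e (lets as @ [Store ea val])] m r s
     (pwrite m N a v) r s (length as + 3) (N * (length as + 2) + 2)"
    by (rule runs_par_Store[OF N]) (use i in \<open>auto simp: Let_def\<close>)
  moreover have aB: "a i < B" if "i < N" for i using i[OF that] by (auto simp: Let_def)
  have L: "lo (pwrite m N a v) = upd (lo m) {..<N} a v"
    by (rule lo_write(1)) (rule aB)
  have "Post (lo (pwrite m N a v)) (vw (pwrite m N a v)) r s"
    unfolding L by (rule Post, rule lo_write(2)) (rule aB)
  ultimately show "\<exists>m' r' s'. runs P w [ParFor x e (lets as @ [Store ea val])] m r s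
     m' r' s' (length as + 3) (N * (length as + 2) + 2) \<and> Post (lo m') (vw m') r' s'" by blast
qed

lemma tri_par_R:
  assumes "\<And>m r s. Pre (lo m) (vw m) r s \<Longrightarrow> \<exists>a v. eval w m r s e = N \<and>
     (\<forall>i<N. let s' = assigns w m r as (s(x := i)) in eval w m r s' ea = a i \<and>
       r (eval w m r s' val) = v i) \<and> Post (lo m) (vw m) (pwrite r N a v) s"
  shows "tri [ParFor x e (lets as @ [RStore ea val])] Pre
    (length as + 3) (N * (length as + 2) + 2) Post"
  unfolding tri_def
proof (intro allI impI)
  fix m r s assume "Pre (lo m) (vw m) r s"
  from assms(1)[OF this] obtain a v where N: "eval w m r s e = N" and
    i: "\<And>i. i < N \<Longrightarrow> let s' = assigns w m r as (s(x := i)) in eval w m r s' ea = a i \<and>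
       r (eval w m r s' val) = v i" and
    Post: "Post (lo m) (vw m) (pwrite r N a v) s" by blast
  have "runs P w [ParFor x e (lets as @ [RStore ea val])] m r s
     m (pwrite r N a v) s (length as + 3) (N * (length as + 2) + 2)"
    by (rule runs_par_RStore[OF N]) (use i in \<open>auto simp: Let_def\<close>)
  then show "\<exists>m' r' s'. runs P w [ParFor x e (lets as @ [RStore ea val])] m r s
     m' r' s' (length as + 3) (N * (length as + 2) + 2) \<and> Post (lo m') (vw m') r' s'"
    using Post by blast
qed

lemma assigns_append: "assigns w m r (as @ bs) s = assigns w m r bs (assigns w m r as s)"
  by (induction as arbitrary: s) auto

text \<open>Replaces thread numbers by pairs of an item and a helper number. The two assignments of
  \<open>list_lets\<close> add two steps, and two units of work per thread.\<close>

lemma tri_ParL: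
  assumes A: "finite A" "c * card A < 16 * B" "card A \<le> B" and c: "1 \<le> c" "c < 16"
    and t: "1 \<le> t" "t < 16"
    and pre: "\<And>m r s. Pre (lo m) (vw m) r s \<Longrightarrow> eval w m r s cnt = card A \<and> s 3 = B \<and> i < B \<and>
      bij_betw (\<lambda>j. vw m 1 (i, j, 0, 0)) {..<card A} A \<and>
      (\<forall>j. eval w m r (s(20 := j)) li = i)"
    and ex: "\<And>m r s. Pre (lo m) (vw m) r s \<Longrightarrow> \<exists>idx v.
     (\<forall>e\<in>A. \<forall>q<c. \<forall>s'. s' 21 = e \<longrightarrow> s' 22 = q \<longrightarrow> (\<forall>y. y < 20 \<longrightarrow> s' y = s y) \<longrightarrow>
       (let s'' = assigns w m r as s' in s'' 3 = B \<and> inb (idx e q) \<and>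
       (eval w m r s'' ea, eval w m r s'' eb, eval w m r s'' ec, eval w m r s'' ed) = idx e q \<and>
       eval w m r s'' val = v e q)) \<and>
     Post (lo m) ((vw m)(t := upd (vw m t) (A \<times> {..<c}) (\<lambda>(e, q). idx e q) (\<lambda>(e, q). v e q))) r s"
  shows "tri [ParL li cnt c as t ea eb ec ed val] Pre
    (length as + 5) (c * card A * (length as + 4) + 2) Post"
proof -
  have "tri [ParFor 20 (Times (Const c) cnt) (lets (list_lets li c @ as) @ [Store (AD t ea eb ec ed) val])] Pre
    (length (list_lets li c @ as) + 3) ((c * card A) * (length (list_lets li c @ as) + 2) + 2) Post"
  proof (rule tri_par[OF _ t])
    fix m r s assume Pr: "Pre (lo m) (vw m) r s"
    note p = pre[OF Pr]
    define h where "h = (\<lambda>j. vw m 1 (i, j, 0, 0))"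
    have h: "bij_betw h {..<card A} A" using p by (simp add: h_def)
    from ex[OF Pr] obtain idx v where iv: "\<And>e q s'. e \<in> A \<Longrightarrow> q < c \<Longrightarrow> s' 21 = e \<Longrightarrow> s' 22 = q \<Longrightarrow>
        (\<And>y. y < 20 \<Longrightarrow> s' y = s y) \<Longrightarrow>
       (let s'' = assigns w m r as s' in s'' 3 = B \<and> inb (idx e q) \<and>
       (eval w m r s'' ea, eval w m r s'' eb, eval w m r s'' ec, eval w m r s'' ed) = idx e q \<and>
       eval w m r s'' val = v e q)"
      and Post: "Post (lo m) ((vw m)(t := upd (vw m t) (A \<times> {..<c}) (\<lambda>(e, q). idx e q) (\<lambda>(e, q). v e q))) r s"
      by blast
    define g where "g = (\<lambda>j. (h (j div c), j mod c))"
    have g: "g ` {..<c * card A} = A \<times> {..<c}" unfolding g_def by (rule list_reindex[OF h])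
    have "\<forall>j<c * card A. let s' = assigns w m r (list_lets li c @ as) (s(20 := j))
      in s' 3 = B \<and> inb ((\<lambda>(e, q). idx e q) (g j)) \<and>
         (eval w m r s' ea, eval w m r s' eb, eval w m r s' ec, eval w m r s' ed) = (\<lambda>(e, q). idx e q) (g j) \<and>
         eval w m r s' val = (\<lambda>(e, q). v e q) (g j)"
    proof (intro allI impI)
      fix j assume j: "j < c * card A"
      then have jd: "j div c < card A" by (simp add: less_mult_imp_div_less mult.commute)
      have "j div c < B" using jd A by simp
      then have e21: "eval w m r (s(20 := j)) (LD 1 li (Div (Var 20) (Const c)) (Const 0) (Const 0)) = h (j div c)"
        using p c B16 by (subst eval_LD) (auto simp: eval_Const eval_Div eval_Var h_def)
      define s' where "s' = (s(20 := j, 21 := h (j div c), 22 := j mod c))"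
      have s': "assigns w m r (list_lets li c) (s(20 := j)) = s'"
        using c unfolding list_lets_def assigns.simps fst_conv snd_conv e21
        by (simp add: eval_Mod eval_Const eval_Var s'_def)
      have "h (j div c) \<in> A" using jd bij_betwE[OF h] by auto
      moreover have "j mod c < c" using c by simp
      ultimately show "let s' = assigns w m r (list_lets li c @ as) (s(20 := j))
        in s' 3 = B \<and> inb ((\<lambda>(e, q). idx e q) (g j)) \<and>
         (eval w m r s' ea, eval w m r s' eb, eval w m r s' ec, eval w m r s' ed) = (\<lambda>(e, q). idx e q) (g j) \<and>
         eval w m r s' val = (\<lambda>(e, q). v e q) (g j)"
        unfolding assigns_append s' g_def prod.case by (intro iv) (auto simp: s'_def)
    qed
    moreover have "upd F {..<c * card A} (\<lambda>j. (\<lambda>(e, q). idx e q) (g j)) (\<lambda>j. (\<lambda>(e, q). v e q) (g j)) =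
        upd F (A \<times> {..<c}) (\<lambda>(e, q). idx e q) (\<lambda>(e, q). v e q)" for F
      by (rule upd_reindex[OF g])
    moreover have "eval w m r s (Times (Const c) cnt) = c * card A"
      using p A c by (subst eval_Times) (auto simp: eval_Const)
    ultimately show "\<exists>idx v. eval w m r s (Times (Const c) cnt) = c * card A \<and>
     (\<forall>i<c * card A. let s' = assigns w m r (list_lets li c @ as) (s(20 := i)) in s' 3 = B \<and> inb (idx i) \<and>
       (eval w m r s' ea, eval w m r s' eb, eval w m r s' ec, eval w m r s' ed) = idx i \<and>
       eval w m r s' val = v i) \<and>
     Post (lo m) ((vw m)(t := upd (vw m t) {..<c * card A} idx v)) r s"
      using Post by (intro exI[of _ "\<lambda>j. (\<lambda>(e, q). idx e q) (g j)"] exI[of _ "\<lambda>j. (\<lambda>(e, q). v e q) (g j)"]) simp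
  qed
  moreover have "length (list_lets li c @ as) + 3 = length as + 5"
    "length (list_lets li c @ as) + 2 = length as + 4"
    by (simp_all add: list_lets_def)
  ultimately show ?thesis unfolding ParL_def by (simp only:)
qed

end

section \<open>Merging sorted runs\<close>

context
  fixes f g :: "nat \<Rightarrow> nat" and h :: nat
begin

definition take_left :: "nat \<Rightarrow> nat \<Rightarrow> bool" where
  "take_left a b \<longleftrightarrow> a < h \<and> (h \<le> b \<or> f a < g b)"

fun left_count :: "nat \<Rightarrow> nat" where
  "left_count 0 = 0"
| "left_count (Suc d) = left_count d + of_bool (take_left (left_count d) (d - left_count d))"

definition merged :: "nat \<Rightarrow> nat" where
  "merged d = (if take_left (left_count d) (d - left_count d) then f (left_count d)
     else g (d - left_count d))"

text \<open>The cut points of a merge: every element already taken precedes every element of the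
  other run that is not yet taken.\<close>

definition valid_split :: "nat \<Rightarrow> nat \<Rightarrow> bool" where
  "valid_split a b \<longleftrightarrow> a \<le> h \<and> b \<le> h \<and> (0 < a \<longrightarrow> b < h \<longrightarrow> f (a - 1) < g b) \<and>
     (0 < b \<longrightarrow> a < h \<longrightarrow> g (b - 1) < f a)"

text \<open>The half of \<open>valid_split\<close> that the binary search tests with a single
  comparison; its failure at \<open>a + 1\<close> supplies the other half.\<close>

definition split_cond :: "nat \<Rightarrow> nat \<Rightarrow> bool" where
  "split_cond d a \<longleftrightarrow> a \<le> h \<and> a \<le> d \<and> (0 < a \<longrightarrow> h \<le> d - a \<or> f (a - 1) < g (d - a))"

context
  assumes f: "\<And>i j. i < j \<Longrightarrow> j < h \<Longrightarrow> f i < f j" and g: "\<And>i j. i < j \<Longrightarrow> j < h \<Longrightarrow> g i < g j"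
    and fg: "\<And>i j. i < h \<Longrightarrow> j < h \<Longrightarrow> f i \<noteq> g j"
begin

lemma f': "i \<le> j \<Longrightarrow> j < h \<Longrightarrow> f i \<le> f j" and g': "i \<le> j \<Longrightarrow> j < h \<Longrightarrow> g i \<le> g j"
  using f[of i j] g[of i j] by (auto simp: order.order_iff_strict)

text \<open>Two cuts of the same size would give
  \<open>f a \<le> f (a' - 1) < g b' \<le> g (b - 1) < f a\<close>.\<close>

lemma valid_split_unique_aux:
  assumes "valid_split a b" "valid_split a' b'" "a + b = a' + b'" "a < a'"
  shows False
proof -
  have *: "a < h" "b' < b" "b \<le> h" "a' \<le> h" using assms by (auto simp: valid_split_def)
  have "f a \<le> f (a' - 1)" by (rule f') (use * assms(4) in auto)
  also have "\<dots> < g b'" using assms * by (auto simp: valid_split_def)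
  also have "\<dots> \<le> g (b - 1)" by (rule g') (use * in auto)
  also have "\<dots> < f a" using assms * by (auto simp: valid_split_def)
  finally show False .
qed

lemma valid_split_unique:
  assumes "valid_split a b" "valid_split a' b'" "a + b = a' + b'" shows "a = a'"
  using valid_split_unique_aux[OF assms] valid_split_unique_aux[OF assms(2,1)] assms(3)
  by (metis linorder_neqE_nat)

lemma valid_split_step:
  assumes "valid_split a b" "a + b < 2 * h"
  shows "take_left a b \<Longrightarrow> valid_split (Suc a) b" "\<not> take_left a b \<Longrightarrow> valid_split a (Suc b)"
proof -
  show "valid_split (Suc a) b" if "take_left a b"
  proof -
    have "g (b - 1) < f (Suc a)" if "0 < b" "Suc a < h"
      using f[of a "Suc a"] assms(1) that by (auto simp: valid_split_def)
    then show ?thesis using assms \<open>take_left a b\<close> by (auto simp: valid_split_def take_left_def)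
  qed
  show "valid_split a (Suc b)" if t: "\<not> take_left a b"
  proof -
    have b: "b < h" "a < h \<Longrightarrow> g b < f a"
      using assms t fg[of a b] by (auto simp: valid_split_def take_left_def)
    have "f (a - 1) < g (Suc b)" if "0 < a" "Suc b < h"
      using g[of b "Suc b"] assms(1) that by (auto simp: valid_split_def)
    then show ?thesis using assms b by (auto simp: valid_split_def)
  qed
qed

lemma left_count_valid:
  "d \<le> 2 * h \<Longrightarrow> left_count d \<le> d \<and> valid_split (left_count d) (d - left_count d)"
proof (induction d)
  case (Suc d)
  then have "left_count d \<le> d" "valid_split (left_count d) (d - left_count d)" by auto
  moreover have "left_count d + (d - left_count d) < 2 * h" using Suc calculation by simp
  ultimately show ?case using valid_split_step[of "left_count d" "d - left_count d"]
    by (auto simp: Suc_diff_le)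
qed (simp add: valid_split_def)

lemma left_count_le: "d \<le> 2 * h \<Longrightarrow> left_count d \<le> h \<and> d - left_count d \<le> h"
  using left_count_valid by (auto simp: valid_split_def)

lemma left_count_eqI:
  assumes "d \<le> 2 * h" "split_cond d a" "\<not> split_cond d (a + 1)"
  shows "a = left_count d"
proof -
  have b: "d - a \<le> h" using assms by (auto simp: split_cond_def)
  have "g (d - a - 1) < f a" if "0 < d - a" "a < h"
  proof -
    have "\<not> h \<le> d - (a + 1)" "\<not> f a < g (d - (a + 1))"
      using assms that by (auto simp: split_cond_def)
    then show ?thesis using fg[of a "d - a - 1"] that by auto
  qed
  then have "valid_split a (d - a)"
    using assms(2) b by (auto simp: valid_split_def split_cond_def)
  then show ?thesis
    using left_count_valid[OF assms(1)] assms(2)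
    by (intro valid_split_unique[of a "d - a" _ "d - left_count d"]) (auto simp: split_cond_def)
qed

lemma merged_cases:
  assumes "d < 2 * h"
  shows "left_count d < h \<and> merged d = f (left_count d) \<and> left_count (Suc d) = Suc (left_count d) \<or>
    d - left_count d < h \<and> merged d = g (d - left_count d) \<and> left_count (Suc d) = left_count d"
proof (cases "take_left (left_count d) (d - left_count d)")
  case False
  have "valid_split (left_count d) (Suc (d - left_count d))"
    using left_count_valid[of d] assms False by (intro valid_split_step) auto
  then show ?thesis using False by (auto simp: merged_def valid_split_def)
qed (auto simp: merged_def take_left_def)

lemma merged_Suc:
  assumes "Suc d < 2 * h" shows "merged d < merged (Suc d)"
proof -
  let ?a = "left_count d" and ?b = "d - left_count d"
  let ?a' = "left_count (Suc d)" and ?b' = "Suc d - left_count (Suc d)"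
  have le: "?a \<le> d" using left_count_valid[of d] assms by simp
  have v: "valid_split ?a' ?b'" using left_count_valid[of "Suc d"] assms by simp
  from merged_cases[of d] assms consider
    "?a < h" "merged d = f ?a" "?a' = Suc ?a" | "?b < h" "merged d = g ?b" "?a' = ?a" by force
  then show ?thesis
  proof cases
    case 1
    then have b: "?b' = ?b" using le by simp
    from merged_cases[OF assms] show ?thesis
      using 1 v b f[of ?a "Suc ?a"] by (auto simp: valid_split_def)
  next
    case 2
    then have b: "?b' = Suc ?b" using le by simp
    from merged_cases[OF assms] show ?thesis
      using 2 v b g[of ?b "Suc ?b"] by (auto simp: valid_split_def)
  qed
qed

lemma merged_less: "i < j \<Longrightarrow> j < 2 * h \<Longrightarrow> merged i < merged j"
proof (induction j)
  case (Suc j)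
  then show ?case using merged_Suc[of j] by (cases "i = j") auto
qed simp

end

end

section \<open>Merge sort on aligned runs\<close>

definition run_keys :: "(nat \<Rightarrow> nat) \<Rightarrow> (nat \<Rightarrow> nat) \<Rightarrow> nat \<Rightarrow> nat \<Rightarrow> nat" where
  "run_keys key F base a = key (F (base + a))"

text \<open>
  Two adjacent runs of length \<open>h\<close> occupy a block of length \<open>2 * h\<close>; position \<open>p\<close> lies in the
  block starting at \<open>p - p mod (2 * h)\<close>.
\<close>

definition lcount :: "(nat \<Rightarrow> nat) \<Rightarrow> (nat \<Rightarrow> nat) \<Rightarrow> nat \<Rightarrow> nat \<Rightarrow> nat \<Rightarrow> nat" where
  "lcount key F h base = left_count (run_keys key F base) (run_keys key F (base + h)) h"

definition merge_runs :: "(nat \<Rightarrow> nat) \<Rightarrow> (nat \<Rightarrow> nat) \<Rightarrow> nat \<Rightarrow> nat \<Rightarrow> nat" where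
  "merge_runs key F h p = (let d = p mod (2 * h); base = p - d; a = lcount key F h base d in
     if take_left (run_keys key F base) (run_keys key F (base + h)) h a (d - a)
     then F (base + a) else F (base + h + (d - a)))"

text \<open>The image condition says that every aligned run is permuted within itself, so adjacent
  runs hold disjoint sets of items and their keys differ.\<close>

definition sorted_runs :: "(nat \<Rightarrow> nat) \<Rightarrow> nat \<Rightarrow> nat \<Rightarrow> (nat \<Rightarrow> nat) \<Rightarrow> bool" where
  "sorted_runs key M h F \<longleftrightarrow> (\<forall>base. h dvd base \<longrightarrow> base + h \<le> M \<longrightarrow>
     (\<forall>i j. i < j \<longrightarrow> j < h \<longrightarrow> key (F (base + i)) < key (F (base + j))) \<and>
     F ` {base..<base + h} = {base..<base + h})"

lemma run_props:
  assumes s: "sorted_runs key M h F" and inj: "inj_on key {..<M}"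
    and base: "2 * h dvd base" "base + 2 * h \<le> M"
  shows "i < j \<Longrightarrow> j < h \<Longrightarrow> run_keys key F base i < run_keys key F base j"
    and "i < j \<Longrightarrow> j < h \<Longrightarrow> run_keys key F (base + h) i < run_keys key F (base + h) j"
    and "i < h \<Longrightarrow> j < h \<Longrightarrow> run_keys key F base i \<noteq> run_keys key F (base + h) j"
    and "i < h \<Longrightarrow> F (base + i) \<in> {base..<base + h}"
    and "i < h \<Longrightarrow> F (base + h + i) \<in> {base + h..<base + 2 * h}"
proof -
  have d: "h dvd base" "h dvd base + h" using base(1) by (auto elim: dvdE)
  note 1 = s[unfolded sorted_runs_def, rule_format, OF d(1)]
  note 2 = s[unfolded sorted_runs_def, rule_format, OF d(2)]
  have im: "F ` {base..<base + h} = {base..<base + h}"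
    "F ` {base + h..<base + h + h} = {base + h..<base + h + h}"
    using 1 2 base(2) by auto
  show "i < j \<Longrightarrow> j < h \<Longrightarrow> run_keys key F base i < run_keys key F base j"
    and "i < j \<Longrightarrow> j < h \<Longrightarrow> run_keys key F (base + h) i < run_keys key F (base + h) j"
    using 1 2 base(2) unfolding run_keys_def by auto
  have m1: "F (base + i) \<in> {base..<base + h}" if "i < h" for i
    using that im(1) by (metis atLeastLessThan_iff image_eqI le_add1 nat_add_left_cancel_less)
  have m2: "F (base + h + i) \<in> {base + h..<base + h + h}" if "i < h" for i
    using that im(2) by (metis atLeastLessThan_iff image_eqI le_add1 nat_add_left_cancel_less)
  show "i < h \<Longrightarrow> F (base + i) \<in> {base..<base + h}" using m1 .
  show "i < h \<Longrightarrow> F (base + h + i) \<in> {base + h..<base + 2 * h}" using m2 by (simp add: mult_2 add.assoc)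
  show "run_keys key F base i \<noteq> run_keys key F (base + h) j" if "i < h" "j < h"
  proof
    assume "run_keys key F base i = run_keys key F (base + h) j"
    then have "F (base + i) = F (base + h + j)"
      using inj_onD[OF inj] m1[OF that(1)] m2[OF that(2)] base(2) unfolding run_keys_def by force
    then show False using m1[OF that(1)] m2[OF that(2)] by auto
  qed
qed

lemma merge_runs_eq:
  assumes "2 * h dvd base" "d < 2 * h"
  shows "merge_runs key F h (base + d) = (let a = lcount key F h base d in
     if take_left (run_keys key F base) (run_keys key F (base + h)) h a (d - a)
     then F (base + a) else F (base + h + (d - a)))"
proof -
  have "(base + d) mod (2 * h) = d" using assms by (auto elim!: dvdE)
  then show ?thesis by (simp add: merge_runs_def)
qed

text \<open>Strictly increasing keys make the merged block injective, and an injective map of a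
  finite block into itself is onto.\<close>

lemma sorted_runs_merge:
  assumes s: "sorted_runs key M h F" and inj: "inj_on key {..<M}"
  shows "sorted_runs key M (2 * h) (merge_runs key F h)"
  unfolding sorted_runs_def
proof (intro allI impI)
  fix base assume base: "2 * h dvd base" "base + 2 * h \<le> M"
  let ?f = "run_keys key F base" and ?g = "run_keys key F (base + h)"
  note p = run_props[OF s inj base]
  have key: "key (merge_runs key F h (base + d)) = merged ?f ?g h d" if "d < 2 * h" for d
    unfolding merge_runs_eq[OF base(1) that] merged_def lcount_def Let_def run_keys_def
    by (simp add: add.assoc)
  have less: "key (merge_runs key F h (base + i)) < key (merge_runs key F h (base + j))"
    if "i < j" "j < 2 * h" for i j
    using merged_less[of h ?f ?g, OF p(1-3) that] key that by simp
  let ?G = "merge_runs key F h"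
  have sub: "?G (base + d) \<in> {base..<base + 2 * h}" if "d < 2 * h" for d
  proof -
    let ?a = "lcount key F h base d"
    have "?a < h \<and> take_left ?f ?g h ?a (d - ?a) \<or> d - ?a < h \<and> \<not> take_left ?f ?g h ?a (d - ?a)"
      using merged_cases[of h ?f ?g, OF p(1-3) that] unfolding lcount_def
      by (auto simp: take_left_def)
    then show ?thesis using p(4)[of ?a] p(5)[of "d - ?a"]
      unfolding merge_runs_eq[OF base(1) that] Let_def by auto
  qed
  have "?G ` {base..<base + 2 * h} \<subseteq> {base..<base + 2 * h}"
    using sub by (metis (no_types, lifting) atLeastLessThan_iff image_subsetI le_iff_add nat_add_left_cancel_less)
  moreover have "inj_on ?G {base..<base + 2 * h}"
  proof (rule inj_onI, rule ccontr)
    fix x y assume xy: "x \<in> {base..<base + 2 * h}" "y \<in> {base..<base + 2 * h}" "?G x = ?G y" "x \<noteq> y"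
    then obtain i j where "x = base + i" "y = base + j" "i < 2 * h" "j < 2 * h"
      by (metis atLeastLessThan_iff le_iff_add nat_add_left_cancel_less)
    then show False using less[of i j] less[of j i] xy by (cases "i < j") auto
  qed
  ultimately have "?G ` {base..<base + 2 * h} = {base..<base + 2 * h}"
    by (simp add: endo_inj_surj)
  then show "(\<forall>i j. i < j \<longrightarrow> j < 2 * h \<longrightarrow>
      key (?G (base + i)) < key (?G (base + j))) \<and> ?G ` {base..<base + 2 * h} = {base..<base + 2 * h}"
    using less by blast
qed

text \<open>Ties are broken by index, and the indices from \<open>m\<close> on are padding that is sorted to the end.\<close>

definition before :: "(nat \<Rightarrow> real) \<Rightarrow> nat \<Rightarrow> nat \<Rightarrow> nat \<Rightarrow> bool" where
  "before r m x y \<longleftrightarrow> (if x < m \<and> y < m then r x < r y \<or> \<not> r y < r x \<and> x < y else x < y)"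

text \<open>Counting predecessors turns the comparison \<open>before\<close> into injective natural
  keys, as the theory of merging expects. They exist in the proof only; the program evaluates
  \<open>before\<close> directly.\<close>

definition rank_key :: "(nat \<Rightarrow> real) \<Rightarrow> nat \<Rightarrow> nat \<Rightarrow> nat \<Rightarrow> nat" where
  "rank_key r m M x = card {y. y < M \<and> before r m y x}"

lemma before_rank_key:
  assumes "x < M" "y < M"
  shows "before r m x y \<longleftrightarrow> rank_key r m M x < rank_key r m M y"
proof -
  have trans: "before r m x z" if "before r m x y" "before r m y z" for x y z
    using that unfolding before_def by (auto split: if_splits)
  have irrefl: "\<not> before r m x x" for x by (auto simp: before_def)
  have total: "before r m x y \<or> x = y \<or> before r m y x" for x y by (auto simp: before_def)
  have *: "rank_key r m M x < rank_key r m M y" if "before r m x y" "x < M" for x y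
    unfolding rank_key_def
  proof (rule psubset_card_mono)
    show "{z. z < M \<and> before r m z x} \<subset> {z. z < M \<and> before r m z y}"
      using that trans irrefl by blast
  qed simp
  show ?thesis using *[of x y] *[of y x] total[of x y] assms by fastforce
qed

lemma inj_rank_key: "inj_on (rank_key r m M) {..<M}"
proof (rule inj_onI)
  fix x y assume xy: "x \<in> {..<M}" "y \<in> {..<M}" "rank_key r m M x = rank_key r m M y"
  then have "\<not> before r m x y" "\<not> before r m y x"
    using before_rank_key[of x M y] before_rank_key[of y M x] by auto
  then show "x = y" by (auto simp: before_def split: if_splits)
qed

primrec sort_level :: "(nat \<Rightarrow> nat) \<Rightarrow> nat \<Rightarrow> nat \<Rightarrow> nat" where
  "sort_level key 0 = (\<lambda>p. p)"
| "sort_level key (Suc l) = merge_runs key (sort_level key l) (2 ^ l)"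

lemma sort_level_sorted: "inj_on key {..<M} \<Longrightarrow> sorted_runs key M (2 ^ l) (sort_level key l)"
proof (induction l)
  case 0
  then show ?case by (simp add: sorted_runs_def)
qed (simp add: sorted_runs_merge)

lemma sort_level_less:
  assumes inj: "inj_on key {..<2 ^ k}" and "l \<le> k" "p < 2 ^ k"
  shows "sort_level key l p < 2 ^ k"
proof -
  let ?b = "p - p mod 2 ^ l"
  have "(2::nat) ^ l dvd 2 ^ k" using assms(2) by (simp add: le_imp_power_dvd)
  then obtain q where q: "(2::nat) ^ k = 2 ^ l * q" by (auto elim: dvdE)
  have pd: "p div 2 ^ l < q" using assms(3) q by (simp add: less_mult_imp_div_less mult.commute)
  have b: "?b = 2 ^ l * (p div 2 ^ l)" by (simp add: minus_mod_eq_mult_div)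
  have "2 ^ l * (p div 2 ^ l) + 2 ^ l = 2 ^ l * Suc (p div 2 ^ l)" by simp
  also have "\<dots> \<le> 2 ^ k" unfolding q using pd by (intro mult_le_mono) auto
  finally have le: "?b + 2 ^ l \<le> 2 ^ k" using b by simp
  have "sort_level key l ` {?b..<?b + 2 ^ l} = {?b..<?b + 2 ^ l}"
    using sort_level_sorted[OF inj, of l] b le unfolding sorted_runs_def by (metis dvd_triv_left)
  moreover have "p mod 2 ^ l < 2 ^ l" by simp
  then have "p \<in> {?b..<?b + 2 ^ l}" using mod_less_eq_dividend[of p "2 ^ l"]
    unfolding atLeastLessThan_iff by linarith
  ultimately have "sort_level key l p \<in> {?b..<?b + 2 ^ l}" by (metis imageI)
  then show ?thesis using le unfolding atLeastLessThan_iff by linarith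
qed

lemma sort_level_final:
  fixes r :: "nat \<Rightarrow> real"
  assumes "m \<le> 2 ^ k"
  defines "sig \<equiv> sort_level (rank_key r m (2 ^ k)) k"
  shows "bij_betw sig {..<m} {..<m}"
    and "\<And>i j. i \<le> j \<Longrightarrow> j < m \<Longrightarrow> r (sig i) \<le> r (sig j)"
proof -
  let ?key = "rank_key r m (2 ^ k)"
  have "sorted_runs ?key (2 ^ k) (2 ^ k) sig"
    unfolding sig_def by (rule sort_level_sorted[OF inj_rank_key])
  then have less: "\<And>i j. i < j \<Longrightarrow> j < 2 ^ k \<Longrightarrow> ?key (sig i) < ?key (sig j)"
    and im: "sig ` {..<2 ^ k} = {..<2 ^ k}"
    by (auto simp: sorted_runs_def atLeast0LessThan dest!: spec[of _ 0])
  have bef: "before r m (sig i) (sig j)" if "i < j" "j < 2 ^ k" for i j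
  proof -
    have "sig i < 2 ^ k" "sig j < 2 ^ k" using im that by auto
    then show ?thesis using before_rank_key less[OF that] by blast
  qed
  have inj: "inj_on sig {..<2 ^ k}" using im by (simp add: eq_card_imp_inj_on)
  \<comment> \<open>Pigeonhole: if padding occurred at a position \<open>i < m\<close>, all
    \<open>m\<close> proper items would precede it and fit into \<open>i\<close> positions.\<close>
  have lt: "sig i < m" if "i < m" for i
  proof (rule ccontr)
    assume ge: "\<not> sig i < m"
    have "{..<m} \<subseteq> sig ` {..<i}"
    proof
      fix x assume x: "x \<in> {..<m}"
      then have "x \<in> sig ` {..<2 ^ k}" unfolding im using assms(1) by simp
      then obtain j where j: "j < 2 ^ k" "x = sig j" by auto
      have "j < i"
      proof (rule ccontr)
        assume "\<not> j < i"
        then have "i < j" using ge x j by (cases "i = j") auto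
        then show False using bef[OF _ j(1), of i] ge x j(2) by (auto simp: before_def)
      qed
      then show "x \<in> sig ` {..<i}" using j by auto
    qed
    then have "card {..<m} \<le> card (sig ` {..<i})" by (intro card_mono) auto
    also have "\<dots> \<le> i" using card_image_le[of "{..<i}" sig] by simp
    finally show False using that by simp
  qed
  have "inj_on sig {..<m}" using inj assms(1) by (auto intro: inj_on_subset)
  moreover have "sig ` {..<m} \<subseteq> {..<m}" using lt by auto
  ultimately show "bij_betw sig {..<m} {..<m}"
    unfolding bij_betw_def by (simp add: endo_inj_surj)
  show "r (sig i) \<le> r (sig j)" if "i \<le> j" "j < m" for i j
  proof (cases "i = j")
    case False
    then have "before r m (sig i) (sig j)" using that assms(1) by (intro bef) auto
    then show ?thesis using lt[of i] lt[of j] that by (auto simp: before_def)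
  qed simp
qed


section \<open>Set-up and sorting on the machine\<close>

text \<open>
  Variables 0 to 5 of the main thread hold \<open>n\<close>, the least power of two \<open>M = 2 ^ Lam \<ge> n\<close>, \<open>Lam\<close>,
  \<open>B = 16 * M\<close>, a power of two \<open>L\<close> of order \<open>log n\<close>, and \<open>M div L\<close>.
\<close>

abbreviation Par :: "exp \<Rightarrow> (nat \<times> exp) list \<Rightarrow> nat \<Rightarrow> exp \<Rightarrow> exp \<Rightarrow> exp \<Rightarrow> exp \<Rightarrow> exp \<Rightarrow> instr" where
  "Par e as t a b c d val \<equiv> ParFor 20 e (lets as @ [Store (AD t a b c d) val])"

abbreviation Inc :: "nat \<Rightarrow> instr" where "Inc x \<equiv> Assign x (Plus (Var x) (Const 1))"
abbreviation Dbl :: "nat \<Rightarrow> instr" where "Dbl x \<equiv> Assign x (Plus (Var x) (Var x))"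

definition init_prog :: "instr list" where
  "init_prog = [Assign 0 (Load (Const 0)), Assign 1 (Const 1), Assign 2 (Const 0),
     WhileNZ (Less (Var 1) (Var 0)) [Dbl 1, Inc 2],
     Assign 3 (Times (Const 16) (Var 1)), Assign 4 (Const 1),
     WhileNZ (Less (Var 4) (Plus (Var 2) (Const 1))) [Dbl 4],
     Assign 5 (Div (Var 1) (Var 4))]"

text \<open>
  Array 10 holds the sorted runs of every level. Each thread is responsible for \<open>L\<close> consecutive
  output positions; its cell of array 11 is the number of elements that the output before the
  current position takes from the left run, found initially by binary search.
\<close>

definition e_before :: exp where
  "e_before = EIte (EAnd (Less (Var 25) (Minus (Var 0) (Const 1))) (Less (Var 26) (Minus (Var 0) (Const 1))))
     (EOr (RLess (Var 25) (Var 26)) (EAnd (ENot (RLess (Var 26) (Var 25))) (Less (Var 25) (Var 26))))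
     (Less (Var 25) (Var 26))"

definition e_left :: exp where "e_left = LD 11 (Var 20) (Const 0) (Const 0) (Const 0)"

definition pos_lets :: "exp \<Rightarrow> (nat \<times> exp) list" where
  "pos_lets e = [(21, e), (22, Mod (Var 21) (Plus (Var 7) (Var 7))), (23, Minus (Var 21) (Var 22))]"

definition search_lets :: "(nat \<times> exp) list" where
  "search_lets = pos_lets (Times (Var 20) (Var 4)) @ [(24, Plus e_left (Var 8)),
     (25, LD 10 (Var 6) (Minus (Plus (Var 23) (Var 24)) (Const 1)) (Const 0) (Const 0)),
     (26, LD 10 (Var 6) (Plus (Plus (Var 23) (Var 7)) (Minus (Var 22) (Var 24))) (Const 0) (Const 0))]"

definition search_par :: instr where
  "search_par = Par (Var 5) search_lets 11 (Var 20) (Const 0) (Const 0) (Const 0)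
     (EIte (EAnd (Less (Var 24) (Plus (Var 7) (Const 1))) (EAnd (Less (Var 24) (Plus (Var 22) (Const 1)))
       (EOr (Less (Var 7) (Plus (Minus (Var 22) (Var 24)) (Const 1))) e_before)))
       (Var 24) e_left)"

text \<open>The count restarts at 0 at the beginning of a block, where array 11 may still hold the
  count of the previous block. Reduction modulo \<open>M\<close> bounds the value that is read just
  past an exhausted right run.\<close>

definition merge_lets :: "(nat \<times> exp) list" where
  "merge_lets = pos_lets (Plus (Times (Var 20) (Var 4)) (Var 8)) @
    [(24, EIte (Var 22) e_left (Const 0)),
     (25, Mod (LD 10 (Var 6) (Plus (Var 23) (Var 24)) (Const 0) (Const 0)) (Var 1)),
     (26, Mod (LD 10 (Var 6) (Plus (Plus (Var 23) (Var 7)) (Minus (Var 22) (Var 24))) (Const 0) (Const 0)) (Var 1)),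
     (27, EAnd (Less (Var 24) (Var 7)) (EOr (Less (Var 7) (Plus (Minus (Var 22) (Var 24)) (Const 1))) e_before))]"

definition merge_par :: instr where
  "merge_par = Par (Var 5) merge_lets 10 (Plus (Var 6) (Const 1)) (Var 21) (Const 0) (Const 0)
     (EIte (Var 27) (Var 25) (Var 26))"

definition count_par :: instr where
  "count_par = Par (Var 5) merge_lets 11 (Var 20) (Const 0) (Const 0) (Const 0) (Plus (Var 24) (Var 27))"

definition sort_body :: "instr list" where
  "sort_body = [Par (Var 5) [] 11 (Var 20) (Const 0) (Const 0) (Const 0) (Const 0),
     Assign 8 (Var 7), WhileNZ (Var 8) [search_par, Assign 8 (Div (Var 8) (Const 2))],
     Assign 8 (Const 0), WhileNZ (Less (Var 8) (Var 4)) [merge_par, count_par, Inc 8],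
     Dbl 7, Inc 6]"

definition sort_prog :: "instr list" where
  "sort_prog = [Par (Var 1) [] 10 (Const 0) (Var 20) (Const 0) (Const 0) (Var 20),
     Assign 6 (Const 0), Assign 7 (Const 1), WhileNZ (Less (Var 6) (Var 2)) sort_body]"

text \<open>The equivalences determine \<open>Lam\<close> and \<open>lam\<close> as the binary
  logarithms of \<open>n\<close> and of \<open>Lam + 1\<close>, rounded up.
  \<open>B = 16 * M\<close> leaves room for the labels, which are below \<open>2 * n\<close>, and
  for the output cells, which are below \<open>4 * n\<close>.\<close>

locale instance_params = machine P w B for P w B +
  fixes n Lam lam :: nat
  assumes n1: "1 \<le> n" and Lam: "\<And>k. n \<le> 2 ^ k \<longleftrightarrow> Lam \<le> k"
    and lam: "\<And>k. Lam + 1 \<le> 2 ^ k \<longleftrightarrow> lam \<le> k" and BM: "B = 16 * 2 ^ Lam"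
begin

abbreviation M :: nat where "M \<equiv> 2 ^ Lam"
abbreviation L :: nat where "L \<equiv> 2 ^ lam"

lemma nM: "n \<le> M" using Lam by blast

lemma LL: "Lam + 1 \<le> L" "L \<le> 2 * (Lam + 1)" "lam \<le> Lam"
proof -
  show "Lam + 1 \<le> L" using lam by blast
  show "L \<le> 2 * (Lam + 1)"
  proof (cases lam)
    case (Suc k)
    then have "\<not> Lam + 1 \<le> 2 ^ k" using lam by simp
    then show ?thesis using Suc by simp
  qed simp
  have "Lam + 1 \<le> 2 ^ Lam" using less_exp[of Lam] by linarith
  then show "lam \<le> Lam" using lam by blast
qed

lemma pow_le_M: "k \<le> Lam \<Longrightarrow> (2::nat) ^ k \<le> M"
  by (simp add: power_increasing)

lemma LM: "L \<le> M" "L dvd M" "M div L * L = M" "0 < M div L"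
proof -
  show "L \<le> M" using LL by (intro pow_le_M)
  then show "0 < M div L" by (simp add: div_greater_zero_iff)
  show "L dvd M" using LL by (simp add: le_imp_power_dvd)
  then show "M div L * L = M" by simp
qed

definition base_env :: "env \<Rightarrow> bool" where
  "base_env s \<longleftrightarrow> s 0 = n \<and> s 1 = M \<and> s 2 = Lam \<and> s 3 = B \<and> s 4 = L \<and> s 5 = M div L"

lemma base_env_upd [simp]: "6 \<le> x \<Longrightarrow> base_env (s(x := v)) \<longleftrightarrow> base_env s"
  by (auto simp: base_env_def)

lemma base_envD:
  assumes "base_env s"
  shows "s 0 = n" "s 1 = M" "s 2 = Lam" "s 3 = B" "s 4 = L" "s 5 = M div L"
    "s (Suc 0) = M"
  using assms by (auto simp: base_env_def)

lemma Lam_less: "Lam < M" by (rule less_exp)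

definition fresh :: "nat set \<Rightarrow> (nat \<Rightarrow> index \<Rightarrow> nat) \<Rightarrow> bool" where
  "fresh T V \<longleftrightarrow> (\<forall>t\<in>T. V t = (\<lambda>_. 0))"

lemma fresh_upd [simp]: "t \<notin> T \<Longrightarrow> fresh T (V(t := F)) \<longleftrightarrow> fresh T V"
  by (auto simp: fresh_def)

lemma tri_init:
  assumes "l0 0 = n"
  shows "tri init_prog (\<lambda>l V r s. l = l0 \<and> r = r0 \<and> fresh {1..11} V)
    (6 * (Lam + 1) + 6) (6 * (Lam + 1) + 6)
    (\<lambda>l V r s. l = l0 \<and> r = r0 \<and> fresh {1..11} V \<and> base_env s)"
proof -
  let ?G = "\<lambda>l V r. l = l0 \<and> r = r0 \<and> fresh {1..11} V"
  have MB: "16 * M \<le> B" using BM by simp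
  have B1: "1 < B" using B16 by linarith
  have 1: "tri [Assign 0 (Load (Const 0)), Assign 1 (Const 1), Assign 2 (Const 0)]
    (\<lambda>l V r s. ?G l V r) (1 + (1 + (1 + 0))) (1 + (1 + (1 + 0)))
    (\<lambda>l V r s. ?G l V r \<and> s 0 = n \<and> s 1 = 2 ^ 0 \<and> s 2 = 0)"
    by (rule tri_Cons[OF tri_Assign tri_Cons[OF tri_Assign tri_Cons[OF tri_Assign tri_Nil]],
        where Mid = "\<lambda>l V r s. ?G l V r \<and> s 0 = n" and
          Mid1 = "\<lambda>l V r s. ?G l V r \<and> s 0 = n \<and> s 1 = 2 ^ 0"])
      (use B1 assms in \<open>auto simp: eval_Const eval_Load_lo\<close>)
  have body: "tri [Dbl 1, Inc 2]
      (\<lambda>l V r s. ?G l V r \<and> s 0 = n \<and> s 1 = 2 ^ k \<and> s 2 = k) (1 + (1 + 0)) (1 + (1 + 0))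
      (\<lambda>l V r s. ?G l V r \<and> s 0 = n \<and> s 1 = 2 ^ Suc k \<and> s 2 = Suc k)" if "k < Lam" for k
  proof -
    have "(2::nat) ^ Suc k \<le> M" using that by (intro pow_le_M) simp
    then have "(2::nat) ^ k + 2 ^ k < 16 * B" using MB B1 by simp
    moreover have "k + 1 < 16 * B" using MB that Lam_less B1 by linarith
    ultimately have b: "(2::nat) ^ k + 2 ^ k < 16 * B" "k + 1 < 16 * B" .
    show ?thesis
      by (rule tri_Cons[OF tri_Assign tri_Cons[OF tri_Assign tri_Nil],
          where Mid = "\<lambda>l V r s. ?G l V r \<and> s 0 = n \<and> s 1 = 2 ^ Suc k \<and> s 2 = k"])
        (use b in \<open>auto simp: evs\<close>)
  qed
  have 2: "tri [WhileNZ (Less (Var 1) (Var 0)) [Dbl 1, Inc 2]]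
    (\<lambda>l V r s. ?G l V r \<and> s 0 = n \<and> s 1 = 2 ^ 0 \<and> s 2 = 0)
    (Lam * Suc (1 + (1 + 0)) + 1) (Lam * Suc (1 + (1 + 0)) + 1)
    (\<lambda>l V r s. ?G l V r \<and> s 0 = n \<and> s 1 = 2 ^ Lam \<and> s 2 = Lam)"
    by (rule tri_while_const[where I = "\<lambda>k l V r s. ?G l V r \<and> s 0 = n \<and> s 1 = 2 ^ k \<and> s 2 = k",
        OF body]) (use Lam in \<open>auto simp: evs not_le[symmetric]\<close>)
  let ?H = "\<lambda>l V r s. ?G l V r \<and> s 0 = n \<and> s 1 = M \<and> s 2 = Lam \<and> s 3 = B"
  have 3: "tri [Assign 3 (Times (Const 16) (Var 1)), Assign 4 (Const 1)]
    (\<lambda>l V r s. ?G l V r \<and> s 0 = n \<and> s 1 = 2 ^ Lam \<and> s 2 = Lam) (1 + (1 + 0)) (1 + (1 + 0))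
    (\<lambda>l V r s. ?H l V r s \<and> s 4 = 2 ^ 0)"
    by (rule tri_Cons[OF tri_Assign tri_Cons[OF tri_Assign tri_Nil], where Mid = ?H])
      (use B1 BM in \<open>auto simp: evs\<close>)
  have body4: "tri [Dbl 4] (\<lambda>l V r s. ?H l V r s \<and> s 4 = 2 ^ k) 1 1
      (\<lambda>l V r s. ?H l V r s \<and> s 4 = 2 ^ Suc k)" if "k < lam" for k
  proof -
    have "(2::nat) ^ Suc k \<le> M" using that LL by (intro pow_le_M) simp
    then have b: "(2::nat) ^ k + 2 ^ k < 16 * B" using MB B1 by (simp_all)
    show ?thesis by (rule tri_Assign) (use b in \<open>auto simp: evs\<close>)
  qed
  have L16: "Suc Lam < 16 * B" using Lam_less MB B1 by linarith
  have 4: "tri [WhileNZ (Less (Var 4) (Plus (Var 2) (Const 1))) [Dbl 4]]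
    (\<lambda>l V r s. ?H l V r s \<and> s 4 = 2 ^ 0) (lam * Suc 1 + 1) (lam * Suc 1 + 1)
    (\<lambda>l V r s. ?H l V r s \<and> s 4 = 2 ^ lam)"
    by (rule tri_while_const[where I = "\<lambda>k l V r s. ?H l V r s \<and> s 4 = 2 ^ k",
        OF body4]) (use lam L16 in \<open>auto simp: evs not_le[symmetric]\<close>)
  have 5: "tri [Assign 5 (Div (Var 1) (Var 4))] (\<lambda>l V r s. ?H l V r s \<and> s 4 = 2 ^ lam) 1 1
    (\<lambda>l V r s. ?G l V r \<and> base_env s)"
    by (rule tri_Assign) (auto simp: evs base_env_def)
  have e: "init_prog = ((([Assign 0 (Load (Const 0)), Assign 1 (Const 1), Assign 2 (Const 0)] @
      [WhileNZ (Less (Var 1) (Var 0)) [Dbl 1, Inc 2]]) @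
      [Assign 3 (Times (Const 16) (Var 1)), Assign 4 (Const 1)]) @
      [WhileNZ (Less (Var 4) (Plus (Var 2) (Const 1))) [Dbl 4]]) @ [Assign 5 (Div (Var 1) (Var 4))]"
    by (simp add: init_prog_def)
  show ?thesis unfolding e
    by (rule tri_conseq[OF tri_append[OF tri_append[OF tri_append[OF tri_append[OF 1 2] 3] 4] 5]])
      (use LL(3) in auto)
qed

lemma block_le: "j \<le> Lam \<Longrightarrow> p < M \<Longrightarrow> p - p mod 2 ^ j + 2 ^ j \<le> M"
proof -
  assume j: "j \<le> Lam" and p: "p < M"
  have "(2::nat) ^ j dvd M" using j by (simp add: le_imp_power_dvd)
  then obtain q where q: "M = 2 ^ j * q" by (auto elim: dvdE)
  have pd: "p div 2 ^ j < q" using p q by (simp add: less_mult_imp_div_less mult.commute)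
  have "2 ^ j * (p div 2 ^ j) + 2 ^ j = 2 ^ j * Suc (p div 2 ^ j)" by simp
  also have "\<dots> \<le> M" unfolding q using pd by (intro mult_le_mono) auto
  finally show ?thesis by (simp add: minus_mod_eq_mult_div)
qed

lemma pos_less: "t < M div L \<Longrightarrow> q < L \<Longrightarrow> t * L + q < M"
proof -
  assume t: "t < M div L" and q: "q < L"
  have "t * L + q < Suc t * L" using q by simp
  also have "\<dots> \<le> M div L * L" using t by (intro mult_le_mono) auto
  also have "\<dots> = M" using LM by simp
  finally show ?thesis .
qed

end

section \<open>Correctness and cost of the sort\<close>

locale sorting = instance_params +
  fixes r0 :: "nat \<Rightarrow> real" and l0 :: "nat \<Rightarrow> nat"
begin

abbreviation key :: "nat \<Rightarrow> nat" where "key \<equiv> rank_key r0 (n - 1) M"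
abbreviation SAL :: "nat \<Rightarrow> nat \<Rightarrow> nat" where "SAL \<equiv> sort_level key"

lemma eval_before:
  assumes "s 0 = n" "s 25 = x" "s 26 = y"
  shows "eval w m r s e_before = of_bool (before r (n - 1) x y)"
  using assms B16 unfolding e_before_def before_def by (simp add: evs)

lemma before_key: "x < M \<Longrightarrow> y < M \<Longrightarrow> before r0 (n - 1) x y \<longleftrightarrow> key x < key y"
  by (rule before_rank_key)

definition sort_inv :: "nat \<Rightarrow> assertion" where
  "sort_inv lev l V r s \<longleftrightarrow> l = l0 \<and> r = r0 \<and> fresh {1..9} V \<and> base_env s \<and> s 6 = lev \<and>
     s 7 = 2 ^ lev \<and> (\<forall>p<M. V 10 (lev, p, 0, 0) = SAL lev p)"

text \<open>State of the binary search: \<open>2 * bt\<close> more elements are too many.\<close>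

definition search_inv :: "nat \<Rightarrow> nat \<Rightarrow> assertion" where
  "search_inv lev bit2 l V r s \<longleftrightarrow> sort_inv lev l V r s \<and> (\<forall>t<M div L.
     let p = t * L; d = p mod (2 * 2 ^ lev); base = p - d; a = V 11 (t, 0, 0, 0);
       C = split_cond (run_keys key (SAL lev) base) (run_keys key (SAL lev) (base + 2 ^ lev)) (2 ^ lev) d
     in C a \<and> \<not> C (a + bit2))"

lemma tri_search_par:
  assumes lev: "lev < Lam" and bt: "1 \<le> bt" "bt \<le> 2 ^ lev"
  shows "tri [search_par] (\<lambda>l V r s. search_inv lev (2 * bt) l V r s \<and> s 8 = bt)
    (length search_lets + 3) (M div L * (length search_lets + 2) + 2)
    (\<lambda>l V r s. search_inv lev bt l V r s \<and> s 8 = bt)"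
  unfolding search_par_def
proof (rule tri_par)
  fix mm r s assume pre: "search_inv lev (2 * bt) (lo mm) (vw mm) r s \<and> s 8 = bt"
  let ?h = "(2::nat) ^ lev"
  define ac where "ac t = vw mm 11 (t, 0, 0, 0)" for t
  define d where "d t = t * L mod (2 * ?h)" for t
  define base where "base t = t * L - d t" for t
  define C where "C t = split_cond (run_keys key (SAL lev) (base t)) (run_keys key (SAL lev) (base t + ?h)) ?h (d t)" for t
  have inv: "sort_inv lev (lo mm) (vw mm) r s" "s 8 = bt"
    and C: "\<And>t. t < M div L \<Longrightarrow> C t (ac t) \<and> \<not> C t (ac t + 2 * bt)"
    using pre by (auto simp: search_inv_def Let_def C_def base_def d_def ac_def)
  have be: "base_env s" and s67: "s 6 = lev" "s 7 = ?h" and r: "r = r0"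
    and SA: "\<And>p. p < M \<Longrightarrow> vw mm 10 (lev, p, 0, 0) = SAL lev p"
    using inv by (auto simp: sort_inv_def)
  note s = base_envD[OF be] s67 inv(2)
  have hM: "2 * ?h \<le> M" using pow_le_M[of "Suc lev"] lev by simp
  define idx where "idx t = (t, 0::nat, 0::nat, 0::nat)" for t :: nat
  define v where "v t = (if C t (ac t + bt) then ac t + bt else ac t)" for t
  have main: "let s' = assigns w mm r search_lets (s(20 := t)) in s' 3 = B \<and> inb (idx t) \<and>
       (eval w mm r s' (Var 20), eval w mm r s' (Const 0), eval w mm r s' (Const 0), eval w mm r s' (Const 0)) = idx t \<and>
       eval w mm r s' (EIte (EAnd (Less (Var 24) (Plus (Var 7) (Const 1))) (EAnd (Less (Var 24) (Plus (Var 22) (Const 1)))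
       (EOr (Less (Var 7) (Plus (Minus (Var 22) (Var 24)) (Const 1))) e_before)))
       (Var 24) e_left) = v t" if t: "t < M div L" for t
  proof -
    have p: "t * L < M" using pos_less[OF t, of 0] by simp
    have levM: "lev < M" using lev Lam_less by linarith
    have tM: "t < M" using t by (rule less_le_trans) simp
    have base: "base t + 2 * ?h \<le> M"
      using block_le[of "Suc lev" "t * L"] lev p by (simp add: base_def d_def)
    have dl: "d t < 2 * ?h" "d t \<le> t * L" by (simp_all add: d_def)
    have ac: "ac t \<le> ?h" using C[OF t] by (simp add: C_def split_cond_def)
    define x where "x = vw mm 10 (lev, base t + (ac t + bt) - Suc 0, 0, 0)"
    define y where "y = vw mm 10 (lev, base t + ?h + (d t - (ac t + bt)), 0, 0)"
    define s' where "s' = (s(20 := t, 21 := t * L, 22 := d t, 23 := base t, 24 := ac t + bt, 25 := x, 26 := y))"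
    have bnd: "t * L < 16 * B" "t < B" "?h + ?h < 16 * B" "ac t + bt < 16 * B" "lev < B"
      "base t + (ac t + bt) < 16 * B" "base t + (ac t + bt) - 1 < B" "base t + ?h < 16 * B"
      "base t + ?h + (d t - (ac t + bt)) < 16 * B" "base t + ?h + (d t - (ac t + bt)) < B"
      "ac t < 16 * B" "Suc ?h < 16 * B" "Suc (d t) < 16 * B" "Suc (d t - (ac t + bt)) < 16 * B"
      using p tM base dl ac bt hM levM BM by auto
    have "assigns w mm r search_lets (s(20 := t)) = s'"
      using bnd unfolding search_lets_def pos_lets_def e_left_def s'_def
      by (simp add: evs s mult_2[symmetric] d_def[symmetric] base_def[symmetric] ac_def[symmetric]
          x_def[symmetric] y_def[symmetric])
    \<comment> \<open>The values \<open>x\<close> and \<open>y\<close> matter only when the bounds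
      leave the test open, and then both positions lie inside their runs.\<close>
    moreover have "C t (ac t + bt) \<longleftrightarrow> ac t + bt \<le> ?h \<and> ac t + bt \<le> d t \<and>
       (?h \<le> d t - (ac t + bt) \<or> before r (n - 1) x y)"
    proof -
      have "before r (n - 1) x y \<longleftrightarrow> run_keys key (SAL lev) (base t) (ac t + bt - 1) <
          run_keys key (SAL lev) (base t + ?h) (d t - (ac t + bt))"
        if *: "ac t + bt \<le> ?h" "\<not> ?h \<le> d t - (ac t + bt)"
      proof -
        have le: "base t + (ac t + bt) - Suc 0 < M" "base t + ?h + (d t - (ac t + bt)) < M"
          using * base bt by linarith+
        have "base t + (ac t + bt) - Suc 0 = base t + (ac t + bt - 1)" using bt by simp
        then show ?thesis unfolding r x_def y_def SA[OF le(1)] SA[OF le(2)] run_keys_def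
          using sort_level_less[OF inj_rank_key, of lev Lam] le lev
          by (subst before_key) auto
      qed
      then show ?thesis using bt by (auto simp: C_def split_cond_def)
    qed
    moreover have "eval w mm r s' e_before = of_bool (before r (n - 1) x y)"
      by (rule eval_before) (simp_all add: s'_def s)
    note eb = this[unfolded s'_def]
    ultimately show ?thesis
      using bnd by (auto simp: eb evs e_left_def s'_def s idx_def v_def ac_def[symmetric] less_Suc_eq_le)
  qed
  have post: "search_inv lev bt (lo mm) ((vw mm)(11 := upd (vw mm 11) {..<M div L} idx v)) r s"
  proof -
    have "upd (vw mm 11) {..<M div L} idx v (t, 0, 0, 0) = v t" if "t < M div L" for t
      by (rule upd_hit[of t]) (use that in \<open>auto simp: idx_def\<close>)
    moreover have "C t (v t) \<and> \<not> C t (v t + bt)" if "t < M div L" for t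
      using C[OF that] by (auto simp: v_def mult_2 add.assoc)
    ultimately show ?thesis using inv
      by (auto simp: search_inv_def sort_inv_def Let_def C_def base_def d_def)
  qed
  show "\<exists>idx v. eval w mm r s (Var 5) = M div L \<and> (\<forall>i<M div L.
      let s' = assigns w mm r search_lets (s(20 := i)) in s' 3 = B \<and> inb (idx i) \<and>
       (eval w mm r s' (Var 20), eval w mm r s' (Const 0), eval w mm r s' (Const 0), eval w mm r s' (Const 0)) = idx i \<and>
       eval w mm r s' (EIte (EAnd (Less (Var 24) (Plus (Var 7) (Const 1))) (EAnd (Less (Var 24) (Plus (Var 22) (Const 1)))
       (EOr (Less (Var 7) (Plus (Minus (Var 22) (Var 24)) (Const 1))) e_before)))
       (Var 24) e_left) = v i) \<and>
     search_inv lev bt (lo mm) ((vw mm)(11 := upd (vw mm 11) {..<M div L} idx v)) r s \<and> s 8 = bt"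
    using main post inv s by (intro exI[of _ idx] exI[of _ v]) (simp add: evs)
qed auto

definition LC :: "nat \<Rightarrow> nat \<Rightarrow> nat" where
  "LC lev p = lcount key (SAL lev) (2 ^ lev) (p - p mod (2 * 2 ^ lev)) (p mod (2 * 2 ^ lev))"

text \<open>\<open>done\<close> tells whether output \<open>q\<close> of every thread has been
  written but not yet counted. At the start of a block the count in array 11 is merely bounded,
  since \<open>merge_lets\<close> replaces it by 0 there.\<close>

definition merge_inv :: "nat \<Rightarrow> nat \<Rightarrow> bool \<Rightarrow> assertion" where
  "merge_inv lev q done l V r s \<longleftrightarrow> sort_inv lev l V r s \<and> s 8 = q \<and>
     (\<forall>t<M div L. \<forall>q'. q' < q \<or> q' = q \<and> done \<longrightarrow>
        V 10 (Suc lev, t * L + q', 0, 0) = SAL (Suc lev) (t * L + q')) \<and>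
     (\<forall>t<M div L. V 11 (t, 0, 0, 0) \<le> M \<and>
        ((t * L + q) mod (2 * 2 ^ lev) \<noteq> 0 \<longrightarrow> V 11 (t, 0, 0, 0) = LC lev (t * L + q)))"

text \<open>The body of a loop ends in a single store, so writing the output and advancing the count
  are separate loops; both rebuild this same environment.\<close>

lemma merge_env:
  assumes lev: "lev < Lam" and q: "q < L" and inv: "merge_inv lev q b (lo mm) (vw mm) r s"
    and t: "t < M div L"
  defines "p \<equiv> t * L + q" and "h \<equiv> (2::nat) ^ lev"
  defines "d \<equiv> p mod (2 * h)"
  defines "base \<equiv> p - d" and "a \<equiv> LC lev p"
  defines "T \<equiv> take_left (run_keys key (SAL lev) base) (run_keys key (SAL lev) (base + h)) h a (d - a)"
  shows "\<exists>x z. assigns w mm r merge_lets (s(20 := t)) =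
      s(20 := t, 21 := p, 22 := d, 23 := base, 24 := a, 25 := x, 26 := z, 27 := of_bool T) \<and>
      x < M \<and> z < M \<and> SAL (Suc lev) p = (if T then x else z)"
    and "a \<le> h" "d < 2 * h" "2 * h \<le> M" "p < M"
    "a + of_bool T = lcount key (SAL lev) h base (Suc d)"
proof -
  have be: "base_env s" and s67: "s 6 = lev" "s 7 = h" "s 8 = q" and r: "r = r0"
    and SA: "\<And>p. p < M \<Longrightarrow> vw mm 10 (lev, p, 0, 0) = SAL lev p"
    using inv by (auto simp: sort_inv_def merge_inv_def h_def)
  note s = base_envD[OF be] s67
  show hM: "2 * h \<le> M" using pow_le_M[of "Suc lev"] lev by (simp add: h_def)
  have h1: "1 \<le> h" by (simp add: h_def)
  show p: "p < M" using pos_less[OF t q] by (simp add: p_def)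
  have tM: "t < M" using t by (rule less_le_trans) simp
  have levM: "lev < M" using lev Lam_less by linarith
  have d2: "d = p mod 2 ^ Suc lev" by (simp add: d_def h_def)
  have base: "base + 2 * h \<le> M"
    using block_le[of "Suc lev" p] lev p by (simp add: base_def d_def h_def)
  show dl: "d < 2 * h" using h1 by (simp add: d_def)
  have dvd: "2 * h dvd base" by (simp add: base_def d_def dvd_minus_mod)
  have inj: "inj_on key {..<M}" by (rule inj_rank_key)
  note rp = run_props[OF sort_level_sorted[OF inj, of lev] inj, of base, folded h_def, OF dvd base]
  have a_def': "a = left_count (run_keys key (SAL lev) base) (run_keys key (SAL lev) (base + h)) h d"
    by (simp add: a_def LC_def lcount_def base_def d_def h_def)
  have al: "a \<le> h" "d - a \<le> h"
    using left_count_le[of h _ _ d, OF rp(1-3)] dl unfolding a_def' by auto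
  show "a \<le> h" by (rule al(1))
  show "a + of_bool T = lcount key (SAL lev) h base (Suc d)"
    unfolding lcount_def T_def by (simp add: a_def')
  define x where "x = SAL lev (base + a)"
  define z where "z = vw mm 10 (lev, base + h + (d - a), 0, 0) mod M"
  have xM: "x < M" using sort_level_less[OF inj, of lev "base + a"] lev base al h1 by (simp add: x_def)
  have zM: "z < M" by (simp add: z_def)
  have z: "z = SAL lev (base + h + (d - a))" if "d - a < h"
    using sort_level_less[OF inj, of lev "base + h + (d - a)"] lev base that
    by (simp add: z_def SA)
  have bef: "before r (n - 1) x z \<longleftrightarrow>
      run_keys key (SAL lev) base a < run_keys key (SAL lev) (base + h) (d - a)" if "d - a < h"
    unfolding r run_keys_def z[OF that, symmetric] x_def[symmetric] using xM zM by (rule before_key)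
  have T: "T \<longleftrightarrow> a < h \<and> (h \<le> d - a \<or> before r (n - 1) x z)"
    unfolding T_def take_left_def using bef by (cases "h \<le> d - a") auto
  have AC: "(if d \<noteq> 0 then vw mm 11 (t, 0, 0, 0) else 0) = a"
    using inv t by (auto simp: merge_inv_def p_def a_def d_def h_def LC_def lcount_def)
  have ACM: "vw mm 11 (t, 0, 0, 0) \<le> M" using inv t by (auto simp: merge_inv_def)
  have bnd: "t * L < 16 * B" "t * L + q < 16 * B" "t < B" "h + h < 16 * B" "lev < B"
      "base + a < B" "base + a < 16 * B" "base + h < 16 * B" "base + a < M"
      "base + h + (d - a) < 16 * B" "base + h + (d - a) < B" "vw mm 11 (t, 0, 0, 0) < 16 * B"
      "Suc h < 16 * B" "Suc (d - a) < 16 * B" "Suc d < 16 * B" "0 < B"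
    using p tM base dl al hM h1 levM BM ACM unfolding p_def by auto
  define s6 where "s6 = s(20 := t, 21 := p, 22 := d, 23 := base, 24 := a, 25 := x, 26 := z)"
  have eb: "eval w mm r s6 e_before = of_bool (before r (n - 1) x z)"
    by (rule eval_before) (simp_all add: s6_def s)
  have e24: "eval w mm r (s(20 := t, 21 := p, 22 := d, 23 := base))
      (EIte (Var 22) e_left (Const 0)) = a"
    using bnd AC unfolding e_left_def by (auto simp: evs s split: if_splits)
  have e1: "eval w mm r (s(20 := t)) (Plus (Times (Var 20) (Var 4)) (Var 8)) = p"
    using bnd by (simp add: evs s p_def)
  have e2: "eval w mm r (s(20 := t, 21 := p)) (Mod (Var 21) (Plus (Var 7) (Var 7))) = d"
    using bnd by (simp add: evs s d_def mult_2)
  have e3: "eval w mm r (s(20 := t, 21 := p, 22 := d)) (Minus (Var 21) (Var 22)) = base"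
    by (simp add: evs base_def)
  have e5: "eval w mm r (s(20 := t, 21 := p, 22 := d, 23 := base, 24 := a))
      (Mod (LD 10 (Var 6) (Plus (Var 23) (Var 24)) (Const 0) (Const 0)) (Var 1)) = x"
    using bnd xM SA[OF bnd(9)] by (simp add: evs s x_def)
  have e6: "eval w mm r (s(20 := t, 21 := p, 22 := d, 23 := base, 24 := a, 25 := x))
      (Mod (LD 10 (Var 6) (Plus (Plus (Var 23) (Var 7)) (Minus (Var 22) (Var 24))) (Const 0) (Const 0)) (Var 1)) = z"
    using bnd by (simp add: evs s z_def)
  have e7: "eval w mm r s6 (EAnd (Less (Var 24) (Var 7))
      (EOr (Less (Var 7) (Plus (Minus (Var 22) (Var 24)) (Const 1))) e_before)) = of_bool T"
    unfolding eval_EAnd eval_EOr eb using bnd unfolding s6_def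
    by (simp add: evs s T less_Suc_eq_le)
  have "assigns w mm r merge_lets (s(20 := t)) =
      s(20 := t, 21 := p, 22 := d, 23 := base, 24 := a, 25 := x, 26 := z, 27 := of_bool T)"
    unfolding merge_lets_def pos_lets_def append.simps assigns.simps fst_conv snd_conv
      e1 e2 e3 e24 e5 e6 s6_def[symmetric] e7 ..
  moreover have "SAL (Suc lev) p = (if T then x else z)"
  proof -
    \<comment> \<open>The right run is never taken from past its end: \<open>d - a = h\<close> would
      force \<open>a < h\<close> and then \<open>T\<close>.\<close>
    have "d - a < h" if "\<not> T"
    proof (rule ccontr)
      assume "\<not> d - a < h"
      then have "d - a = h" using al by simp
      then have "a < h" using dl al by simp
      then show False using T \<open>d - a = h\<close> that by simp
    qed
    then show ?thesis
      unfolding sort_level.simps merge_runs_def Let_def h_def[symmetric] d_def[symmetric] base_def[symmetric]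
      using z by (auto simp: T_def x_def a_def LC_def base_def d_def h_def)
  qed
  ultimately show "\<exists>x z. assigns w mm r merge_lets (s(20 := t)) =
      s(20 := t, 21 := p, 22 := d, 23 := base, 24 := a, 25 := x, 26 := z, 27 := of_bool T) \<and>
      x < M \<and> z < M \<and> SAL (Suc lev) p = (if T then x else z)"
    using xM zM by blast
qed

lemma tri_merge_par:
  assumes lev: "lev < Lam" and q: "q < L"
  shows "tri [merge_par] (merge_inv lev q False) (length merge_lets + 3)
    (M div L * (length merge_lets + 2) + 2) (merge_inv lev q True)"
  unfolding merge_par_def
proof (rule tri_par)
  fix mm r s assume inv: "merge_inv lev q False (lo mm) (vw mm) r s"
  then have be: "base_env s" and s67: "s 6 = lev"
    by (auto simp: merge_inv_def sort_inv_def)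
  note s = base_envD[OF be] s67
  have levM: "lev < M" using lev Lam_less by linarith
  define idx where "idx t = (Suc lev, t * L + q, 0::nat, 0::nat)" for t :: nat
  define v where "v t = SAL (Suc lev) (t * L + q)" for t
  have main: "let s' = assigns w mm r merge_lets (s(20 := t)) in s' 3 = B \<and> inb (idx t) \<and>
       (eval w mm r s' (Plus (Var 6) (Const 1)), eval w mm r s' (Var 21), eval w mm r s' (Const 0), eval w mm r s' (Const 0)) = idx t \<and>
       eval w mm r s' (EIte (Var 27) (Var 25) (Var 26)) = v t" if t: "t < M div L" for t
  proof -
    note m = merge_env[OF lev q inv t]
    from m(1) obtain x z T base a d where "assigns w mm r merge_lets (s(20 := t)) =
      s(20 := t, 21 := t * L + q, 22 := d, 23 := base, 24 := a, 25 := x, 26 := z, 27 := of_bool T)"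
      "x < M" "z < M" "SAL (Suc lev) (t * L + q) = (if T then x else z)" by blast
    moreover from this have "x < 16 * B" "z < 16 * B" "Suc lev < 16 * B" "Suc lev < B"
      "t * L + q < B" "0 < B" using levM m(5) BM by linarith+
    ultimately show ?thesis by (simp add: evs s idx_def v_def)
  qed
  have "inj_on idx {..<M div L}" by (auto simp: idx_def inj_on_def)
  then have u: "upd F {..<M div L} idx v (Suc lev, t * L + q, 0, 0) = v t" if "t < M div L" for F t
    using upd_hit_inj[of t "{..<M div L}" idx F v] that by (simp add: idx_def)
  \<comment> \<open>Positions written at different \<open>q\<close> differ modulo \<open>L\<close>,
    so earlier outputs are untouched.\<close>
  have u': "upd F {..<M div L} idx v (Suc lev, t * L + q', 0, 0) = F (Suc lev, t * L + q', 0, 0)"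
    if "q' < q" for F t q'
  proof (rule upd_miss)
    fix i
    have "(t * L + q') mod L = q'" "(i * L + q) mod L = q" using q that by auto
    then show "idx i \<noteq> (Suc lev, t * L + q', 0, 0)" using that unfolding idx_def by (metis nat_neq_iff prod.inject)
  qed
  have u'': "upd F {..<M div L} idx v (lev, p, 0, 0) = F (lev, p, 0, 0)" for F p
    by (rule upd_miss) (simp add: idx_def)
  have post: "merge_inv lev q True (lo mm) ((vw mm)(10 := upd (vw mm 10) {..<M div L} idx v)) r s"
    using inv unfolding merge_inv_def sort_inv_def by (auto simp: u u' u'' v_def)
  show "\<exists>idx v. eval w mm r s (Var 5) = M div L \<and> (\<forall>i<M div L.
      let s' = assigns w mm r merge_lets (s(20 := i)) in s' 3 = B \<and> inb (idx i) \<and>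
       (eval w mm r s' (Plus (Var 6) (Const 1)), eval w mm r s' (Var 21), eval w mm r s' (Const 0), eval w mm r s' (Const 0)) = idx i \<and>
       eval w mm r s' (EIte (Var 27) (Var 25) (Var 26)) = v i) \<and>
     merge_inv lev q True (lo mm) ((vw mm)(10 := upd (vw mm 10) {..<M div L} idx v)) r s"
    using main post s by (intro exI[of _ idx] exI[of _ v]) (simp add: evs)
qed auto

text \<open>The postcondition speaks about \<open>s(8 := Suc q)\<close> in anticipation of the
  increment that follows the loop.\<close>

lemma tri_count_par:
  assumes lev: "lev < Lam" and q: "q < L"
  shows "tri [count_par] (merge_inv lev q True) (length merge_lets + 3)
    (M div L * (length merge_lets + 2) + 2)
    (\<lambda>l V r s. s 8 = q \<and> merge_inv lev (Suc q) False l V r (s(8 := Suc q)))"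
  unfolding count_par_def
proof (rule tri_par)
  fix mm r s assume inv: "merge_inv lev q True (lo mm) (vw mm) r s"
  then have be: "base_env s" and s8: "s 8 = q"
    by (auto simp: merge_inv_def sort_inv_def)
  note s = base_envD[OF be] s8
  let ?h = "(2::nat) ^ lev"
  define idx where "idx t = (t, 0::nat, 0::nat, 0::nat)" for t :: nat
  define v where "v t = lcount key (SAL lev) ?h (t * L + q - (t * L + q) mod (2 * ?h)) (Suc ((t * L + q) mod (2 * ?h)))" for t
  have vM: "v t \<le> M" if t: "t < M div L" for t
  proof -
    note m = merge_env[OF lev q inv t]
    have "v t \<le> ?h + 1" using m(2) m(6) unfolding v_def
      by (metis (no_types, lifting) add_mono of_bool_eq(1) of_bool_eq(2) of_bool_def le_add1 le_refl zero_le_one)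
    then show ?thesis using m(4) one_le_power[of "2::nat" lev] by linarith
  qed
  have main: "let s' = assigns w mm r merge_lets (s(20 := t)) in s' 3 = B \<and> inb (idx t) \<and>
       (eval w mm r s' (Var 20), eval w mm r s' (Const 0), eval w mm r s' (Const 0), eval w mm r s' (Const 0)) = idx t \<and>
       eval w mm r s' (Plus (Var 24) (Var 27)) = v t" if t: "t < M div L" for t
  proof -
    note m = merge_env[OF lev q inv t]
    from m(1) obtain x z where e: "assigns w mm r merge_lets (s(20 := t)) =
      s(20 := t, 21 := t * L + q, 22 := (t * L + q) mod (2 * ?h), 23 := t * L + q - (t * L + q) mod (2 * ?h),
        24 := LC lev (t * L + q), 25 := x, 26 := z,
        27 := of_bool (take_left (run_keys key (SAL lev) (t * L + q - (t * L + q) mod (2 * ?h)))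
          (run_keys key (SAL lev) (t * L + q - (t * L + q) mod (2 * ?h) + ?h)) ?h
          (LC lev (t * L + q)) ((t * L + q) mod (2 * ?h) - LC lev (t * L + q))))" by blast
    have "t < M" using t by (rule less_le_trans) simp
    moreover have "0 < M" by simp
    ultimately have "v t < 16 * B" "t < B" "0 < B" using vM[OF t] BM by linarith+
    then show ?thesis unfolding e using m(6) unfolding v_def[symmetric]
      by (simp add: evs s idx_def)
  qed
  have u: "upd F {..<M div L} idx v (t, 0, 0, 0) = v t" if "t < M div L" for F t
    by (rule upd_hit[of t]) (use that in \<open>auto simp: idx_def\<close>)
  \<comment> \<open>Within a block the offset advances by one with the position; at the first
    position of a block nothing is claimed.\<close>
  have nxt: "LC lev (t * L + Suc q) = v t" if "(t * L + Suc q) mod (2 * ?h) \<noteq> 0" for t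
  proof -
    have "Suc (t * L + q) mod (2 * ?h) = Suc ((t * L + q) mod (2 * ?h))"
      using that by (auto simp: mod_Suc split: if_splits)
    then show ?thesis by (simp add: LC_def v_def)
  qed
  have "merge_inv lev (Suc q) False (lo mm) ((vw mm)(11 := upd (vw mm 11) {..<M div L} idx v)) r (s(8 := Suc q))"
    using inv vM nxt unfolding merge_inv_def sort_inv_def by (auto simp: u less_Suc_eq)
  then show "\<exists>idx v. eval w mm r s (Var 5) = M div L \<and> (\<forall>i<M div L.
      let s' = assigns w mm r merge_lets (s(20 := i)) in s' 3 = B \<and> inb (idx i) \<and>
       (eval w mm r s' (Var 20), eval w mm r s' (Const 0), eval w mm r s' (Const 0), eval w mm r s' (Const 0)) = idx i \<and>
       eval w mm r s' (Plus (Var 24) (Var 27)) = v i) \<and>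
     s 8 = q \<and> merge_inv lev (Suc q) False (lo mm) ((vw mm)(11 := upd (vw mm 11) {..<M div L} idx v)) r (s(8 := Suc q))"
    using main s by (intro exI[of _ idx] exI[of _ v]) (simp add: evs)
qed auto

end

context sorting
begin

lemma search_invD: "search_inv lev bt2 l V r s \<Longrightarrow> sort_inv lev l V r s"
  by (simp add: search_inv_def)

lemma sort_inv_env: "sort_inv lev l V r (s(8 := x)) = sort_inv lev l V r s"
  by (simp add: sort_inv_def)

lemma search_inv_env: "search_inv lev b l V r (s(8 := x)) = search_inv lev b l V r s"
  by (simp add: search_inv_def sort_inv_env)

lemma search_start:
  assumes "sort_inv lev l V r s" "\<forall>t<M div L. V 11 (t, 0, 0, 0) = 0"
  shows "search_inv lev (2 * 2 ^ lev) l V r s"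
  using assms by (auto simp: search_inv_def Let_def split_cond_def)

lemma search_done:
  assumes lev: "lev < Lam" and inv: "search_inv lev 1 l V r s"
  shows "merge_inv lev 0 False l V r (s(8 := 0))"
proof -
  have "V 11 (t, 0, 0, 0) \<le> M \<and> V 11 (t, 0, 0, 0) = LC lev (t * L)" if t: "t < M div L" for t
  proof -
    let ?h = "(2::nat) ^ lev" and ?d = "t * L mod (2 * 2 ^ lev)"
    let ?base = "t * L - ?d"
    have inj: "inj_on key {..<M}" by (rule inj_rank_key)
    have p: "t * L < M" using pos_less[OF t, of 0] by simp
    have base: "?base + 2 * ?h \<le> M" using block_le[of "Suc lev" "t * L"] lev p by simp
    have dvd: "2 * ?h dvd ?base" by (simp add: dvd_minus_mod)
    note rp = run_props[OF sort_level_sorted[OF inj, of lev] inj dvd base]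
    have c: "split_cond (run_keys key (SAL lev) ?base) (run_keys key (SAL lev) (?base + ?h)) ?h ?d (V 11 (t, 0, 0, 0))"
      "\<not> split_cond (run_keys key (SAL lev) ?base) (run_keys key (SAL lev) (?base + ?h)) ?h ?d (V 11 (t, 0, 0, 0) + 1)"
      using inv t by (auto simp: search_inv_def Let_def)
    have dl: "?d \<le> 2 * ?h" by (simp add: less_imp_le)
    have "V 11 (t, 0, 0, 0) = LC lev (t * L)"
      unfolding LC_def lcount_def by (rule left_count_eqI[OF rp(1-3) dl c])
    moreover have "V 11 (t, 0, 0, 0) \<le> ?h" using c(1) by (simp add: split_cond_def)
    then have "V 11 (t, 0, 0, 0) \<le> M" using lev by (intro le_trans[OF _ pow_le_M[of lev]]) auto
    ultimately show ?thesis by simp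
  qed
  note V = this
  have 1: "V 11 (t, 0, 0, 0) \<le> M" if "t < M div L" for t using V[OF that] by blast
  have 2: "V 11 (t, 0, 0, 0) = LC lev (t * L)" if "t < M div L" for t using V[OF that] by blast
  show ?thesis unfolding merge_inv_def sort_inv_env using search_invD[OF inv] 1 2 by simp
qed

lemma tri_search_loop:
  assumes lev: "lev < Lam"
  shows "tri [WhileNZ (Var 8) [search_par, Assign 8 (Div (Var 8) (Const 2))]]
    (\<lambda>l V r s. search_inv lev (2 * 2 ^ lev) l V r s \<and> s 8 = 2 ^ lev)
    ((lev + 1) * Suc (9 + (1 + 0)) + 1) ((lev + 1) * Suc ((M div L * 8 + 2) + (1 + 0)) + 1)
    (\<lambda>l V r s. search_inv lev 1 l V r s)"
proof -
  \<comment> \<open>\<open>Var 8\<close> runs through \<open>2 ^ lev, ..., 2, 1, 0\<close>, so there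
    are \<open>lev + 1\<close> searches; the gap in the invariant is twice the next step and ends at
    1.\<close>
  define I where "I k l V r s \<longleftrightarrow> search_inv lev (2 ^ (Suc lev - k)) l V r s \<and> s 8 = 2 ^ lev div 2 ^ k" for k l V r s
  have len: "length search_lets = 6" by (simp add: search_lets_def pos_lets_def)
  have body: "tri [search_par, Assign 8 (Div (Var 8) (Const 2))] (I k) (9 + (1 + 0))
      ((M div L * 8 + 2) + (1 + 0)) (I (Suc k))" if "k < lev + 1" for k
  proof -
    have k: "k \<le> lev" using that by simp
    then have 1: "(2::nat) ^ lev div 2 ^ k = 2 ^ (lev - k)" by (simp add: power_diff)
    have 2: "(2::nat) ^ (Suc lev - k) = 2 * 2 ^ (lev - k)" using k by (simp add: Suc_diff_le)
    have le: "(2::nat) ^ (lev - k) \<le> 2 ^ lev" by (simp add: power_increasing)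
    have "tri [search_par] (I k) 9 (M div L * 8 + 2)
      (\<lambda>l V r s. search_inv lev (2 ^ (lev - k)) l V r s \<and> s 8 = 2 ^ (lev - k))"
      by (rule tri_conseq[OF tri_search_par[OF lev _ le]]) (auto simp: len I_def 1 2)
    moreover have "tri [Assign 8 (Div (Var 8) (Const 2))]
      (\<lambda>l V r s. search_inv lev (2 ^ (lev - k)) l V r s \<and> s 8 = 2 ^ (lev - k)) 1 1 (I (Suc k))"
    proof (rule tri_Assign)
      fix m r s assume "search_inv lev (2 ^ (lev - k)) (lo m) (vw m) r s \<and> s 8 = 2 ^ (lev - k)"
      moreover have "2 ^ (lev - k) div 2 = (2::nat) ^ lev div 2 ^ Suc k"
        unfolding 1[symmetric] by (simp only: power_Suc2 div_mult2_eq)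
      ultimately show "I (Suc k) (lo m) (vw m) r (s(8 := eval w m r s (Div (Var 8) (Const 2))))"
        by (simp add: I_def evs search_inv_env)
    qed
    ultimately show ?thesis using tri_Cons tri_Cons[OF _ tri_Nil] by blast
  qed
  have "tri [WhileNZ (Var 8) [search_par, Assign 8 (Div (Var 8) (Const 2))]] (I 0)
    ((lev + 1) * Suc (9 + (1 + 0)) + 1) ((lev + 1) * Suc ((M div L * 8 + 2) + (1 + 0)) + 1) (I (lev + 1))"
  proof (rule tri_while_const[where I = I, OF body])
    fix k m r s assume "k \<le> lev + 1" "I k (lo m) (vw m) r s"
    moreover have "(2::nat) ^ lev div 2 ^ k \<noteq> 0 \<longleftrightarrow> k < lev + 1"
      using power_increasing_iff[of "2::nat" k lev] by (auto simp: div_eq_0_iff not_less)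
    ultimately show "eval w m r s (Var 8) \<noteq> 0 \<longleftrightarrow> k < lev + 1" by (simp add: I_def evs)
  qed
  then show ?thesis by (rule tri_conseq) (auto simp: I_def)
qed

lemma tri_merge_loop:
  assumes lev: "lev < Lam"
  shows "tri [WhileNZ (Less (Var 8) (Var 4)) [merge_par, count_par, Inc 8]]
    (merge_inv lev 0 False) (L * Suc (10 + (10 + (1 + 0))) + 1)
    (L * Suc ((M div L * 9 + 2) + ((M div L * 9 + 2) + (1 + 0))) + 1) (merge_inv lev L False)"
proof (rule tri_while_const)
  have len: "length merge_lets = 7" by (simp add: merge_lets_def pos_lets_def)
  fix q assume q: "q < L"
  have "tri [merge_par] (merge_inv lev q False) 10 (M div L * 9 + 2) (merge_inv lev q True)"
    using tri_merge_par[OF lev q] by (simp add: len)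
  moreover have "tri [count_par] (merge_inv lev q True) 10 (M div L * 9 + 2)
    (\<lambda>l V r s. s 8 = q \<and> merge_inv lev (Suc q) False l V r (s(8 := Suc q)))"
    using tri_count_par[OF lev q] by (simp add: len)
  moreover have "Suc q < 16 * B" using q LM BM by linarith
  then have "tri [Inc 8] (\<lambda>l V r s. s 8 = q \<and> merge_inv lev (Suc q) False l V r (s(8 := Suc q))) 1 1
    (merge_inv lev (Suc q) False)"
    by (intro tri_Assign) (auto simp: evs)
  ultimately show "tri [merge_par, count_par, Inc 8] (merge_inv lev q False) (10 + (10 + (1 + 0)))
    ((M div L * 9 + 2) + ((M div L * 9 + 2) + (1 + 0))) (merge_inv lev (Suc q) False)"
    using tri_Cons[OF _ tri_Cons[OF _ tri_Cons[OF _ tri_Nil]]] by blast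
next
  fix q m r s assume "merge_inv lev q False (lo m) (vw m) r s"
  then have "s 8 = q" "s 4 = L" by (auto simp: merge_inv_def sort_inv_def base_env_def)
  then show "eval w m r s (Less (Var 8) (Var 4)) \<noteq> 0 \<longleftrightarrow> q < L" by (simp add: evs)
qed

lemma merge_done:
  assumes "merge_inv lev L False l V r s" "p < M"
  shows "V 10 (Suc lev, p, 0, 0) = SAL (Suc lev) p"
proof -
  have "p div L < M div L"
    using assms(2) LM by (metis less_mult_imp_div_less)
  moreover have "p mod L < L" by simp
  ultimately have "V 10 (Suc lev, p div L * L + p mod L, 0, 0) = SAL (Suc lev) (p div L * L + p mod L)"
    using assms(1) unfolding merge_inv_def by blast
  then show ?thesis by (simp only: div_mult_mod_eq)
qed

lemma tri_sort_body:
  assumes lev: "lev < Lam"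
  shows "tri sort_body (sort_inv lev) (70 * (Lam + 1)) (70 * M) (sort_inv (Suc lev))"
proof -
  have TM: "M div L \<le> M" by simp
  have zero: "tri [Par (Var 5) [] 11 (Var 20) (Const 0) (Const 0) (Const 0) (Const 0)] (sort_inv lev) (length ([]::(nat \<times> exp) list) + 3)
     (M div L * (length ([]::(nat \<times> exp) list) + 2) + 2)
     (\<lambda>l V r s. sort_inv lev l V r s \<and> (\<forall>t<M div L. V 11 (t, 0, 0, 0) = 0))"
  proof (rule tri_par)
    fix m r s assume inv: "sort_inv lev (lo m) (vw m) r s"
    then have be: "base_env s" by (simp add: sort_inv_def)
    note s = base_envD[OF be]
    let ?idx = "\<lambda>t. (t, 0::nat, 0::nat, 0::nat)"
    have "upd (vw m 11) {..<M div L} ?idx (\<lambda>_. 0) (t, 0, 0, 0) = 0" if "t < M div L" for t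
      by (rule upd_hit[of t]) (use that in auto)
    moreover have "i < B" if "i < M div L" for i
      using that TM BM by linarith
    ultimately show "\<exists>idx v. eval w m r s (Var 5) = M div L \<and> (\<forall>i<M div L.
      let s' = assigns w m r [] (s(20 := i)) in s' 3 = B \<and> inb (idx i) \<and>
       (eval w m r s' (Var 20), eval w m r s' (Const 0), eval w m r s' (Const 0), eval w m r s' (Const 0)) = idx i \<and>
       eval w m r s' (Const 0) = v i) \<and> sort_inv lev (lo m) ((vw m)(11 := upd (vw m 11) {..<M div L} idx v)) r s \<and>
       (\<forall>t<M div L. ((vw m)(11 := upd (vw m 11) {..<M div L} idx v)) 11 (t, 0, 0, 0) = 0)"
      using inv s B16 by (intro exI[of _ ?idx] exI[of _ "\<lambda>_. 0"]) (auto simp: evs sort_inv_def)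
  qed auto
  have a1: "tri [Assign 8 (Var 7)] (\<lambda>l V r s. sort_inv lev l V r s \<and> (\<forall>t<M div L. V 11 (t, 0, 0, 0) = 0)) 1 1
    (\<lambda>l V r s. search_inv lev (2 * 2 ^ lev) l V r s \<and> s 8 = 2 ^ lev)"
  proof (rule tri_Assign)
    fix m r s assume a: "sort_inv lev (lo m) (vw m) r s \<and> (\<forall>t<M div L. vw m 11 (t, 0, 0, 0) = 0)"
    then have "s 7 = 2 ^ lev" by (simp add: sort_inv_def)
    then show "search_inv lev (2 * 2 ^ lev) (lo m) (vw m) r (s(8 := eval w m r s (Var 7))) \<and>
      (s(8 := eval w m r s (Var 7))) 8 = 2 ^ lev"
      using search_start a by (simp add: evs search_inv_env)
  qed
  have a2: "tri [Assign 8 (Const 0)] (\<lambda>l V r s. search_inv lev 1 l V r s) 1 1 (merge_inv lev 0 False)"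
    by (rule tri_Assign) (simp add: evs search_done[OF lev])
  have a3: "tri [Dbl 7] (merge_inv lev L False) 1 1
    (\<lambda>l V r s. l = l0 \<and> r = r0 \<and> fresh {1..9} V \<and> base_env s \<and> s 6 = lev \<and>
     s 7 = 2 ^ Suc lev \<and> (\<forall>p<M. V 10 (Suc lev, p, 0, 0) = SAL (Suc lev) p))"
  proof (rule tri_Assign)
    fix m r s assume a: "merge_inv lev L False (lo m) (vw m) r s"
    have "2 * 2 ^ lev \<le> M" "0 < M" using pow_le_M[of "Suc lev"] lev by simp_all
    then have "(2::nat) ^ lev + 2 ^ lev < 16 * B" using BM by linarith
    then show "lo m = l0 \<and> r = r0 \<and> fresh {1..9} (vw m) \<and> base_env (s(7 := eval w m r s (Plus (Var 7) (Var 7)))) \<and>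
      (s(7 := eval w m r s (Plus (Var 7) (Var 7)))) 6 = lev \<and>
      (s(7 := eval w m r s (Plus (Var 7) (Var 7)))) 7 = 2 ^ Suc lev \<and>
      (\<forall>p<M. vw m 10 (Suc lev, p, 0, 0) = SAL (Suc lev) p)"
      using a merge_done[OF a] by (auto simp: merge_inv_def sort_inv_def evs simp del: sort_level.simps)
  qed
  have "lev < M" using lev Lam_less by linarith
  then have "Suc lev < 16 * B" using BM by linarith
  then have a4: "tri [Inc 6] (\<lambda>l V r s. l = l0 \<and> r = r0 \<and> fresh {1..9} V \<and> base_env s \<and> s 6 = lev \<and>
     s 7 = 2 ^ Suc lev \<and> (\<forall>p<M. V 10 (Suc lev, p, 0, 0) = SAL (Suc lev) p)) 1 1 (sort_inv (Suc lev))"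
    by (intro tri_Assign) (auto simp: evs sort_inv_def simp del: sort_level.simps)
  \<comment> \<open>The reason for the size of \<open>L\<close>: the binary searches of all threads
    cost \<open>(lev + 1) * (M div L)\<close> up to a constant, which is linear in \<open>M\<close>
    because \<open>L\<close> exceeds \<open>Lam\<close>.\<close>
  have dK: "(lev + 1) * (M div L) \<le> M"
  proof -
    have "(lev + 1) * (M div L) \<le> L * (M div L)" using lev LL(1) by (intro mult_le_mono) auto
    then show ?thesis using LM by (simp add: mult.commute)
  qed
  have LK: "L * (M div L) = M" using LM by (simp add: mult.commute)
  have lM: "lev + 1 \<le> M" using lev Lam_less by linarith
  show ?thesis unfolding sort_body_def
  proof (rule tri_conseq[OF tri_Cons[OF zero tri_Cons[OF a1 tri_Cons[OF tri_search_loop[OF lev]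
      tri_Cons[OF a2 tri_Cons[OF tri_merge_loop[OF lev] tri_Cons[OF a3 tri_Cons[OF a4 tri_Nil]]]]]]]])
    show "length ([]::(nat \<times> exp) list) + 3 + (1 + ((lev + 1) * Suc (9 + (1 + 0)) + 1 + (1 + (L * Suc (10 + (10 + (1 + 0))) + 1 + (1 + (1 + 0))))))
      \<le> 70 * (Lam + 1)"
      using LL(2) lev by simp
    have "(lev + 1) * Suc (M div L * 8 + 2 + (1 + 0)) = 8 * ((lev + 1) * (M div L)) + 4 * (lev + 1)"
      by (simp add: algebra_simps)
    moreover have "L * Suc (M div L * 9 + 2 + (M div L * 9 + 2 + (1 + 0))) = 18 * (L * (M div L)) + 6 * L"
      by (simp add: algebra_simps)
    moreover have "1 \<le> M" by simp
    moreover have "y * (0 + 2) + 2 + (1 + (8 * x + 4 * k + 1 + (1 + (18 * M + 6 * l + 1 + (1 + (1 + 0)))))) \<le> 70 * M"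
      if "x \<le> M" "y \<le> M" "k \<le> M" "l \<le> M" "1 \<le> M" for x y k l M :: nat using that by simp
    ultimately show "M div L * (length ([]::(nat \<times> exp) list) + 2) + 2 + (1 + ((lev + 1) * Suc (M div L * 8 + 2 + (1 + 0)) + 1 + (1 + (L * Suc (M div L * 9 + 2 + (M div L * 9 + 2 + (1 + 0))) + 1 + (1 + (1 + 0))))))
      \<le> 70 * M"
      using dK LK lM LM(1) TM by (simp only: list.size)
  qed auto
qed

lemma tri_sort:
  "tri sort_prog (\<lambda>l V r s. l = l0 \<and> r = r0 \<and> fresh {1..11} V \<and> base_env s)
    (80 * (Lam + 1)\<^sup>2) (80 * M * (Lam + 1)) (sort_inv Lam)"
proof -
  let ?Pre = "\<lambda>l V r s. l = l0 \<and> r = r0 \<and> fresh {1..11} V \<and> base_env s"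
  let ?Mid = "\<lambda>l V r s. l = l0 \<and> r = r0 \<and> fresh {1..9} V \<and> base_env s \<and> (\<forall>p<M. V 10 (0, p, 0, 0) = p)"
  have a: "tri [Par (Var 1) [] 10 (Const 0) (Var 20) (Const 0) (Const 0) (Var 20)] ?Pre (length ([]::(nat \<times> exp) list) + 3)
     (M * (length ([]::(nat \<times> exp) list) + 2) + 2) ?Mid"
  proof (rule tri_par)
    fix m r s assume pre: "lo m = l0 \<and> r = r0 \<and> fresh {1..11} (vw m) \<and> base_env s"
    then have s: "s 1 = M" "s 3 = B" "s (Suc 0) = M" by (auto simp: base_env_def)
    let ?idx = "\<lambda>t. (0::nat, t, 0::nat, 0::nat)"
    have "upd (vw m 10) {..<M} ?idx (\<lambda>t. t) (0, t, 0, 0) = t" if "t < M" for t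
      by (rule upd_hit[of t]) (use that in auto)
    moreover have "i < B" if "i < M" for i using that BM by linarith
    ultimately show "\<exists>idx v. eval w m r s (Var 1) = M \<and> (\<forall>i<M.
      let s' = assigns w m r [] (s(20 := i)) in s' 3 = B \<and> inb (idx i) \<and>
       (eval w m r s' (Const 0), eval w m r s' (Var 20), eval w m r s' (Const 0), eval w m r s' (Const 0)) = idx i \<and>
       eval w m r s' (Var 20) = v i) \<and> lo m = l0 \<and> r = r0 \<and> fresh {1..9} ((vw m)(10 := upd (vw m 10) {..<M} idx v)) \<and>
       base_env s \<and> (\<forall>p<M. ((vw m)(10 := upd (vw m 10) {..<M} idx v)) 10 (0, p, 0, 0) = p)"
      using pre s B16 by (intro exI[of _ ?idx] exI[of _ "\<lambda>t. t"]) (auto simp: evs fresh_def)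
  qed auto
  have b: "tri [Assign 6 (Const 0)] ?Mid 1 1 (\<lambda>l V r s. ?Mid l V r s \<and> s 6 = 0)"
    by (rule tri_Assign) (auto simp: evs)
  have c: "tri [Assign 7 (Const 1)] (\<lambda>l V r s. ?Mid l V r s \<and> s 6 = 0) 1 1 (sort_inv 0)"
    by (rule tri_Assign) (auto simp: evs sort_inv_def)
  have d: "tri [WhileNZ (Less (Var 6) (Var 2)) sort_body] (sort_inv 0) (Lam * Suc (70 * (Lam + 1)) + 1)
    (Lam * Suc (70 * M) + 1) (sort_inv Lam)"
  proof (rule tri_while_const[where I = sort_inv, OF tri_sort_body])
    fix k m r s assume "sort_inv k (lo m) (vw m) r s"
    then have "s 6 = k" "s 2 = Lam" by (auto simp: sort_inv_def base_env_def)
    then show "eval w m r s (Less (Var 6) (Var 2)) \<noteq> 0 \<longleftrightarrow> k < Lam" by (simp add: evs)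
  qed
  have LM1: "Lam \<le> M" "1 \<le> M" using Lam_less by (auto intro: less_imp_le)
  show ?thesis unfolding sort_prog_def
  proof (rule tri_conseq[OF tri_Cons[OF a tri_Cons[OF b tri_Cons[OF c tri_Cons[OF d tri_Nil]]]]])
    show "length ([]::(nat \<times> exp) list) + 3 + (1 + (1 + (Lam * Suc (70 * (Lam + 1)) + 1 + 0))) \<le> 80 * (Lam + 1)\<^sup>2"
      by (simp add: power2_eq_square algebra_simps)
    have "Lam * Suc (70 * M) = 70 * (M * Lam) + Lam" by simp
    moreover have "80 * M * (Lam + 1) = 80 * (M * Lam) + 80 * M" by simp
    moreover have "M * (0 + 2) + 2 + (1 + (1 + (70 * y + l + 1 + 0))) \<le> 80 * y + 80 * M"
      if "l \<le> M" "1 \<le> M" for y l M :: nat using that by simp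
    ultimately show "M * (length ([]::(nat \<times> exp) list) + 2) + 2 + (1 + (1 + (Lam * Suc (70 * M) + 1 + 0))) \<le> 80 * M * (Lam + 1)"
      using LM1 by (simp only: list.size)
  qed auto
qed

end


section \<open>Boruvka rounds on the machine\<close>

text \<open>
  Array 1: labels of the edges of round \<open>i\<close>; array 2: endpoints of every edge in round \<open>i\<close>;
  array 3: parents of the nodes in the dendrogram of the contracted tree of round \<open>i\<close>, where the
  parent of a vertex is its lightest incident edge; array 4: contraction map; array 5: prefix sums;
  array 6: number of edges of round \<open>i\<close>.
\<close>

abbreviation C0 :: exp where "C0 \<equiv> Const 0"
abbreviation C1 :: exp where "C1 \<equiv> Const 1"

text \<open>All edges write their labels to both ends, and the priority rule keeps the smallest, so
  one loop finds all lightest edges.\<close>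

definition min_par :: instr where
  "min_par = ParL (Var 6) (Var 9) 2 [] 3 (Var 6) (LD 2 (Var 6) (Var 21) (Var 22) C0) C0 C0 (Var 21)"

definition hook_lets :: "(nat \<times> exp) list" where
  "hook_lets = [(23, LD 2 (Var 6) (Var 21) (Var 22) C0), (24, LD 3 (Var 6) (Var 23) C0 C0),
     (25, Minus (Plus (LD 2 (Var 6) (Var 24) C0 C0) (LD 2 (Var 6) (Var 24) C1 C0)) (Var 23))]"

definition hook_par :: instr where
  "hook_par = ParL (Var 6) (Var 9) 2 hook_lets 4 (Var 6) (Var 23) C0 C0
     (EIte (EAnd (Equal (LD 3 (Var 6) (Var 25) C0 C0) (Var 24)) (Less (Var 23) (Var 25))) (Var 23) (Var 25))"

text \<open>Pointer doubling of the contraction map in place, which is sound because all reads of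
  the loop precede its writes.\<close>

definition jump_par :: instr where
  "jump_par = ParL (Var 6) (Var 9) 2 [(23, LD 2 (Var 6) (Var 21) (Var 22) C0)] 4 (Var 6) (Var 23) C0 C0
     (LD 4 (Var 6) (LD 4 (Var 6) (Var 23) C0 C0) C0 C0)"

definition relabel_par :: instr where
  "relabel_par = ParL (Var 6) (Var 9) 2 [] 2 (Plus (Var 6) C1) (Var 21) (Var 22) C0
     (LD 4 (Var 6) (LD 2 (Var 6) (Var 21) (Var 22) C0) C0 C0)"

definition e_loop :: exp where
  "e_loop = Equal (LD 2 (Plus (Var 6) C1) (Var 21) C0 C0) (LD 2 (Plus (Var 6) C1) (Var 21) C1 C0)"

definition flag_par :: instr where
  "flag_par = Par (Var 9) [(21, LD 1 (Var 6) (Var 20) C0 C0)] 5 (Var 6) (Var 20) C0 C0 (ENot e_loop)"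

text \<open>One step of a prefix sum by doubling, again in place.\<close>

definition scan_par :: instr where
  "scan_par = Par (Var 9) [] 5 (Var 6) (Var 20) C0 C0 (Plus (LD 5 (Var 6) (Var 20) C0 C0)
     (EIte (Less (Var 20) (Var 7)) C0 (LD 5 (Var 6) (Minus (Var 20) (Var 7)) C0 C0)))"

text \<open>Edges that have become loops are moved out of the way by a third index of 1.\<close>

definition compact_par :: instr where
  "compact_par = Par (Var 9) [(21, LD 1 (Var 6) (Var 20) C0 C0), (22, e_loop)] 1 (Plus (Var 6) C1)
     (Minus (LD 5 (Var 6) (Var 20) C0 C0) C1) (Var 22) C0 (Var 21)"

definition round_body :: "instr list" where
  "round_body = [min_par, hook_par, Assign 8 C0, WhileNZ (Less (Var 8) (Var 2)) [jump_par, Inc 8],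
     relabel_par, flag_par, Assign 7 C1, Assign 8 C0,
     WhileNZ (Less (Var 8) (Var 2)) [scan_par, Dbl 7, Inc 8], compact_par,
     Assign 9 (LD 5 (Var 6) (Minus (Var 9) C1) C0 C0), Inc 6,
     Par C1 [] 6 (Var 6) C0 C0 C0 (Var 9)]"

section \<open>Number and sizes of the contraction rounds\<close>

locale rounds = instance_params +
  fixes ep0 :: "nat \<Rightarrow> nat \<Rightarrow> nat" and r0 :: "nat \<Rightarrow> real" and l0 :: "nat \<Rightarrow> nat"
    and Z :: "index \<Rightarrow> nat"
  assumes tree0: "ctree {1..n} {Suc n..<2 * n} ep0"
begin

text \<open>\<open>M\<close> hooks reach a root because the labels lie between \<open>n + 1\<close>
  and \<open>n + M\<close>.\<close>

primrec G :: "nat \<Rightarrow> nat set \<times> (nat \<Rightarrow> nat \<Rightarrow> nat) \<times> nat set" where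
  "G 0 = ({Suc n..<2 * n}, ep0, {1..n})"
| "G (Suc i) = (case G i of (A, ep, V) \<Rightarrow> let P = hook A ep ^^ M in (surv A ep P, ren ep P, P ` V))"

definition rA :: "nat \<Rightarrow> nat set" where "rA i = fst (G i)"
definition rE :: "nat \<Rightarrow> nat \<Rightarrow> nat \<Rightarrow> nat" where "rE i = fst (snd (G i))"
definition rV :: "nat \<Rightarrow> nat set" where "rV i = snd (snd (G i))"
definition rP :: "nat \<Rightarrow> nat \<Rightarrow> nat" where "rP i = hook (rA i) (rE i) ^^ M"
definition cnt :: "nat \<Rightarrow> nat" where "cnt i = card (rA i)"

lemma r0: "rA 0 = {Suc n..<2 * n}" "rE 0 = ep0" "rV 0 = {1..n}"
  by (simp_all add: rA_def rE_def rV_def)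

lemma rSuc: "rA (Suc i) = surv (rA i) (rE i) (rP i)" "rE (Suc i) = ren (rE i) (rP i)"
    "rV (Suc i) = rP i ` rV i"
  by (simp_all add: rA_def rE_def rV_def rP_def Let_def split: prod.splits)

definition R :: nat where "R = (LEAST i. rA i = {})"

lemma rA_mono: "rA (Suc i) \<subseteq> rA i"
  by (auto simp: rSuc surv_def)

lemma rA_sub: "rA i \<subseteq> {Suc n..<2 * n}"
  by (induction i) (use rA_mono in \<open>auto simp: r0\<close>)

lemma rA_finite: "finite (rA i)"
  using rA_sub finite_subset by blast

lemma keys: "e \<in> rA i \<Longrightarrow> n < e \<and> e \<le> n + M"
  using rA_sub[of i] nM by force

lemma R_ne: "i < R \<Longrightarrow> rA i \<noteq> {}"
  unfolding R_def by (rule not_less_Least)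

lemma tree_step: "ctree (rV i) (rA i) (rE i) \<Longrightarrow> rA i \<noteq> {} \<Longrightarrow> ctree (rV (Suc i)) (rA (Suc i)) (rE (Suc i))"
  unfolding rSuc by (rule round_ctree[OF _ _ keys]) (auto simp: rP_def)

lemma tree: "i \<le> R \<Longrightarrow> ctree (rV i) (rA i) (rE i)"
proof (induction i)
  case 0
  then show ?case using tree0 by (simp add: r0)
next
  case (Suc i)
  then show ?case using tree_step R_ne by simp
qed

lemma cnt_step: "ctree (rV i) (rA i) (rE i) \<Longrightarrow> rA i \<noteq> {} \<Longrightarrow> 2 * (cnt (Suc i) + 1) \<le> cnt i + 1"
  unfolding cnt_def rSuc by (rule round_halves[OF _ _ keys]) (auto simp: rP_def)

text \<open>Phrased without \<open>R\<close>, because it is what shows that an empty round exists.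
  The number of vertices, \<open>cnt i + 1\<close>, is the quantity that halves.\<close>

lemma cnt_pow: "(\<And>j. j < i \<Longrightarrow> rA j \<noteq> {}) \<Longrightarrow> ctree (rV i) (rA i) (rE i) \<and> 2 ^ i * (cnt i + 1) \<le> n"
proof (induction i)
  case 0
  then show ?case using tree0 n1 by (simp add: r0 cnt_def)
next
  case (Suc i)
  then have "ctree (rV i) (rA i) (rE i)" "2 ^ i * (cnt i + 1) \<le> n" by auto
  moreover have "2 ^ i * (2 * (cnt (Suc i) + 1)) \<le> 2 ^ i * (cnt i + 1)"
    using cnt_step[OF calculation(1)] Suc.prems by (intro mult_le_mono) auto
  ultimately show ?case using tree_step Suc.prems by (simp add: algebra_simps)
qed

lemma empty_exists: "\<exists>i\<le>Lam. rA i = {}"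
proof (rule ccontr)
  assume *: "\<not> ?thesis"
  then have "2 ^ Lam * (cnt Lam + 1) \<le> n" using cnt_pow[of Lam] by auto
  also have "n \<le> 2 ^ Lam" by (rule nM)
  finally have "cnt Lam = 0" by simp
  then show False using * rA_finite[of Lam] by (auto simp: cnt_def)
qed

lemma R_le: "R \<le> Lam" and R_empty: "rA R = {}"
proof -
  obtain i where i: "i \<le> Lam" "rA i = {}" using empty_exists by blast
  show "rA R = {}" unfolding R_def by (rule LeastI[of "\<lambda>i. rA i = {}", OF i(2)])
  show "R \<le> Lam" unfolding R_def using Least_le[of "\<lambda>i. rA i = {}", OF i(2)] i(1) by simp
qed

lemma cnt_half: "i < R \<Longrightarrow> 2 * cnt (Suc i) \<le> cnt i"
  using cnt_step[OF tree R_ne, of i] by simp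

lemma cnt_0: "cnt 0 = n - 1"
  by (simp add: cnt_def r0)

lemma cnt_le: "cnt i \<le> n - 1"
proof -
  have "card (rA i) \<le> card {Suc n..<2 * n}" by (intro card_mono rA_sub) simp
  then show ?thesis by (simp add: cnt_def)
qed

lemma cnt_M: "cnt i < M"
  using cnt_le[of i] nM n1 by linarith

text \<open>By halving, a partial sum plus \<open>2 * cnt k\<close> never exceeds
  \<open>2 * cnt 0\<close>.\<close>

lemma sum_cnt: "(\<Sum>i<R. cnt i) \<le> 2 * M"
proof -
  have "(\<Sum>i<k. cnt i) + 2 * cnt k \<le> 2 * cnt 0" if "k \<le> R" for k
    using that
  proof (induction k)
    case (Suc k)
    then show ?case using cnt_half[of k] by simp
  qed simp
  from this[of R] show ?thesis using cnt_M[of 0] by simp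
qed

lemma rV_sub: "i \<le> R \<Longrightarrow> rV i \<subseteq> {1..n}"
proof (induction i)
  case (Suc i)
  have "rP i x \<in> rV i" if "x \<in> rV i" for x
    by (rule P_in[OF tree R_ne keys rP_def]) (use Suc(2) that in auto)
  then show ?case using Suc by (auto simp: rSuc)
qed (simp add: r0)

lemma sep: "i \<le> R \<Longrightarrow> v \<in> rV i \<Longrightarrow> e \<in> rA i \<Longrightarrow> v < e"
  using rV_sub[of i] rA_sub[of i] by fastforce

lemma rE_in: "i \<le> R \<Longrightarrow> e \<in> rA i \<Longrightarrow> q < 2 \<Longrightarrow> rE i e q \<in> rV i"
  using ctreeD(4)[OF tree] by blast

lemma rV_less: "i \<le> R \<Longrightarrow> x \<in> rV i \<Longrightarrow> x < B"
  and rV_pos: "i \<le> R \<Longrightarrow> x \<in> rV i \<Longrightarrow> 0 < x"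
  using rV_sub[of i] nM BM by fastforce+

lemma rA_less: "e \<in> rA i \<Longrightarrow> e < B"
  using keys[of e i] nM BM by linarith

lemma hook_in: "i < R \<Longrightarrow> x \<in> rV i \<Longrightarrow> (hook (rA i) (rE i) ^^ k) x \<in> rV i"
  using hook_iter[OF tree R_ne, of i x k] by simp

section \<open>Memory invariants during contraction\<close>

definition LSok :: "nat \<Rightarrow> (index \<Rightarrow> nat) \<Rightarrow> bool" where
  "LSok i F \<longleftrightarrow> (\<forall>k\<le>i. bij_betw (\<lambda>j. F (k, j, 0, 0)) {..<cnt k} (rA k))"

text \<open>Row \<open>Suc k\<close> is kept for all edges of round \<open>k\<close>, also the
  contracted ones: the unwinding needs the vertex into which such an edge has vanished.\<close>

definition EPok :: "nat \<Rightarrow> (index \<Rightarrow> nat) \<Rightarrow> bool" where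
  "EPok i F \<longleftrightarrow> (\<forall>e\<in>rA 0. \<forall>q<2. F (0, e, q, 0) = rE 0 e q) \<and>
     (\<forall>k<i. \<forall>e\<in>rA k. \<forall>q<2. F (Suc k, e, q, 0) = rE (Suc k) e q)"

text \<open>The rows above \<open>i\<close> are still zero; after the last round, row
  \<open>R\<close> serves as the parent table of the one remaining vertex.\<close>

definition PRok :: "nat \<Rightarrow> (index \<Rightarrow> nat) \<Rightarrow> bool" where
  "PRok i F \<longleftrightarrow> (\<forall>k<i. \<forall>x\<in>rV k. F (k, x, 0, 0) = mn (rA k) (rE k) x) \<and>
     (\<forall>k>i. \<forall>x b c. F (k, x, b, c) = 0)"

definition MMok :: "nat \<Rightarrow> (index \<Rightarrow> nat) \<Rightarrow> bool" where
  "MMok i F \<longleftrightarrow> (\<forall>k\<le>i. F (k, 0, 0, 0) = cnt k)"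

definition core :: "nat \<Rightarrow> assertion" where
  "core i l V r s \<longleftrightarrow> l = l0 \<and> r = r0 \<and> base_env s \<and> s 6 = i \<and> s 9 = cnt i \<and> V 10 = Z \<and>
     fresh {7, 8, 9} V \<and> LSok i (V 1) \<and> EPok i (V 2) \<and> PRok i (V 3) \<and> MMok i (V 6)"

lemma EPokD: "EPok i F \<Longrightarrow> e \<in> rA i \<Longrightarrow> q < 2 \<Longrightarrow> F (i, e, q, 0) = rE i e q"
  using subsetD[OF rA_mono] by (cases i) (auto simp: EPok_def)

lemma core_env: "7 \<le> x \<Longrightarrow> x \<noteq> 9 \<Longrightarrow> core i l V r (s(x := v)) = core i l V r s"
  by (simp add: core_def)

lemma tri_round_par:
  assumes i: "i < R" and c: "1 \<le> c" "c < 4" and t: "1 \<le> t" "t < 16"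
    and core: "\<And>m r s. Pre (lo m) (vw m) r s \<Longrightarrow> core i (lo m) (vw m) r s"
    and ex: "\<And>m r s. Pre (lo m) (vw m) r s \<Longrightarrow> \<exists>idx v.
     (\<forall>e\<in>rA i. \<forall>q<c. \<forall>s'. s' 21 = e \<longrightarrow> s' 22 = q \<longrightarrow> s' 3 = B \<longrightarrow> s' 6 = i \<longrightarrow>
       (let s'' = assigns w m r as s' in s'' 3 = B \<and> inb (idx e q) \<and>
       (eval w m r s'' ea, eval w m r s'' eb, eval w m r s'' ec, eval w m r s'' ed) = idx e q \<and>
       eval w m r s'' val = v e q)) \<and>
     Post (lo m) ((vw m)(t := upd (vw m t) (rA i \<times> {..<c}) (\<lambda>(e, q). idx e q) (\<lambda>(e, q). v e q))) r s"
  shows "tri [ParL (Var 6) (Var 9) c as t ea eb ec ed val] Pre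
    (length as + 5) (c * cnt i * (length as + 4) + 2) Post"
  unfolding cnt_def
proof (rule tri_ParL)
  have "c * card (rA i) \<le> 4 * M" using c cnt_M[of i] by (intro mult_le_mono) (auto simp: cnt_def)
  then show "c * card (rA i) < 16 * B" "card (rA i) \<le> B"
    using cnt_M[of i] BM by (auto simp: cnt_def)
  show "finite (rA i)" by (rule rA_finite)
  fix m r s assume pre: "Pre (lo m) (vw m) r s"
  have co: "core i (lo m) (vw m) r s" using core[OF pre] .
  then have s: "s 3 = B" "s 6 = i" "s 9 = cnt i" by (auto simp: core_def base_env_def)
  have iB: "i < B" using i R_le Lam_less BM by linarith
  show "eval w m r s (Var 9) = card (rA i) \<and> s 3 = B \<and> i < B \<and>
      bij_betw (\<lambda>j. vw m 1 (i, j, 0, 0)) {..<card (rA i)} (rA i) \<and>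
      (\<forall>j. eval w m r (s(20 := j)) (Var 6) = i)"
    using s iB co by (auto simp: evs core_def LSok_def cnt_def)
  from ex[OF pre] obtain idx v where
    1: "\<And>e q s'. e \<in> rA i \<Longrightarrow> q < c \<Longrightarrow> s' 21 = e \<Longrightarrow> s' 22 = q \<Longrightarrow> s' 3 = B \<Longrightarrow> s' 6 = i \<Longrightarrow>
       (let s'' = assigns w m r as s' in s'' 3 = B \<and> inb (idx e q) \<and>
       (eval w m r s'' ea, eval w m r s'' eb, eval w m r s'' ec, eval w m r s'' ed) = idx e q \<and>
       eval w m r s'' val = v e q)" and
    2: "Post (lo m) ((vw m)(t := upd (vw m t) (rA i \<times> {..<c}) (\<lambda>(e, q). idx e q) (\<lambda>(e, q). v e q))) r s"
    by blast
  have "\<forall>e\<in>rA i. \<forall>q<c. \<forall>s'. s' 21 = e \<longrightarrow> s' 22 = q \<longrightarrow> (\<forall>y<20. s' y = s y) \<longrightarrow>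
       (let s'' = assigns w m r as s' in s'' 3 = B \<and> inb (idx e q) \<and>
       (eval w m r s'' ea, eval w m r s'' eb, eval w m r s'' ec, eval w m r s'' ed) = idx e q \<and>
       eval w m r s'' val = v e q)"
    by (intro ballI allI impI, rule 1) (use s in auto)
  then show "\<exists>idx v. (\<forall>e\<in>rA i. \<forall>q<c. \<forall>s'. s' 21 = e \<longrightarrow> s' 22 = q \<longrightarrow> (\<forall>y<20. s' y = s y) \<longrightarrow>
       (let s'' = assigns w m r as s' in s'' 3 = B \<and> inb (idx e q) \<and>
       (eval w m r s'' ea, eval w m r s'' eb, eval w m r s'' ec, eval w m r s'' ed) = idx e q \<and>
       eval w m r s'' val = v e q)) \<and>
      Post (lo m) ((vw m)(t := upd (vw m t) (rA i \<times> {..<c}) (\<lambda>(e, q). idx e q) (\<lambda>(e, q). v e q))) r s"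
    using 2 by blast
qed (use c t in auto)

definition min_inv :: "nat \<Rightarrow> assertion" where
  "min_inv i l V r s \<longleftrightarrow> core i l V r s \<and> (\<forall>x\<in>rV i. V 3 (i, x, 0, 0) = mn (rA i) (rE i) x)"

definition map_inv :: "nat \<Rightarrow> nat \<Rightarrow> assertion" where
  "map_inv i k l V r s \<longleftrightarrow> min_inv i l V r s \<and>
     (\<forall>x\<in>rV i. V 4 (i, x, 0, 0) = (hook (rA i) (rE i) ^^ k) x)"

lemma i_less: "i < R \<Longrightarrow> i < B \<and> Suc i < B \<and> Suc i < 16 * B \<and> 0 < B \<and> 1 < B \<and> 2 < B"
  using R_le Lam_less BM B16 by linarith

text \<open>Many edge ends write to the same vertex, but all of them write the same value, so the
  priority rule is harmless.\<close>

lemma upd_endpoints: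
  assumes i: "i < R" and x: "x \<in> rV i"
  shows "upd F (rA i \<times> {..<2}) (\<lambda>(e, q). (k, rE i e q, 0, 0)) (\<lambda>(e, q). f (rE i e q)) (k, x, 0, 0) = f x"
proof -
  obtain e q where "e \<in> rA i" "q < 2" "rE i e q = x"
    using vertices_eq[OF tree R_ne, of i x] i x by auto
  then show ?thesis by (intro upd_hit[of "(e, q)"]) auto
qed

lemma tri_min_par:
  assumes i: "i < R"
  shows "tri [min_par] (core i) 5 (8 * cnt i + 2) (min_inv i)"
proof -
  have "tri [min_par] (core i) (length ([]::(nat \<times> exp) list) + 5) (2 * cnt i * (length ([]::(nat \<times> exp) list) + 4) + 2) (min_inv i)"
    unfolding min_par_def
  proof (rule tri_round_par[OF i])
    fix m r s assume co: "core i (lo m) (vw m) r s"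
    then have EP: "EPok i (vw m 2)" by (simp add: core_def)
    let ?idx = "\<lambda>e q. (i, rE i e q, 0::nat, 0::nat)" and ?v = "\<lambda>e q::nat. e"
    let ?U = "upd (vw m 3) (rA i \<times> {..<2}) (\<lambda>(e, q). ?idx e q) (\<lambda>(e, q). ?v e q)"
    have "let s'' = assigns w m r [] s' in s'' 3 = B \<and> inb (?idx e q) \<and>
       (eval w m r s'' (Var 6), eval w m r s'' (LD 2 (Var 6) (Var 21) (Var 22) C0), eval w m r s'' C0, eval w m r s'' C0) = ?idx e q \<and>
       eval w m r s'' (Var 21) = ?v e q"
      if "e \<in> rA i" "q < 2" "s' 21 = e" "s' 22 = q" "s' 3 = B" "s' 6 = i" for e q s'
      using that EPokD[OF EP that(1,2)] rA_less[OF that(1)] i_less[OF i] rV_less[OF _ rE_in[OF _ that(1,2)]] i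
      by (simp add: evs)
    moreover have "min_inv i (lo m) ((vw m)(3 := ?U)) r s"
    proof -
      have "?U (i, x, 0, 0) = mn (rA i) (rE i) x" if x: "x \<in> rV i" for x
      proof -
        obtain e q where eq: "e \<in> rA i" "q < 2" "rE i e q = x"
          using vertices_eq[OF tree R_ne, of i x] i x by auto
        have "?U (i, x, 0, 0) = Min {(\<lambda>(e, q). ?v e q) j |j. j \<in> rA i \<times> {..<2} \<and> (\<lambda>(e, q). ?idx e q) j = (i, x, 0, 0)}"
          by (rule upd_Min[of "(e, q)"]) (use eq in auto)
        also have "{(\<lambda>(e, q). ?v e q) j |j. j \<in> rA i \<times> {..<2} \<and> (\<lambda>(e, q). ?idx e q) j = (i, x, 0, 0)} =
            {e \<in> rA i. \<exists>q<2. rE i e q = x}" by auto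
        finally show ?thesis by (simp add: mn_def)
      qed
      moreover have "?U (k, x, b, c) = vw m 3 (k, x, b, c)" if "k \<noteq> i" for k x b c
        by (rule upd_miss) (use that in auto)
      ultimately show ?thesis using co by (simp add: min_inv_def core_def PRok_def fresh_def)
    qed
    ultimately show "\<exists>idx v. (\<forall>e\<in>rA i. \<forall>q<2. \<forall>s'. s' 21 = e \<longrightarrow> s' 22 = q \<longrightarrow> s' 3 = B \<longrightarrow> s' 6 = i \<longrightarrow>
       (let s'' = assigns w m r [] s' in s'' 3 = B \<and> inb (idx e q) \<and>
       (eval w m r s'' (Var 6), eval w m r s'' (LD 2 (Var 6) (Var 21) (Var 22) C0), eval w m r s'' C0, eval w m r s'' C0) = idx e q \<and>
       eval w m r s'' (Var 21) = v e q)) \<and>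
     min_inv i (lo m) ((vw m)(3 := upd (vw m 3) (rA i \<times> {..<2}) (\<lambda>(e, q). idx e q) (\<lambda>(e, q). v e q))) r s"
      by (intro exI[of _ ?idx] exI[of _ ?v]) blast
  qed auto
  then show ?thesis by simp
qed

lemma tri_hook_par:
  assumes i: "i < R"
  shows "tri [hook_par] (min_inv i) 8 (14 * cnt i + 2) (map_inv i 1)"
proof -
  have "tri [hook_par] (min_inv i) (length hook_lets + 5) (2 * cnt i * (length hook_lets + 4) + 2) (map_inv i 1)"
    unfolding hook_par_def
  proof (rule tri_round_par[OF i])
    fix m r s assume inv: "min_inv i (lo m) (vw m) r s"
    then have EP: "EPok i (vw m 2)" by (simp add: core_def min_inv_def)
    have MN: "\<And>x. x \<in> rV i \<Longrightarrow> vw m 3 (i, x, 0, 0) = mn (rA i) (rE i) x"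
      using inv by (simp add: min_inv_def)
    let ?idx = "\<lambda>e q. (i, rE i e q, 0::nat, 0::nat)" and ?v = "\<lambda>e q::nat. hook (rA i) (rE i) (rE i e q)"
    have "let s'' = assigns w m r hook_lets s' in s'' 3 = B \<and> inb (?idx e q) \<and>
       (eval w m r s'' (Var 6), eval w m r s'' (Var 23), eval w m r s'' C0, eval w m r s'' C0) = ?idx e q \<and>
       eval w m r s'' (EIte (EAnd (Equal (LD 3 (Var 6) (Var 25) C0 C0) (Var 24)) (Less (Var 23) (Var 25))) (Var 23) (Var 25)) = ?v e q"
      if e: "e \<in> rA i" "q < 2" and s': "s' 21 = e" "s' 22 = q" "s' 3 = B" "s' 6 = i" for e q s'
    proof -
      let ?x = "rE i e q"
      let ?f = "mn (rA i) (rE i) ?x" and ?y = "oth (rA i) (rE i) ?x"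
      have x: "?x \<in> rV i" using rE_in[OF _ e] i by simp
      have f: "?f \<in> rA i" using mn_in[OF tree R_ne x] i by simp
      have y: "?y \<in> rV i" using oth_facts(1)[OF tree R_ne x] i by simp
      have f01: "rE i ?f 0 \<in> rV i" "rE i ?f 1 \<in> rV i" using rE_in[OF _ f] i by auto
      have b: "?x < B" "?y < B" "rE i ?f 0 < B" "rE i ?f 1 < B"
        using rV_less[OF less_imp_le[OF i]] x y f01 by blast+
      note bb = b rA_less[OF f] rA_less[OF e(1)] i_less[OF i]
      note EPf = EPokD[OF EP f, of 0] EPokD[OF EP f, of 1]
      have e1: "eval w m r s' (LD 2 (Var 6) (Var 21) (Var 22) C0) = ?x"
        using s' e bb EPokD[OF EP e] by (simp add: evs)
      have e2: "eval w m r (s'(23 := ?x)) (LD 3 (Var 6) (Var 23) C0 C0) = ?f"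
        using s' bb MN[OF x] by (simp add: evs)
      have e3: "eval w m r (s'(23 := ?x, 24 := ?f)) (Minus (Plus (LD 2 (Var 6) (Var 24) C0 C0)
          (LD 2 (Var 6) (Var 24) C1 C0)) (Var 23)) = ?y"
        using s' bb EPf by (simp add: evs oth_def)
      have as: "assigns w m r hook_lets s' = s'(23 := ?x, 24 := ?f, 25 := ?y)"
        unfolding hook_lets_def assigns.simps fst_conv snd_conv e1 e2 e3 ..
      have "eval w m r (s'(23 := ?x, 24 := ?f, 25 := ?y)) (EIte (EAnd (Equal (LD 3 (Var 6) (Var 25) C0 C0) (Var 24))
          (Less (Var 23) (Var 25))) (Var 23) (Var 25)) = hook (rA i) (rE i) ?x"
        using s' bb MN[OF y] by (simp add: evs hook_def)
      then show ?thesis unfolding as Let_def using s' bb by (simp add: evs)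
    qed
    moreover have "map_inv i 1 (lo m) ((vw m)(4 := upd (vw m 4) (rA i \<times> {..<2}) (\<lambda>(e, q). ?idx e q) (\<lambda>(e, q). ?v e q))) r s"
    proof -
      have "\<forall>x\<in>rV i. upd (vw m 4) (rA i \<times> {..<2}) (\<lambda>(e, q). ?idx e q) (\<lambda>(e, q). ?v e q) (i, x, 0, 0) =
          (hook (rA i) (rE i) ^^ 1) x"
        unfolding funpow.simps One_nat_def comp_id by (intro ballI upd_endpoints[OF i])
      moreover have "min_inv i (lo m) ((vw m)(4 := upd (vw m 4) (rA i \<times> {..<2}) (\<lambda>(e, q). ?idx e q) (\<lambda>(e, q). ?v e q))) r s"
        using inv by (simp add: min_inv_def core_def)
      ultimately show ?thesis unfolding map_inv_def fun_upd_same by blast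
    qed
    ultimately show "\<exists>idx v. (\<forall>e\<in>rA i. \<forall>q<2. \<forall>s'. s' 21 = e \<longrightarrow> s' 22 = q \<longrightarrow> s' 3 = B \<longrightarrow> s' 6 = i \<longrightarrow>
       (let s'' = assigns w m r hook_lets s' in s'' 3 = B \<and> inb (idx e q) \<and>
       (eval w m r s'' (Var 6), eval w m r s'' (Var 23), eval w m r s'' C0, eval w m r s'' C0) = idx e q \<and>
       eval w m r s'' (EIte (EAnd (Equal (LD 3 (Var 6) (Var 25) C0 C0) (Var 24)) (Less (Var 23) (Var 25))) (Var 23) (Var 25)) = v e q)) \<and>
     map_inv i 1 (lo m) ((vw m)(4 := upd (vw m 4) (rA i \<times> {..<2}) (\<lambda>(e, q). idx e q) (\<lambda>(e, q). v e q))) r s"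
      by (intro exI[of _ ?idx] exI[of _ ?v]) blast
  qed (auto simp: min_inv_def)
  then show ?thesis by (simp add: hook_lets_def)
qed

lemma tri_jump_par:
  assumes i: "i < R"
  shows "tri [jump_par] (\<lambda>l V r s. map_inv i k l V r s \<and> s 8 = c) 6 (10 * cnt i + 2)
    (\<lambda>l V r s. map_inv i (2 * k) l V r s \<and> s 8 = c)"
proof -
  let ?as = "[(23::nat, LD 2 (Var 6) (Var 21) (Var 22) C0)]"
  have "tri [jump_par] (\<lambda>l V r s. map_inv i k l V r s \<and> s 8 = c) (length ?as + 5) (2 * cnt i * (length ?as + 4) + 2)
    (\<lambda>l V r s. map_inv i (2 * k) l V r s \<and> s 8 = c)"
    unfolding jump_par_def
  proof (rule tri_round_par[OF i])
    fix m r s assume pre: "map_inv i k (lo m) (vw m) r s \<and> s 8 = c"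
    then have inv: "map_inv i k (lo m) (vw m) r s" by simp
    then have EP: "EPok i (vw m 2)" by (simp add: core_def min_inv_def map_inv_def)
    let ?h = "hook (rA i) (rE i)"
    have MN: "\<And>x. x \<in> rV i \<Longrightarrow> vw m 4 (i, x, 0, 0) = (?h ^^ k) x"
      using inv by (simp add: map_inv_def)
    let ?idx = "\<lambda>e q. (i, rE i e q, 0::nat, 0::nat)" and ?v = "\<lambda>e q::nat. (?h ^^ (2 * k)) (rE i e q)"
    have "let s'' = assigns w m r ?as s' in s'' 3 = B \<and> inb (?idx e q) \<and>
       (eval w m r s'' (Var 6), eval w m r s'' (Var 23), eval w m r s'' C0, eval w m r s'' C0) = ?idx e q \<and>
       eval w m r s'' (LD 4 (Var 6) (LD 4 (Var 6) (Var 23) C0 C0) C0 C0) = ?v e q"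
      if e: "e \<in> rA i" "q < 2" and s': "s' 21 = e" "s' 22 = q" "s' 3 = B" "s' 6 = i" for e q s'
    proof -
      let ?x = "rE i e q"
      have x: "?x \<in> rV i" using rE_in[OF _ e] i by simp
      have y: "(?h ^^ k) ?x \<in> rV i" using hook_in[OF i x] .
      have b: "?x < B" "(?h ^^ k) ?x < B" using rV_less[OF less_imp_le[OF i]] x y by blast+
      note bb = b rA_less[OF e(1)] i_less[OF i]
      have e1: "eval w m r s' (LD 2 (Var 6) (Var 21) (Var 22) C0) = ?x"
        using s' e bb EPokD[OF EP e] by (simp add: evs)
      have "(?h ^^ k) ((?h ^^ k) ?x) = (?h ^^ (2 * k)) ?x"
        by (simp add: mult_2 funpow_add)
      then show ?thesis unfolding assigns.simps fst_conv snd_conv e1 Let_def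
        using s' bb MN[OF x] MN[OF y] by (simp add: evs)
    qed
    moreover have "map_inv i (2 * k) (lo m) ((vw m)(4 := upd (vw m 4) (rA i \<times> {..<2}) (\<lambda>(e, q). ?idx e q) (\<lambda>(e, q). ?v e q))) r s"
    proof -
      have "\<forall>x\<in>rV i. upd (vw m 4) (rA i \<times> {..<2}) (\<lambda>(e, q). ?idx e q) (\<lambda>(e, q). ?v e q) (i, x, 0, 0) = (?h ^^ (2 * k)) x"
        by (intro ballI upd_endpoints[OF i])
      moreover have "min_inv i (lo m) ((vw m)(4 := upd (vw m 4) (rA i \<times> {..<2}) (\<lambda>(e, q). ?idx e q) (\<lambda>(e, q). ?v e q))) r s"
        using inv by (simp add: map_inv_def min_inv_def core_def)
      ultimately show ?thesis unfolding map_inv_def fun_upd_same by blast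
    qed
    ultimately show "\<exists>idx v. (\<forall>e\<in>rA i. \<forall>q<2. \<forall>s'. s' 21 = e \<longrightarrow> s' 22 = q \<longrightarrow> s' 3 = B \<longrightarrow> s' 6 = i \<longrightarrow>
       (let s'' = assigns w m r ?as s' in s'' 3 = B \<and> inb (idx e q) \<and>
       (eval w m r s'' (Var 6), eval w m r s'' (Var 23), eval w m r s'' C0, eval w m r s'' C0) = idx e q \<and>
       eval w m r s'' (LD 4 (Var 6) (LD 4 (Var 6) (Var 23) C0 C0) C0 C0) = v e q)) \<and>
     (map_inv i (2 * k) (lo m) ((vw m)(4 := upd (vw m 4) (rA i \<times> {..<2}) (\<lambda>(e, q). idx e q) (\<lambda>(e, q). v e q))) r s \<and> s 8 = c)"
      using pre by (intro exI[of _ ?idx] exI[of _ ?v]) blast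
  qed (auto simp: min_inv_def map_inv_def)
  then show ?thesis by simp
qed

lemma tri_jump_loop:
  assumes i: "i < R"
  shows "tri [Assign 8 C0, WhileNZ (Less (Var 8) (Var 2)) [jump_par, Inc 8]] (map_inv i 1)
    (8 * Lam + 2) (Lam * (10 * cnt i + 4) + 2) (map_inv i M)"
proof -
  have a: "tri [Assign 8 C0] (map_inv i 1) 1 1 (\<lambda>l V r s. map_inv i (2 ^ 0) l V r s \<and> s 8 = 0)"
    by (rule tri_Assign) (simp add: evs map_inv_def min_inv_def core_env)
  have b: "tri [jump_par, Inc 8] (\<lambda>l V r s. map_inv i (2 ^ k) l V r s \<and> s 8 = k) (6 + (1 + 0))
    ((10 * cnt i + 2) + (1 + 0)) (\<lambda>l V r s. map_inv i (2 ^ Suc k) l V r s \<and> s 8 = Suc k)" if k: "k < Lam" for k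
  proof -
    have "Suc k < 16 * B" using k Lam_less BM by linarith
    then have "tri [Inc 8] (\<lambda>l V r s. map_inv i (2 * 2 ^ k) l V r s \<and> s 8 = k) 1 1
      (\<lambda>l V r s. map_inv i (2 ^ Suc k) l V r s \<and> s 8 = Suc k)"
      by (intro tri_Assign) (simp add: evs map_inv_def min_inv_def core_env)
    then show ?thesis by (intro tri_Cons[OF tri_jump_par[OF i] tri_Cons[OF _ tri_Nil]])
  qed
  have c: "tri [WhileNZ (Less (Var 8) (Var 2)) [jump_par, Inc 8]] (\<lambda>l V r s. map_inv i (2 ^ 0) l V r s \<and> s 8 = 0)
     (Lam * Suc (6 + (1 + 0)) + 1) (Lam * Suc ((10 * cnt i + 2) + (1 + 0)) + 1)
     (\<lambda>l V r s. map_inv i (2 ^ Lam) l V r s \<and> s 8 = Lam)"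
  proof (rule tri_while_const[where I = "\<lambda>k l V r s. map_inv i (2 ^ k) l V r s \<and> s 8 = k", OF b])
    fix k m r s assume "map_inv i (2 ^ k) (lo m) (vw m) r s \<and> s 8 = k"
    then have "s 8 = k" "s 2 = Lam" by (auto simp: map_inv_def min_inv_def core_def base_env_def)
    then show "eval w m r s (Less (Var 8) (Var 2)) \<noteq> 0 \<longleftrightarrow> k < Lam" by (simp add: evs)
  qed
  show ?thesis by (rule tri_conseq[OF tri_Cons[OF a c]]) (auto simp: algebra_simps)
qed

definition rel_inv :: "nat \<Rightarrow> assertion" where
  "rel_inv i l V r s \<longleftrightarrow> min_inv i l V r s \<and> EPok (Suc i) (V 2)"

lemma tri_relabel_par:
  assumes i: "i < R"
  shows "tri [relabel_par] (map_inv i M) 5 (8 * cnt i + 2) (rel_inv i)"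
proof -
  have "tri [relabel_par] (map_inv i M) (length ([]::(nat \<times> exp) list) + 5) (2 * cnt i * (length ([]::(nat \<times> exp) list) + 4) + 2) (rel_inv i)"
    unfolding relabel_par_def
  proof (rule tri_round_par[OF i])
    fix m r s assume inv: "map_inv i M (lo m) (vw m) r s"
    then have EP: "EPok i (vw m 2)" by (simp add: core_def min_inv_def map_inv_def)
    have MP: "\<And>x. x \<in> rV i \<Longrightarrow> vw m 4 (i, x, 0, 0) = rP i x"
      using inv by (simp add: map_inv_def rP_def)
    let ?idx = "\<lambda>e q. (Suc i, e, q, 0::nat)" and ?v = "\<lambda>e q. rE (Suc i) e q"
    have "let s'' = assigns w m r [] s' in s'' 3 = B \<and> inb (?idx e q) \<and>
       (eval w m r s'' (Plus (Var 6) C1), eval w m r s'' (Var 21), eval w m r s'' (Var 22), eval w m r s'' C0) = ?idx e q \<and>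
       eval w m r s'' (LD 4 (Var 6) (LD 2 (Var 6) (Var 21) (Var 22) C0) C0 C0) = ?v e q"
      if e: "e \<in> rA i" "q < 2" and s': "s' 21 = e" "s' 22 = q" "s' 3 = B" "s' 6 = i" for e q s'
    proof -
      let ?x = "rE i e q"
      have x: "?x \<in> rV i" using rE_in[OF _ e] i by simp
      have b: "?x < B" using rV_less[OF less_imp_le[OF i]] x by blast
      note bb = b rA_less[OF e(1)] i_less[OF i]
      have e1: "eval w m r s' (LD 2 (Var 6) (Var 21) (Var 22) C0) = ?x"
        using s' e bb EPokD[OF EP e] by (simp add: evs)
      have "eval w m r s' (LD 4 (Var 6) (LD 2 (Var 6) (Var 21) (Var 22) C0) C0 C0) = rP i ?x"
        using s' bb e1 MP[OF x] by (subst eval_LD) (simp_all add: evs)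
      then show ?thesis
        using s' bb e by (simp add: evs rSuc ren_def)
    qed
    moreover have "rel_inv i (lo m) ((vw m)(2 := upd (vw m 2) (rA i \<times> {..<2}) (\<lambda>(e, q). ?idx e q) (\<lambda>(e, q). ?v e q))) r s"
    proof -
      let ?U = "upd (vw m 2) (rA i \<times> {..<2}) (\<lambda>(e, q). ?idx e q) (\<lambda>(e, q). ?v e q)"
      have "?U (Suc i, e, q, 0) = rE (Suc i) e q" if "e \<in> rA i" "q < 2" for e q
        by (rule upd_hit[of "(e, q)"]) (use that in auto)
      moreover have "?U (k, e, q, 0) = vw m 2 (k, e, q, 0)" if "k \<noteq> Suc i" for k e q
        by (rule upd_miss) (use that in auto)
      ultimately have "EPok (Suc i) ?U" using EP by (auto simp: EPok_def less_Suc_eq)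
      moreover from this have "EPok i ?U" by (auto simp: EPok_def)
      ultimately show ?thesis using inv by (simp add: rel_inv_def map_inv_def min_inv_def core_def)
    qed
    ultimately show "\<exists>idx v. (\<forall>e\<in>rA i. \<forall>q<2. \<forall>s'. s' 21 = e \<longrightarrow> s' 22 = q \<longrightarrow> s' 3 = B \<longrightarrow> s' 6 = i \<longrightarrow>
       (let s'' = assigns w m r [] s' in s'' 3 = B \<and> inb (idx e q) \<and>
       (eval w m r s'' (Plus (Var 6) C1), eval w m r s'' (Var 21), eval w m r s'' (Var 22), eval w m r s'' C0) = idx e q \<and>
       eval w m r s'' (LD 4 (Var 6) (LD 2 (Var 6) (Var 21) (Var 22) C0) C0 C0) = v e q)) \<and>
     rel_inv i (lo m) ((vw m)(2 := upd (vw m 2) (rA i \<times> {..<2}) (\<lambda>(e, q). idx e q) (\<lambda>(e, q). v e q))) r s"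
      by (intro exI[of _ ?idx] exI[of _ ?v]) blast
  qed (auto simp: min_inv_def map_inv_def)
  then show ?thesis by simp
qed

section \<open>Prefix sums and compaction\<close>

definition flag_count :: "nat \<Rightarrow> (index \<Rightarrow> nat) \<Rightarrow> nat \<Rightarrow> nat \<Rightarrow> nat" where
  "flag_count i F k j = card {j'. j' \<le> j \<and> j < j' + k \<and> F (i, j', 0, 0) \<in> rA (Suc i)}"

definition scan_inv :: "nat \<Rightarrow> nat \<Rightarrow> assertion" where
  "scan_inv i k l V r s \<longleftrightarrow> rel_inv i l V r s \<and>
     (\<forall>j<cnt i. V 5 (i, j, 0, 0) = flag_count i (V 1) k j)"

lemma flag_count_le: "flag_count i F k j \<le> Suc j"
proof -
  have "flag_count i F k j \<le> card {..j}" unfolding flag_count_def by (intro card_mono) auto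
  then show ?thesis by simp
qed

lemma flag_count_1: "flag_count i F 1 j = of_bool (F (i, j, 0, 0) \<in> rA (Suc i))"
proof -
  have "{j'. j' \<le> j \<and> j < j' + 1 \<and> F (i, j', 0, 0) \<in> rA (Suc i)} =
    (if F (i, j, 0, 0) \<in> rA (Suc i) then {j} else {})" by (auto simp: le_less_Suc_eq)
  then show ?thesis by (simp add: flag_count_def)
qed

text \<open>The window of length \<open>2 * k\<close> ending at \<open>j\<close> is the disjoint
  union of the windows of length \<open>k\<close> ending at \<open>j\<close> and at
  \<open>j - k\<close>. For \<open>j < k\<close> the first of them already reaches back to
  0.\<close>

lemma flag_count_double:
  "flag_count i F (2 * k) j = flag_count i F k j + (if j < k then 0 else flag_count i F k (j - k))"
proof (cases "j < k")
  case True
  then show ?thesis unfolding flag_count_def by (auto intro!: arg_cong[where f = card])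
next
  case False
  let ?S = "\<lambda>j k. {j'. j' \<le> j \<and> j < j' + k \<and> F (i, j', 0, 0) \<in> rA (Suc i)}"
  have "?S j (2 * k) = ?S j k \<union> ?S (j - k) k" "?S j k \<inter> ?S (j - k) k = {}" using False by auto
  moreover have "finite (?S j k)" for j by (rule finite_subset[of _ "{..j}"]) auto
  ultimately show ?thesis unfolding flag_count_def using False by (simp add: card_Un_disjoint)
qed

lemma eval_loop:
  assumes i: "i < R" and EP: "EPok (Suc i) (vw m 2)" and e: "e \<in> rA i"
    and s: "s 21 = e" "s 3 = B" "s 6 = i"
  shows "eval w m r s e_loop = of_bool (e \<notin> rA (Suc i))"
proof -
  have "vw m 2 (Suc i, e, q, 0) = rE (Suc i) e q" if "q < 2" for q
    using EP e that by (auto simp: EPok_def)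
  from this[of 0] this[of 1] have "vw m 2 (Suc i, e, 0, 0) = rP i (rE i e 0)" "vw m 2 (Suc i, e, Suc 0, 0) = rP i (rE i e 1)"
    by (simp_all add: rSuc ren_def)
  then show ?thesis using s rA_less[OF e] i_less[OF i] e unfolding e_loop_def
    by (simp add: evs rSuc surv_def)
qed

lemma rel_invD:
  assumes "rel_inv i l V r s"
  shows "core i l V r s" "base_env s" "s 6 = i" "s 9 = cnt i" "s 3 = B" "EPok (Suc i) (V 2)"
    "bij_betw (\<lambda>j. V 1 (i, j, 0, 0)) {..<cnt i} (rA i)"
  using assms by (auto simp: rel_inv_def min_inv_def core_def base_env_def LSok_def)

lemma tri_flag_par:
  assumes i: "i < R"
  shows "tri [flag_par] (rel_inv i) 4 (3 * cnt i + 2) (scan_inv i 1)"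
proof -
  let ?as = "[(21::nat, LD 1 (Var 6) (Var 20) C0 C0)]"
  have "tri [flag_par] (rel_inv i) (length ?as + 3) (cnt i * (length ?as + 2) + 2) (scan_inv i 1)"
    unfolding flag_par_def
  proof (rule tri_par)
    fix m r s assume inv: "rel_inv i (lo m) (vw m) r s"
    note s = rel_invD[OF inv]
    let ?idx = "\<lambda>j. (i, j, 0::nat, 0::nat)" and ?v = "\<lambda>j. flag_count i (vw m 1) 1 j"
    have "let s' = assigns w m r ?as (s(20 := j)) in s' 3 = B \<and> inb (?idx j) \<and>
       (eval w m r s' (Var 6), eval w m r s' (Var 20), eval w m r s' C0, eval w m r s' C0) = ?idx j \<and>
       eval w m r s' (ENot e_loop) = ?v j" if j: "j < cnt i" for j
    proof -
      have jB: "j < B" using j cnt_M[of i] BM by linarith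
      have e1: "eval w m r (s(20 := j)) (LD 1 (Var 6) (Var 20) C0 C0) = vw m 1 (i, j, 0, 0)"
        using s jB i_less[OF i] by (simp add: evs)
      have h: "vw m 1 (i, j, 0, 0) \<in> rA i" using bij_betwE[OF s(7)] j by auto
      have "eval w m r (s(20 := j, 21 := vw m 1 (i, j, 0, 0))) e_loop = of_bool (vw m 1 (i, j, 0, 0) \<notin> rA (Suc i))"
        by (rule eval_loop[OF i s(6) h]) (use s in auto)
      then have e2: "eval w m r (s(20 := j, 21 := vw m 1 (i, j, 0, 0))) (ENot e_loop) = ?v j"
        unfolding flag_count_1 eval_ENot by simp
      show ?thesis unfolding assigns.simps fst_conv snd_conv e1 Let_def e2
        using s jB i_less[OF i] by (simp add: evs)
    qed
    moreover have "scan_inv i 1 (lo m) ((vw m)(5 := upd (vw m 5) {..<cnt i} ?idx ?v)) r s"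
    proof -
      have "upd (vw m 5) {..<cnt i} ?idx ?v (i, j, 0, 0) = ?v j" if "j < cnt i" for j
        by (rule upd_hit[of j]) (use that in auto)
      then show ?thesis using inv by (simp add: scan_inv_def rel_inv_def min_inv_def core_def)
    qed
    ultimately show "\<exists>idx v. eval w m r s (Var 9) = cnt i \<and> (\<forall>j<cnt i.
      let s' = assigns w m r ?as (s(20 := j)) in s' 3 = B \<and> inb (idx j) \<and>
       (eval w m r s' (Var 6), eval w m r s' (Var 20), eval w m r s' C0, eval w m r s' C0) = idx j \<and>
       eval w m r s' (ENot e_loop) = v j) \<and> scan_inv i 1 (lo m) ((vw m)(5 := upd (vw m 5) {..<cnt i} idx v)) r s"
      using eval_Var[of m r s 9, unfolded s(4)] by (intro exI[of _ ?idx] exI[of _ ?v]) blast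
  qed auto
  then show ?thesis by (rule tri_conseq) auto
qed

lemma rel_inv_env: "7 \<le> x \<Longrightarrow> x \<noteq> 9 \<Longrightarrow> rel_inv i l V r (s(x := v)) = rel_inv i l V r s"
  by (simp add: rel_inv_def min_inv_def core_env)

lemma tri_scan_par:
  assumes i: "i < R" and k: "k < M"
  shows "tri [scan_par] (\<lambda>l V r s. scan_inv i k l V r s \<and> s 7 = k \<and> s 8 = c) 3 (2 * cnt i + 2)
    (\<lambda>l V r s. scan_inv i (2 * k) l V r s \<and> s 7 = k \<and> s 8 = c)"
proof -
  let ?as = "[]::(nat \<times> exp) list"
  have "tri [scan_par] (\<lambda>l V r s. scan_inv i k l V r s \<and> s 7 = k \<and> s 8 = c) (length ?as + 3)
    (cnt i * (length ?as + 2) + 2) (\<lambda>l V r s. scan_inv i (2 * k) l V r s \<and> s 7 = k \<and> s 8 = c)"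
    unfolding scan_par_def
  proof (rule tri_par)
    fix m r s assume pre: "scan_inv i k (lo m) (vw m) r s \<and> s 7 = k \<and> s 8 = c"
    then have inv: "rel_inv i (lo m) (vw m) r s"
      and S: "\<And>j. j < cnt i \<Longrightarrow> vw m 5 (i, j, 0, 0) = flag_count i (vw m 1) k j"
      by (auto simp: scan_inv_def)
    note s = rel_invD[OF inv]
    let ?idx = "\<lambda>j. (i, j, 0::nat, 0::nat)" and ?v = "\<lambda>j. flag_count i (vw m 1) (2 * k) j"
    have "let s' = assigns w m r ?as (s(20 := j)) in s' 3 = B \<and> inb (?idx j) \<and>
       (eval w m r s' (Var 6), eval w m r s' (Var 20), eval w m r s' C0, eval w m r s' C0) = ?idx j \<and>
       eval w m r s' (Plus (LD 5 (Var 6) (Var 20) C0 C0)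
         (EIte (Less (Var 20) (Var 7)) C0 (LD 5 (Var 6) (Minus (Var 20) (Var 7)) C0 C0))) = ?v j" if j: "j < cnt i" for j
    proof -
      have jB: "j < B" "j - k < B" using j cnt_M[of i] BM by linarith+
      have jk: "j - k < cnt i" using j by simp
      have fb: "flag_count i (vw m 1) k j < B" "flag_count i (vw m 1) k (j - k) < B"
        using flag_count_le[of i "vw m 1" k j] flag_count_le[of i "vw m 1" k "j - k"] j cnt_M[of i] BM by linarith+
      have bb: "flag_count i (vw m 1) k j + flag_count i (vw m 1) k (j - k) < 16 * B" using fb by linarith
      have e1: "eval w m r (s(20 := j)) (LD 5 (Var 6) (Var 20) C0 C0) = flag_count i (vw m 1) k j"
        using s jB i_less[OF i] S[OF j] by (simp add: evs)
      have e2: "eval w m r (s(20 := j)) (LD 5 (Var 6) (Minus (Var 20) (Var 7)) C0 C0) = flag_count i (vw m 1) k (j - k)"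
        using s jB i_less[OF i] S[OF jk] pre by (simp add: evs)
      have e3: "eval w m r (s(20 := j)) (EIte (Less (Var 20) (Var 7)) C0 (LD 5 (Var 6) (Minus (Var 20) (Var 7)) C0 C0)) =
        (if j < k then 0 else flag_count i (vw m 1) k (j - k))"
        by (subst eval_EIte) (use e2 fb pre i_less[OF i] in \<open>auto simp: evs\<close>)
      have "eval w m r (s(20 := j)) (Plus (LD 5 (Var 6) (Var 20) C0 C0)
         (EIte (Less (Var 20) (Var 7)) C0 (LD 5 (Var 6) (Minus (Var 20) (Var 7)) C0 C0))) = ?v j"
        unfolding flag_count_double by (subst eval_Plus) (use e1 e3 bb in auto)
      then show ?thesis using s jB i_less[OF i] by (simp add: evs)
    qed
    moreover have "scan_inv i (2 * k) (lo m) ((vw m)(5 := upd (vw m 5) {..<cnt i} ?idx ?v)) r s"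
    proof -
      have "upd (vw m 5) {..<cnt i} ?idx ?v (i, j, 0, 0) = ?v j" if "j < cnt i" for j
        by (rule upd_hit[of j]) (use that in auto)
      then show ?thesis using inv by (simp add: scan_inv_def rel_inv_def min_inv_def core_def)
    qed
    ultimately show "\<exists>idx v. eval w m r s (Var 9) = cnt i \<and> (\<forall>j<cnt i.
      let s' = assigns w m r ?as (s(20 := j)) in s' 3 = B \<and> inb (idx j) \<and>
       (eval w m r s' (Var 6), eval w m r s' (Var 20), eval w m r s' C0, eval w m r s' C0) = idx j \<and>
       eval w m r s' (Plus (LD 5 (Var 6) (Var 20) C0 C0)
         (EIte (Less (Var 20) (Var 7)) C0 (LD 5 (Var 6) (Minus (Var 20) (Var 7)) C0 C0))) = v j) \<and>
      scan_inv i (2 * k) (lo m) ((vw m)(5 := upd (vw m 5) {..<cnt i} idx v)) r s \<and> s 7 = k \<and> s 8 = c"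
      using eval_Var[of m r s 9, unfolded s(4)] pre by (intro exI[of _ ?idx] exI[of _ ?v]) blast
  qed auto
  then show ?thesis by (rule tri_conseq) auto
qed

lemma tri_scan_loop:
  assumes i: "i < R"
  shows "tri [Assign 7 C1, Assign 8 C0, WhileNZ (Less (Var 8) (Var 2)) [scan_par, Dbl 7, Inc 8]] (scan_inv i 1)
    (6 * Lam + 3) (Lam * (2 * cnt i + 5) + 3) (scan_inv i M)"
proof -
  let ?I = "\<lambda>k l V r s. scan_inv i (2 ^ k) l V r s \<and> s 7 = 2 ^ k \<and> s 8 = k"
  have a: "tri [Assign 7 C1] (scan_inv i 1) 1 1 (\<lambda>l V r s. scan_inv i (2 ^ 0) l V r s \<and> s 7 = 2 ^ 0)"
    by (rule tri_Assign) (simp add: evs scan_inv_def rel_inv_env)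
  have b: "tri [Assign 8 C0] (\<lambda>l V r s. scan_inv i (2 ^ 0) l V r s \<and> s 7 = 2 ^ 0) 1 1 (?I 0)"
    by (rule tri_Assign) (simp add: evs scan_inv_def rel_inv_env)
  have c: "tri [scan_par, Dbl 7, Inc 8] (?I k) (3 + (1 + (1 + 0))) ((2 * cnt i + 2) + (1 + (1 + 0))) (?I (Suc k))"
    if k: "k < Lam" for k
  proof -
    have kM: "(2::nat) ^ k < M" using k by simp
    have "Suc k < 16 * B" "(2::nat) ^ k + 2 ^ k < 16 * B" using k kM Lam_less BM by linarith+
    note bb = this
    have 1: "tri [Dbl 7] (\<lambda>l V r s. scan_inv i (2 * 2 ^ k) l V r s \<and> s 7 = 2 ^ k \<and> s 8 = k) 1 1
      (\<lambda>l V r s. scan_inv i (2 * 2 ^ k) l V r s \<and> s 7 = 2 ^ Suc k \<and> s 8 = k)"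
      by (rule tri_Assign) (use bb in \<open>simp add: evs scan_inv_def rel_inv_env\<close>)
    have 2: "tri [Inc 8] (\<lambda>l V r s. scan_inv i (2 * 2 ^ k) l V r s \<and> s 7 = 2 ^ Suc k \<and> s 8 = k) 1 1 (?I (Suc k))"
      by (rule tri_Assign) (use bb in \<open>simp add: evs scan_inv_def rel_inv_env\<close>)
    show ?thesis by (rule tri_Cons[OF tri_scan_par[OF i kM] tri_Cons[OF 1 tri_Cons[OF 2 tri_Nil]]])
  qed
  have d: "tri [WhileNZ (Less (Var 8) (Var 2)) [scan_par, Dbl 7, Inc 8]] (?I 0)
     (Lam * Suc (3 + (1 + (1 + 0))) + 1) (Lam * Suc ((2 * cnt i + 2) + (1 + (1 + 0))) + 1) (?I Lam)"
  proof (rule tri_while_const[where I = ?I, OF c])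
    fix k m r s assume "scan_inv i (2 ^ k) (lo m) (vw m) r s \<and> s 7 = 2 ^ k \<and> s 8 = k"
    then have "s 8 = k" "s 2 = Lam" by (auto simp: scan_inv_def rel_inv_def min_inv_def core_def base_env_def)
    then show "eval w m r s (Less (Var 8) (Var 2)) \<noteq> 0 \<longleftrightarrow> k < Lam" by (simp add: evs)
  qed
  show ?thesis by (rule tri_conseq[OF tri_Cons[OF a tri_Cons[OF b d]]]) (auto simp: algebra_simps)
qed

end

text \<open>Prefix counts are strictly increasing on \<open>J\<close>, so after subtracting one they
  are consecutive target positions for the compaction.\<close>

lemma bij_betw_rank:
  fixes J :: "nat set"
  assumes "finite J"
  shows "bij_betw (\<lambda>j. card {j' \<in> J. j' \<le> j} - 1) J {..<card J}"
proof -
  let ?c = "\<lambda>j. card {j' \<in> J. j' \<le> j}"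
  have pos: "1 \<le> ?c j" if "j \<in> J" for j
    using that assms by (simp add: Suc_le_eq card_gt_0_iff) blast
  have less: "?c i < ?c j" if "i < j" "j \<in> J" for i j
  proof (rule psubset_card_mono)
    have "j \<in> {j' \<in> J. j' \<le> j}" "j \<notin> {j' \<in> J. j' \<le> i}" using that by auto
    then show "{j' \<in> J. j' \<le> i} \<subset> {j' \<in> J. j' \<le> j}" using that by fastforce
  qed (use assms in simp)
  have inj: "inj_on (\<lambda>j. ?c j - 1) J"
  proof (rule inj_onI, rule ccontr)
    fix x y assume "x \<in> J" "y \<in> J" "?c x - 1 = ?c y - 1" "x \<noteq> y"
    then show False using less[of x y] less[of y x] pos[of x] pos[of y] by (cases "x < y") auto
  qed
  have "(\<lambda>j. ?c j - 1) ` J \<subseteq> {..<card J}"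
  proof
    fix x assume "x \<in> (\<lambda>j. ?c j - 1) ` J"
    then obtain j where j: "j \<in> J" "x = ?c j - 1" by auto
    have "?c j \<le> card J" using assms by (intro card_mono) auto
    then show "x \<in> {..<card J}" using pos[OF j(1)] j(2) by auto
  qed
  then have "(\<lambda>j. ?c j - 1) ` J = {..<card J}"
    using card_image[OF inj] by (intro card_subset_eq) auto
  then show ?thesis using inj by (simp add: bij_betw_def)
qed

context rounds
begin

definition bor_inv :: "nat \<Rightarrow> assertion" where
  "bor_inv i l V r s \<longleftrightarrow> core i l V r s \<and> (\<forall>x b c. V 3 (i, x, b, c) = 0)"

definition done_inv :: "nat \<Rightarrow> assertion" where
  "done_inv i l V r s \<longleftrightarrow> scan_inv i M l V r s \<and> LSok (Suc i) (V 1)"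

lemma flag_count_all:
  assumes "j < cnt i"
  shows "flag_count i F M j = card {j' \<in> {j. j < cnt i \<and> F (i, j, 0, 0) \<in> rA (Suc i)}. j' \<le> j}"
  using assms cnt_M[of i] unfolding flag_count_def by (intro arg_cong[where f = card]) auto

lemma flagged:
  assumes "bij_betw (\<lambda>j. F (i, j, 0, 0)) {..<cnt i} (rA i)"
  shows "bij_betw (\<lambda>j. F (i, j, 0, 0)) {j. j < cnt i \<and> F (i, j, 0, 0) \<in> rA (Suc i)} (rA (Suc i))"
    "card {j. j < cnt i \<and> F (i, j, 0, 0) \<in> rA (Suc i)} = cnt (Suc i)"
proof -
  have "(\<lambda>j. F (i, j, 0, 0)) ` {j. j < cnt i \<and> F (i, j, 0, 0) \<in> rA (Suc i)} = rA (Suc i)"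
    using bij_betw_imp_surj_on[OF assms] rA_mono[of i] by force
  moreover have "inj_on (\<lambda>j. F (i, j, 0, 0)) {j. j < cnt i \<and> F (i, j, 0, 0) \<in> rA (Suc i)}"
    using bij_betw_imp_inj_on[OF assms] by (rule inj_on_subset) auto
  ultimately show b: "bij_betw (\<lambda>j. F (i, j, 0, 0)) {j. j < cnt i \<and> F (i, j, 0, 0) \<in> rA (Suc i)} (rA (Suc i))"
    by (simp add: bij_betw_def)
  show "card {j. j < cnt i \<and> F (i, j, 0, 0) \<in> rA (Suc i)} = cnt (Suc i)"
    using bij_betw_same_card[OF b] by (simp add: cnt_def)
qed

lemma tri_compact_par:
  assumes i: "i < R"
  shows "tri [compact_par] (scan_inv i M) 5 (4 * cnt i + 2) (done_inv i)"
proof -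
  let ?as = "[(21::nat, LD 1 (Var 6) (Var 20) C0 C0), (22, e_loop)]"
  have "tri [compact_par] (scan_inv i M) (length ?as + 3) (cnt i * (length ?as + 2) + 2) (done_inv i)"
    unfolding compact_par_def
  proof (rule tri_par)
    fix m r s assume pre: "scan_inv i M (lo m) (vw m) r s"
    then have inv: "rel_inv i (lo m) (vw m) r s"
      and S: "\<And>j. j < cnt i \<Longrightarrow> vw m 5 (i, j, 0, 0) = flag_count i (vw m 1) M j"
      by (auto simp: scan_inv_def)
    note s = rel_invD[OF inv]
    define h where "h j = vw m 1 (i, j, 0, 0)" for j
    define J where "J = {j. j < cnt i \<and> h j \<in> rA (Suc i)}"
    \<comment> \<open>A loop may share its prefix count with a survivor, and before the first
      survivor the subtraction is truncated at 0; the third index keeps such writes away from the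
      list of survivors.\<close>
    define idx where "idx j = (Suc i, flag_count i (vw m 1) M j - 1, of_bool (h j \<notin> rA (Suc i)) :: nat, 0::nat)" for j
    have "let s' = assigns w m r ?as (s(20 := j)) in s' 3 = B \<and> inb (idx j) \<and>
       (eval w m r s' (Plus (Var 6) C1), eval w m r s' (Minus (LD 5 (Var 6) (Var 20) C0 C0) C1), eval w m r s' (Var 22), eval w m r s' C0) = idx j \<and>
       eval w m r s' (Var 21) = h j" if j: "j < cnt i" for j
    proof -
      have jB: "j < B" using j cnt_M[of i] BM by linarith
      have fb: "flag_count i (vw m 1) M j - 1 < B"
        using flag_count_le[of i "vw m 1" M j] j cnt_M[of i] BM by linarith
      have e1: "eval w m r (s(20 := j)) (LD 1 (Var 6) (Var 20) C0 C0) = h j"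
        using s jB i_less[OF i] by (simp add: evs h_def)
      have h: "h j \<in> rA i" using bij_betwE[OF s(7)] j by (auto simp: h_def)
      have e2: "eval w m r (s(20 := j, 21 := h j)) e_loop = of_bool (h j \<notin> rA (Suc i))"
        by (rule eval_loop[OF i s(6) h]) (use s in auto)
      have e3: "eval w m r (s(20 := j, 21 := h j, 22 := of_bool (h j \<notin> rA (Suc i)))) (LD 5 (Var 6) (Var 20) C0 C0) =
          flag_count i (vw m 1) M j"
        using s jB i_less[OF i] S[OF j] by (simp add: evs)
      have "of_bool (h j \<notin> rA (Suc i)) < B" using i_less[OF i] by (simp add: of_bool_def)
      then show ?thesis unfolding assigns.simps fst_conv snd_conv e1 e2 Let_def
        using s fb i_less[OF i] e3 by (simp add: evs idx_def)
    qed
    moreover have "done_inv i (lo m) ((vw m)(1 := upd (vw m 1) {..<cnt i} idx h)) r s"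
    proof -
      let ?U = "upd (vw m 1) {..<cnt i} idx h"
      have old: "?U (k, j, 0, 0) = vw m 1 (k, j, 0, 0)" if "k \<le> i" for k j
        by (rule upd_miss) (use that in \<open>auto simp: idx_def\<close>)
      have hJ: "bij_betw h J (rA (Suc i))" "card J = cnt (Suc i)"
        using flagged[OF s(7)] unfolding h_def J_def by auto
      have fJ: "finite J" by (simp add: J_def)
      define p where "p j = card {j' \<in> J. j' \<le> j} - 1" for j
      have pJ: "bij_betw p J {..<cnt (Suc i)}"
        using bij_betw_rank[OF fJ] hJ(2) unfolding p_def by simp
      have fc: "flag_count i (vw m 1) M j - 1 = p j" if "j \<in> J" for j
        using flag_count_all[of j i "vw m 1"] that unfolding p_def J_def h_def by simp
      have "?U (Suc i, p j, 0, 0) = h j" if j: "j \<in> J" for j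
      proof (rule upd_hit[of j])
        show "j \<in> {..<cnt i}" "idx j = (Suc i, p j, 0, 0)" using j fc[OF j] by (auto simp: J_def idx_def)
        fix j' assume j': "j' \<in> {..<cnt i}" "idx j' = (Suc i, p j, 0, 0)"
        then have "j' \<in> J" by (auto simp: idx_def J_def)
        then have "p j' = p j" using j' fc by (simp add: idx_def)
        then show "h j' = h j" using inj_onD[OF bij_betw_imp_inj_on[OF pJ]] \<open>j' \<in> J\<close> j by metis
      qed
      then have "bij_betw ((\<lambda>q. ?U (Suc i, q, 0, 0)) \<circ> p) J (rA (Suc i))"
        using hJ(1) by (subst bij_betw_cong[of _ _ h]) auto
      then have "bij_betw (\<lambda>q. ?U (Suc i, q, 0, 0)) {..<cnt (Suc i)} (rA (Suc i))"
        using bij_betw_comp_iff[OF pJ] by blast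
      moreover have "LSok i (vw m 1)" using s(1) by (simp add: core_def)
      ultimately have "LSok (Suc i) ?U" using old by (auto simp: LSok_def le_Suc_eq)
      moreover from this have "LSok i ?U" by (auto simp: LSok_def)
      moreover have "flag_count i ?U k j = flag_count i (vw m 1) k j" for k j
        unfolding flag_count_def old[OF le_refl] ..
      ultimately show ?thesis using pre
        by (simp add: done_inv_def scan_inv_def rel_inv_def min_inv_def core_def)
    qed
    ultimately show "\<exists>idx v. eval w m r s (Var 9) = cnt i \<and> (\<forall>j<cnt i.
      let s' = assigns w m r ?as (s(20 := j)) in s' 3 = B \<and> inb (idx j) \<and>
       (eval w m r s' (Plus (Var 6) C1), eval w m r s' (Minus (LD 5 (Var 6) (Var 20) C0 C0) C1), eval w m r s' (Var 22), eval w m r s' C0) = idx j \<and>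
       eval w m r s' (Var 21) = v j) \<and> done_inv i (lo m) ((vw m)(1 := upd (vw m 1) {..<cnt i} idx v)) r s"
      using eval_Var[of m r s 9, unfolded s(4)] by (intro exI[of _ idx] exI[of _ h]) blast
  qed auto
  then show ?thesis by (rule tri_conseq) auto
qed

lemma tri_round_end:
  assumes i: "i < R"
  shows "tri [Assign 9 (LD 5 (Var 6) (Minus (Var 9) C1) C0 C0), Inc 6, Par C1 [] 6 (Var 6) C0 C0 C0 (Var 9)]
    (done_inv i) 5 6 (bor_inv (Suc i))"
proof -
  let ?Q = "\<lambda>l V r s. l = l0 \<and> r = r0 \<and> base_env s \<and> s 9 = cnt (Suc i) \<and> V 10 = Z \<and>
     fresh {7, 8, 9} V \<and> LSok (Suc i) (V 1) \<and> EPok (Suc i) (V 2) \<and> PRok (Suc i) (V 3) \<and>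
     (\<forall>x b c. V 3 (Suc i, x, b, c) = 0) \<and> MMok i (V 6)"
  have a: "tri [Assign 9 (LD 5 (Var 6) (Minus (Var 9) C1) C0 C0)] (done_inv i) 1 1 (\<lambda>l V r s. ?Q l V r s \<and> s 6 = i)"
  proof (rule tri_Assign)
    fix m r s assume pre: "done_inv i (lo m) (vw m) r s"
    then have inv: "rel_inv i (lo m) (vw m) r s" and LS: "LSok (Suc i) (vw m 1)"
      and S: "\<And>j. j < cnt i \<Longrightarrow> vw m 5 (i, j, 0, 0) = flag_count i (vw m 1) M j"
      by (auto simp: scan_inv_def done_inv_def)
    note s = rel_invD[OF inv]
    \<comment> \<open>The last prefix sum is the number of survivors; position
      \<open>cnt i - 1\<close> exists because the round is not empty.\<close>
    have c0: "0 < cnt i" using R_ne[OF i] rA_finite[of i] by (simp add: cnt_def card_gt_0_iff)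
    have jB: "cnt i - 1 < B" using cnt_M[of i] BM by linarith
    have "flag_count i (vw m 1) M (cnt i - 1) = card {j. j < cnt i \<and> vw m 1 (i, j, 0, 0) \<in> rA (Suc i)}"
      using flag_count_all[of "cnt i - 1" i "vw m 1"] c0
      by (auto intro!: arg_cong[where f = card])
    then have "eval w m r s (LD 5 (Var 6) (Minus (Var 9) C1) C0 C0) = cnt (Suc i)"
      using s jB i_less[OF i] S[of "cnt i - 1"] c0 flagged(2)[OF s(7)] by (simp add: evs)
    moreover have "PRok (Suc i) (vw m 3) \<and> (\<forall>x b c. vw m 3 (Suc i, x, b, c) = 0)"
      using inv by (auto simp: rel_inv_def min_inv_def core_def PRok_def less_Suc_eq)
    ultimately show "?Q (lo m) (vw m) r (s(9 := eval w m r s (LD 5 (Var 6) (Minus (Var 9) C1) C0 C0))) \<and>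
      (s(9 := eval w m r s (LD 5 (Var 6) (Minus (Var 9) C1) C0 C0))) 6 = i"
      using s(1,6) LS by (simp add: core_def)
  qed
  have b: "tri [Inc 6] (\<lambda>l V r s. ?Q l V r s \<and> s 6 = i) 1 1 (\<lambda>l V r s. ?Q l V r s \<and> s 6 = Suc i)"
    by (rule tri_Assign) (use i_less[OF i] in \<open>simp add: evs\<close>)
  have c: "tri [Par C1 [] 6 (Var 6) C0 C0 C0 (Var 9)] (\<lambda>l V r s. ?Q l V r s \<and> s 6 = Suc i)
    (length ([]::(nat \<times> exp) list) + 3) (1 * (length ([]::(nat \<times> exp) list) + 2) + 2) (bor_inv (Suc i))"
  proof (rule tri_par)
    fix m r s assume pre: "?Q (lo m) (vw m) r s \<and> s 6 = Suc i"
    then have s: "s 3 = B" "s 6 = Suc i" "s 9 = cnt (Suc i)" by (auto simp: base_env_def)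
    let ?idx = "\<lambda>j::nat. (Suc i, 0::nat, 0::nat, 0::nat)"
    have "upd (vw m 6) {..<1} ?idx (\<lambda>_. cnt (Suc i)) (Suc i, 0, 0, 0) = cnt (Suc i)"
      by (rule upd_hit[of 0]) auto
    moreover have "upd (vw m 6) {..<1} ?idx (\<lambda>_. cnt (Suc i)) (k, 0, 0, 0) = vw m 6 (k, 0, 0, 0)" if "k \<noteq> Suc i" for k
      by (rule upd_miss) (use that in auto)
    ultimately have "MMok (Suc i) (upd (vw m 6) {..<1} ?idx (\<lambda>_. cnt (Suc i)))"
      using pre by (auto simp: MMok_def le_Suc_eq)
    then show "\<exists>idx v. eval w m r s C1 = 1 \<and> (\<forall>j<1.
      let s' = assigns w m r [] (s(20 := j)) in s' 3 = B \<and> inb (idx j) \<and>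
       (eval w m r s' (Var 6), eval w m r s' C0, eval w m r s' C0, eval w m r s' C0) = idx j \<and>
       eval w m r s' (Var 9) = v j) \<and> bor_inv (Suc i) (lo m) ((vw m)(6 := upd (vw m 6) {..<1} idx v)) r s"
      using pre s i_less[OF i]
      by (intro exI[of _ ?idx] exI[of _ "\<lambda>_. cnt (Suc i)"]) (simp add: evs bor_inv_def core_def)
  qed auto
  show ?thesis by (rule tri_conseq[OF tri_Cons[OF a tri_Cons[OF b tri_Cons[OF c tri_Nil]]]]) auto
qed

lemma tri_round:
  assumes i: "i < R"
  shows "tri round_body (bor_inv i) (50 * (Lam + 1)) (60 * (cnt i * (Lam + 1)) + 50 * (Lam + 1)) (bor_inv (Suc i))"
proof -
  have e: "round_body = [min_par] @ [hook_par] @ [Assign 8 C0, WhileNZ (Less (Var 8) (Var 2)) [jump_par, Inc 8]] @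
     [relabel_par] @ [flag_par] @ [Assign 7 C1, Assign 8 C0, WhileNZ (Less (Var 8) (Var 2)) [scan_par, Dbl 7, Inc 8]] @
     [compact_par] @ [Assign 9 (LD 5 (Var 6) (Minus (Var 9) C1) C0 C0), Inc 6, Par C1 [] 6 (Var 6) C0 C0 C0 (Var 9)]"
    by (simp add: round_body_def)
  show ?thesis unfolding e
  proof (rule tri_conseq[OF tri_append[OF tri_min_par[OF i] tri_append[OF tri_hook_par[OF i]
      tri_append[OF tri_jump_loop[OF i] tri_append[OF tri_relabel_par[OF i] tri_append[OF tri_flag_par[OF i]
      tri_append[OF tri_scan_loop[OF i] tri_append[OF tri_compact_par[OF i] tri_round_end[OF i]]]]]]]]])
    show "8 * cnt i + 2 + (14 * cnt i + 2 + (Lam * (10 * cnt i + 4) + 2 + (8 * cnt i + 2 + (3 * cnt i + 2 +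
      (Lam * (2 * cnt i + 5) + 3 + (4 * cnt i + 2 + 6)))))) \<le> 60 * (cnt i * (Lam + 1)) + 50 * (Lam + 1)"
      by (simp add: algebra_simps)
  qed (auto simp: bor_inv_def)
qed

text \<open>A round has an overhead of order \<open>Lam + 1\<close> however few edges it has; over
  \<open>R \<le> Lam < M\<close> rounds this is absorbed by \<open>M * (Lam + 1)\<close>.\<close>

lemma tri_rounds:
  "tri [WhileNZ (Var 9) round_body] (bor_inv 0) (60 * (Lam + 1)\<^sup>2) (200 * M * (Lam + 1)) (bor_inv R)"
proof -
  have a: "tri [WhileNZ (Var 9) round_body] (bor_inv 0) ((\<Sum>k<R. Suc (50 * (Lam + 1))) + 1)
     ((\<Sum>k<R. Suc (60 * (cnt k * (Lam + 1)) + 50 * (Lam + 1))) + 1) (bor_inv R)"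
  proof (rule tri_while[where I = bor_inv, OF tri_round])
    fix k m r s assume "k \<le> R" "bor_inv k (lo m) (vw m) r s"
    moreover have "cnt k \<noteq> 0 \<longleftrightarrow> k < R" if "k \<le> R"
      using that R_ne[of k] R_empty rA_finite[of k] by (cases "k = R") (auto simp: cnt_def)
    ultimately show "eval w m r s (Var 9) \<noteq> 0 \<longleftrightarrow> k < R" by (simp add: evs bor_inv_def core_def)
  qed
  have "R * Suc (50 * (Lam + 1)) + 1 \<le> Lam * Suc (50 * (Lam + 1)) + 1"
    using R_le by (simp only: add_le_cancel_right) (rule mult_le_mono1)
  also have "\<dots> \<le> 60 * (Lam + 1)\<^sup>2" by (simp add: power2_eq_square algebra_simps)
  finally have d: "(\<Sum>k<R. Suc (50 * (Lam + 1))) + 1 \<le> 60 * (Lam + 1)\<^sup>2" by simp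
  have "(\<Sum>k<R. Suc (60 * (cnt k * (Lam + 1)) + 50 * (Lam + 1))) =
     60 * (Lam + 1) * (\<Sum>k<R. cnt k) + R * Suc (50 * (Lam + 1))"
    by (simp add: sum.distrib sum_distrib_left algebra_simps)
  also have "\<dots> \<le> 60 * (Lam + 1) * (2 * M) + M * (51 * (Lam + 1))"
  proof (intro add_mono mult_le_mono2 sum_cnt mult_le_mono)
    show "R \<le> M" using R_le Lam_less by linarith
  qed simp
  finally have k: "(\<Sum>k<R. Suc (60 * (cnt k * (Lam + 1)) + 50 * (Lam + 1))) + 1 \<le> 200 * M * (Lam + 1)"
  proof -
    assume a: "(\<Sum>k<R. Suc (60 * (cnt k * (Lam + 1)) + 50 * (Lam + 1))) \<le> 60 * (Lam + 1) * (2 * M) + M * (51 * (Lam + 1))"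
    have "60 * (Lam + 1) * (2 * M) + M * (51 * (Lam + 1)) = 171 * (M * (Lam + 1))" by (simp add: algebra_simps)
    moreover have "1 \<le> M * (Lam + 1)" by (simp add: Suc_le_eq)
    moreover have "200 * M * (Lam + 1) = 200 * (M * (Lam + 1))" by simp
    ultimately show ?thesis using a by linarith
  qed
  show ?thesis using d k by (rule tri_conseq[OF a, rotated 2]) auto
qed

end

section \<open>Unwinding the rounds\<close>

text \<open>
  Array 7: ancestors at distance \<open>2 ^ l\<close> in the dendrogram of the next round; array 8: for a
  contracted edge, the topmost node below it in that dendrogram on the path from its vertex, and
  for other edges the edge itself; array 9: lightest edge for every value of array 8 and every
  dyadic block of labels.
\<close>

definition e_node :: exp where
  "e_node = EIte (Less (Var 22) (Const 2)) (LD 2 (Plus (Var 6) C1) (Var 21) (Mod (Var 22) (Const 2)) C0) (Var 21)"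

definition e_nu :: exp where "e_nu = LD 8 (Var 6) (Var 21) C0 C0"

definition up_par :: instr where
  "up_par = ParL (Plus (Var 6) C1) (Var 10) 3 [(23, e_node)] 7 (Var 6) C0 (Var 23) C0
     (LD 3 (Plus (Var 6) C1) (Var 23) C0 C0)"

definition lift_par :: instr where
  "lift_par = ParL (Plus (Var 6) C1) (Var 10) 3 [(23, e_node)] 7 (Var 6) (Plus (Var 8) C1) (Var 23) C0
     (LD 7 (Var 6) (Var 8) (LD 7 (Var 6) (Var 8) (Var 23) C0) C0)"

definition start_par :: instr where
  "start_par = ParL (Var 6) (Var 9) 1 [] 8 (Var 6) (Var 21) C0 C0
     (EIte e_loop (LD 2 (Plus (Var 6) C1) (Var 21) C0 C0) (Var 21))"

definition descend_par :: instr where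
  "descend_par = ParL (Var 6) (Var 9) 1 [(23, e_nu), (24, LD 7 (Var 6) (Var 8) (Var 23) C0)] 8 (Var 6) (Var 21) C0 C0
     (EIte (EAnd (Var 24) (Less (Var 24) (Var 21))) (Var 24) (Var 23))"

definition par0_par :: instr where
  "par0_par = ParL (Var 6) (Var 9) 1 [(23, e_nu)] 3 (Var 6) (Var 21) C0 C0
     (LD 3 (Plus (Var 6) C1) (Var 23) C0 C0)"

definition block_par :: instr where
  "block_par = ParL (Var 6) (Var 9) 1 [(23, e_nu)] 9 (Var 6) (Var 8) (Var 23) (Div (Var 21) (Var 7)) (Var 21)"

definition next_par :: instr where
  "next_par = ParL (Var 6) (Var 9) 1 [(25, e_nu), (23, LD 9 (Var 6) (Var 8) (Var 25) (Plus (Div (Var 21) (Var 7)) C1)),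
       (24, LD 3 (Var 6) (Var 21) C0 C0)] 3 (Var 6) (Var 21) C0 C0
     (EIte (EAnd (ENot (Mod (Div (Var 21) (Var 7)) (Const 2))) (EAnd (Var 23) (EOr (ENot (Var 24)) (Less (Var 23) (Var 24)))))
       (Var 23) (Var 24))"

definition unwind_body :: "instr list" where
  "unwind_body = [Assign 6 (Minus (Var 6) C1), Assign 9 (LD 6 (Var 6) C0 C0 C0),
     Assign 10 (LD 6 (Plus (Var 6) C1) C0 C0 C0), up_par, Assign 8 C0,
     WhileNZ (Less (Var 8) (Var 2)) [lift_par, Inc 8], start_par, Assign 8 (Plus (Var 2) C1),
     WhileNZ (Var 8) [Assign 8 (Minus (Var 8) C1), descend_par], par0_par, Assign 7 C1, Assign 8 C0,
     WhileNZ (Less (Var 8) (Plus (Var 2) C1)) [block_par, next_par, Dbl 7, Inc 8]]"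

text \<open>At the highest bit in which \<open>e\<close> and \<open>g\<close> differ, they lie in
  sibling blocks. Hence the minima of the right sibling blocks over all levels cover every later
  element of a chain.\<close>

lemma dyadic_split:
  "e < g \<Longrightarrow> g < 2 ^ K \<Longrightarrow> \<exists>l<K. even (e div 2 ^ l) \<and> g div 2 ^ l = e div 2 ^ l + (1::nat)"
proof (induction K arbitrary: e g)
  case (Suc K)
  show ?case
  proof (cases "e div 2 = g div 2")
    case True
    then have "even e \<and> g = e + 1" using Suc.prems(1) by presburger
    then show ?thesis by (intro exI[of _ 0]) auto
  next
    case False
    then have "e div 2 < g div 2" "g div 2 < 2 ^ K" using Suc.prems by auto
    from Suc.IH[OF this] obtain l where "l < K" "even (e div 2 div 2 ^ l)"
      "g div 2 div 2 ^ l = e div 2 div 2 ^ l + 1" by blast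
    then show ?thesis by (intro exI[of _ "Suc l"]) (auto simp: div_mult2_eq)
  qed
qed simp

lemma minz_Un:
  assumes "finite X" "finite S" "0 \<notin> X"
  shows "minz (X \<union> S) = (if S \<noteq> {} \<and> (minz X = 0 \<or> Min S < minz X) then Min S else minz X)"
proof (cases "X = {} \<or> S = {}")
  case False
  then have "minz X \<in> X" using assms by (simp add: minz_def)
  then have "minz X \<noteq> 0" using assms(3) by metis
  moreover have "minz X = Min X" "minz (X \<union> S) = min (Min X) (Min S)" "S \<noteq> {}"
    using False assms by (auto simp: minz_def Min_Un)
  ultimately show ?thesis unfolding min_def by auto
qed (use assms in \<open>auto simp: minz_def\<close>)

section \<open>Ancestors in the contracted dendrogram\<close>

context rounds
begin

definition nodes :: "nat \<Rightarrow> nat set" where "nodes i = rV i \<union> rA i"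

definition pf :: "nat \<Rightarrow> nat \<Rightarrow> nat" where "pf i = par (rA (Suc i)) (rE (Suc i))"

lemma nodes_bounds: "i \<le> R \<Longrightarrow> x \<in> nodes i \<Longrightarrow> 0 < x \<and> x < 2 * n \<and> x < B"
  using rV_pos[of i x] rV_sub[of i] rA_sub[of i] rV_less[of i x] rA_less[of x i] by (force simp: nodes_def)

lemma pf_in: "pf i x \<noteq> 0 \<Longrightarrow> x < pf i x \<and> pf i x \<in> rA (Suc i)"
  unfolding pf_def by (rule par_gt[OF rA_finite])

text \<open>0 belongs to no component of the tree, so it is a sink in which the ancestor pointers
  come to rest.\<close>

lemma pf_0: "i < R \<Longrightarrow> pf i 0 = 0"
proof (rule ccontr)
  assume i: "i < R" and ne: "pf i 0 \<noteq> 0"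
  have t: "ctree (rV (Suc i)) (rA (Suc i)) (rE (Suc i))" using tree i by simp
  have zero: "0 \<notin> rA (Suc i)" using keys by blast
  have "pf i 0 \<in> parset (rA (Suc i)) (rE (Suc i)) 0"
    using par_in[OF rA_finite] ne unfolding pf_def by blast
  then have p: "pf i 0 \<in> rA (Suc i)" "conn (cut (rA (Suc i)) (pf i 0)) (rE (Suc i)) 0 (rE (Suc i) (pf i 0) 0)"
    using zero by (auto simp: parset_def rep_def)
  have "rE (Suc i) (pf i 0) 0 \<in> rV (Suc i)" using ctreeD(4)[OF t p(1)] by simp
  then have "0 \<in> rV (Suc i)"
    using conn_in_V[OF t _ conn_sym[OF p(2)]] sep[of "Suc i"] i by auto
  then show False using rV_pos[of "Suc i" 0] i by simp
qed

lemma pf_pow_0: "i < R \<Longrightarrow> (pf i ^^ k) 0 = 0"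
  by (induction k) (auto simp: pf_0)

lemma pf_pow_in: "i < R \<Longrightarrow> x \<in> nodes (Suc i) \<union> {0} \<Longrightarrow> (pf i ^^ k) x \<in> nodes (Suc i) \<union> {0}"
  using pf_in by (induction k) (auto simp: nodes_def pf_0)

text \<open>Parents have larger numbers, so \<open>k\<close> steps raise the number by at least
  \<open>k\<close>; this bounds the length of ancestor chains.\<close>

lemma pf_pow_chain:
  assumes "i < R" "(pf i ^^ k) x \<noteq> 0"
  shows "x + k \<le> (pf i ^^ k) x \<and>
    conn (cut (rA (Suc i)) ((pf i ^^ k) x)) (rE (Suc i)) (rep (rA (Suc i)) (rE (Suc i)) x)
      (rep (rA (Suc i)) (rE (Suc i)) ((pf i ^^ k) x))"
  using assms(2)
proof (induction k)
  case (Suc k)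
  let ?y = "(pf i ^^ k) x"
  have "?y \<noteq> 0"
  proof
    assume "?y = 0"
    then show False using Suc.prems pf_0[OF assms(1)] by simp
  qed
  from Suc.IH[OF this] have IH: "x + k \<le> ?y" "conn (cut (rA (Suc i)) ?y) (rE (Suc i)) (rep (rA (Suc i)) (rE (Suc i)) x)
      (rep (rA (Suc i)) (rE (Suc i)) ?y)" by auto
  have p: "?y < pf i ?y" "pf i ?y \<in> rA (Suc i)" using pf_in Suc.prems by auto
  have "pf i ?y \<in> parset (rA (Suc i)) (rE (Suc i)) ?y"
    using par_in[OF rA_finite, of "Suc i" "rE (Suc i)" ?y] Suc.prems unfolding pf_def by simp
  then have "conn (cut (rA (Suc i)) (pf i ?y)) (rE (Suc i)) (rep (rA (Suc i)) (rE (Suc i)) ?y)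
      (rep (rA (Suc i)) (rE (Suc i)) (pf i ?y))" by (simp add: parset_def rep_def)
  moreover have "conn (cut (rA (Suc i)) (pf i ?y)) (rE (Suc i)) (rep (rA (Suc i)) (rE (Suc i)) x)
      (rep (rA (Suc i)) (rE (Suc i)) ?y)"
    using IH(2) by (rule conn_mono) (use p in auto)
  ultimately show ?case using IH(1) p(1) by (auto intro: conn_trans)
qed simp

definition ucore :: "nat \<Rightarrow> assertion" where
  "ucore i l V r s \<longleftrightarrow> l = l0 \<and> r = r0 \<and> base_env s \<and> s 6 = i \<and> s 9 = cnt i \<and> s 10 = cnt (Suc i) \<and>
     V 10 = Z \<and> LSok R (V 1) \<and> EPok R (V 2) \<and> MMok R (V 6) \<and>
     (\<forall>k\<le>i. \<forall>x\<in>rV k. V 3 (k, x, 0, 0) = mn (rA k) (rE k) x) \<and>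
     (\<forall>x\<in>nodes (Suc i). V 3 (Suc i, x, 0, 0) = pf i x) \<and>
     (\<forall>k<i. \<forall>b c d. V 7 (k, b, c, d) = 0 \<and> V 9 (k, b, c, d) = 0)"

lemma ucore_env: "x = 7 \<or> x = 8 \<Longrightarrow> ucore i l V r (s(x := v)) = ucore i l V r s"
  by (auto simp: ucore_def)

lemma ucore_upd:
  assumes "ucore i l V r s" "\<And>j. j \<in> I \<Longrightarrow> fst (idx j) = i"
  shows "t \<in> {7, 8, 9} \<Longrightarrow> ucore i l (V(t := upd (V t) I idx v)) r s"
    and "(\<And>j. j \<in> I \<Longrightarrow> fst (snd (idx j)) \<notin> rV i) \<Longrightarrow> ucore i l (V(3 := upd (V 3) I idx v)) r s"
proof -
  have *: "upd F I idx v (k, p) = F (k, p)" if "k \<noteq> i" for F k p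
    by (rule upd_miss) (use assms(2) that in fastforce)
  show "t \<in> {7, 8, 9} \<Longrightarrow> ucore i l (V(t := upd (V t) I idx v)) r s"
    using assms(1) * unfolding ucore_def by auto
  assume "\<And>j. j \<in> I \<Longrightarrow> fst (snd (idx j)) \<notin> rV i"
  then have "upd F I idx v (i, x, p) = F (i, x, p)" if "x \<in> rV i" for F x p
    by (intro upd_miss) (use that in force)
  then have "upd (V 3) I idx v (k, x, 0, 0) = V 3 (k, x, 0, 0)" if "x \<in> rV k" for k x
    using that * by (cases "k = i") auto
  then show "ucore i l (V(3 := upd (V 3) I idx v)) r s"
    using assms(1) * unfolding ucore_def by simp
qed

lemma tri_unw_par:
  assumes i: "i < R" and k: "k = i \<and> li = Var 6 \<and> cn = Var 9 \<or> k = Suc i \<and> li = Plus (Var 6) C1 \<and> cn = Var 10"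
    and c: "1 \<le> c" "c < 4" and t: "1 \<le> t" "t < 16"
    and core: "\<And>m r s. Pre (lo m) (vw m) r s \<Longrightarrow> ucore i (lo m) (vw m) r s"
    and ex: "\<And>m r s. Pre (lo m) (vw m) r s \<Longrightarrow> \<exists>idx v.
     (\<forall>e\<in>rA k. \<forall>q<c. \<forall>s'. s' 21 = e \<longrightarrow> s' 22 = q \<longrightarrow> s' 3 = B \<longrightarrow> s' 6 = i \<longrightarrow> s' 7 = s 7 \<longrightarrow> s' 8 = s 8 \<longrightarrow>
       (let s'' = assigns w m r as s' in s'' 3 = B \<and> inb (idx e q) \<and>
       (eval w m r s'' ea, eval w m r s'' eb, eval w m r s'' ec, eval w m r s'' ed) = idx e q \<and>
       eval w m r s'' val = v e q)) \<and>
     Post (lo m) ((vw m)(t := upd (vw m t) (rA k \<times> {..<c}) (\<lambda>(e, q). idx e q) (\<lambda>(e, q). v e q))) r s"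
  shows "tri [ParL li cn c as t ea eb ec ed val] Pre
    (length as + 5) (c * cnt k * (length as + 4) + 2) Post"
  unfolding cnt_def
proof (rule tri_ParL)
  have "c * card (rA k) \<le> 4 * M" using c cnt_M[of k] by (intro mult_le_mono) (auto simp: cnt_def)
  then show "c * card (rA k) < 16 * B" "card (rA k) \<le> B"
    using cnt_M[of k] BM by (auto simp: cnt_def)
  show "finite (rA k)" by (rule rA_finite)
  fix m r s assume pre: "Pre (lo m) (vw m) r s"
  have co: "ucore i (lo m) (vw m) r s" using core[OF pre] .
  then have s: "s 3 = B" "s 6 = i" "s 9 = cnt i" "s 10 = cnt (Suc i)" "LSok R (vw m 1)"
    by (auto simp: ucore_def base_env_def)
  have kR: "k \<le> R" "k < B" using k i i_less[OF i] by auto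
  have "bij_betw (\<lambda>j. vw m 1 (k, j, 0, 0)) {..<card (rA k)} (rA k)"
    using s(5) kR by (simp add: LSok_def cnt_def)
  then show "eval w m r s cn = card (rA k) \<and> s 3 = B \<and> k < B \<and>
      bij_betw (\<lambda>j. vw m 1 (k, j, 0, 0)) {..<card (rA k)} (rA k) \<and>
      (\<forall>j. eval w m r (s(20 := j)) li = k)"
    using s kR k i_less[OF i] by (auto simp: evs cnt_def)
  from ex[OF pre] obtain idx v where
    1: "\<And>e q s'. e \<in> rA k \<Longrightarrow> q < c \<Longrightarrow> s' 21 = e \<Longrightarrow> s' 22 = q \<Longrightarrow> s' 3 = B \<Longrightarrow> s' 6 = i \<Longrightarrow> s' 7 = s 7 \<Longrightarrow> s' 8 = s 8 \<Longrightarrow>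
       (let s'' = assigns w m r as s' in s'' 3 = B \<and> inb (idx e q) \<and>
       (eval w m r s'' ea, eval w m r s'' eb, eval w m r s'' ec, eval w m r s'' ed) = idx e q \<and>
       eval w m r s'' val = v e q)" and
    2: "Post (lo m) ((vw m)(t := upd (vw m t) (rA k \<times> {..<c}) (\<lambda>(e, q). idx e q) (\<lambda>(e, q). v e q))) r s"
    by blast
  have "\<forall>e\<in>rA k. \<forall>q<c. \<forall>s'. s' 21 = e \<longrightarrow> s' 22 = q \<longrightarrow> (\<forall>y<20. s' y = s y) \<longrightarrow>
       (let s'' = assigns w m r as s' in s'' 3 = B \<and> inb (idx e q) \<and>
       (eval w m r s'' ea, eval w m r s'' eb, eval w m r s'' ec, eval w m r s'' ed) = idx e q \<and>
       eval w m r s'' val = v e q)"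
    by (intro ballI allI impI, rule 1) (use s in auto)
  then show "\<exists>idx v. (\<forall>e\<in>rA k. \<forall>q<c. \<forall>s'. s' 21 = e \<longrightarrow> s' 22 = q \<longrightarrow> (\<forall>y<20. s' y = s y) \<longrightarrow>
       (let s'' = assigns w m r as s' in s'' 3 = B \<and> inb (idx e q) \<and>
       (eval w m r s'' ea, eval w m r s'' eb, eval w m r s'' ec, eval w m r s'' ed) = idx e q \<and>
       eval w m r s'' val = v e q)) \<and>
      Post (lo m) ((vw m)(t := upd (vw m t) (rA k \<times> {..<c}) (\<lambda>(e, q). idx e q) (\<lambda>(e, q). v e q))) r s"
    using 2 by blast
qed (use c t in auto)

definition nd :: "nat \<Rightarrow> nat \<Rightarrow> nat \<Rightarrow> nat" where
  "nd i e q = (if q < 2 then rE (Suc i) e q else e)"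

lemma nd_in: "i < R \<Longrightarrow> e \<in> rA (Suc i) \<Longrightarrow> nd i e q \<in> nodes (Suc i)"
  using rE_in[of "Suc i" e q] by (simp add: nd_def nodes_def)

text \<open>In a tree with an edge every vertex is an end of some edge, so three threads per edge
  reach all nodes: its two ends and the edge itself.\<close>

lemma nd_onto:
  assumes i: "i < R" and ne: "rA (Suc i) \<noteq> {}" and x: "x \<in> nodes (Suc i)"
  shows "\<exists>e\<in>rA (Suc i). \<exists>q<3. nd i e q = x"
proof (cases "x \<in> rA (Suc i)")
  case True
  then show ?thesis by (intro bexI[of _ x] exI[of _ 2]) (auto simp: nd_def)
next
  case False
  then have "x \<in> rV (Suc i)" using x by (simp add: nodes_def)
  then obtain e q where "e \<in> rA (Suc i)" "q < 2" "x = rE (Suc i) e q"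
    using vertices_eq[OF tree ne, of x] i by auto
  then show ?thesis by (intro bexI[of _ e] exI[of _ q]) (auto simp: nd_def)
qed

lemma EPokR: "EPok R F \<Longrightarrow> i < R \<Longrightarrow> e \<in> rA i \<Longrightarrow> q < 2 \<Longrightarrow> F (Suc i, e, q, 0) = rE (Suc i) e q"
  by (simp add: EPok_def)

lemma eval_node:
  assumes i: "i < R" and u: "ucore i l (vw m) r' s0" and e: "e \<in> rA (Suc i)" "q < 3"
    and s: "s 21 = e" "s 22 = q" "s 3 = B" "s 6 = i"
  shows "eval w m r s e_node = nd i e q"
proof -
  have eA: "e \<in> rA i" using e rA_mono by blast
  have "q mod 2 < 2" by simp
  then have EP: "vw m 2 (Suc i, e, q mod 2, 0) = rE (Suc i) e (q mod 2)"
    using EPokR[OF _ i eA] u by (simp add: ucore_def)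
  have "rE (Suc i) e (q mod 2) \<in> rV (Suc i)" using rE_in[of "Suc i" e] e i by simp
  then have "rE (Suc i) e (q mod 2) < B" using rV_less[of "Suc i"] i by simp
  then show ?thesis using s EP i_less[OF i] rA_less[OF e(1)] e unfolding e_node_def
    by (auto simp: evs nd_def)
qed

definition up_inv :: "nat \<Rightarrow> nat \<Rightarrow> assertion" where
  "up_inv i k l V r s \<longleftrightarrow> ucore i l V r s \<and>
     (\<forall>k'\<le>k. \<forall>x\<in>nodes (Suc i) \<union> {0}. V 7 (i, k', x, 0) = (pf i ^^ (2 ^ k')) x) \<and>
     (\<forall>b d. V 7 (i, b, 0, d) = 0) \<and> (rA (Suc i) = {} \<longrightarrow> (\<forall>b c d. V 7 (i, b, c, d) = 0)) \<and>
     (\<forall>b c d. V 9 (i, b, c, d) = 0)"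

lemma pf_pow_empty: "rA (Suc i) = {} \<Longrightarrow> (pf i ^^ (2 ^ k)) x = 0"
proof -
  assume "rA (Suc i) = {}"
  then have "pf i x = 0" for x using pf_in[of i x] by auto
  then have "(pf i ^^ Suc j) x = 0" for j by simp
  then show ?thesis by (metis not0_implies_Suc power_not_zero zero_neq_numeral)
qed

lemma upd_nodes:
  assumes i: "i < R" and inj: "rA (Suc i) \<noteq> {}" and x: "x \<in> nodes (Suc i)"
  shows "upd F (rA (Suc i) \<times> {..<3}) (\<lambda>(e, q). (i, k, nd i e q, 0)) (\<lambda>(e, q). f (nd i e q)) (i, k, x, 0) = f x"
proof -
  obtain e q where "e \<in> rA (Suc i)" "q < 3" "nd i e q = x"
    using nd_onto[OF i inj x] by auto
  then show ?thesis by (intro upd_hit[of "(e, q)"]) auto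
qed

text \<open>If the contracted tree has no edges, no thread runs and the slice stays zero, which is
  right because all parents are missing.\<close>

lemma up_inv_upd:
  assumes i: "i < R" and u: "ucore i l V r s"
    and old: "\<forall>k'<k. \<forall>x\<in>nodes (Suc i) \<union> {0}. V 7 (i, k', x, 0) = (pf i ^^ (2 ^ k')) x"
    and z: "\<forall>b d. V 7 (i, b, 0, d) = 0" "rA (Suc i) = {} \<longrightarrow> (\<forall>b c d. V 7 (i, b, c, d) = 0)"
    and z9: "\<forall>b c d. V 9 (i, b, c, d) = 0"
  shows "up_inv i k l (V(7 := upd (V 7) (rA (Suc i) \<times> {..<3}) (\<lambda>(e, q). (i, k, nd i e q, 0))
    (\<lambda>(e, q). (pf i ^^ (2 ^ k)) (nd i e q)))) r s"
proof -
  let ?U = "upd (V 7) (rA (Suc i) \<times> {..<3}) (\<lambda>(e, q). (i, k, nd i e q, 0)) (\<lambda>(e, q). (pf i ^^ (2 ^ k)) (nd i e q))"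
  have 0: "?U (i, b, 0, d) = 0" for b d
  proof -
    have "nd i e q \<noteq> 0" if "e \<in> rA (Suc i)" for e q
      using nd_in[OF i that, of q] nodes_bounds[of "Suc i"] i by fastforce
    then have "(case p of (e, q) \<Rightarrow> (i, k, nd i e q, 0)) \<noteq> (i, b, 0, d)" if "p \<in> rA (Suc i) \<times> {..<3}" for p
      using that by (cases p) auto
    then have "?U (i, b, 0, d) = V 7 (i, b, 0, d)"
      by (intro upd_miss) blast
    then show ?thesis using z by simp
  qed
  have e: "?U (i, b, c, d) = 0" if "rA (Suc i) = {}" for b c d
    using that z by (simp add: upd_def)
  have "?U (i, k', x, 0) = (pf i ^^ (2 ^ k')) x" if "k' \<le> k" "x \<in> nodes (Suc i) \<union> {0}" for k' x
  proof -
    consider "x = 0" | "rA (Suc i) = {}" | "x \<noteq> 0" "k' < k" | "x \<noteq> 0" "rA (Suc i) \<noteq> {}" "k' = k"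
      using \<open>k' \<le> k\<close> by linarith
    then show ?thesis
    proof cases
      case 1
      then show ?thesis using 0 pf_pow_0[OF i] by simp
    next
      case 2
      then show ?thesis using e pf_pow_empty by simp
    next
      case 3
      then have "?U (i, k', x, 0) = V 7 (i, k', x, 0)" by (intro upd_miss) auto
      then show ?thesis using 3 old that by simp
    next
      case 4
      then show ?thesis using upd_nodes[OF i 4(2), of x "V 7" k "pf i ^^ (2 ^ k)"] that by simp
    qed
  qed
  moreover have "ucore i l (V(7 := ?U)) r s" by (rule ucore_upd(1)[OF u]) auto
  ultimately show ?thesis using 0 e z9 by (simp add: up_inv_def)
qed

lemma tri_up_par:
  assumes i: "i < R"
  shows "tri [up_par] (\<lambda>l V r s. ucore i l V r s \<and> (\<forall>b c d. V 7 (i, b, c, d) = 0 \<and> V 9 (i, b, c, d) = 0)) 6 (15 * cnt (Suc i) + 2) (up_inv i 0)"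
proof -
  let ?as = "[(23::nat, e_node)]"
  have "tri [up_par] (\<lambda>l V r s. ucore i l V r s \<and> (\<forall>b c d. V 7 (i, b, c, d) = 0 \<and> V 9 (i, b, c, d) = 0)) (length ?as + 5)
    (3 * cnt (Suc i) * (length ?as + 4) + 2) (up_inv i 0)"
    unfolding up_par_def
  proof (rule tri_unw_par[OF i])
    fix m r s assume pre: "ucore i (lo m) (vw m) r s \<and> (\<forall>b c d. vw m 7 (i, b, c, d) = 0 \<and> vw m 9 (i, b, c, d) = 0)"
    then have u: "ucore i (lo m) (vw m) r s" by simp
    let ?idx = "\<lambda>e q. (i, 0::nat, nd i e q, 0::nat)" and ?v = "\<lambda>e q. (pf i ^^ (2 ^ 0)) (nd i e q)"
    have "let s'' = assigns w m r ?as s' in s'' 3 = B \<and> inb (?idx e q) \<and>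
       (eval w m r s'' (Var 6), eval w m r s'' C0, eval w m r s'' (Var 23), eval w m r s'' C0) = ?idx e q \<and>
       eval w m r s'' (LD 3 (Plus (Var 6) C1) (Var 23) C0 C0) = ?v e q"
      if e: "e \<in> rA (Suc i)" "q < 3" and s': "s' 21 = e" "s' 22 = q" "s' 3 = B" "s' 6 = i" for e q s'
    proof -
      have nd: "nd i e q \<in> nodes (Suc i)" using nd_in[OF i e(1)] .
      then have ndB: "nd i e q < B" using nodes_bounds[of "Suc i"] i by simp
      have PR: "vw m 3 (Suc i, nd i e q, 0, 0) = pf i (nd i e q)" using u nd by (simp add: ucore_def)
      show ?thesis unfolding assigns.simps fst_conv snd_conv eval_node[OF i u e s'] Let_def
        using s' ndB i_less[OF i] PR by (simp add: evs)
    qed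
    moreover have "up_inv i 0 (lo m) ((vw m)(7 := upd (vw m 7) (rA (Suc i) \<times> {..<3}) (\<lambda>(e, q). ?idx e q) (\<lambda>(e, q). ?v e q))) r s"
      by (rule up_inv_upd[OF i u]) (use pre in auto)
    ultimately show "\<exists>idx v. (\<forall>e\<in>rA (Suc i). \<forall>q<3. \<forall>s'. s' 21 = e \<longrightarrow> s' 22 = q \<longrightarrow> s' 3 = B \<longrightarrow> s' 6 = i \<longrightarrow> s' 7 = s 7 \<longrightarrow> s' 8 = s 8 \<longrightarrow>
       (let s'' = assigns w m r ?as s' in s'' 3 = B \<and> inb (idx e q) \<and>
       (eval w m r s'' (Var 6), eval w m r s'' C0, eval w m r s'' (Var 23), eval w m r s'' C0) = idx e q \<and>
       eval w m r s'' (LD 3 (Plus (Var 6) C1) (Var 23) C0 C0) = v e q)) \<and>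
     up_inv i 0 (lo m) ((vw m)(7 := upd (vw m 7) (rA (Suc i) \<times> {..<3}) (\<lambda>(e, q). idx e q) (\<lambda>(e, q). v e q))) r s"
      by (intro exI[of _ ?idx] exI[of _ ?v]) blast
  qed auto
  then show ?thesis by (rule tri_conseq) auto
qed

lemma up_inv_env: "x = 7 \<or> x = 8 \<Longrightarrow> up_inv i k l V r (s(x := v)) = up_inv i k l V r s"
  by (simp add: up_inv_def ucore_env)

lemma tri_lift_par:
  assumes i: "i < R" and k: "k < Lam"
  shows "tri [lift_par] (\<lambda>l V r s. up_inv i k l V r s \<and> s 8 = k) 6 (15 * cnt (Suc i) + 2)
    (\<lambda>l V r s. up_inv i (Suc k) l V r s \<and> s 8 = k)"
proof -
  let ?as = "[(23::nat, e_node)]"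
  have "tri [lift_par] (\<lambda>l V r s. up_inv i k l V r s \<and> s 8 = k) (length ?as + 5)
    (3 * cnt (Suc i) * (length ?as + 4) + 2) (\<lambda>l V r s. up_inv i (Suc k) l V r s \<and> s 8 = k)"
    unfolding lift_par_def
  proof (rule tri_unw_par[OF i])
    fix m r s assume pre: "up_inv i k (lo m) (vw m) r s \<and> s 8 = k"
    then have u: "ucore i (lo m) (vw m) r s" by (simp add: up_inv_def)
    have U: "vw m 7 (i, k, x, 0) = (pf i ^^ (2 ^ k)) x" if "x \<in> nodes (Suc i) \<union> {0}" for x
      using pre that by (auto simp: up_inv_def)
    let ?idx = "\<lambda>e q. (i, Suc k, nd i e q, 0::nat)" and ?v = "\<lambda>e q. (pf i ^^ (2 ^ Suc k)) (nd i e q)"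
    have kB: "k < B" "Suc k < B" "Suc k < 16 * B" using k Lam_less BM by linarith+
    have "let s'' = assigns w m r ?as s' in s'' 3 = B \<and> inb (?idx e q) \<and>
       (eval w m r s'' (Var 6), eval w m r s'' (Plus (Var 8) C1), eval w m r s'' (Var 23), eval w m r s'' C0) = ?idx e q \<and>
       eval w m r s'' (LD 7 (Var 6) (Var 8) (LD 7 (Var 6) (Var 8) (Var 23) C0) C0) = ?v e q"
      if e: "e \<in> rA (Suc i)" "q < 3" and s': "s' 21 = e" "s' 22 = q" "s' 3 = B" "s' 6 = i" "s' 8 = s 8" for e q s'
    proof -
      have nd: "nd i e q \<in> nodes (Suc i)" using nd_in[OF i e(1)] .
      then have ndB: "nd i e q < B" using nodes_bounds[of "Suc i"] i by simp
      let ?y = "(pf i ^^ (2 ^ k)) (nd i e q)"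
      have y: "?y \<in> nodes (Suc i) \<union> {0}" using pf_pow_in[OF i] nd by blast
      then have yB: "?y < B" using nodes_bounds[of "Suc i" ?y] i i_less[OF i] by auto
      have e1: "eval w m r (s'(23 := nd i e q)) (LD 7 (Var 6) (Var 8) (Var 23) C0) = ?y"
        using s' pre ndB kB i_less[OF i] U[of "nd i e q"] nd by (simp add: evs)
      have "(pf i ^^ (2 ^ k)) ?y = ?v e q" by (simp add: funpow_add mult_2)
      then have e2: "eval w m r (s'(23 := nd i e q)) (LD 7 (Var 6) (Var 8) (LD 7 (Var 6) (Var 8) (Var 23) C0) C0) = ?v e q"
        using s' pre yB kB i_less[OF i] e1 U[OF y] by (subst eval_LD) (simp_all add: evs)
      show ?thesis unfolding assigns.simps fst_conv snd_conv eval_node[OF i u e s'(1-4)] Let_def e2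
        using s' pre ndB kB i_less[OF i] by (simp add: evs)
    qed
    note main = this
    have "up_inv i (Suc k) (lo m) ((vw m)(7 := upd (vw m 7) (rA (Suc i) \<times> {..<3}) (\<lambda>(e, q). ?idx e q) (\<lambda>(e, q). ?v e q))) r s"
      by (rule up_inv_upd[OF i u]) (use pre in \<open>auto simp: up_inv_def less_Suc_eq_le\<close>)
    then show "\<exists>idx v. (\<forall>e\<in>rA (Suc i). \<forall>q<3. \<forall>s'. s' 21 = e \<longrightarrow> s' 22 = q \<longrightarrow> s' 3 = B \<longrightarrow> s' 6 = i \<longrightarrow> s' 7 = s 7 \<longrightarrow> s' 8 = s 8 \<longrightarrow>
       (let s'' = assigns w m r ?as s' in s'' 3 = B \<and> inb (idx e q) \<and>
       (eval w m r s'' (Var 6), eval w m r s'' (Plus (Var 8) C1), eval w m r s'' (Var 23), eval w m r s'' C0) = idx e q \<and>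
       eval w m r s'' (LD 7 (Var 6) (Var 8) (LD 7 (Var 6) (Var 8) (Var 23) C0) C0) = v e q)) \<and>
     up_inv i (Suc k) (lo m) ((vw m)(7 := upd (vw m 7) (rA (Suc i) \<times> {..<3}) (\<lambda>(e, q). idx e q) (\<lambda>(e, q). v e q))) r s \<and> s 8 = k"
      using pre main by (intro exI[of _ ?idx] exI[of _ ?v]) blast
  qed (auto simp: up_inv_def)
  then show ?thesis by (rule tri_conseq) auto
qed

lemma tri_lift_loop:
  assumes i: "i < R"
  shows "tri [Assign 8 C0, WhileNZ (Less (Var 8) (Var 2)) [lift_par, Inc 8]] (up_inv i 0)
    (8 * Lam + 2) (Lam * (15 * cnt (Suc i) + 4) + 2) (up_inv i Lam)"
proof -
  let ?I = "\<lambda>k l V r s. up_inv i k l V r s \<and> s 8 = k"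
  have a: "tri [Assign 8 C0] (up_inv i 0) 1 1 (?I 0)"
    by (rule tri_Assign) (simp add: evs up_inv_env)
  have b: "tri [lift_par, Inc 8] (?I k) (6 + (1 + 0)) ((15 * cnt (Suc i) + 2) + (1 + 0)) (?I (Suc k))" if k: "k < Lam" for k
  proof -
    have "Suc k < 16 * B" using k Lam_less BM by linarith
    then have "tri [Inc 8] (\<lambda>l V r s. up_inv i (Suc k) l V r s \<and> s 8 = k) 1 1 (?I (Suc k))"
      by (intro tri_Assign) (simp add: evs up_inv_env)
    then show ?thesis by (intro tri_Cons[OF tri_lift_par[OF i k] tri_Cons[OF _ tri_Nil]])
  qed
  have c: "tri [WhileNZ (Less (Var 8) (Var 2)) [lift_par, Inc 8]] (?I 0)
     (Lam * Suc (6 + (1 + 0)) + 1) (Lam * Suc ((15 * cnt (Suc i) + 2) + (1 + 0)) + 1) (?I Lam)"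
  proof (rule tri_while_const[where I = ?I, OF b])
    fix k m r s assume "up_inv i k (lo m) (vw m) r s \<and> s 8 = k"
    then have "s 8 = k" "s 2 = Lam" by (auto simp: up_inv_def ucore_def base_env_def)
    then show "eval w m r s (Less (Var 8) (Var 2)) \<noteq> 0 \<longleftrightarrow> k < Lam" by (simp add: evs)
  qed
  show ?thesis by (rule tri_conseq[OF tri_Cons[OF a c]]) (auto simp: algebra_simps)
qed

text \<open>
  State of the binary lifting: \<open>c\<close> is an ancestor of the vertex to which \<open>e\<close> was contracted, and the
  step from \<open>c\<close> to its ancestor at distance \<open>2 ^ k\<close> goes too far.
\<close>

definition nu_ok :: "nat \<Rightarrow> nat \<Rightarrow> nat \<Rightarrow> nat \<Rightarrow> bool" where
  "nu_ok i k e c \<longleftrightarrow> (if e \<in> rA (Suc i) then c = e else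
     c \<in> nodes (Suc i) \<and> c < e \<and>
     conn (cut (rA (Suc i)) c) (rE (Suc i)) (rE (Suc i) e 0) (rep (rA (Suc i)) (rE (Suc i)) c) \<and>
     ((pf i ^^ (2 ^ k)) c = 0 \<or> e \<le> (pf i ^^ (2 ^ k)) c))"

definition nu_inv :: "nat \<Rightarrow> nat \<Rightarrow> assertion" where
  "nu_inv i k l V r s \<longleftrightarrow> up_inv i Lam l V r s \<and> (\<forall>e\<in>rA i. nu_ok i k e (V 8 (i, e, 0, 0)))"

lemma upd_labels:
  "e \<in> rA i \<Longrightarrow> upd F (rA i \<times> {..<1::nat}) (\<lambda>(e, q). (k, e, 0, 0)) (\<lambda>(e, q). f e q) (k, e, 0, 0) = f e 0"
  by (rule upd_hit[of "(e, 0)"]) auto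

lemma up_inv_8:
  "up_inv i k l V r s \<Longrightarrow> up_inv i k l (V(8 := upd (V 8) (rA i \<times> {..<1}) (\<lambda>(e, q). (i, e, 0, 0)) f)) r s"
  using ucore_upd(1)[of i l V r s "rA i \<times> {..<1}" "\<lambda>(e, q). (i, e, 0, 0)" 8 f]
  by (auto simp: up_inv_def)

text \<open>As \<open>2 ^ Suc Lam\<close> is at least \<open>2 * n\<close>, no node has an ancestor
  at that distance.\<close>

lemma start_ok:
  assumes i: "i < R" and e: "e \<in> rA i"
  shows "nu_ok i (Suc Lam) e (if e \<in> rA (Suc i) then e else rE (Suc i) e 0)"
proof (cases "e \<in> rA (Suc i)")
  case False
  let ?x = "rE (Suc i) e 0"
  have x: "?x \<in> rV (Suc i)"
    using rE_in[OF _ e, of 0] i by (simp add: rSuc ren_def)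
  then have xA: "?x \<notin> rA (Suc i)" using sep[of "Suc i"] i by fastforce
  have lt: "?x < e" using rV_sub[of "Suc i"] x i keys[OF e] by fastforce
  have "(pf i ^^ 2 ^ Suc Lam) ?x = 0"
  proof (rule ccontr)
    assume ne: "(pf i ^^ 2 ^ Suc Lam) ?x \<noteq> 0"
    have "(pf i ^^ 2 ^ Suc Lam) ?x \<in> nodes (Suc i) \<union> {0}"
      using pf_pow_in[OF i] x by (auto simp: nodes_def)
    then have "(pf i ^^ 2 ^ Suc Lam) ?x < 2 * n" using nodes_bounds[of "Suc i"] i n1 by fastforce
    moreover have "?x + 2 ^ Suc Lam \<le> (pf i ^^ 2 ^ Suc Lam) ?x"
      using pf_pow_chain[OF i ne] by blast
    moreover have "2 ^ Suc Lam = 2 * M" by simp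
    ultimately show False using nM by linarith
  qed
  then show ?thesis using False x xA lt by (simp add: nu_ok_def nodes_def rep_def)
qed (simp add: nu_ok_def)

text \<open>After a jump, distance \<open>2 ^ k\<close> from \<open>u\<close> is distance
  \<open>2 ^ Suc k\<close> from \<open>c\<close>, which was known to be too far; without a jump,
  \<open>2 ^ k\<close> was itself too far.\<close>

lemma descend_ok:
  assumes i: "i < R" and e: "e \<in> rA i" and c: "nu_ok i (Suc k) e c"
  defines "u \<equiv> (pf i ^^ (2 ^ k)) c"
  shows "nu_ok i k e (if u \<noteq> 0 \<and> u < e then u else c)"
proof (cases "e \<in> rA (Suc i)")
  case True
  then have ce: "c = e" using c by (simp add: nu_ok_def)
  \<comment> \<open>A surviving edge starts at itself and all its ancestors exceed it, so it never
    moves.\<close>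
  have "e < u" if "u \<noteq> 0"
  proof -
    have "e + 2 ^ k \<le> u" using pf_pow_chain[OF i that[unfolded u_def]] ce by (simp add: u_def)
    moreover have "0 < (2::nat) ^ k" by simp
    ultimately show ?thesis by linarith
  qed
  then show ?thesis using True ce by (auto simp: nu_ok_def)
next
  case False
  let ?A = "rA (Suc i)" and ?E = "rE (Suc i)"
  have c': "c \<in> nodes (Suc i)" "c < e" "conn (cut ?A c) ?E (?E e 0) (rep ?A ?E c)"
    "(pf i ^^ (2 ^ Suc k)) c = 0 \<or> e \<le> (pf i ^^ (2 ^ Suc k)) c"
    using c False by (auto simp: nu_ok_def)
  show ?thesis
  proof (cases "u \<noteq> 0 \<and> u < e")
    case True
    have ch: "c + 2 ^ k \<le> u" "conn (cut ?A u) ?E (rep ?A ?E c) (rep ?A ?E u)"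
      using pf_pow_chain[OF i, of "2 ^ k" c] True by (auto simp: u_def)
    have "u \<in> nodes (Suc i)" using pf_pow_in[OF i, of c "2 ^ k"] c'(1) True by (auto simp: u_def)
    moreover have "conn (cut ?A u) ?E (?E e 0) (rep ?A ?E c)"
      using c'(3) by (rule conn_mono) (use ch(1) in auto)
    moreover have "(pf i ^^ (2 ^ k)) u = (pf i ^^ (2 ^ Suc k)) c" by (simp add: u_def funpow_add mult_2)
    ultimately show ?thesis using True False c'(4) ch(2) by (auto simp: nu_ok_def intro: conn_trans)
  next
    case F: False
    then have "u = 0 \<or> e \<le> u" by auto
    then show ?thesis using False F c' by (auto simp: nu_ok_def u_def)
  qed
qed

lemma eval_loop_u:
  assumes i: "i < R" and u: "ucore i l (vw m) r' s0" and e: "e \<in> rA i"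
    and s: "s 21 = e" "s 3 = B" "s 6 = i"
  shows "eval w m r s e_loop = of_bool (e \<notin> rA (Suc i))"
proof (rule eval_loop[OF i _ e s])
  show "EPok (Suc i) (vw m 2)" using u i by (auto simp: ucore_def EPok_def)
qed

lemma tri_start_par:
  assumes i: "i < R"
  shows "tri [start_par] (up_inv i Lam) 5 (4 * cnt i + 2) (nu_inv i (Suc Lam))"
proof -
  let ?as = "[]::(nat \<times> exp) list"
  have "tri [start_par] (up_inv i Lam) (length ?as + 5) (1 * cnt i * (length ?as + 4) + 2) (nu_inv i (Suc Lam))"
    unfolding start_par_def
  proof (rule tri_unw_par[OF i])
    fix m r s assume pre: "up_inv i Lam (lo m) (vw m) r s"
    then have u: "ucore i (lo m) (vw m) r s" by (simp add: up_inv_def)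
    let ?idx = "\<lambda>e q::nat. (i, e, 0::nat, 0::nat)" and ?v = "\<lambda>e q::nat. if e \<in> rA (Suc i) then e else rE (Suc i) e 0"
    have "let s'' = assigns w m r ?as s' in s'' 3 = B \<and> inb (?idx e q) \<and>
       (eval w m r s'' (Var 6), eval w m r s'' (Var 21), eval w m r s'' C0, eval w m r s'' C0) = ?idx e q \<and>
       eval w m r s'' (EIte e_loop (LD 2 (Plus (Var 6) C1) (Var 21) C0 C0) (Var 21)) = ?v e q"
      if e: "e \<in> rA i" and s': "s' 21 = e" "s' 3 = B" "s' 6 = i" for e and q :: nat and s'
    proof -
      have EP: "vw m 2 (Suc i, e, 0, 0) = rE (Suc i) e 0"
        using EPokR[OF _ i e, of "vw m 2" 0] u by (simp add: ucore_def)
      have "rE (Suc i) e 0 \<in> rV (Suc i)"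
        using rE_in[OF _ e, of 0] i by (simp add: rSuc ren_def)
      then have xB: "rE (Suc i) e 0 < B" using rV_less[of "Suc i"] i by simp
      have e1: "eval w m r s' (LD 2 (Plus (Var 6) C1) (Var 21) C0 C0) = rE (Suc i) e 0"
        using s' EP i_less[OF i] rA_less[OF e] by (simp add: evs)
      have e2: "eval w m r s' (EIte e_loop (LD 2 (Plus (Var 6) C1) (Var 21) C0 C0) (Var 21)) = ?v e q"
        using s' xB rA_less[OF e] e1 eval_loop_u[OF i u e s']
        by (subst eval_EIte) (simp_all add: evs)
      show ?thesis unfolding assigns.simps Let_def e2
        using s' i_less[OF i] rA_less[OF e] by (simp add: evs)
    qed
    note main = this
    have "nu_inv i (Suc Lam) (lo m) ((vw m)(8 := upd (vw m 8) (rA i \<times> {..<1}) (\<lambda>(e, q). ?idx e q) (\<lambda>(e, q). ?v e q))) r s"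
      unfolding nu_inv_def fun_upd_same
    proof (intro conjI ballI)
      fix e assume e: "e \<in> rA i"
      show "nu_ok i (Suc Lam) e (upd (vw m 8) (rA i \<times> {..<1}) (\<lambda>(e, q). ?idx e q) (\<lambda>(e, q). ?v e q) (i, e, 0, 0))"
        unfolding upd_labels[OF e] by (rule start_ok[OF i e])
    qed (rule up_inv_8[OF pre])
    then show "\<exists>idx v. (\<forall>e\<in>rA i. \<forall>q<1. \<forall>s'. s' 21 = e \<longrightarrow> s' 22 = q \<longrightarrow> s' 3 = B \<longrightarrow> s' 6 = i \<longrightarrow> s' 7 = s 7 \<longrightarrow> s' 8 = s 8 \<longrightarrow>
       (let s'' = assigns w m r ?as s' in s'' 3 = B \<and> inb (idx e q) \<and>
       (eval w m r s'' (Var 6), eval w m r s'' (Var 21), eval w m r s'' C0, eval w m r s'' C0) = idx e q \<and>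
       eval w m r s'' (EIte e_loop (LD 2 (Plus (Var 6) C1) (Var 21) C0 C0) (Var 21)) = v e q)) \<and>
     nu_inv i (Suc Lam) (lo m) ((vw m)(8 := upd (vw m 8) (rA i \<times> {..<1}) (\<lambda>(e, q). idx e q) (\<lambda>(e, q). v e q))) r s"
      using main by (intro exI[of _ ?idx] exI[of _ ?v]) blast
  qed (auto simp: up_inv_def)
  then show ?thesis by (rule tri_conseq) auto
qed

lemma eval_nu:
  assumes i: "i < R" and e: "e \<in> rA i" and s: "s 21 = e" "s 3 = B" "s 6 = i"
  shows "eval w m r s e_nu = vw m 8 (i, e, 0, 0)"
  unfolding e_nu_def using s i_less[OF i] rA_less[OF e] by (simp add: evs)

lemma nu_ok_bounds: "i < R \<Longrightarrow> e \<in> rA i \<Longrightarrow> nu_ok i k e c \<Longrightarrow> c \<in> nodes (Suc i) \<and> c < B"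
  using nodes_bounds[of "Suc i" c] by (auto simp: nu_ok_def nodes_def split: if_splits)

lemma tri_descend_par:
  assumes i: "i < R" and k: "k \<le> Lam"
  shows "tri [descend_par] (\<lambda>l V r s. nu_inv i (Suc k) l V r s \<and> s 8 = k) 7 (6 * cnt i + 2)
    (\<lambda>l V r s. nu_inv i k l V r s \<and> s 8 = k)"
proof -
  let ?as = "[(23::nat, e_nu), (24, LD 7 (Var 6) (Var 8) (Var 23) C0)]"
  have "tri [descend_par] (\<lambda>l V r s. nu_inv i (Suc k) l V r s \<and> s 8 = k) (length ?as + 5)
    (1 * cnt i * (length ?as + 4) + 2) (\<lambda>l V r s. nu_inv i k l V r s \<and> s 8 = k)"
    unfolding descend_par_def
  proof (rule tri_unw_par[OF i])
    fix m r s assume pre: "nu_inv i (Suc k) (lo m) (vw m) r s \<and> s 8 = k"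
    then have up: "up_inv i Lam (lo m) (vw m) r s" by (simp add: nu_inv_def)
    define nu where "nu e = vw m 8 (i, e, 0, 0)" for e
    define u where "u e = (pf i ^^ (2 ^ k)) (nu e)" for e
    have ok: "nu_ok i (Suc k) e (nu e)" if "e \<in> rA i" for e using pre that by (simp add: nu_inv_def nu_def)
    have U: "vw m 7 (i, k, x, 0) = (pf i ^^ (2 ^ k)) x" if "x \<in> nodes (Suc i)" for x
      using up that k by (auto simp: up_inv_def)
    have kB: "k < B" using k Lam_less BM by linarith
    let ?idx = "\<lambda>e q::nat. (i, e, 0::nat, 0::nat)" and ?v = "\<lambda>e q::nat. if u e \<noteq> 0 \<and> u e < e then u e else nu e"
    have "let s'' = assigns w m r ?as s' in s'' 3 = B \<and> inb (?idx e q) \<and>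
       (eval w m r s'' (Var 6), eval w m r s'' (Var 21), eval w m r s'' C0, eval w m r s'' C0) = ?idx e q \<and>
       eval w m r s'' (EIte (EAnd (Var 24) (Less (Var 24) (Var 21))) (Var 24) (Var 23)) = ?v e q"
      if e: "e \<in> rA i" and s': "s' 21 = e" "s' 3 = B" "s' 6 = i" "s' 8 = s 8" for e and q :: nat and s'
    proof -
      have nu: "nu e \<in> nodes (Suc i)" "nu e < B" using nu_ok_bounds[OF i e ok[OF e]] by auto
      have "u e \<in> nodes (Suc i) \<union> {0}" unfolding u_def using pf_pow_in[OF i] nu by blast
      then have uB: "u e < B" using nodes_bounds[of "Suc i" "u e"] i i_less[OF i] by auto
      have e1: "eval w m r s' e_nu = nu e" using eval_nu[OF i e s'(1-3)] by (simp add: nu_def)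
      have e2: "eval w m r (s'(23 := nu e)) (LD 7 (Var 6) (Var 8) (Var 23) C0) = u e"
        using s' pre nu kB i_less[OF i] U[OF nu(1)] by (simp add: evs u_def)
      show ?thesis unfolding assigns.simps fst_conv snd_conv e1 e2 Let_def
        using s' nu uB i_less[OF i] rA_less[OF e] by (simp add: evs)
    qed
    note main = this
    have "nu_inv i k (lo m) ((vw m)(8 := upd (vw m 8) (rA i \<times> {..<1}) (\<lambda>(e, q). ?idx e q) (\<lambda>(e, q). ?v e q))) r s"
      unfolding nu_inv_def fun_upd_same
    proof (intro conjI ballI)
      fix e assume e: "e \<in> rA i"
      show "nu_ok i k e (upd (vw m 8) (rA i \<times> {..<1}) (\<lambda>(e, q). ?idx e q) (\<lambda>(e, q). ?v e q) (i, e, 0, 0))"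
        unfolding upd_labels[OF e] u_def by (rule descend_ok[OF i e ok[OF e]])
    qed (rule up_inv_8[OF up])
    then show "\<exists>idx v. (\<forall>e\<in>rA i. \<forall>q<1. \<forall>s'. s' 21 = e \<longrightarrow> s' 22 = q \<longrightarrow> s' 3 = B \<longrightarrow> s' 6 = i \<longrightarrow> s' 7 = s 7 \<longrightarrow> s' 8 = s 8 \<longrightarrow>
       (let s'' = assigns w m r ?as s' in s'' 3 = B \<and> inb (idx e q) \<and>
       (eval w m r s'' (Var 6), eval w m r s'' (Var 21), eval w m r s'' C0, eval w m r s'' C0) = idx e q \<and>
       eval w m r s'' (EIte (EAnd (Var 24) (Less (Var 24) (Var 21))) (Var 24) (Var 23)) = v e q)) \<and>
     nu_inv i k (lo m) ((vw m)(8 := upd (vw m 8) (rA i \<times> {..<1}) (\<lambda>(e, q). idx e q) (\<lambda>(e, q). v e q))) r s \<and> s 8 = k"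
      using pre main by (intro exI[of _ ?idx] exI[of _ ?v]) blast
  qed (auto simp: up_inv_def nu_inv_def)
  then show ?thesis by (rule tri_conseq) auto
qed

lemma nu_inv_env: "x = 7 \<or> x = 8 \<Longrightarrow> nu_inv i k l V r (s(x := v)) = nu_inv i k l V r s"
  by (simp add: nu_inv_def up_inv_env)

lemma tri_descend_loop:
  assumes i: "i < R"
  shows "tri [Assign 8 (Plus (Var 2) C1), WhileNZ (Var 8) [Assign 8 (Minus (Var 8) C1), descend_par]]
    (nu_inv i (Suc Lam)) (9 * (Lam + 1) + 2) ((Lam + 1) * (6 * cnt i + 4) + 2) (nu_inv i 0)"
proof -
  let ?I = "\<lambda>j l V r s. nu_inv i (Suc Lam - j) l V r s \<and> s 8 = Suc Lam - j"
  have LB: "Suc Lam < 16 * B" using Lam_less BM by linarith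
  have a: "tri [Assign 8 (Plus (Var 2) C1)] (nu_inv i (Suc Lam)) 1 1 (?I 0)"
  proof (rule tri_Assign)
    fix m r s assume "nu_inv i (Suc Lam) (lo m) (vw m) r s"
    moreover from this have "s 2 = Lam" by (auto simp: nu_inv_def up_inv_def ucore_def base_env_def)
    ultimately show "nu_inv i (Suc Lam - 0) (lo m) (vw m) r (s(8 := eval w m r s (Plus (Var 2) C1))) \<and>
      (s(8 := eval w m r s (Plus (Var 2) C1))) 8 = Suc Lam - 0"
      using LB by (simp add: evs nu_inv_env)
  qed
  have b: "tri [Assign 8 (Minus (Var 8) C1), descend_par] (?I j) (1 + (7 + 0)) (1 + ((6 * cnt i + 2) + 0)) (?I (Suc j))"
    if j: "j < Suc Lam" for j
  proof -
    have e: "Suc Lam - j = Suc (Lam - j)" using j by simp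
    have 1: "tri [Assign 8 (Minus (Var 8) C1)] (?I j) 1 1 (\<lambda>l V r s. nu_inv i (Suc (Lam - j)) l V r s \<and> s 8 = Lam - j)"
      by (rule tri_Assign) (simp add: evs nu_inv_env e)
    have "tri [descend_par] (\<lambda>l V r s. nu_inv i (Suc (Lam - j)) l V r s \<and> s 8 = Lam - j) 7 (6 * cnt i + 2) (?I (Suc j))"
      using tri_descend_par[OF i, of "Lam - j"] by simp
    then show ?thesis by (intro tri_Cons[OF 1 tri_Cons[OF _ tri_Nil]])
  qed
  have c: "tri [WhileNZ (Var 8) [Assign 8 (Minus (Var 8) C1), descend_par]] (?I 0)
     (Suc Lam * Suc (1 + (7 + 0)) + 1) (Suc Lam * Suc (1 + ((6 * cnt i + 2) + 0)) + 1) (?I (Suc Lam))"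
    by (rule tri_while_const[where I = ?I, OF b]) (auto simp: evs)
  show ?thesis by (rule tri_conseq[OF tri_Cons[OF a c]]) (auto simp: algebra_simps)
qed

section \<open>Successors within a chain\<close>

definition cand :: "nat \<Rightarrow> (nat \<Rightarrow> nat) \<Rightarrow> nat \<Rightarrow> nat \<Rightarrow> nat set" where
  "cand i nu k e = ({pf i (nu e)} - {0}) \<union> {g \<in> rA i. e < g \<and> nu g = nu e \<and>
     (\<exists>l<k. even (e div 2 ^ l) \<and> g div 2 ^ l = e div 2 ^ l + 1)}"

definition block :: "nat \<Rightarrow> (nat \<Rightarrow> nat) \<Rightarrow> nat \<Rightarrow> nat \<Rightarrow> nat \<Rightarrow> nat set" where
  "block i nu k c b = {g \<in> rA i. nu g = c \<and> g div 2 ^ k = b}"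

definition par_inv :: "nat \<Rightarrow> (nat \<Rightarrow> nat) \<Rightarrow> nat \<Rightarrow> nat \<Rightarrow> assertion" where
  "par_inv i nu k j l V r s \<longleftrightarrow> ucore i l V r s \<and> (\<forall>e\<in>rA i. V 8 (i, e, 0, 0) = nu e) \<and>
     (\<forall>e\<in>rA i. V 3 (i, e, 0, 0) = minz (cand i nu k e)) \<and> (\<forall>b c d. j \<le> b \<longrightarrow> V 9 (i, b, c, d) = 0)"

lemma finite_cand: "finite (cand i nu k e)" and finite_block: "finite (block i nu k c b)"
  using rA_finite by (auto simp: cand_def block_def)

lemma minz_in: "finite S \<Longrightarrow> minz S = 0 \<or> minz S \<in> S"
  by (simp add: minz_def)

lemma minz_less:
  assumes i: "i < R"
  shows "minz (cand i nu k e) < B" "minz (block i nu k c b) < B"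
proof -
  have *: "x < B" if "x \<in> cand i nu k e" for x
    using that rA_less[of _ i] rA_less[of _ "Suc i"] pf_in[of i "nu e"] by (auto simp: cand_def)
  show "minz (cand i nu k e) < B"
    using minz_in[OF finite_cand, of i nu k e] * i_less[OF i] by auto
  have "x < B" if "x \<in> block i nu k c b" for x
    using that rA_less[of _ i] by (auto simp: block_def)
  then show "minz (block i nu k c b) < B"
    using minz_in[OF finite_block, of i nu k c b] i_less[OF i] by auto
qed

text \<open>A new level only adds the block to the right of the one that contains \<open>e\<close>,
  whose members are automatically larger than \<open>e\<close>.\<close>

lemma cand_Suc:
  assumes e: "e \<in> rA i"
  shows "minz (cand i nu (Suc k) e) = (let c = minz (block i nu k (nu e) (e div 2 ^ k + 1)); p = minz (cand i nu k e)
    in if even (e div 2 ^ k) \<and> c \<noteq> 0 \<and> (p = 0 \<or> c < p) then c else p)"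
proof -
  let ?S = "block i nu k (nu e) (e div 2 ^ k + 1)"
  have 0: "0 \<notin> cand i nu k e" "0 \<notin> ?S"
    using keys[of 0 i] by (auto simp: cand_def block_def)
  have gt: "e < g" if "g div 2 ^ k = e div 2 ^ k + 1" for g
  proof (rule ccontr)
    assume "\<not> e < g"
    then have "g div 2 ^ k \<le> e div 2 ^ k" by (intro div_le_mono) simp
    then show False using that by simp
  qed
  show ?thesis
  proof (cases "even (e div 2 ^ k)")
    case True
    then have "cand i nu (Suc k) e = cand i nu k e \<union> ?S"
      using gt by (auto simp: cand_def block_def less_Suc_eq)
    moreover have "?S \<noteq> {} \<longleftrightarrow> minz ?S \<noteq> 0"
    proof (cases "?S = {}")
      case False
      then have "Min ?S \<in> ?S" by (rule Min_in[OF finite_block])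
      then have "Min ?S \<noteq> 0" using 0(2) by metis
      then show ?thesis using False by (simp add: minz_def)
    qed (simp add: minz_def)
    moreover have "?S \<noteq> {} \<Longrightarrow> Min ?S = minz ?S" by (simp add: minz_def)
    ultimately show ?thesis
      using minz_Un[OF finite_cand finite_block 0(1), of i nu k "nu e" "e div 2 ^ k + 1"] True
      by (auto simp: Let_def)
  next
    case False
    then have "cand i nu (Suc k) e = cand i nu k e" by (auto simp: cand_def less_Suc_eq)
    then show ?thesis using False by (simp add: Let_def)
  qed
qed

lemma label_not_vertex: "i < R \<Longrightarrow> e \<in> rA i \<Longrightarrow> e \<notin> rV i"
  using sep[of i e e] by auto

lemma par_write:
  assumes i: "i < R" and u: "ucore i l V r s"
  shows "ucore i l (V(3 := upd (V 3) (rA i \<times> {..<1::nat}) (\<lambda>(e, q). (i, e, 0, 0)) f)) r s"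
  by (rule ucore_upd(2)[OF u]) (use label_not_vertex[OF i] in auto)

context
  fixes i and nu :: "nat \<Rightarrow> nat"
  assumes i: "i < R" and nu: "\<And>e. e \<in> rA i \<Longrightarrow> nu_ok i 0 e (nu e)"
begin

lemma nu_B: "e \<in> rA i \<Longrightarrow> nu e < B" and nu_node: "e \<in> rA i \<Longrightarrow> nu e \<in> nodes (Suc i)"
  using nu_ok_bounds[OF i _ nu] by auto

lemma tri_par0:
  "tri [par0_par] (\<lambda>l V r s. nu_inv i 0 l V r s \<and> (\<forall>e\<in>rA i. V 8 (i, e, 0, 0) = nu e)) 6 (5 * cnt i + 2)
    (par_inv i nu 0 0)"
proof -
  let ?as = "[(23::nat, e_nu)]"
  have "tri [par0_par] (\<lambda>l V r s. nu_inv i 0 l V r s \<and> (\<forall>e\<in>rA i. V 8 (i, e, 0, 0) = nu e)) (length ?as + 5)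
    (1 * cnt i * (length ?as + 4) + 2) (par_inv i nu 0 0)"
    unfolding par0_par_def
  proof (rule tri_unw_par[OF i])
    fix m r s assume pre: "nu_inv i 0 (lo m) (vw m) r s \<and> (\<forall>e\<in>rA i. vw m 8 (i, e, 0, 0) = nu e)"
    then have u: "ucore i (lo m) (vw m) r s" by (simp add: nu_inv_def up_inv_def)
    let ?idx = "\<lambda>e q::nat. (i, e, 0::nat, 0::nat)" and ?v = "\<lambda>e q::nat. pf i (nu e)"
    have main: "let s'' = assigns w m r ?as s' in s'' 3 = B \<and> inb (?idx e q) \<and>
       (eval w m r s'' (Var 6), eval w m r s'' (Var 21), eval w m r s'' C0, eval w m r s'' C0) = ?idx e q \<and>
       eval w m r s'' (LD 3 (Plus (Var 6) C1) (Var 23) C0 C0) = ?v e q"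
      if e: "e \<in> rA i" and s': "s' 21 = e" "s' 3 = B" "s' 6 = i" for e and q :: nat and s'
    proof -
      have e1: "eval w m r s' e_nu = nu e" using eval_nu[OF i e s'] pre e by simp
      have PR: "vw m 3 (Suc i, nu e, 0, 0) = pf i (nu e)" using u nu_node[OF e] by (simp add: ucore_def)
      show ?thesis unfolding assigns.simps fst_conv snd_conv e1 Let_def
        using s' nu_B[OF e] i_less[OF i] rA_less[OF e] PR by (simp add: evs)
    qed
    have c0: "minz (cand i nu 0 e) = pf i (nu e)" for e by (simp add: cand_def minz_def)
    let ?U = "upd (vw m 3) (rA i \<times> {..<1}) (\<lambda>(e, q). ?idx e q) (\<lambda>(e, q). ?v e q)"
    have "ucore i (lo m) ((vw m)(3 := ?U)) r s" by (rule par_write[OF i u])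
    moreover have "?U (i, e, 0, 0) = pf i (nu e)" if "e \<in> rA i" for e
      by (rule upd_labels[OF that])
    ultimately have "par_inv i nu 0 0 (lo m) ((vw m)(3 := ?U)) r s"
      using pre by (simp add: par_inv_def c0 nu_inv_def up_inv_def)
    then show "\<exists>idx v. (\<forall>e\<in>rA i. \<forall>q<1. \<forall>s'. s' 21 = e \<longrightarrow> s' 22 = q \<longrightarrow> s' 3 = B \<longrightarrow> s' 6 = i \<longrightarrow> s' 7 = s 7 \<longrightarrow> s' 8 = s 8 \<longrightarrow>
       (let s'' = assigns w m r ?as s' in s'' 3 = B \<and> inb (idx e q) \<and>
       (eval w m r s'' (Var 6), eval w m r s'' (Var 21), eval w m r s'' C0, eval w m r s'' C0) = idx e q \<and>
       eval w m r s'' (LD 3 (Plus (Var 6) C1) (Var 23) C0 C0) = v e q)) \<and>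
     par_inv i nu 0 0 (lo m) ((vw m)(3 := upd (vw m 3) (rA i \<times> {..<1}) (\<lambda>(e, q). idx e q) (\<lambda>(e, q). v e q))) r s"
      using main by (intro exI[of _ ?idx] exI[of _ ?v]) blast
  qed (auto simp: up_inv_def nu_inv_def)
  then show ?thesis by (rule tri_conseq) auto
qed

definition block_inv :: "nat \<Rightarrow> assertion" where
  "block_inv k l V r s \<longleftrightarrow> par_inv i nu k (Suc k) l V r s \<and> s 7 = 2 ^ k \<and> s 8 = k \<and>
     (\<forall>c b. V 9 (i, k, c, b) = minz (block i nu k c b))"

lemma tri_block:
  assumes k: "k \<le> Lam"
  shows "tri [block_par] (\<lambda>l V r s. par_inv i nu k k l V r s \<and> s 7 = 2 ^ k \<and> s 8 = k) 6 (5 * cnt i + 2) (block_inv k)"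
proof -
  let ?as = "[(23::nat, e_nu)]"
  have "tri [block_par] (\<lambda>l V r s. par_inv i nu k k l V r s \<and> s 7 = 2 ^ k \<and> s 8 = k) (length ?as + 5)
    (1 * cnt i * (length ?as + 4) + 2) (block_inv k)"
    unfolding block_par_def
  proof (rule tri_unw_par[OF i])
    fix m r s assume pre: "par_inv i nu k k (lo m) (vw m) r s \<and> s 7 = 2 ^ k \<and> s 8 = k"
    then have u: "ucore i (lo m) (vw m) r s" and z: "\<And>c d. vw m 9 (i, k, c, d) = 0"
      by (auto simp: par_inv_def)
    have kB: "k < B" using k Lam_less BM by linarith
    let ?idx = "\<lambda>e q::nat. (i, k, nu e, e div 2 ^ k)" and ?v = "\<lambda>e q::nat. e"
    have main: "let s'' = assigns w m r ?as s' in s'' 3 = B \<and> inb (?idx e q) \<and>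
       (eval w m r s'' (Var 6), eval w m r s'' (Var 8), eval w m r s'' (Var 23), eval w m r s'' (Div (Var 21) (Var 7))) = ?idx e q \<and>
       eval w m r s'' (Var 21) = ?v e q"
      if e: "e \<in> rA i" and s': "s' 21 = e" "s' 3 = B" "s' 6 = i" "s' 7 = s 7" "s' 8 = s 8" for e and q :: nat and s'
    proof -
      have e1: "eval w m r s' e_nu = nu e" using eval_nu[OF i e s'(1-3)] pre e by (simp add: par_inv_def)
      have "e div 2 ^ k \<le> e" by (rule div_le_dividend)
      then have "e div 2 ^ k < B" using rA_less[OF e] by linarith
      then show ?thesis unfolding assigns.simps fst_conv snd_conv e1 Let_def
        using s' pre nu_B[OF e] i_less[OF i] rA_less[OF e] kB by (simp add: evs)
    qed
    let ?U = "upd (vw m 9) (rA i \<times> {..<1}) (\<lambda>(e, q). ?idx e q) (\<lambda>(e, q). ?v e q)"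
    \<comment> \<open>A cell to which no thread writes is still zero, and this is
      \<open>minz\<close> of the empty block.\<close>
    have new: "?U (i, k, c, b) = minz (block i nu k c b)" for c b
    proof -
      have "(\<exists>j\<in>rA i \<times> {..<1}. (\<lambda>(e, q). ?idx e q) j = (i, k, c, b)) \<longleftrightarrow> block i nu k c b \<noteq> {}"
        and "{(\<lambda>(e, q). ?v e q) j |j. j \<in> rA i \<times> {..<1} \<and> (\<lambda>(e, q). ?idx e q) j = (i, k, c, b)} = block i nu k c b"
        by (auto simp: block_def)
      then show ?thesis unfolding upd_def minz_def using z by presburger
    qed
    have old: "?U (i, b, c, d) = vw m 9 (i, b, c, d)" if "Suc k \<le> b" for b c d
      by (rule upd_miss) (use that in auto)
    have "ucore i (lo m) ((vw m)(9 := ?U)) r s" by (rule ucore_upd(1)[OF u]) auto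
    then have "block_inv k (lo m) ((vw m)(9 := ?U)) r s"
      unfolding block_inv_def par_inv_def using pre new old by (simp add: par_inv_def)
    then show "\<exists>idx v. (\<forall>e\<in>rA i. \<forall>q<1. \<forall>s'. s' 21 = e \<longrightarrow> s' 22 = q \<longrightarrow> s' 3 = B \<longrightarrow> s' 6 = i \<longrightarrow> s' 7 = s 7 \<longrightarrow> s' 8 = s 8 \<longrightarrow>
       (let s'' = assigns w m r ?as s' in s'' 3 = B \<and> inb (idx e q) \<and>
       (eval w m r s'' (Var 6), eval w m r s'' (Var 8), eval w m r s'' (Var 23), eval w m r s'' (Div (Var 21) (Var 7))) = idx e q \<and>
       eval w m r s'' (Var 21) = v e q)) \<and>
     block_inv k (lo m) ((vw m)(9 := upd (vw m 9) (rA i \<times> {..<1}) (\<lambda>(e, q). idx e q) (\<lambda>(e, q). v e q))) r s"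
      using main by (intro exI[of _ ?idx] exI[of _ ?v]) blast
  qed (auto simp: par_inv_def)
  then show ?thesis by (rule tri_conseq) auto
qed

lemma tri_next:
  assumes k: "k \<le> Lam"
  shows "tri [next_par] (block_inv k) 8 (7 * cnt i + 2)
    (\<lambda>l V r s. par_inv i nu (Suc k) (Suc k) l V r s \<and> s 7 = 2 ^ k \<and> s 8 = k)"
proof -
  let ?as = "[(25, e_nu), (23, LD 9 (Var 6) (Var 8) (Var 25) (Plus (Div (Var 21) (Var 7)) C1)),
       (24::nat, LD 3 (Var 6) (Var 21) C0 C0)]"
  let ?val = "EIte (EAnd (ENot (Mod (Div (Var 21) (Var 7)) (Const 2))) (EAnd (Var 23) (EOr (ENot (Var 24)) (Less (Var 23) (Var 24)))))
       (Var 23) (Var 24)"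
  have "tri [next_par] (block_inv k) (length ?as + 5) (1 * cnt i * (length ?as + 4) + 2)
    (\<lambda>l V r s. par_inv i nu (Suc k) (Suc k) l V r s \<and> s 7 = 2 ^ k \<and> s 8 = k)"
    unfolding next_par_def
  proof (rule tri_unw_par[OF i])
    fix m r s assume pre: "block_inv k (lo m) (vw m) r s"
    then have u: "ucore i (lo m) (vw m) r s" and P: "par_inv i nu k (Suc k) (lo m) (vw m) r s"
      and s: "s 7 = 2 ^ k" "s 8 = k"
      and T: "\<And>c b. vw m 9 (i, k, c, b) = minz (block i nu k c b)"
      by (auto simp: block_inv_def par_inv_def)
    have kB: "k < B" using k Lam_less BM by linarith
    let ?idx = "\<lambda>e q::nat. (i, e, 0::nat, 0::nat)" and ?v = "\<lambda>e q::nat. minz (cand i nu (Suc k) e)"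
    have main: "let s'' = assigns w m r ?as s' in s'' 3 = B \<and> inb (?idx e q) \<and>
       (eval w m r s'' (Var 6), eval w m r s'' (Var 21), eval w m r s'' C0, eval w m r s'' C0) = ?idx e q \<and>
       eval w m r s'' ?val = ?v e q"
      if e: "e \<in> rA i" and s': "s' 21 = e" "s' 3 = B" "s' 6 = i" "s' 7 = s 7" "s' 8 = s 8" for e and q :: nat and s'
    proof -
      define c where "c = minz (block i nu k (nu e) (e div 2 ^ k + 1))"
      define p where "p = minz (cand i nu k e)"
      have cp: "c < B" "p < B" using minz_less[OF i] by (auto simp: c_def p_def)
      have e1: "eval w m r s' e_nu = nu e" using eval_nu[OF i e s'(1-3)] P e by (simp add: par_inv_def)
      have "e div 2 ^ k \<le> e" by (rule div_le_dividend)
      moreover have "e + 1 < B" using keys[OF e] nM BM n1 by linarith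
      ultimately have d: "e div 2 ^ k + 1 < B" "e div 2 ^ k + 1 < 16 * B" by linarith+
      have e2: "eval w m r (s'(25 := nu e)) (LD 9 (Var 6) (Var 8) (Var 25) (Plus (Div (Var 21) (Var 7)) C1)) = c"
        using s' s d nu_B[OF e] kB i_less[OF i] T[of "nu e" "e div 2 ^ k + 1"] by (simp add: evs c_def)
      have e3: "eval w m r (s'(25 := nu e, 23 := c)) (LD 3 (Var 6) (Var 21) C0 C0) = p"
        using s' P e i_less[OF i] rA_less[OF e] by (simp add: evs par_inv_def p_def)
      have "?v e q = (if even (e div 2 ^ k) \<and> c \<noteq> 0 \<and> (p = 0 \<or> c < p) then c else p)"
        unfolding cand_Suc[OF e] Let_def c_def p_def ..
      then have e4: "eval w m r (s'(25 := nu e, 23 := c, 24 := p)) ?val = ?v e q"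
        using s' s cp i_less[OF i] by (simp add: evs even_iff_mod_2_eq_zero)
      show ?thesis unfolding assigns.simps fst_conv snd_conv e1 e2 e3 Let_def e4
        using s' i_less[OF i] rA_less[OF e] by (simp add: evs)
    qed
    let ?U = "upd (vw m 3) (rA i \<times> {..<1}) (\<lambda>(e, q). ?idx e q) (\<lambda>(e, q). ?v e q)"
    have "ucore i (lo m) ((vw m)(3 := ?U)) r s" by (rule par_write[OF i u])
    moreover have "?U (i, e, 0, 0) = minz (cand i nu (Suc k) e)" if "e \<in> rA i" for e
      by (rule upd_labels[OF that])
    ultimately have "par_inv i nu (Suc k) (Suc k) (lo m) ((vw m)(3 := ?U)) r s"
      using P by (simp add: par_inv_def)
    then show "\<exists>idx v. (\<forall>e\<in>rA i. \<forall>q<1. \<forall>s'. s' 21 = e \<longrightarrow> s' 22 = q \<longrightarrow> s' 3 = B \<longrightarrow> s' 6 = i \<longrightarrow> s' 7 = s 7 \<longrightarrow> s' 8 = s 8 \<longrightarrow>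
       (let s'' = assigns w m r ?as s' in s'' 3 = B \<and> inb (idx e q) \<and>
       (eval w m r s'' (Var 6), eval w m r s'' (Var 21), eval w m r s'' C0, eval w m r s'' C0) = idx e q \<and>
       eval w m r s'' ?val = v e q)) \<and>
     par_inv i nu (Suc k) (Suc k) (lo m) ((vw m)(3 := upd (vw m 3) (rA i \<times> {..<1}) (\<lambda>(e, q). idx e q) (\<lambda>(e, q). v e q))) r s \<and>
     s 7 = 2 ^ k \<and> s 8 = k"
      using main s by (intro exI[of _ ?idx] exI[of _ ?v]) blast
  qed (auto simp: par_inv_def block_inv_def)
  then show ?thesis by (rule tri_conseq) auto
qed

lemma par_inv_env: "x = 7 \<or> x = 8 \<Longrightarrow> par_inv i nu k j l V r (s(x := v)) = par_inv i nu k j l V r s"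
  by (simp add: par_inv_def ucore_env)

lemma tri_next_loop:
  "tri [Assign 7 C1, Assign 8 C0, WhileNZ (Less (Var 8) (Plus (Var 2) C1)) [block_par, next_par, Dbl 7, Inc 8]]
    (par_inv i nu 0 0) (17 * (Lam + 1) + 3) ((Lam + 1) * (12 * cnt i + 7) + 3) (par_inv i nu (Suc Lam) (Suc Lam))"
proof -
  let ?I = "\<lambda>k l V r s. par_inv i nu k k l V r s \<and> s 7 = 2 ^ k \<and> s 8 = k"
  have LB: "Suc Lam < 16 * B" using Lam_less BM by linarith
  have a: "tri [Assign 7 C1] (par_inv i nu 0 0) 1 1 (\<lambda>l V r s. par_inv i nu 0 0 l V r s \<and> s 7 = 2 ^ 0)"
    by (rule tri_Assign) (simp add: evs par_inv_env)
  have b: "tri [Assign 8 C0] (\<lambda>l V r s. par_inv i nu 0 0 l V r s \<and> s 7 = 2 ^ 0) 1 1 (?I 0)"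
    by (rule tri_Assign) (simp add: evs par_inv_env)
  have c: "tri [block_par, next_par, Dbl 7, Inc 8] (?I k) (6 + (8 + (1 + (1 + 0))))
      ((5 * cnt i + 2) + ((7 * cnt i + 2) + (1 + (1 + 0)))) (?I (Suc k))" if "k < Suc Lam" for k
  proof -
    have k: "k \<le> Lam" using that by simp
    have kM: "(2::nat) ^ k \<le> M" "0 < M" using k by (simp_all add: pow_le_M)
    have bb: "Suc k < 16 * B" "(2::nat) ^ k + 2 ^ k < 16 * B" using k kM Lam_less BM by linarith+
    have 1: "tri [Dbl 7] (\<lambda>l V r s. par_inv i nu (Suc k) (Suc k) l V r s \<and> s 7 = 2 ^ k \<and> s 8 = k) 1 1
      (\<lambda>l V r s. par_inv i nu (Suc k) (Suc k) l V r s \<and> s 7 = 2 ^ Suc k \<and> s 8 = k)"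
      by (rule tri_Assign) (use bb in \<open>simp add: evs par_inv_env\<close>)
    have 2: "tri [Inc 8] (\<lambda>l V r s. par_inv i nu (Suc k) (Suc k) l V r s \<and> s 7 = 2 ^ Suc k \<and> s 8 = k) 1 1 (?I (Suc k))"
      by (rule tri_Assign) (use bb in \<open>simp add: evs par_inv_env\<close>)
    show ?thesis
      by (rule tri_Cons[OF tri_block[OF k] tri_Cons[OF tri_next[OF k] tri_Cons[OF 1 tri_Cons[OF 2 tri_Nil]]]])
  qed
  have d: "tri [WhileNZ (Less (Var 8) (Plus (Var 2) C1)) [block_par, next_par, Dbl 7, Inc 8]] (?I 0)
     (Suc Lam * Suc (6 + (8 + (1 + (1 + 0)))) + 1)
     (Suc Lam * Suc ((5 * cnt i + 2) + ((7 * cnt i + 2) + (1 + (1 + 0)))) + 1) (?I (Suc Lam))"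
  proof (rule tri_while_const[where I = ?I, OF c])
    fix k m r s assume "par_inv i nu k k (lo m) (vw m) r s \<and> s 7 = 2 ^ k \<and> s 8 = k"
    then have "s 8 = k" "s 2 = Lam" by (auto simp: par_inv_def ucore_def base_env_def)
    then show "eval w m r s (Less (Var 8) (Plus (Var 2) C1)) \<noteq> 0 \<longleftrightarrow> k < Suc Lam"
      using LB by (simp add: evs)
  qed
  show ?thesis by (rule tri_conseq[OF tri_Cons[OF a tri_Cons[OF b d]]]) (auto simp: algebra_simps)
qed

text \<open>Labels are below \<open>2 ^ Suc Lam\<close>, so by \<open>dyadic_split\<close> all
  larger members of the chain have become candidates, and \<open>par_uncontract\<close> identifies
  the minimum.\<close>

lemma par_final:
  assumes e: "e \<in> rA i"
  shows "minz (cand i nu (Suc Lam) e) = par (rA i) (rE i) e"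
proof -
  have "cand i nu (Suc Lam) e = {pf i (nu e)} - {0} \<union> {g \<in> rA i. e < g \<and> nu g = nu e}"
  proof -
    have "\<exists>l<Suc Lam. even (e div 2 ^ l) \<and> g div 2 ^ l = e div 2 ^ l + 1" if "g \<in> rA i" "e < g" for g
    proof (rule dyadic_split[OF that(2)])
      have "g < 2 * n" using that(1) rA_sub[of i] by auto
      also have "\<dots> \<le> 2 ^ Suc Lam" using nM by simp
      finally show "g < 2 ^ Suc Lam" .
    qed
    then show ?thesis by (auto simp: cand_def)
  qed
  moreover have "par (rA i) (rE i) e = minz ({par (rA (Suc i)) (rE (Suc i)) (nu e)} - {0} \<union> {g \<in> rA i. e < g \<and> nu g = nu e})"
  proof (rule par_uncontract[OF rA_finite _ _ rSuc(1) rSuc(2) _ _ e])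
    show "v < e" if "v \<in> rV (Suc i)" "e \<in> rA i" for v e
      using rV_sub[of "Suc i"] i that keys[OF that(2)] by fastforce
    show "conn (cut (rA i) e) (rE i) (rE i e s) (rP i (rE i e s))" if "e \<in> rA i" "s < 2" for e s
      using P_near[OF tree R_ne keys rP_def that] i by simp
    show "nu e = e" if "e \<in> rA (Suc i)" for e
      using nu[of e] that rA_mono by (auto simp: nu_ok_def)
    show "istop (rV (Suc i)) (rA (Suc i)) (rE (Suc i)) (rE (Suc i) e 0) e (nu e)" if "e \<in> rA i - rA (Suc i)" for e
      using nu[of e] that by (auto simp: nu_ok_def istop_def nodes_def pf_def)
  qed
  ultimately show ?thesis by (simp add: pf_def)
qed

end

section \<open>Assembling the unwinding\<close>

definition un_inv :: "nat \<Rightarrow> assertion" where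
  "un_inv i l V r s \<longleftrightarrow> l = l0 \<and> r = r0 \<and> base_env s \<and> s 6 = i \<and> V 10 = Z \<and> LSok R (V 1) \<and> EPok R (V 2) \<and>
     MMok R (V 6) \<and> (\<forall>k<i. \<forall>x\<in>rV k. V 3 (k, x, 0, 0) = mn (rA k) (rE k) x) \<and>
     (\<forall>x\<in>nodes i. V 3 (i, x, 0, 0) = par (rA i) (rE i) x) \<and>
     (\<forall>k<i. \<forall>b c d. V 7 (k, b, c, d) = 0 \<and> V 9 (k, b, c, d) = 0)"

text \<open>Without edges every parent is missing, and row \<open>R\<close> of array 3 has not been
  written yet, so it is correct as it stands.\<close>

lemma un_inv_start:
  assumes "bor_inv R l V r s" shows "un_inv R l V r s"
proof -
  have "par (rA R) (rE R) x = 0" for x by (simp add: R_empty par_def parset_def minz_def)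
  then show ?thesis using assms
    by (auto simp: bor_inv_def un_inv_def core_def fresh_def PRok_def)
qed

lemma tri_unwind_head:
  assumes i: "i < R"
  shows "tri [Assign 6 (Minus (Var 6) C1), Assign 9 (LD 6 (Var 6) C0 C0 C0), Assign 10 (LD 6 (Plus (Var 6) C1) C0 C0 C0)]
    (un_inv (Suc i)) 3 3 (\<lambda>l V r s. ucore i l V r s \<and> (\<forall>b c d. V 7 (i, b, c, d) = 0 \<and> V 9 (i, b, c, d) = 0))"
proof -
  let ?Q = "\<lambda>l V r s. un_inv (Suc i) l V r (s(6 := Suc i)) \<and> s 6 = i"
  have a: "tri [Assign 6 (Minus (Var 6) C1)] (un_inv (Suc i)) 1 1 ?Q"
    by (rule tri_Assign) (auto simp: evs un_inv_def)
  have b: "tri [Assign 9 (LD 6 (Var 6) C0 C0 C0)] ?Q 1 1 (\<lambda>l V r s. ?Q l V r s \<and> s 9 = cnt i)"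
  proof (rule tri_Assign)
    fix m r s assume q: "?Q (lo m) (vw m) r s"
    then have "s 3 = B" "s 6 = i" "vw m 6 (i, 0, 0, 0) = cnt i" using i by (auto simp: un_inv_def base_env_def MMok_def)
    then have "eval w m r s (LD 6 (Var 6) C0 C0 C0) = cnt i" using i_less[OF i] by (simp add: evs)
    then show "?Q (lo m) (vw m) r (s(9 := eval w m r s (LD 6 (Var 6) C0 C0 C0))) \<and> (s(9 := eval w m r s (LD 6 (Var 6) C0 C0 C0))) 9 = cnt i"
      using q by (auto simp: un_inv_def)
  qed
  have c: "tri [Assign 10 (LD 6 (Plus (Var 6) C1) C0 C0 C0)] (\<lambda>l V r s. ?Q l V r s \<and> s 9 = cnt i) 1 1
    (\<lambda>l V r s. ucore i l V r s \<and> (\<forall>b c d. V 7 (i, b, c, d) = 0 \<and> V 9 (i, b, c, d) = 0))"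
  proof (rule tri_Assign)
    fix m r s assume q: "?Q (lo m) (vw m) r s \<and> s 9 = cnt i"
    then have "s 3 = B" "s 6 = i" "vw m 6 (Suc i, 0, 0, 0) = cnt (Suc i)" using i by (auto simp: un_inv_def base_env_def MMok_def)
    then have "eval w m r s (LD 6 (Plus (Var 6) C1) C0 C0 C0) = cnt (Suc i)" using i_less[OF i] by (simp add: evs)
    then show "ucore i (lo m) (vw m) r (s(10 := eval w m r s (LD 6 (Plus (Var 6) C1) C0 C0 C0))) \<and>
      (\<forall>b c d. vw m 7 (i, b, c, d) = 0 \<and> vw m 9 (i, b, c, d) = 0)"
      using q by (auto simp: un_inv_def ucore_def pf_def less_Suc_eq_le)
  qed
  show ?thesis by (rule tri_conseq[OF tri_Cons[OF a tri_Cons[OF b tri_Cons[OF c tri_Nil]]]]) auto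
qed

lemma tri_unwind_body:
  assumes i: "i < R"
  shows "tri unwind_body (un_inv (Suc i)) (70 * (Lam + 1)) (80 * (cnt i * (Lam + 1)) + 50 * (Lam + 1)) (un_inv i)"
proof -
  have e: "unwind_body = ([Assign 6 (Minus (Var 6) C1), Assign 9 (LD 6 (Var 6) C0 C0 C0), Assign 10 (LD 6 (Plus (Var 6) C1) C0 C0 C0)] @
     [up_par] @ [Assign 8 C0, WhileNZ (Less (Var 8) (Var 2)) [lift_par, Inc 8]] @ [start_par] @
     [Assign 8 (Plus (Var 2) C1), WhileNZ (Var 8) [Assign 8 (Minus (Var 8) C1), descend_par]]) @ [par0_par] @
     [Assign 7 C1, Assign 8 C0, WhileNZ (Less (Var 8) (Plus (Var 2) C1)) [block_par, next_par, Dbl 7, Inc 8]]"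
    by (simp add: unwind_body_def)
  \<comment> \<open>\<open>nu\<close> can be read off array 8 only after the descent, so it enters
    the middle assertion as an existential parameter; for a wrong \<open>nu\<close> the remaining
    triple is vacuous.\<close>
  let ?Mid = "\<lambda>nu l V r s. (\<forall>e\<in>rA i. nu_ok i 0 e (nu e)) \<and> nu_inv i 0 l V r s \<and> (\<forall>e\<in>rA i. V 8 (i, e, 0, 0) = nu e)"
  note 1 = tri_append[OF tri_unwind_head[OF i] tri_append[OF tri_up_par[OF i] tri_append[OF tri_lift_loop[OF i]
      tri_append[OF tri_start_par[OF i] tri_descend_loop[OF i]]]]]
  have 2: "tri ([par0_par] @ [Assign 7 C1, Assign 8 C0, WhileNZ (Less (Var 8) (Plus (Var 2) C1)) [block_par, next_par, Dbl 7, Inc 8]])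
    (\<lambda>l V r s. \<exists>nu. ?Mid nu l V r s) (6 + (17 * (Lam + 1) + 3)) ((5 * cnt i + 2) + ((Lam + 1) * (12 * cnt i + 7) + 3)) (un_inv i)"
  proof (rule tri_Ex)
    fix nu
    show "tri ([par0_par] @ [Assign 7 C1, Assign 8 C0, WhileNZ (Less (Var 8) (Plus (Var 2) C1)) [block_par, next_par, Dbl 7, Inc 8]])
      (?Mid nu) (6 + (17 * (Lam + 1) + 3)) ((5 * cnt i + 2) + ((Lam + 1) * (12 * cnt i + 7) + 3)) (un_inv i)"
    proof (cases "\<forall>e\<in>rA i. nu_ok i 0 e (nu e)")
      case True
      then have ok: "\<And>e. e \<in> rA i \<Longrightarrow> nu_ok i 0 e (nu e)" by blast
      \<comment> \<open>The lightest edges stored during contraction are the parents of the vertices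
        of round \<open>i\<close>, so only the rows of the edges had to be written.\<close>
      have mp: "mn (rA i) (rE i) x = par (rA i) (rE i) x" if "x \<in> rV i" for x
        using par_vertex[OF tree[of i] R_ne[OF i] that sep[of i]] i by simp
      show ?thesis
      proof (rule tri_conseq[OF tri_append[OF tri_par0[OF i ok] tri_next_loop[OF i ok]]])
        fix l V r s assume "par_inv i nu (Suc Lam) (Suc Lam) l V r s"
        then show "un_inv i l V r s" using par_final[OF i ok] mp
          by (auto simp: par_inv_def ucore_def un_inv_def nodes_def)
      qed auto
    next
      case False
      then show ?thesis unfolding tri_def by blast
    qed
  qed
  have 3: "?Mid (\<lambda>e. V 8 (i, e, 0, 0)) l V r s" if "nu_inv i 0 l V r s" for l V r s
    using that by (auto simp: nu_inv_def)
  have cs: "cnt (Suc i) \<le> cnt i" using cnt_half[OF i] by simp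
  have 4: "tri X (un_inv (Suc i)) D K (\<lambda>l V r s. \<exists>nu. ?Mid nu l V r s)"
    if "tri X (un_inv (Suc i)) D K (nu_inv i 0)" for X D K
    using that
  proof (rule tri_conseq[OF _ _ _ order_refl order_refl])
    show "\<exists>nu. ?Mid nu l V r s" if "nu_inv i 0 l V r s" for l V r s
      by (rule exI[of _ "\<lambda>e. V 8 (i, e, 0, 0)"], rule 3[OF that])
  qed
  have c1: "Lam * (15 * cnt (Suc i)) \<le> Lam * (62 * cnt i)" using cs by (intro mult_le_mono) auto
  show ?thesis unfolding e
  proof (rule tri_conseq[OF tri_append[OF 4[OF 1] 2]], goal_cases)
    case 4
    have "15 * cnt (Suc i) + Lam * (15 * cnt (Suc i)) \<le> 23 + (Lam * 35 + (cnt i * 53 + Lam * (cnt i * 62)))"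
      using c1 cs by (simp only: algebra_simps)
    then show ?case by (simp add: algebra_simps)
  qed auto
qed

lemma tri_unwind:
  "tri [WhileNZ (Var 6) unwind_body] (bor_inv R) (80 * (Lam + 1)\<^sup>2) (250 * M * (Lam + 1)) (un_inv 0)"
proof -
  let ?I = "\<lambda>j. un_inv (R - j)"
  have a: "tri [WhileNZ (Var 6) unwind_body] (?I 0) ((\<Sum>k<R. Suc (70 * (Lam + 1))) + 1)
     ((\<Sum>k<R. Suc (80 * (cnt (R - Suc k) * (Lam + 1)) + 50 * (Lam + 1))) + 1) (?I R)"
  proof (rule tri_while[where I = ?I])
    fix k assume k: "k < R"
    then have "R - k = Suc (R - Suc k)" by simp
    then show "tri unwind_body (?I k) (70 * (Lam + 1)) (80 * (cnt (R - Suc k) * (Lam + 1)) + 50 * (Lam + 1)) (?I (Suc k))"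
      using tri_unwind_body[of "R - Suc k"] k by simp
  next
    fix k m r s assume "k \<le> R" "un_inv (R - k) (lo m) (vw m) r s"
    then show "eval w m r s (Var 6) \<noteq> 0 \<longleftrightarrow> k < R" by (auto simp: evs un_inv_def)
  qed
  have "R * Suc (70 * (Lam + 1)) + 1 \<le> Lam * Suc (70 * (Lam + 1)) + 1"
    using R_le by (simp only: add_le_cancel_right) (rule mult_le_mono1)
  also have "\<dots> \<le> 80 * (Lam + 1)\<^sup>2" by (simp add: power2_eq_square algebra_simps)
  finally have d: "(\<Sum>k<R. Suc (70 * (Lam + 1))) + 1 \<le> 80 * (Lam + 1)\<^sup>2" by simp
  have rev: "(\<Sum>k<R. cnt (R - Suc k)) = (\<Sum>k<R. cnt k)"
    by (rule sum.nat_diff_reindex)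
  have "(\<Sum>k<R. Suc (80 * (cnt (R - Suc k) * (Lam + 1)) + 50 * (Lam + 1))) =
     80 * (Lam + 1) * (\<Sum>k<R. cnt (R - Suc k)) + R * Suc (50 * (Lam + 1))"
    by (simp add: sum.distrib sum_distrib_left algebra_simps)
  also have "\<dots> \<le> 80 * (Lam + 1) * (2 * M) + M * (51 * (Lam + 1))"
    unfolding rev
  proof (intro add_mono mult_le_mono2 sum_cnt mult_le_mono)
    show "R \<le> M" using R_le Lam_less by linarith
  qed simp
  finally have k: "(\<Sum>k<R. Suc (80 * (cnt (R - Suc k) * (Lam + 1)) + 50 * (Lam + 1))) + 1 \<le> 250 * M * (Lam + 1)"
  proof -
    assume a: "(\<Sum>k<R. Suc (80 * (cnt (R - Suc k) * (Lam + 1)) + 50 * (Lam + 1))) \<le> 80 * (Lam + 1) * (2 * M) + M * (51 * (Lam + 1))"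
    have "80 * (Lam + 1) * (2 * M) + M * (51 * (Lam + 1)) = 211 * (M * (Lam + 1))" by (simp add: algebra_simps)
    moreover have "1 \<le> M * (Lam + 1)" by (simp add: Suc_le_eq)
    moreover have "250 * M * (Lam + 1) = 250 * (M * (Lam + 1))" by simp
    ultimately show ?thesis using a by linarith
  qed
  show ?thesis using d k by (rule tri_conseq[OF a, rotated 2]) (auto simp: un_inv_start)
qed

end


section \<open>Input and output\<close>

definition load_prog :: "instr list" where
  "load_prog = [Assign 9 (Minus (Var 0) C1),
     Par (Var 9) [] 1 C0 (Var 20) C0 C0 (Plus (Plus (Var 0) C1) (Var 20)),
     Par (Times (Const 2) (Var 9)) [] 2 C0 (Plus (Plus (Var 0) C1) (Div (Var 20) (Const 2)))
       (Mod (Var 20) (Const 2)) C0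
       (Plus (Load (Plus C1 (Plus (Times (Const 2) (LD 10 (Var 2) (Div (Var 20) (Const 2)) C0 C0))
         (Mod (Var 20) (Const 2))))) C1),
     Assign 6 C0,
     Par C1 [] 6 C0 C0 C0 C0 (Var 9)]"

text \<open>Output index of the dendrogram node \<open>x\<close>; truncated subtraction sends \<open>0\<close> to \<open>0\<close>.\<close>

definition e_oid :: "exp \<Rightarrow> exp" where
  "e_oid x = EIte (Less (Var 0) x)
     (Plus (Var 0) (LD 10 (Var 2) (Minus (Minus x (Var 0)) C1) C0 C0)) (Minus x C1)"

definition out_lets :: "(nat \<times> exp) list" where
  "out_lets = [(23, Plus (Var 20) C1), (24, e_oid (Var 23)), (25, LD 3 C0 (Var 23) C0 C0),
     (26, Times (Const 2) (e_oid (Var 25)))]"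

text \<open>
  Every node is written to the first child cell of its parent, where the smaller child wins; then
  the nodes that lost are written to the second cell. The root has parent \<open>0\<close>, so it is written to
  cell 0. In the second loop the winners write to cell 1, which is not part of the output.
\<close>

definition output_prog :: "instr list" where
  "output_prog = [ParFor 20 (Minus (Var 0) C1) (lets [] @ [RStore (Plus (Var 0) (Var 20)) (Var 20)]),
     ParFor 20 (Minus (Times (Const 2) (Var 0)) C1) (lets out_lets @ [Store (Var 26) (Var 24)]),
     ParFor 20 (Minus (Times (Const 2) (Var 0)) C1) (lets out_lets @
       [Store (EIte (Equal (Load (Var 26)) (Var 24)) C1 (Plus (Var 26) C1)) (Var 24)])]"

definition main_prog :: "instr list" where
  "main_prog = init_prog @ sort_prog @ load_prog @ [WhileNZ (Var 9) round_body] @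
     [WhileNZ (Var 6) unwind_body] @ output_prog"

locale input_output = rounds +
  fixes sig :: "nat \<Rightarrow> nat" and E :: "nat set set" and wt :: "nat set \<Rightarrow> real" and es :: "(nat \<times> nat) list"
  assumes ti: "tree_input n E es" and len: "length es = n - 1"
    and bij: "bij_betw sig {..<n - 1} {..<n - 1}"
    and mono: "\<And>i j. i \<le> j \<Longrightarrow> j < n - 1 \<Longrightarrow> r0 (sig i) \<le> r0 (sig j)"
    and Z: "\<And>p. p < M \<Longrightarrow> Z (Lam, p, 0, 0) = sig p" and sigM: "\<And>p. p < M \<Longrightarrow> sig p < M"
    and ep0: "ep0 = ep_in n es sig"
    and l0: "\<And>x. x < B \<Longrightarrow> l0 x = word_mem (initial_config n wt es) x"
    and r0_wt: "\<And>i. i < n - 1 \<Longrightarrow> r0 i = wt (edge (es ! i))"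
begin

lemma sig_less: "p < n - 1 \<Longrightarrow> sig p < n - 1"
  using bij_betwE[OF bij] by auto

lemma l0_endpoint:
  assumes "i < n - 1" "q < 2"
  shows "l0 (1 + (2 * i + q)) = (if q = 0 then fst (es ! i) else snd (es ! i))"
proof -
  have "1 + (2 * i + q) < B" using assms nM BM n1 by linarith
  moreover have "1 + (2 * i + q) \<le> 2 * length es" using assms len by linarith
  moreover have "q = 0 \<or> q = 1" using assms by auto
  ultimately show ?thesis by (auto simp: l0 initial_config_def)
qed

lemma ep0_less:
  assumes "e \<in> {Suc n..<2 * n}" "q < 2"
  shows "ep0 e q = Suc (l0 (1 + (2 * sig (e - Suc n) + q)))" "ep0 e q \<le> n"
proof -
  have "sig (e - Suc n) < n - 1" using assms by (intro sig_less) auto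
  from l0_endpoint[OF this assms(2)] show "ep0 e q = Suc (l0 (1 + (2 * sig (e - Suc n) + q)))"
    by (simp add: ep0 ep_in_def)
  show "ep0 e q \<le> n" using ctreeD(4)[OF tree0 assms] by simp
qed

lemma tri_load:
  "tri load_prog (\<lambda>l V r s. l = l0 \<and> r = r0 \<and> fresh {1..9} V \<and> base_env s \<and> V 10 = Z)
    11 (10 * M + 10) (bor_inv 0)"
proof -
  define G where "G = (\<lambda>l V r s. l = l0 \<and> r = r0 \<and> fresh {3, 7, 8, 9} V \<and> base_env s \<and> V 10 = Z \<and> s 9 = n - 1)"
  have a: "tri [Assign 9 (Minus (Var 0) C1)]
    (\<lambda>l V r s. l = l0 \<and> r = r0 \<and> fresh {1..9} V \<and> base_env s \<and> V 10 = Z) 1 1 G"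
    by (rule tri_Assign) (auto simp: evs G_def fresh_def base_env_def)
  have b: "tri [Par (Var 9) [] 1 C0 (Var 20) C0 C0 (Plus (Plus (Var 0) C1) (Var 20))] G
    (length ([] :: (nat \<times> exp) list) + 3) ((n - 1) * (length ([] :: (nat \<times> exp) list) + 2) + 2)
    (\<lambda>l V r s. G l V r s \<and> LSok 0 (V 1))"
  proof (rule tri_par)
    fix m r s assume G: "G (lo m) (vw m) r s"
    let ?idx = "\<lambda>j::nat. (0::nat, j, 0::nat, 0::nat)" and ?v = "\<lambda>j. Suc n + j"
    have s: "s 0 = n" "s 3 = B" "s 9 = n - 1" using G by (auto simp: G_def base_env_def)
    have jB: "j < B" "Suc n + j < 16 * B" if "j < n - 1" for j using that nM BM n1 by linarith+
    have main: "let s' = assigns w m r [] (s(20 := j)) in s' 3 = B \<and> inb (?idx j) \<and>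
       (eval w m r s' C0, eval w m r s' (Var 20), eval w m r s' C0, eval w m r s' C0) = ?idx j \<and>
       eval w m r s' (Plus (Plus (Var 0) C1) (Var 20)) = ?v j" if "j < n - 1" for j
      using s jB[OF that] B16 by (simp add: evs)
    let ?U = "upd (vw m 1) {..<n - 1} ?idx ?v"
    have U: "?U (0, j, 0, 0) = Suc n + j" if "j < n - 1" for j
      by (rule upd_hit[of j]) (use that in auto)
    have "bij_betw (\<lambda>j. ?U (0, j, 0, 0)) {..<n - 1} {Suc n..<2 * n} \<longleftrightarrow> bij_betw (\<lambda>j. Suc n + j) {..<n - 1} {Suc n..<2 * n}"
      by (rule bij_betw_cong) (use U in auto)
    moreover have "bij_betw (\<lambda>j. Suc n + j) {..<n - 1} {Suc n..<2 * n}"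
      by (rule bij_betw_byWitness[where f' = "\<lambda>x. x - Suc n"]) auto
    ultimately have "LSok 0 ?U" by (simp add: LSok_def cnt_0 r0)
    then have "G (lo m) ((vw m)(1 := ?U)) r s \<and> LSok 0 (((vw m)(1 := ?U)) 1)"
      using G by (simp add: G_def)
    then show "\<exists>idx v. eval w m r s (Var 9) = n - 1 \<and>
     (\<forall>i<n - 1. let s' = assigns w m r [] (s(20 := i)) in s' 3 = B \<and> inb (idx i) \<and>
       (eval w m r s' C0, eval w m r s' (Var 20), eval w m r s' C0, eval w m r s' C0) = idx i \<and>
       eval w m r s' (Plus (Plus (Var 0) C1) (Var 20)) = v i) \<and>
     G (lo m) ((vw m)(1 := upd (vw m 1) {..<n - 1} idx v)) r s \<and>
     LSok 0 (((vw m)(1 := upd (vw m 1) {..<n - 1} idx v)) 1)"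
      using main eval_Var[of m r s 9, unfolded s(3)] by (intro exI[of _ ?idx] exI[of _ ?v]) blast
  qed auto
  let ?val = "Plus (Load (Plus C1 (Plus (Times (Const 2) (LD 10 (Var 2) (Div (Var 20) (Const 2)) C0 C0))
         (Mod (Var 20) (Const 2))))) C1"
  let ?eb = "Plus (Plus (Var 0) C1) (Div (Var 20) (Const 2))"
  have c: "tri [Par (Times (Const 2) (Var 9)) [] 2 C0 ?eb (Mod (Var 20) (Const 2)) C0 ?val]
    (\<lambda>l V r s. G l V r s \<and> LSok 0 (V 1)) (length ([] :: (nat \<times> exp) list) + 3)
    ((2 * (n - 1)) * (length ([] :: (nat \<times> exp) list) + 2) + 2)
    (\<lambda>l V r s. G l V r s \<and> LSok 0 (V 1) \<and> EPok 0 (V 2))"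
  proof (rule tri_par)
    fix m r s assume G: "G (lo m) (vw m) r s \<and> LSok 0 (vw m 1)"
    let ?idx = "\<lambda>j::nat. (0::nat, Suc n + j div 2, j mod 2, 0::nat)"
      and ?v = "\<lambda>j. ep0 (Suc n + j div 2) (j mod 2)"
    have s: "s 0 = n" "s 2 = Lam" "s 3 = B" "s 9 = n - 1" using G by (auto simp: G_def base_env_def)
    have l: "lo m = l0" and VZ: "vw m 10 = Z" using G by (auto simp: G_def)
    have main: "let s' = assigns w m r [] (s(20 := j)) in s' 3 = B \<and> inb (?idx j) \<and>
       (eval w m r s' C0, eval w m r s' ?eb, eval w m r s' (Mod (Var 20) (Const 2)), eval w m r s' C0) = ?idx j \<and>
       eval w m r s' ?val = ?v j" if j: "j < 2 * (n - 1)" for j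
    proof -
      let ?s = "s(20 := j)"
      define i where "i = j div 2"
      define q where "q = j mod 2"
      have i: "i < n - 1" and q: "q < 2" using j by (auto simp: i_def q_def)
      have eA: "Suc n + i \<in> {Suc n..<2 * n}" using i by auto
      have sg: "sig i < n - 1" by (rule sig_less[OF i])
      have b: "Lam < B" "i < B" "i < M" "2 * sig i < 16 * B" "1 + (2 * sig i + q) < B" "Suc n + i < B" "q < B"
          "2 * sig i + q < 16 * B" "1 + (2 * sig i + q) < 16 * B"
        using Lam_less i sg q nM BM n1 by linarith+
      have e1: "eval w m r ?s (LD 10 (Var 2) (Div (Var 20) (Const 2)) C0 C0) = sig i"
        using s b Z[of i] B16 by (simp add: evs VZ i_def[symmetric])
      have e2: "eval w m r ?s (Plus C1 (Plus (Times (Const 2) (LD 10 (Var 2) (Div (Var 20) (Const 2)) C0 C0))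
         (Mod (Var 20) (Const 2)))) = 1 + (2 * sig i + q)"
        using b e1 by (simp add: eval_Plus eval_Times eval_Const eval_Mod eval_Var q_def[symmetric])
      have e3: "eval w m r ?s (Load (Plus C1 (Plus (Times (Const 2) (LD 10 (Var 2) (Div (Var 20) (Const 2)) C0 C0))
         (Mod (Var 20) (Const 2))))) = l0 (1 + (2 * sig i + q))"
        by (subst eval_Load_lo) (simp_all only: e2 l b)
      have le: "ep0 (Suc n + i) q = Suc (l0 (1 + (2 * sig i + q)))" "ep0 (Suc n + i) q \<le> n"
        using ep0_less[OF eA q] by simp_all
      then have b': "l0 (1 + (2 * sig i + q)) + 1 < 16 * B" using nM BM n1 by linarith
      have e1': "eval w m r ?s C1 = 1" by (simp add: eval_Const)
      have e4: "eval w m r ?s ?val = ep0 (Suc n + i) q"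
        unfolding le(1) by (subst eval_Plus) (simp_all only: e3 e1' b' Suc_eq_plus1)
      have e5: "eval w m r ?s ?eb = Suc n + i"
        using s b by (simp add: evs i_def[symmetric])
      have e6: "eval w m r ?s (Mod (Var 20) (Const 2)) = q" by (simp add: evs q_def)
      show ?thesis unfolding assigns.simps Let_def i_def[symmetric] q_def[symmetric] e4 e5 e6
        using s b by (simp add: evs)
    qed
    let ?U = "upd (vw m 2) {..<2 * (n - 1)} ?idx ?v"
    have "?U (0, e, q, 0) = ep0 e q" if e: "e \<in> {Suc n..<2 * n}" and q: "q < 2" for e q
    proof (rule upd_hit[of "2 * (e - Suc n) + q"])
      show "?idx (2 * (e - Suc n) + q) = (0, e, q, 0)" using e q by simp
      show "2 * (e - Suc n) + q \<in> {..<2 * (n - 1)}" using e q by simp linarith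
    qed auto
    then have "EPok 0 ?U" by (simp add: EPok_def r0)
    then have "G (lo m) ((vw m)(2 := ?U)) r s \<and> LSok 0 (((vw m)(2 := ?U)) 1) \<and> EPok 0 (((vw m)(2 := ?U)) 2)"
      using G by (simp add: G_def)
    moreover have "2 * (n - 1) < 16 * B" using nM BM n1 by linarith
    then have "eval w m r s (Times (Const 2) (Var 9)) = 2 * (n - 1)"
      by (subst eval_Times) (simp_all add: eval_Const eval_Var s)
    ultimately show "\<exists>idx v. eval w m r s (Times (Const 2) (Var 9)) = 2 * (n - 1) \<and>
     (\<forall>i<2 * (n - 1). let s' = assigns w m r [] (s(20 := i)) in s' 3 = B \<and> inb (idx i) \<and>
       (eval w m r s' C0, eval w m r s' ?eb, eval w m r s' (Mod (Var 20) (Const 2)), eval w m r s' C0) = idx i \<and>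
       eval w m r s' ?val = v i) \<and>
     G (lo m) ((vw m)(2 := upd (vw m 2) {..<2 * (n - 1)} idx v)) r s \<and>
     LSok 0 (((vw m)(2 := upd (vw m 2) {..<2 * (n - 1)} idx v)) 1) \<and>
     EPok 0 (((vw m)(2 := upd (vw m 2) {..<2 * (n - 1)} idx v)) 2)"
      using main by (intro exI[of _ ?idx] exI[of _ ?v]) blast
  qed auto
  have d: "tri [Assign 6 C0] (\<lambda>l V r s. G l V r s \<and> LSok 0 (V 1) \<and> EPok 0 (V 2)) 1 1
    (\<lambda>l V r s. G l V r s \<and> LSok 0 (V 1) \<and> EPok 0 (V 2) \<and> s 6 = 0)"
    by (rule tri_Assign) (simp add: evs G_def)
  have e: "tri [Par C1 [] 6 C0 C0 C0 C0 (Var 9)]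
    (\<lambda>l V r s. G l V r s \<and> LSok 0 (V 1) \<and> EPok 0 (V 2) \<and> s 6 = 0)
    (length ([] :: (nat \<times> exp) list) + 3) (1 * (length ([] :: (nat \<times> exp) list) + 2) + 2) (bor_inv 0)"
  proof (rule tri_par)
    fix m r s assume G: "G (lo m) (vw m) r s \<and> LSok 0 (vw m 1) \<and> EPok 0 (vw m 2) \<and> s 6 = 0"
    let ?idx = "\<lambda>j::nat. (0::nat, 0::nat, 0::nat, 0::nat)" and ?v = "\<lambda>j::nat. n - 1"
    have s: "s 3 = B" "s 9 = n - 1" using G by (auto simp: G_def base_env_def)
    have main: "let s' = assigns w m r [] (s(20 := j)) in s' 3 = B \<and> inb (?idx j) \<and>
       (eval w m r s' C0, eval w m r s' C0, eval w m r s' C0, eval w m r s' C0) = ?idx j \<and>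
       eval w m r s' (Var 9) = ?v j" for j
      using s B16 by (simp add: evs)
    let ?U = "upd (vw m 6) {..<1} ?idx ?v"
    have "?U (0, 0, 0, 0) = n - 1" by (rule upd_hit[of 0]) auto
    then have "MMok 0 ?U" by (simp add: MMok_def cnt_0)
    moreover have "vw m 3 = (\<lambda>_. 0)" using G by (simp add: G_def fresh_def)
    ultimately have "bor_inv 0 (lo m) ((vw m)(6 := ?U)) r s"
      using G by (simp add: G_def bor_inv_def core_def cnt_0 PRok_def fresh_def)
    moreover have "eval w m r s C1 = 1" by (simp add: evs)
    ultimately show "\<exists>idx v. eval w m r s C1 = 1 \<and>
     (\<forall>i<1. let s' = assigns w m r [] (s(20 := i)) in s' 3 = B \<and> inb (idx i) \<and>
       (eval w m r s' C0, eval w m r s' C0, eval w m r s' C0, eval w m r s' C0) = idx i \<and>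
       eval w m r s' (Var 9) = v i) \<and>
     bor_inv 0 (lo m) ((vw m)(6 := upd (vw m 6) {..<1} idx v)) r s"
      using main by (intro exI[of _ ?idx] exI[of _ ?v]) blast
  qed auto
  have "(n - 1) * 2 + 2 * (n - 1) * 2 \<le> 10 * M" using nM by simp
  then show ?thesis unfolding load_prog_def
    by (intro tri_conseq[OF tri_Cons[OF a tri_Cons[OF b tri_Cons[OF c tri_Cons[OF d e]]]]]) auto
qed

section \<open>Numbering of the output nodes\<close>

definition oid :: "nat \<Rightarrow> nat" where
  "oid q = (if n < q then n + sig (q - n - 1) else q - 1)"

abbreviation pr :: "nat \<Rightarrow> nat" where "pr \<equiv> par {Suc n..<2 * n} ep0"

lemma sep0: "v \<in> {1..n} \<Longrightarrow> e \<in> {Suc n..<2 * n} \<Longrightarrow> v < e"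
  by auto

lemma nodes0: "{1..n} \<union> {Suc n..<2 * n} = {1..<2 * n}"
  using n1 by auto

lemma pr_cases: "pr q = 0 \<or> pr q \<in> {Suc n..<2 * n}"
  using par_in[of "{Suc n..<2 * n}" ep0 q] by (auto simp: parset_def)

lemma oid_ge: "f \<in> {Suc n..<2 * n} \<Longrightarrow> n \<le> oid f" and oid_0: "oid 0 = 0"
  by (auto simp: oid_def)

lemma oid_less: "q < 2 * n \<Longrightarrow> oid q < 2 * n - 1"
proof -
  assume q: "q < 2 * n"
  show ?thesis
  proof (cases "n < q")
    case True
    then have "sig (q - n - 1) < n - 1" using q by (intro sig_less) linarith
    then show ?thesis using True unfolding oid_def if_P[OF True] by linarith
  next
    case False
    then show ?thesis using n1 unfolding oid_def if_not_P[OF False] by linarith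
  qed
qed

lemma oid_inj: "inj_on oid {1..<2 * n}"
proof (rule inj_onI)
  fix x y assume xy: "x \<in> {1..<2 * n}" "y \<in> {1..<2 * n}" "oid x = oid y"
  have "n < z \<longleftrightarrow> n \<le> oid z" if "1 \<le> z" for z using that n1 by (auto simp: oid_def)
  then have *: "n < x \<longleftrightarrow> n \<le> oid x" "n < y \<longleftrightarrow> n \<le> oid y" using xy by auto
  show "x = y"
  proof (cases "n < x")
    case True
    then have "n < y" using * xy by simp
    with True xy have "sig (x - n - 1) = sig (y - n - 1)" by (simp add: oid_def)
    moreover have "x - n - 1 \<in> {..<n - 1}" "y - n - 1 \<in> {..<n - 1}" using xy True \<open>n < y\<close> by auto
    ultimately have "x - n - 1 = y - n - 1" using bij by (auto simp: bij_betw_def inj_on_def)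
    then show ?thesis using True \<open>n < y\<close> by simp
  next
    case False
    then have "\<not> n < y" using * xy by simp
    then show ?thesis using False xy by (auto simp: oid_def)
  qed
qed

text \<open>\<open>oid\<close> sends both 0 and the vertex 1 to 0, so injectivity fails once 0 is
  included; but a parent is never a vertex.\<close>

lemma oid_pr_eq:
  assumes "f = 0 \<or> f \<in> {Suc n..<2 * n}"
  shows "oid (pr q) = oid f \<longleftrightarrow> pr q = f"
proof
  assume e: "oid (pr q) = oid f"
  show "pr q = f"
  proof (cases "pr q = 0 \<or> f = 0")
    case True
    then have "\<not> n \<le> oid (pr q) \<or> \<not> n \<le> oid f" using n1 oid_0 by auto
    then show ?thesis using e assms pr_cases[of q] oid_ge by metis
  next
    case False
    then have "pr q \<in> {1..<2 * n}" "f \<in> {1..<2 * n}" using assms pr_cases[of q] by auto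
    then show ?thesis using e oid_inj by (auto simp: inj_on_def)
  qed
qed simp

lemma eval_oid:
  assumes "s 0 = n" "s 2 = Lam" "s 3 = B" and V: "vw m 10 = Z"
    and x: "eval w m r s e = x" "x < 2 * n"
  shows "eval w m r s (e_oid e) = oid x"
proof -
  have xM: "x - n - 1 < M" using x nM n1 by linarith
  have b: "Lam < B" "x - n - 1 < B" "n + sig (x - n - 1) < 16 * B" "x - 1 < 16 * B"
    using Lam_less xM sigM[OF xM] x nM BM n1 by linarith+
  have e1: "eval w m r s (LD 10 (Var 2) (Minus (Minus e (Var 0)) C1) C0 C0) = sig (x - n - 1)"
    using assms b Z[OF xM] B16 by (simp add: evs)
  have e2: "eval w m r s (Plus (Var 0) (LD 10 (Var 2) (Minus (Minus e (Var 0)) C1) C0 C0)) = n + sig (x - n - 1)"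
    using assms b e1 by (subst eval_Plus) (simp_all add: eval_Var)
  have e3: "eval w m r s (Minus e C1) = x - 1" using x by (simp add: evs)
  have e4: "eval w m r s (Less (Var 0) e) = of_bool (n < x)" using assms by (simp add: evs)
  show ?thesis unfolding e_oid_def oid_def
    by (subst eval_EIte) (simp_all only: e2 e3 e4 b, simp)
qed

lemma out_lets:
  assumes s: "base_env s" and V: "vw m 10 = Z" "\<forall>x\<in>{1..<2 * n}. vw m 3 (0, x, 0, 0) = pr x"
    and j: "j < 2 * n - 1"
  shows "assigns w m r out_lets (s(20 := j)) =
    s(20 := j, 23 := Suc j, 24 := oid (Suc j), 25 := pr (Suc j), 26 := 2 * oid (pr (Suc j)))"
proof -
  have s': "s 0 = n" "s 2 = Lam" "s 3 = B" using s by (auto simp: base_env_def)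
  have j': "Suc j < 2 * n" "Suc j < B" "Suc j < 16 * B" using j nM BM n1 by linarith+
  have p: "pr (Suc j) < 2 * n" using pr_cases[of "Suc j"] n1 by auto
  have o: "2 * oid (pr (Suc j)) < 16 * B" using oid_less[OF p] nM BM n1 by linarith
  have e1: "eval w m r (s(20 := j)) (Plus (Var 20) C1) = Suc j" using j' by (simp add: evs)
  have e2: "eval w m r (s(20 := j, 23 := Suc j)) (e_oid (Var 23)) = oid (Suc j)"
    using s' V j' by (intro eval_oid) (simp_all add: eval_Var)
  have e3: "eval w m r (s(20 := j, 23 := Suc j, 24 := oid (Suc j))) (LD 3 C0 (Var 23) C0 C0) = pr (Suc j)"
    using s' V j' B16 by (simp add: evs)
  have e4: "eval w m r (s(20 := j, 23 := Suc j, 24 := oid (Suc j), 25 := pr (Suc j))) (e_oid (Var 25)) = oid (pr (Suc j))"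
    using s' V p by (intro eval_oid) (simp_all add: eval_Var)
  have e5: "eval w m r (s(20 := j, 23 := Suc j, 24 := oid (Suc j), 25 := pr (Suc j))) (Times (Const 2) (e_oid (Var 25)))
     = 2 * oid (pr (Suc j))"
    using e4 o by (subst eval_Times) (simp_all add: eval_Const)
  show ?thesis unfolding out_lets_def assigns.simps fst_conv snd_conv e1 e2 e3 e5 ..
qed

definition out1 :: "nat \<Rightarrow> nat" where
  "out1 = upd l0 {..<2 * n - 1} (\<lambda>j. 2 * oid (pr (Suc j))) (\<lambda>j. oid (Suc j))"

definition out2 :: "nat \<Rightarrow> nat" where
  "out2 = upd out1 {..<2 * n - 1}
     (\<lambda>j. if out1 (2 * oid (pr (Suc j))) = oid (Suc j) then 1 else 2 * oid (pr (Suc j)) + 1) (\<lambda>j. oid (Suc j))"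

definition outr :: "nat \<Rightarrow> real" where
  "outr = pwrite r0 (n - 1) (\<lambda>i. n + i) r0"

lemma tri_output:
  "tri output_prog (un_inv 0) 17 (40 * M + 10) (\<lambda>l V r s. l = out2 \<and> r = outr)"
proof -
  define G where "G = (\<lambda>V s. base_env s \<and> V (10::nat) = Z \<and> (\<forall>x\<in>{1..<2 * n}. V 3 (0, x, 0, 0) = pr x))"
  have a: "tri [ParFor 20 (Minus (Var 0) C1) (lets [] @ [RStore (Plus (Var 0) (Var 20)) (Var 20)])] (un_inv 0)
    (length ([] :: (nat \<times> exp) list) + 3) ((n - 1) * (length ([] :: (nat \<times> exp) list) + 2) + 2)
    (\<lambda>l V r s. l = l0 \<and> r = outr \<and> G V s)"
  proof (rule tri_par_R)
    fix m r s assume u: "un_inv 0 (lo m) (vw m) r s"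
    have s: "s 0 = n" "r = r0" using u by (auto simp: un_inv_def base_env_def)
    have "n + j < 16 * B" if "j < n - 1" for j using that nM BM n1 by linarith
    then have "let s' = assigns w m r [] (s(20 := j)) in eval w m r s' (Plus (Var 0) (Var 20)) = n + j \<and>
       r (eval w m r s' (Var 20)) = r0 j" if "j < n - 1" for j
      using that s by (simp add: evs)
    moreover have "lo m = l0 \<and> pwrite r (n - 1) (\<lambda>j. n + j) r0 = outr \<and> G (vw m) s"
      using u nodes0 unfolding G_def un_inv_def nodes_def r0 outr_def by simp
    moreover have "eval w m r s (Minus (Var 0) C1) = n - 1" using s by (simp add: evs)
    ultimately show "\<exists>a v. eval w m r s (Minus (Var 0) C1) = n - 1 \<and>
      (\<forall>i<n - 1. let s' = assigns w m r [] (s(20 := i)) in eval w m r s' (Plus (Var 0) (Var 20)) = a i \<and>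
       r (eval w m r s' (Var 20)) = v i) \<and> lo m = l0 \<and> pwrite r (n - 1) a v = outr \<and> G (vw m) s"
      by (intro exI[of _ "\<lambda>j. n + j"] exI[of _ r0]) blast
  qed
  have N: "eval w m r s (Minus (Times (Const 2) (Var 0)) C1) = 2 * n - 1" if "G V s" for m r V s
  proof -
    have "s 0 = n" using that by (simp add: G_def base_env_def)
    moreover have "2 * n < 16 * B" using nM BM n1 by linarith
    ultimately show ?thesis by (simp add: evs)
  qed
  have pB: "2 * oid (pr q) + 1 < B" for q
  proof -
    have "oid (pr q) < 2 * n - 1" using pr_cases[of q] n1 by (intro oid_less) auto
    then show ?thesis using nM BM n1 by linarith
  qed
  have pB': "2 * oid (pr q) < B" for q using pB[of q] by linarith
  have GV: "G V s" if "G (vw m) s" "\<forall>t\<ge>1. V t = vw m t" for V m s using that by (simp add: G_def)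
  have b: "tri [ParFor 20 (Minus (Times (Const 2) (Var 0)) C1) (lets out_lets @ [Store (Var 26) (Var 24)])]
    (\<lambda>l V r s. l = l0 \<and> r = outr \<and> G V s) (length out_lets + 3) ((2 * n - 1) * (length out_lets + 2) + 2)
    (\<lambda>l V r s. l = out1 \<and> r = outr \<and> G V s)"
  proof (rule tri_par_lo)
    fix m r s assume p: "lo m = l0 \<and> r = outr \<and> G (vw m) s"
    let ?a = "\<lambda>j. 2 * oid (pr (Suc j))" and ?v = "\<lambda>j. oid (Suc j)"
    have main: "let s' = assigns w m r out_lets (s(20 := j)) in eval w m r s' (Var 26) = ?a j \<and> ?a j < B \<and>
       eval w m r s' (Var 24) = ?v j" if j: "j < 2 * n - 1" for j
    proof -
      have "assigns w m r out_lets (s(20 := j)) =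
        s(20 := j, 23 := Suc j, 24 := oid (Suc j), 25 := pr (Suc j), 26 := 2 * oid (pr (Suc j)))"
        by (rule out_lets) (use p j in \<open>auto simp: G_def\<close>)
      then show ?thesis using pB' by (simp add: eval_Var)
    qed
    have post: "upd (lo m) {..<2 * n - 1} ?a ?v = out1 \<and> r = outr \<and> G V s" if "\<forall>t\<ge>1. V t = vw m t" for V
      using p GV[OF _ that] by (simp add: out1_def)
    have e: "eval w m r s (Minus (Times (Const 2) (Var 0)) C1) = 2 * n - 1" using N p by blast
    note main' = allI[OF impI[OF main]] and post' = allI[OF impI[OF post]]
    show "\<exists>a v. eval w m r s (Minus (Times (Const 2) (Var 0)) C1) = 2 * n - 1 \<and>
     (\<forall>i<2 * n - 1. let s' = assigns w m r out_lets (s(20 := i)) in eval w m r s' (Var 26) = a i \<and> a i < B \<and>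
       eval w m r s' (Var 24) = v i) \<and>
     (\<forall>V. (\<forall>t\<ge>1. V t = vw m t) \<longrightarrow> upd (lo m) {..<2 * n - 1} a v = out1 \<and> r = outr \<and> G V s)"
      by (rule exI[of _ ?a], rule exI[of _ ?v], rule conjI[OF e conjI[OF main' post']])
  qed
  let ?ea = "EIte (Equal (Load (Var 26)) (Var 24)) C1 (Plus (Var 26) C1)"
  have c: "tri [ParFor 20 (Minus (Times (Const 2) (Var 0)) C1) (lets out_lets @ [Store ?ea (Var 24)])]
    (\<lambda>l V r s. l = out1 \<and> r = outr \<and> G V s) (length out_lets + 3) ((2 * n - 1) * (length out_lets + 2) + 2)
    (\<lambda>l V r s. l = out2 \<and> r = outr)"
  proof (rule tri_par_lo)
    fix m r s assume p: "lo m = out1 \<and> r = outr \<and> G (vw m) s"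
    let ?a = "\<lambda>j. if out1 (2 * oid (pr (Suc j))) = oid (Suc j) then 1 else 2 * oid (pr (Suc j)) + 1"
      and ?v = "\<lambda>j. oid (Suc j)"
    have main: "let s' = assigns w m r out_lets (s(20 := j)) in eval w m r s' ?ea = ?a j \<and> ?a j < B \<and>
       eval w m r s' (Var 24) = ?v j" if j: "j < 2 * n - 1" for j
    proof -
      let ?s = "s(20 := j, 23 := Suc j, 24 := oid (Suc j), 25 := pr (Suc j), 26 := 2 * oid (pr (Suc j)))"
      have e: "assigns w m r out_lets (s(20 := j)) = ?s"
        by (rule out_lets) (use p j in \<open>auto simp: G_def\<close>)
      have "eval w m r ?s (Load (Var 26)) = out1 (2 * oid (pr (Suc j)))"
        using pB' p by (subst eval_Load_lo) (simp_all add: eval_Var)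
      then have e1: "eval w m r ?s (Equal (Load (Var 26)) (Var 24)) = of_bool (out1 (2 * oid (pr (Suc j))) = oid (Suc j))"
        by (simp add: eval_bool eval_Var)
      have e2: "eval w m r ?s (Plus (Var 26) C1) = 2 * oid (pr (Suc j)) + 1"
        using pB[of "Suc j"] by (subst eval_Plus) (simp_all add: eval_Var eval_Const)
      have e3: "eval w m r ?s C1 = 1" by (simp add: eval_Const)
      have "2 * oid (pr (Suc j)) + 1 < 16 * B" "1 < 16 * B" using pB[of "Suc j"] B16 by linarith+
      then have e4: "eval w m r ?s ?ea = ?a j"
        by (subst eval_EIte) (simp_all only: e1 e2 e3, simp)
      have "?a j < B" using pB[of "Suc j"] B16 by auto
      then show ?thesis unfolding e Let_def e4 by (simp add: eval_Var)
    qed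
    have post: "upd (lo m) {..<2 * n - 1} ?a ?v = out2 \<and> r = outr" using p by (simp add: out2_def)
    have e: "eval w m r s (Minus (Times (Const 2) (Var 0)) C1) = 2 * n - 1" using N p by blast
    note main' = allI[OF impI[OF main]] and post' = allI[OF impI[OF post]]
    show "\<exists>a v. eval w m r s (Minus (Times (Const 2) (Var 0)) C1) = 2 * n - 1 \<and>
     (\<forall>i<2 * n - 1. let s' = assigns w m r out_lets (s(20 := i)) in eval w m r s' ?ea = a i \<and> a i < B \<and>
       eval w m r s' (Var 24) = v i) \<and>
     (\<forall>V. (\<forall>t\<ge>1. V t = vw m t) \<longrightarrow> upd (lo m) {..<2 * n - 1} a v = out2 \<and> r = outr)"
      by (rule exI[of _ ?a], rule exI[of _ ?v], rule conjI[OF e conjI[OF main' post']])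
  qed
  have l: "length out_lets = 4" by (simp add: out_lets_def)
  have "(n - 1) * 2 + (2 * n - 1) * 6 + (2 * n - 1) * 6 + 6 \<le> 40 * M + 10" using nM by simp
  then show ?thesis unfolding output_prog_def
    by (intro tri_conseq[OF tri_Cons[OF a tri_Cons[OF b c]]]) (auto simp: l)
qed

lemma upd_oid:
  fixes C :: "nat \<Rightarrow> bool"
  assumes "\<And>j. a j = p \<longleftrightarrow> C (Suc j)"
  shows "upd F {..<2 * n - 1} a (\<lambda>j. oid (Suc j)) p =
    (if \<exists>q\<in>{1..<2 * n}. C q then Min {oid q |q. q \<in> {1..<2 * n} \<and> C q} else F p)"
proof -
  have *: "(\<exists>j<2 * n - 1. Q (Suc j)) \<longleftrightarrow> (\<exists>q\<in>{1..<2 * n}. Q q)" for Q :: "nat \<Rightarrow> bool"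
  proof
    assume "\<exists>q\<in>{1..<2 * n}. Q q"
    then obtain q where "q \<in> {1..<2 * n}" "Q q" by blast
    then show "\<exists>j<2 * n - 1. Q (Suc j)" by (intro exI[of _ "q - 1"]) auto
  qed auto
  have "{oid (Suc j) |j. j \<in> {..<2 * n - 1} \<and> C (Suc j)} = {oid q |q. q \<in> {1..<2 * n} \<and> C q}"
    using *[of "\<lambda>q. C q \<and> _ = oid q"] by (intro Collect_cong) (metis (no_types, lifting) lessThan_iff)
  moreover have "(\<exists>j\<in>{..<2 * n - 1}. C (Suc j)) \<longleftrightarrow> (\<exists>q\<in>{1..<2 * n}. C q)"
    using *[of C] by auto
  ultimately show ?thesis unfolding upd_def assms by simp
qed

text \<open>The second loop writes to odd cells only.\<close>

lemma out2_even: "out2 (2 * x) = out1 (2 * x)"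
  unfolding out2_def by (rule upd_miss) (auto split: if_splits, presburger+)

lemma out_children:
  assumes f: "f \<in> {Suc n..<2 * n}"
  shows "\<exists>c c'. c \<noteq> c' \<and> {c, c'} \<subseteq> {1..<2 * n} \<and> pr c = f \<and> pr c' = f \<and>
    out2 (2 * oid f) = oid c \<and> out2 (2 * oid f + 1) = oid c'"
proof -
  \<comment> \<open>Ordering the children by output number makes \<open>c\<close> the winner of the
    first priority write.\<close>
  obtain c c' where c: "oid c < oid c'" "c \<in> {1..<2 * n}" "c' \<in> {1..<2 * n}" "pr c = f" "pr c' = f"
    "\<And>q. q \<in> {1..<2 * n} \<Longrightarrow> pr q = f \<longleftrightarrow> q = c \<or> q = c'"
  proof -
    obtain c0 c1 where c: "c0 \<noteq> c1" "c0 \<in> {1..<2 * n}" "c1 \<in> {1..<2 * n}" "pr c0 = f" "pr c1 = f"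
      "\<And>q. q \<in> {1..<2 * n} \<Longrightarrow> pr q = f \<Longrightarrow> q = c0 \<or> q = c1"
      using tops[OF tree0 sep0 f] unfolding nodes0 by metis
    then have "oid c0 \<noteq> oid c1" using oid_inj by (auto simp: inj_on_def)
    then have "oid c0 < oid c1 \<or> oid c1 < oid c0" by linarith
    then show ?thesis using c that[of c0 c1] that[of c1 c0] by blast
  qed
  \<comment> \<open>Internal nodes have positive output numbers, so neither cell 0 of the root nor
    cell 1 of the winners is a child cell of \<open>f\<close>.\<close>
  have f0: "oid f \<noteq> 0" using oid_ge[OF f] n1 by auto
  have 1: "out1 (2 * oid f) = oid c"
  proof -
    have "{oid q |q. q \<in> {1..<2 * n} \<and> pr q = f} = {oid c, oid c'}" using c by auto
    then show ?thesis unfolding out1_def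
      by (subst upd_oid[where C = "\<lambda>q. pr q = f"]) (use c oid_pr_eq[of f] f in auto)
  qed
  have "out2 (2 * oid f + 1) = oid c'"
  proof -
    have eq: "(if out1 (2 * oid (pr (Suc j))) = oid (Suc j) then 1 else 2 * oid (pr (Suc j)) + 1) = 2 * oid f + 1
       \<longleftrightarrow> pr (Suc j) = f \<and> oid c \<noteq> oid (Suc j)" for j
      using f0 1 oid_pr_eq[of f "Suc j"] f by auto
    have "{oid q |q. q \<in> {1..<2 * n} \<and> pr q = f \<and> oid c \<noteq> oid q} = {oid c'}" using c by auto
    moreover have "\<exists>q\<in>{1..<2 * n}. pr q = f \<and> oid c \<noteq> oid q" using c by auto
    ultimately show ?thesis unfolding out2_def
      by (subst upd_oid[where C = "\<lambda>q. pr q = f \<and> oid c \<noteq> oid q", OF eq]) simp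
  qed
  moreover have "c \<noteq> c'" using c(1) by auto
  moreover have "{c, c'} \<subseteq> {1..<2 * n}" using c(2,3) by simp
  moreover have "out2 (2 * oid f) = oid c" unfolding out2_even by (rule 1)
  ultimately have "c \<noteq> c' \<and> {c, c'} \<subseteq> {1..<2 * n} \<and> pr c = f \<and> pr c' = f \<and>
    out2 (2 * oid f) = oid c \<and> out2 (2 * oid f + 1) = oid c'" using c(4,5) by (intro conjI)
  then show ?thesis by (intro exI)
qed

text \<open>Only nodes without a parent target cell 0, and there is just one of them, so the minimum
  is over a single value.\<close>

lemma out_root:
  assumes c: "c \<in> {1..<2 * n}" "pr c = 0"
  shows "out2 0 = oid c"
proof -
  have "q = c" if "q \<in> {1..<2 * n}" "pr q = 0" for q
    by (rule root_unique[OF tree0 sep0]) (use that c nodes0 in simp_all)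
  then have "q \<in> {1..<2 * n} \<and> pr q = 0 \<longleftrightarrow> q = c" for q using c by blast
  then have "{oid q |q. q \<in> {1..<2 * n} \<and> pr q = 0} = {oid c}" by (simp only:) simp
  moreover have "2 * oid (pr (Suc j)) = 0 \<longleftrightarrow> pr (Suc j) = 0" for j
    using oid_pr_eq[of 0 "Suc j"] oid_0 by auto
  moreover have "\<exists>q\<in>{1..<2 * n}. pr q = 0" using c by blast
  ultimately have "out1 0 = oid c" unfolding out1_def
    by (subst upd_oid[where C = "\<lambda>q. pr q = 0"]) simp_all
  then show ?thesis using out2_even[of 0] by simp
qed

lemma outr_node: "i < n - 1 \<Longrightarrow> outr (n + i) = r0 i"
proof -
  assume "i < n - 1"
  then have "{r0 j |j. j < n - 1 \<and> n + j = n + i} = {r0 i}" by auto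
  then show ?thesis using \<open>i < n - 1\<close> by (auto simp: outr_def pwrite_eq)
qed

lemma output_correct:
  assumes m: "lo m = out2"
  shows "\<exists>d. is_dendrogram wt {..<n} E d \<and> represents n es m outr d (m 0)"
proof -
  define ed where "ed e = edge (es ! sig (e - Suc n))" for e
  define al where "al x = x - (1::nat)" for x
  let ?A = "{Suc n..<2 * n}"
  have mlo: "m x = out2 x" if "x < B" for x using m that by (metis lo_def)
  have idx: "e - Suc n < n - 1" "sig (e - Suc n) < n - 1" if "e \<in> ?A" for e
    using that sig_less[of "e - Suc n"] by auto
  have al: "inj_on al {1..n}" by (auto simp: al_def inj_on_def)
  have ed: "ed e = {al (ep0 e 0), al (ep0 e 1)}" if "e \<in> ?A" for e
    by (simp add: ed_def al_def ep0 ep_in_def edge_def)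
  have wt: "wt (ed e) \<le> wt (ed g)" if "e \<in> ?A" "g \<in> ?A" "e \<le> g" for e g
    using mono[of "e - Suc n" "g - Suc n"] idx[OF that(1)] idx[OF that(2)] that(3)
    by (simp add: ed_def r0_wt[symmetric] diff_le_mono)
  obtain c where c: "c \<in> {1..<2 * n}" "pr c = 0"
    using root_exists[OF tree0 sep0] unfolding nodes0 by blast
  have oidf: "oid f = n + sig (f - Suc n)" if "f \<in> ?A" for f
    using that by (simp add: oid_def)
  have "\<exists>d. is_dendrogram wt (al ` cluster ?A ep0 c) (cluster_edges ?A ep0 ed c) d \<and>
      represents n es m outr d (oid c)"
  proof (rule dendrogram_of_parents[where V = "{1..n}" and A = ?A and ep = ep0 and al = al and ed = ed and wt = wt,
      OF tree0 sep0 al ed wt])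
    show "al v < n \<and> oid v = al v" if "v \<in> {1..n}" for v
      using that by (auto simp: al_def oid_def)
    show "(\<exists>j<length es. oid f = n + j \<and> edge (es ! j) = ed f) \<and> outr (oid f) = wt (ed f)" if "f \<in> ?A" for f
      using idx[OF that] oidf[OF that] len outr_node r0_wt by (auto simp: ed_def)
    show "\<exists>c c'. c \<noteq> c' \<and> {c, c'} \<subseteq> {1..n} \<union> ?A \<and> pr c = f \<and> pr c' = f \<and>
      m (2 * oid f) = oid c \<and> m (2 * oid f + 1) = oid c'" if "f \<in> ?A" for f
    proof -
      have "oid f < 2 * n - 1" using that by (intro oid_less) auto
      then have "2 * oid f < B" "2 * oid f + 1 < B" using nM BM n1 by linarith+
      then have "m (2 * oid f) = out2 (2 * oid f)" "m (2 * oid f + 1) = out2 (2 * oid f + 1)" by (simp_all only: mlo)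
      then show ?thesis using out_children[OF that] unfolding nodes0 by (simp only:)
    qed
    show "c \<in> {1..n} \<union> ?A" using c nodes0 by simp
  qed
  moreover have "cluster ?A ep0 c = {1..n}" "cluster_edges ?A ep0 ed c = ed ` ?A"
    using root_cluster[where V = "{1..n}" and A = ?A and ep = ep0 and al = al and ed = ed and wt = wt,
      OF tree0 sep0 al ed wt, of c] c unfolding nodes0 by simp_all
  moreover have "al ` {1..n} = {..<n}"
  proof -
    have "x \<in> al ` {1..n}" if "x < n" for x using that by (intro image_eqI[of _ _ "Suc x"]) (auto simp: al_def)
    then show ?thesis by (auto simp: al_def)
  qed
  moreover have "ed ` ?A = E"
  proof -
    have "(\<lambda>e. e - Suc n) ` ?A = {..<n - 1}"
    proof -
      have "x \<in> (\<lambda>e. e - Suc n) ` ?A" if "x < n - 1" for x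
        using that by (intro image_eqI[of _ _ "x + Suc n"]) auto
      then show ?thesis by auto
    qed
    then have "(\<lambda>j. edge (es ! j)) ` sig ` (\<lambda>e. e - Suc n) ` ?A = (\<lambda>j. edge (es ! j)) ` sig ` {..<n - 1}"
      by simp
    then have "ed ` ?A = (\<lambda>j. edge (es ! j)) ` sig ` {..<n - 1}"
      unfolding ed_def image_image .
    also have "\<dots> = (\<lambda>j. edge (es ! j)) ` {..<length es}"
      using bij len by (simp add: bij_betw_def)
    also have "\<dots> = set (map edge es)"
    proof -
      have "set es = (!) es ` {..<length es}" by (auto simp: set_conv_nth)
      then show ?thesis by (simp add: image_image)
    qed
    finally show ?thesis using ti by (simp add: tree_input_def)
  qed
  moreover have "m 0 = oid c" using out_root[OF c] mlo[of 0] B16 by simp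
  ultimately show ?thesis by simp
qed

end


section \<open>The algorithm computes a dendrogram\<close>

text \<open>The edges are counted in the labelled tree, for which any labelling will do, here the
  one by input order.\<close>

lemma tree_input_length:
  assumes "tree_input n E es" shows "1 \<le> n" "length es = n - 1"
proof -
  have "{..<n} \<noteq> {}" using assms by (simp add: tree_input_def is_tree_def)
  then show "1 \<le> n" by (auto simp: Suc_le_eq)
  have "ctree {1..n} {Suc n..<Suc n + length es} (ep_in n es id)"
    by (rule tree_input_ctree[OF assms]) (simp add: bij_betw_def)
  from card_ctree[OF this] show "length es = n - 1" by simp
qed

context instance_params
begin

lemma main_runs:
  fixes wt :: "nat set \<Rightarrow> real"
  assumes ti: "tree_input n E es"
  defines "m0 \<equiv> word_mem (initial_config n wt es)" and "r0 \<equiv> real_mem (initial_config n wt es)"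
  shows "\<exists>m' r' s'. runs P w main_prog m0 r0 (\<lambda>_. 0) m' r' s' (260 * (Lam + 1)\<^sup>2) (612 * (M * (Lam + 1))) \<and>
    (\<exists>d. is_dendrogram wt {..<n} E d \<and> represents n es m' r' d (m' 0))"
proof -
  note len = tree_input_length(2)[OF ti]
  define sig where "sig = sort_level (rank_key r0 (n - 1) M) Lam"
  interpret S: sorting P w B n Lam lam r0 "lo m0" by unfold_locales
  have n1M: "n - 1 \<le> M" using nM by linarith
  have bij: "bij_betw sig {..<n - 1} {..<n - 1}"
    and mono: "\<And>i j. i \<le> j \<Longrightarrow> j < n - 1 \<Longrightarrow> r0 (sig i) \<le> r0 (sig j)"
    using sort_level_final[OF n1M, where r = r0] unfolding sig_def by blast+
  have sigM: "sig p < M" if "p < M" for p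
    unfolding sig_def by (rule sort_level_less[OF inj_rank_key]) (use that in auto)
  \<comment> \<open>Only the last sorted row of array 10 is specified after sorting, so the whole
    array is carried along as a parameter \<open>Z\<close> about which just this row is
    known.\<close>
  define okZ where "okZ Z \<longleftrightarrow> (\<forall>p<M. Z (Lam, p, 0, 0) = sig p)" for Z :: "index \<Rightarrow> nat"
  define Mid where "Mid Z = (\<lambda>l V r s. okZ Z \<and> l = lo m0 \<and> r = r0 \<and> fresh {1..9} V \<and> base_env s \<and> V 10 = Z)" for Z
  define Post where "Post = (\<lambda>l (V :: nat \<Rightarrow> index \<Rightarrow> nat) r (s :: env). \<forall>m'. lo m' = l \<longrightarrow>
    (\<exists>d. is_dendrogram wt {..<n} E d \<and> represents n es m' r d (m' 0)))"
  have tree0: "ctree {1..n} {Suc n..<2 * n} (ep_in n es sig)"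
  proof -
    have "Suc n + length es = 2 * n" using len n1 by simp
    then show ?thesis using tree_input_ctree[OF ti, of sig] bij len by (simp only:)
  qed
  have lo0: "lo m0 0 = n" using B16 by (simp add: lo_def m0_def initial_config_def)
  have "tri sort_prog (\<lambda>l V r s. l = lo m0 \<and> r = r0 \<and> fresh {1..11} V \<and> base_env s) (80 * (Lam + 1)\<^sup>2)
     (80 * M * (Lam + 1)) (\<lambda>l V r s. \<exists>Z. Mid Z l V r s)"
  proof (rule tri_conseq[OF S.tri_sort])
    fix l V r s assume "S.sort_inv Lam l V r s"
    then have "Mid (V 10) l V r s" by (simp add: S.sort_inv_def Mid_def okZ_def sig_def)
    then show "\<exists>Z. Mid Z l V r s" by (rule exI[of _ "V 10"])
  qed auto
  note 1 = tri_append[OF tri_init[of "lo m0" r0, OF lo0] this]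
  have 2: "tri (load_prog @ [WhileNZ (Var 9) round_body] @ [WhileNZ (Var 6) unwind_body] @ output_prog)
    (\<lambda>l V r s. \<exists>Z. Mid Z l V r s)
    (11 + (60 * (Lam + 1)\<^sup>2 + (80 * (Lam + 1)\<^sup>2 + 17)))
    ((10 * M + 10) + (200 * M * (Lam + 1) + (250 * M * (Lam + 1) + (40 * M + 10)))) Post"
  proof (rule tri_Ex)
    fix Z
    show "tri (load_prog @ [WhileNZ (Var 9) round_body] @ [WhileNZ (Var 6) unwind_body] @ output_prog) (Mid Z)
      (11 + (60 * (Lam + 1)\<^sup>2 + (80 * (Lam + 1)\<^sup>2 + 17)))
      ((10 * M + 10) + (200 * M * (Lam + 1) + (250 * M * (Lam + 1) + (40 * M + 10)))) Post"
    proof (cases "okZ Z")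
      case True
      interpret I: input_output P w B n Lam lam "ep_in n es sig" r0 "lo m0" Z sig E wt es
      proof unfold_locales
        show "lo m0 x = word_mem (initial_config n wt es) x" if "x < B" for x
          using that by (simp add: lo_def m0_def)
        show "r0 i = wt (edge (es ! i))" if "i < n - 1" for i
          using that len by (simp add: r0_def initial_config_def)
      qed (use ti len bij mono sigM True tree0 in \<open>auto simp: okZ_def\<close>)
      show ?thesis
      proof (rule tri_conseq[OF tri_append[OF I.tri_load tri_append[OF I.tri_rounds tri_append[OF I.tri_unwind I.tri_output]]]])
        fix l V r s assume "l = I.out2 \<and> r = I.outr"
        then show "Post l V r s" using I.output_correct unfolding Post_def by blast
      qed (simp_all add: Mid_def)
    next
      case False
      then show ?thesis by (simp add: tri_def Mid_def)
    qed
  qed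
  have main: "main_prog = (init_prog @ sort_prog) @
     load_prog @ [WhileNZ (Var 9) round_body] @ [WhileNZ (Var 6) unwind_body] @ output_prog"
    by (simp add: main_prog_def)
  have M1: "1 \<le> M * (Lam + 1)" by (simp add: Suc_le_eq)
  have "1 * (Lam + 1) \<le> M * (Lam + 1)" by (rule mult_le_mono1) simp
  then have q: "1 \<le> (Lam + 1)\<^sup>2" "Lam + 1 \<le> (Lam + 1)\<^sup>2" "Lam + 1 \<le> M * (Lam + 1)" "M \<le> M * (Lam + 1)"
    by (simp_all only: mult_1) (simp_all add: power2_eq_square)
  have a: "80 * M * (Lam + 1) = 80 * (M * (Lam + 1))" "200 * M * (Lam + 1) = 200 * (M * (Lam + 1))"
    "250 * M * (Lam + 1) = 250 * (M * (Lam + 1))" by simp_all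
  have "tri main_prog (\<lambda>l V r s. l = lo m0 \<and> r = r0 \<and> fresh {1..11} V)
    (260 * (Lam + 1)\<^sup>2) (612 * (M * (Lam + 1))) Post"
    unfolding main
  proof (rule tri_conseq[OF tri_append[OF 1 2]], goal_cases)
    case 3
    \<comment> \<open>260 is the sum 6 + 6 + 80 + 11 + 60 + 80 + 17 of all coefficients, as
      \<open>x\<close> and 1 are at most \<open>y\<close>.\<close>
    have "6 * x + 6 + 80 * y + (11 + (60 * y + (80 * y + 17))) \<le> 260 * y" if "1 \<le> y" "x \<le> y" for x y :: nat
      using that by linarith
    then show ?case using q(1,2) .
  next
    case 4
    \<comment> \<open>Likewise 612 = 6 + 6 + 80 + 10 + 10 + 200 + 250 + 40 + 10.\<close>
    have "6 * x + 6 + 80 * y + (10 * z + 10 + (200 * y + (250 * y + (40 * z + 10)))) \<le> 612 * y"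
      if "x \<le> y" "z \<le> y" "1 \<le> y" for x y z :: nat
      using that by linarith
    then show ?case unfolding a using q(3,4) M1 .
  qed
  moreover have "fresh {1..11} (vw m0)"
  proof -
    have "m0 (ad t p) = 0" if "1 \<le> t" for t p
    proof -
      \<comment> \<open>The input ends below \<open>B\<close>, where the arrays begin, so they are
        all zero at the start.\<close>
      have "2 * length es < B" using len nM BM n1 by linarith
      then have "2 * length es < ad t p" "ad t p \<noteq> 0" using ad_ge[OF that, of p] by linarith+
      then show ?thesis by (simp add: m0_def initial_config_def)
    qed
    then show ?thesis by (auto simp: fresh_def vw_def)
  qed
  ultimately obtain m' r' s' where "runs P w main_prog m0 r0 (\<lambda>_. 0) m' r' s' (260 * (Lam + 1)\<^sup>2) (612 * (M * (Lam + 1)))"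
    "Post (lo m') (vw m') r' s'"
    unfolding tri_def by blast
  then show ?thesis unfolding Post_def by blast
qed

end

text \<open>An address has five digits below \<open>16 * 2 ^ Lam\<close> and so needs at most
  \<open>20 + 5 * floorlog 2 n\<close> bits. As \<open>floorlog 2 n\<close> is at least 1, words of
  30 times that length suffice.\<close>

lemma instance_exists:
  assumes "1 \<le> n"
  obtains Lam lam where "instance_params (word_size 30 n) (16 * 2 ^ Lam) n Lam lam"
    "2 ^ Lam \<le> 2 * n" "real Lam \<le> log 2 n + 1"
proof -
  define Lam where "Lam = (LEAST k. n \<le> 2 ^ k)"
  define lam where "lam = (LEAST k. Lam + 1 \<le> 2 ^ k)"
  have least: "x \<le> 2 ^ k \<longleftrightarrow> (LEAST k. x \<le> 2 ^ k) \<le> k" for x k :: nat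
  proof
    assume "(LEAST k. x \<le> 2 ^ k) \<le> k"
    then have "(2::nat) ^ (LEAST k. x \<le> 2 ^ k) \<le> 2 ^ k" by (rule power_increasing) simp
    moreover have "x \<le> 2 ^ (LEAST k. x \<le> 2 ^ k)"
      by (rule LeastI[of "\<lambda>k. x \<le> 2 ^ k" x]) simp
    ultimately show "x \<le> 2 ^ k" by (rule le_trans[rotated])
  qed (rule Least_le)
  have L1: "2 ^ Lam \<le> 2 * n"
  proof (cases Lam)
    case (Suc k)
    then have "\<not> n \<le> 2 ^ k" using least[of n k] by (simp add: Lam_def)
    then show ?thesis by (simp add: Suc)
  qed (use assms in simp)
  have "Lam \<le> floorlog 2 n"
    unfolding Lam_def least[symmetric] using floorlog_bounds[of n 2] assms by simp
  then have "16 * 2 ^ Lam \<le> 16 * (2::nat) ^ floorlog 2 n" by simp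
  also have "\<dots> = 2 ^ (4 + floorlog 2 n)" by (simp add: power_add)
  finally have "(16 * 2 ^ Lam) ^ 5 \<le> ((2::nat) ^ (4 + floorlog 2 n)) ^ 5" by (rule power_mono) simp
  also have "\<dots> = 2 ^ (20 + 5 * floorlog 2 n)" by (simp flip: power_mult add: algebra_simps)
  also have "\<dots> \<le> 2 ^ word_size 30 n"
  proof -
    have "1 \<le> floorlog 2 n" using assms by (simp add: floorlog_def)
    then show ?thesis by (simp add: word_size_def)
  qed
  finally have "instance_params (word_size 30 n) (16 * 2 ^ Lam) n Lam lam"
  proof unfold_locales
    show "n \<le> 2 ^ k \<longleftrightarrow> Lam \<le> k" "Lam + 1 \<le> 2 ^ k \<longleftrightarrow> lam \<le> k" for k
      unfolding lam_def Lam_def by (rule least)+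
  qed (use assms in simp_all)
  moreover have "real Lam \<le> log 2 n + 1"
  proof -
    have "real (2 ^ Lam) \<le> real (2 * n)" using L1 by (rule of_nat_mono)
    then have "log 2 (2 ^ Lam) \<le> log 2 (2 * n)" using assms by (subst log_le_cancel_iff) auto
    then show ?thesis using assms by (simp add: log_mult log_nat_power)
  qed
  ultimately show ?thesis using L1 that by blast
qed

lemma main_result:
  assumes ti: "tree_input n E es"
  shows "computes [main_prog] (word_size 30 n) (initial_config n wt es) (dendrogram_output n E wt es)"
    and "expected_work [main_prog] (word_size 30 n) (initial_config n wt es)
      \<le> ennreal (1 + 1224 * real n * (log 2 n + 2))"
    and "prob_depth_le [main_prog] (word_size 30 n) (initial_config n wt es)
      (Suc (nat \<lceil>260 * (log 2 n + 2)\<^sup>2\<rceil>)) = 1"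
proof -
  let ?c = "initial_config n wt es"
  note n1 = tree_input_length(1)[OF ti]
  obtain Lam lam where I: "instance_params (word_size 30 n) (16 * 2 ^ Lam) n Lam lam"
    and M: "2 ^ Lam \<le> 2 * n" and L: "real Lam \<le> log 2 n + 1" using instance_exists[OF n1] .
  obtain m' r' s' where r: "runs [main_prog] (word_size 30 n) main_prog (word_mem ?c) (real_mem ?c) (\<lambda>_. 0) m' r' s'
      (260 * (Lam + 1)\<^sup>2) (612 * (2 ^ Lam * (Lam + 1)))"
    and d: "\<exists>d. is_dendrogram wt {..<n} E d \<and> represents n es m' r' d (m' 0)"
    using instance_params.main_runs[OF I ti, of "[main_prog]" wt] by blast
  have Q: "dendrogram_output n E wt es (cfg (Active [] s') m' r' W)" for W
    using d by (simp add: dendrogram_output_def)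
  have c: "cfg (Active [Call 0] (\<lambda>_. 0)) (word_mem ?c) (real_mem ?c) 0 = ?c"
    by (simp add: initial_config_def)
  show "computes [main_prog] (word_size 30 n) ?c (dendrogram_output n E wt es)"
    using runs_main(1)[OF r, of "dendrogram_output n E wt es", OF Q] unfolding c .
  \<comment> \<open>\<open>2 ^ Lam \<le> 2 * n\<close> doubles 612 to 1224; the summand 1 pays for
    the initial call.\<close>
  have "real (612 * (2 ^ Lam * (Lam + 1))) = 612 * (real (2 ^ Lam) * (real Lam + 1))" by (simp add: algebra_simps)
  also have "\<dots> \<le> 612 * (real (2 * n) * (log 2 n + 2))"
    using M L by (intro mult_left_mono mult_mono of_nat_mono) auto
  finally have "real (Suc (612 * (2 ^ Lam * (Lam + 1)))) \<le> 1 + 1224 * real n * (log 2 n + 2)"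
    by (simp add: algebra_simps)
  then have "of_nat (Suc (612 * (2 ^ Lam * (Lam + 1)))) \<le> ennreal (1 + 1224 * real n * (log 2 n + 2))"
    unfolding ennreal_of_nat_eq_real_of_nat by (rule ennreal_leI)
  then show "expected_work [main_prog] (word_size 30 n) ?c \<le> ennreal (1 + 1224 * real n * (log 2 n + 2))"
    using runs_main(2)[OF r, of "\<lambda>_. True", OF TrueI] unfolding c by (rule order_trans[rotated])
  have "real (260 * (Lam + 1)\<^sup>2) = 260 * (real Lam + 1)\<^sup>2" by simp
  also have "\<dots> \<le> 260 * (log 2 n + 2)\<^sup>2"
    using L by (intro mult_left_mono power_mono) auto
  finally have "260 * (Lam + 1)\<^sup>2 \<le> nat \<lceil>260 * (log 2 n + 2)\<^sup>2\<rceil>" by linarith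
  from runs_main(3)[OF runs_mono[OF r this order_refl], of "\<lambda>_. True", OF TrueI]
  show "prob_depth_le [main_prog] (word_size 30 n) ?c (Suc (nat \<lceil>260 * (log 2 n + 2)\<^sup>2\<rceil>)) = 1"
    unfolding c .
qed

theorem theorem4p1:
  shows "\<exists>(P :: program) (k :: nat). k \<ge> 1 \<and>
    (\<forall>n E wt es. tree_input n E es \<longrightarrow>
       computes P (word_size k n) (initial_config n wt es) (dendrogram_output n E wt es)) \<and>
    (\<exists>W :: nat \<Rightarrow> real. W \<in> O(\<lambda>n. real n * ln (real n)) \<and>
       (\<forall>n E wt es. tree_input n E es \<longrightarrow>
          expected_work P (word_size k n) (initial_config n wt es) \<le> ennreal (W n))) \<and>
    (\<forall>c :: real. c > 0 \<longrightarrow>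
       (\<exists>D :: nat \<Rightarrow> nat. (\<lambda>n. real (D n)) \<in> O(\<lambda>n. (ln (real n))\<^sup>2 * ln (ln (real n))) \<and>
          (\<forall>n E wt es. tree_input n E es \<longrightarrow>
             prob_depth_le P (word_size k n) (initial_config n wt es) (D n)
               \<ge> 1 - real n powr (- c))))"
proof (intro exI[of _ "[main_prog]"] exI[of _ 30] conjI allI impI)
  \<comment> \<open>The bound has to hold also for \<open>n = 1\<close>, where
    \<open>n * ln n\<close> vanishes; the lower-order terms provide for this and disappear
    asymptotically.\<close>
  let ?W = "\<lambda>n::nat. 1 + 1224 * real n * (log 2 n + 2)"
  have "?W \<in> O(\<lambda>n. real n * ln (real n))" by real_asymp
  then show "\<exists>W :: nat \<Rightarrow> real. W \<in> O(\<lambda>n. real n * ln (real n)) \<and>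
       (\<forall>n E wt es. tree_input n E es \<longrightarrow>
          expected_work [main_prog] (word_size 30 n) (initial_config n wt es) \<le> ennreal (W n))"
    using main_result(2) by (intro exI[of _ ?W] conjI allI impI)
next
  fix c :: real assume "c > 0"
  \<comment> \<open>The machine halts within this depth with certainty, so the same \<open>D\<close>
    serves for every \<open>c\<close>. It is of order \<open>log^2 n\<close>, so the iterated
    logarithm only weakens the bound.\<close>
  let ?D = "\<lambda>n::nat. Suc (nat \<lceil>260 * (log 2 n + 2)\<^sup>2\<rceil>)"
  have "(\<lambda>n. real (?D n)) \<in> O(\<lambda>n. 260 * (log 2 (real n) + 2)\<^sup>2 + 2)"
  proof (intro landau_o.bigI[of 1] eventuallyI)
    fix n :: nat
    have "real (Suc (nat \<lceil>x\<rceil>)) \<le> x + 2" if "0 \<le> x" for x :: real using that by linarith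
    from this[of "260 * (log 2 n + 2)\<^sup>2"]
    show "norm (real (?D n)) \<le> 1 * norm (260 * (log 2 n + 2)\<^sup>2 + 2)"
      unfolding real_norm_def mult_1 by (simp only: abs_of_nat) (rule order_trans[OF _ abs_ge_self], simp)
  qed simp
  also have "(\<lambda>n. 260 * (log 2 (real n) + 2)\<^sup>2 + 2) \<in> O(\<lambda>n. (ln (real n))\<^sup>2 * ln (ln (real n)))"
    by real_asymp
  finally have "(\<lambda>n. real (?D n)) \<in> O(\<lambda>n. (ln (real n))\<^sup>2 * ln (ln (real n)))" .
  then show "\<exists>D :: nat \<Rightarrow> nat. (\<lambda>n. real (D n)) \<in> O(\<lambda>n. (ln (real n))\<^sup>2 * ln (ln (real n))) \<and>
          (\<forall>n E wt es. tree_input n E es \<longrightarrow>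
             prob_depth_le [main_prog] (word_size 30 n) (initial_config n wt es) (D n) \<ge> 1 - real n powr (- c))"
    by (intro exI[of _ ?D] conjI allI impI) (simp_all only: main_result(3), simp)
next
  show "(1::nat) \<le> 30" by simp
next
  show "computes [main_prog] (word_size 30 n) (initial_config n wt es) (dendrogram_output n E wt es)"
    if "tree_input n E es" for n E wt es by (rule main_result(1)[OF that])
qed

end
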